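(* Let $m>0$, let $V$ satisfy the standing assumptions on the potential listed in the context, and let $H$ be the Dirac operator in $L^2(\mathbb{R},\mathbb{C}^2)$ $$H=-i\partial_x\sigma_1+m\sigma_3+iVI_2,\qquad\mathrm{Dom}(H)=H^1(\mathbb{R},\mathbb{C}^2)\cap\mathrm{Dom}(VI_2).$$ For all sufficiently large $b>0$ let $x_b\in(0,\infty)$ be the unique solution of $V(x_b)=b$, and let $\lambda_b:=a(b)+ib$, $b>0$, with a real-valued function $a$. Suppose furthermore that $$\mu_b:=\frac{a(b)}{V'(x_b)^{\frac12}}=\mathcal{O}(1),\qquad b\to+\infty.$$ Then as $b\to+\infty$ $$\|(H-\lambda_b)^{-1}\|=\|(A_{m_b}-\mu_b)^{-1}\|\,(V'(x_b))^{-\frac12}\left(1+\mathcal{O}\big(x_b^{-\frac12}+b^{-\frac12}\big)\right),$$ where $A_{m_b}$ denotes the Airy-Dirac operator with mass $$m_b:=\frac{m}{V'(x_b)^{\frac12}}.$$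
   Context: $\sigma_1=\begin{pmatrix}0&1\\1&0\end{pmatrix}$, $\sigma_3=\begin{pmatrix}1&0\\0&-1\end{pmatrix}$, $I_2$ is the $2\times2$ identity matrix; $\mathrm{Dom}(VI_2)=\{u\in L^2(\mathbb{R},\mathbb{C}^2):VI_2u\in L^2(\mathbb{R},\mathbb{C}^2)\}$ and similarly for $\mathrm{Dom}(xI_2)$. $\|\cdot\|$ is the operator norm on $L^2(\mathbb{R},\mathbb{C}^2)$. Airy-Dirac operator with mass $\mathsf m>0$: $A_{\mathsf m}=-i\partial_x\sigma_1+\mathsf m\sigma_3+ixI_2$, $\mathrm{Dom}(A_{\mathsf m})=H^1(\mathbb{R},\mathbb{C}^2)\cap\mathrm{Dom}(xI_2)$ (its spectrum is empty). Standing assumptions on $V$: $V\in C^1(\mathbb{R},\mathbb{R})\cap C^2((x_0,\infty),\mathbb{R})$ for some $x_0\ge0$; there exist $\varepsilon\in(0,1)$ and $M_\varepsilon>0$ such that $|V'(x)|\le\varepsilon|V(x)|^2+M_\varepsilon$ for all $x\in\mathbb{R}$; and (i) $\lim_{x\to+\infty}V(x)=+\infty$ and $V'(x)>0$ for $x>x_0$; (ii) there exists $M\in\mathbb{R}$ such that $V(x)\le M$ for $x<0$; (iii) $V'(x)\approx V(x)x^{-1}$ and $|V''(x)|\lesssim V'(x)x^{-1}$ for $x>x_0$. Here $a\lesssim b$ means $a\le Cb$ with $C>0$ independent of the variables involved, and $a\approx b$ means $a\lesssim b$ and $b\lesssim a$. *)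

theory Defs
  imports "HOL-Analysis.Analysis" "HOL-Library.Landau_Symbols"
begin

section \<open>The Hilbert space of square-integrable spinors on the real line\<close>

definition square_integrable :: "(real \<Rightarrow> complex ^ 2) \<Rightarrow> bool" where
  "square_integrable u \<longleftrightarrow>
     u \<in> borel_measurable lborel \<and> integrable lborel (\<lambda>x. (norm (u x))\<^sup>2)"

definition ae_eq :: "(real \<Rightarrow> complex ^ 2) \<Rightarrow> (real \<Rightarrow> complex ^ 2) \<Rightarrow> bool" where
  "ae_eq u v \<longleftrightarrow> square_integrable u \<and> square_integrable v \<and> (AE x in lborel. u x = v x)"

lemma norm_vector_scalar_mult: "norm (c *s (v :: complex ^ 'n)) = cmod c * norm v"
  by (simp add: norm_vec_def norm_mult L2_set_right_distrib)

lemma bounded_linear_vector_scalar_mult: "bounded_linear (\<lambda>v :: complex ^ 'n. c *s v)"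
  by (rule bounded_linear_intro[where K = "cmod c"])
     (simp_all add: norm_vector_scalar_mult vec_eq_iff algebra_simps)

lemma square_integrable_zero: "square_integrable (\<lambda>_. 0)"
  by (simp add: square_integrable_def)

lemma square_integrable_add:
  assumes "square_integrable u" "square_integrable v"
  shows "square_integrable (\<lambda>x. u x + v x)"
proof -
  have m[measurable]: "u \<in> borel_measurable lborel" "v \<in> borel_measurable lborel"
    and i: "integrable lborel (\<lambda>x. (norm (u x))\<^sup>2)" "integrable lborel (\<lambda>x. (norm (v x))\<^sup>2)"
    using assms by (auto simp: square_integrable_def)
  have le: "(norm (u x + v x))\<^sup>2 \<le> 2 * (norm (u x))\<^sup>2 + 2 * (norm (v x))\<^sup>2" for x
  proof -
    have "(norm (u x + v x))\<^sup>2 \<le> (norm (u x) + norm (v x))\<^sup>2"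
      by (intro power_mono norm_triangle_ineq) auto
    also have "\<dots> \<le> 2 * (norm (u x))\<^sup>2 + 2 * (norm (v x))\<^sup>2"
      using sum_squares_bound[of "norm (u x)" "norm (v x)"] by (simp add: power2_sum)
    finally show ?thesis .
  qed
  have "integrable lborel (\<lambda>x. 2 * (norm (u x))\<^sup>2 + 2 * (norm (v x))\<^sup>2)"
    using i by simp
  then have "integrable lborel (\<lambda>x. (norm (u x + v x))\<^sup>2)"
    by (rule Bochner_Integration.integrable_bound) (use le in \<open>auto intro!: AE_I2\<close>)
  then show ?thesis by (simp add: square_integrable_def)
qed

lemma square_integrable_cscale:
  assumes "square_integrable u"
  shows "square_integrable (\<lambda>x. c *s u x)"
proof -
  have "(\<lambda>x. c *s u x) \<in> borel_measurable lborel"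
    using assms borel_measurable_continuous_onI[OF linear_continuous_on[OF bounded_linear_vector_scalar_mult[of c]]]
    by (auto simp: square_integrable_def intro: measurable_compose)
  then show ?thesis
    using assms by (simp add: square_integrable_def norm_vector_scalar_mult power_mult_distrib)
qed

lemma square_integrable_scaleR:
  assumes "square_integrable u"
  shows "square_integrable (\<lambda>x. r *\<^sub>R u x)"
  using assms by (auto simp: square_integrable_def power_mult_distrib intro: borel_measurable_scaleR)

lemma square_integrable_inner:
  assumes "square_integrable u" "square_integrable v"
  shows "integrable lborel (\<lambda>x. u x \<bullet> v x)"
proof -
  have [measurable]: "u \<in> borel_measurable lborel" "v \<in> borel_measurable lborel"
    and i: "integrable lborel (\<lambda>x. (norm (u x))\<^sup>2)" "integrable lborel (\<lambda>x. (norm (v x))\<^sup>2)"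
    using assms by (auto simp: square_integrable_def)
  have le: "norm (u x \<bullet> v x) \<le> (norm (u x))\<^sup>2 + (norm (v x))\<^sup>2" for x
  proof -
    have "norm (u x \<bullet> v x) \<le> norm (u x) * norm (v x)"
      by (simp add: Cauchy_Schwarz_ineq2)
    moreover have "2 * norm (u x) * norm (v x) \<le> (norm (u x))\<^sup>2 + (norm (v x))\<^sup>2"
      by (rule sum_squares_bound)
    moreover have "0 \<le> norm (u x) * norm (v x)" by simp
    ultimately show ?thesis by linarith
  qed
  have "integrable lborel (\<lambda>x. (norm (u x))\<^sup>2 + (norm (v x))\<^sup>2)"
    using i by simp
  then show ?thesis
    by (rule Bochner_Integration.integrable_bound) (use le in \<open>auto intro!: AE_I2\<close>)
qed

quotient_type L2C2 = "real \<Rightarrow> complex ^ 2" / partial: ae_eq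
proof (rule part_equivpI)
  show "\<exists>u. ae_eq u u"
    using square_integrable_zero by (auto simp: ae_eq_def)
  show "symp ae_eq"
    by (auto simp: symp_def ae_eq_def)
  show "transp ae_eq"
    unfolding transp_def ae_eq_def by (auto elim!: eventually_elim2)
qed

text \<open>The inner product below is the real part of the usual complex one; it induces the same norm.\<close>

instantiation L2C2 :: real_inner
begin

lift_definition zero_L2C2 :: L2C2 is "\<lambda>_. 0"
  by (simp add: ae_eq_def square_integrable_zero)

lift_definition plus_L2C2 :: "L2C2 \<Rightarrow> L2C2 \<Rightarrow> L2C2" is "\<lambda>u v x. u x + v x"
  by (auto simp: ae_eq_def square_integrable_add elim!: eventually_elim2)

lift_definition uminus_L2C2 :: "L2C2 \<Rightarrow> L2C2" is "\<lambda>u x. - u x"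
  by (auto simp: ae_eq_def square_integrable_def)

definition minus_L2C2 :: "L2C2 \<Rightarrow> L2C2 \<Rightarrow> L2C2" where
  "minus_L2C2 u v = u + - v"

lift_definition scaleR_L2C2 :: "real \<Rightarrow> L2C2 \<Rightarrow> L2C2" is "\<lambda>r u x. r *\<^sub>R u x"
  by (auto simp: ae_eq_def square_integrable_scaleR)

lift_definition inner_L2C2 :: "L2C2 \<Rightarrow> L2C2 \<Rightarrow> real" is "\<lambda>u v. \<integral>x. u x \<bullet> v x \<partial>lborel"
  by (rule integral_cong_AE) (auto simp: ae_eq_def square_integrable_def)

definition norm_L2C2 :: "L2C2 \<Rightarrow> real" where
  "norm_L2C2 u = sqrt (u \<bullet> u)"

definition sgn_L2C2 :: "L2C2 \<Rightarrow> L2C2" where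
  "sgn_L2C2 u = inverse (norm u) *\<^sub>R u"

definition dist_L2C2 :: "L2C2 \<Rightarrow> L2C2 \<Rightarrow> real" where
  "dist_L2C2 u v = norm (u - v)"

definition uniformity_L2C2 :: "(L2C2 \<times> L2C2) filter" where
  "uniformity_L2C2 = (INF e\<in>{0<..}. principal {(u, v). dist u v < e})"

definition open_L2C2 :: "L2C2 set \<Rightarrow> bool" where
  "open_L2C2 U = (\<forall>u\<in>U. \<forall>\<^sub>F (u', v) in uniformity. u' = u \<longrightarrow> v \<in> U)"

instance
proof
  fix a b c :: L2C2 and r s :: real
  show "a + b + c = a + (b + c)"
    by transfer (auto simp: ae_eq_def add.assoc square_integrable_add)
  show "a + b = b + a"
    by transfer (auto simp: ae_eq_def add.commute square_integrable_add)
  show "0 + a = a"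
    by transfer (auto simp: ae_eq_def)
  show "- a + a = 0"
    by transfer (auto simp: ae_eq_def square_integrable_zero)
  show "a - b = a + - b"
    by (rule minus_L2C2_def)
  show "r *\<^sub>R (a + b) = r *\<^sub>R a + r *\<^sub>R b"
    by transfer (auto simp: ae_eq_def scaleR_add_right square_integrable_add square_integrable_scaleR)
  show "(r + s) *\<^sub>R a = r *\<^sub>R a + s *\<^sub>R a"
    by transfer (auto simp: ae_eq_def scaleR_add_left square_integrable_add square_integrable_scaleR)
  show "r *\<^sub>R s *\<^sub>R a = (r * s) *\<^sub>R a"
    by transfer (auto simp: ae_eq_def square_integrable_scaleR)
  show "1 *\<^sub>R a = a"
    by transfer (auto simp: ae_eq_def)
  show "sgn a = inverse (norm a) *\<^sub>R a"
    by (rule sgn_L2C2_def)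
  show "dist a b = norm (a - b)"
    by (rule dist_L2C2_def)
  show "uniformity = (INF e\<in>{0<..}. principal {(u, v). dist u (v :: L2C2) < e})"
    by (rule uniformity_L2C2_def)
  show "open U = (\<forall>u\<in>U. \<forall>\<^sub>F (u', v) in uniformity. u' = u \<longrightarrow> v \<in> U)" for U :: "L2C2 set"
    by (rule open_L2C2_def)
  show "a \<bullet> b = b \<bullet> a"
    by transfer (simp add: inner_commute)
  show "(a + b) \<bullet> c = a \<bullet> c + b \<bullet> c"
    by transfer (simp add: ae_eq_def inner_add_left square_integrable_inner)
  show "r *\<^sub>R a \<bullet> b = r * (a \<bullet> b)"
    by transfer simp
  show "0 \<le> a \<bullet> a"
    by transfer (simp add: integral_nonneg_AE)
  show "a \<bullet> a = 0 \<longleftrightarrow> a = 0"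
  proof transfer
    fix u :: "real \<Rightarrow> complex ^ 2" assume "ae_eq u u"
    then have u: "square_integrable u" by (simp add: ae_eq_def)
    have "(\<integral>x. u x \<bullet> u x \<partial>lborel) = 0 \<longleftrightarrow> (AE x in lborel. u x \<bullet> u x = 0)"
      by (rule integral_nonneg_eq_0_iff_AE) (use u in \<open>auto intro: square_integrable_inner\<close>)
    then show "(\<integral>x. u x \<bullet> u x \<partial>lborel) = 0 \<longleftrightarrow> ae_eq u (\<lambda>_. 0)"
      using u by (simp add: ae_eq_def square_integrable_zero)
  qed
  show "norm a = sqrt (a \<bullet> a)"
    by (rule norm_L2C2_def)
qed

end

lift_definition scaleC :: "complex \<Rightarrow> L2C2 \<Rightarrow> L2C2"  (infixr \<open>*\<^sub>C\<close> 75) is "\<lambda>c u x. c *s u x"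
  by (auto simp: ae_eq_def square_integrable_cscale)

section \<open>Unbounded operators, resolvent set and resolvent\<close>

text \<open>An unbounded operator is a pair of its domain and its action; the values of the action
  outside the domain are irrelevant.\<close>

type_synonym operator = "L2C2 set \<times> (L2C2 \<Rightarrow> L2C2)"

definition resolvent :: "operator \<Rightarrow> complex \<Rightarrow> L2C2 \<Rightarrow> L2C2" where
  "resolvent T z = inv_into (fst T) (\<lambda>u. snd T u - z *\<^sub>C u)"

text \<open>Only complex-linear operators are considered, whose inverses are complex-linear; hence
  \<^const>\<open>bounded_linear\<close> (real linearity and boundedness) is enough. The operator
  norm over the reals, \<^const>\<open>onorm\<close>, is also the one over the complex numbers.\<close>

definition resolvent_set :: "operator \<Rightarrow> complex set" where
  "resolvent_set T =
     {z. bij_betw (\<lambda>u. snd T u - z *\<^sub>C u) (fst T) UNIV \<and> bounded_linear (resolvent T z)}"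

section \<open>Weak derivatives and the first-order Sobolev space\<close>

definition test_function :: "(real \<Rightarrow> real) \<Rightarrow> bool" where
  "test_function \<phi> \<longleftrightarrow>
     (\<forall>n x. (deriv ^^ n) \<phi> differentiable (at x)) \<and> (\<exists>R. \<forall>x. R < \<bar>x\<bar> \<longrightarrow> \<phi> x = 0)"

definition has_weak_deriv :: "L2C2 \<Rightarrow> L2C2 \<Rightarrow> bool" where
  "has_weak_deriv u v \<longleftrightarrow>
     (\<forall>\<phi>. test_function \<phi> \<longrightarrow>
        (\<integral>x. deriv \<phi> x *\<^sub>R rep_L2C2 u x \<partial>lborel) = - (\<integral>x. \<phi> x *\<^sub>R rep_L2C2 v x \<partial>lborel))"

definition H1 :: "L2C2 set" where
  "H1 = {u. \<exists>v. has_weak_deriv u v}"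

definition weak_deriv :: "L2C2 \<Rightarrow> L2C2" where
  "weak_deriv u = (THE v. has_weak_deriv u v)"

section \<open>Dirac operators\<close>

definition sigma1 :: "complex ^ 2 ^ 2" where
  "sigma1 = vector [vector [0, 1], vector [1, 0]]"

definition sigma3 :: "complex ^ 2 ^ 2" where
  "sigma3 = vector [vector [1, 0], vector [0, -1]]"

definition mult_dom :: "(real \<Rightarrow> real) \<Rightarrow> L2C2 set" where
  "mult_dom W = {u. square_integrable (\<lambda>x. complex_of_real (W x) *s rep_L2C2 u x)}"

text \<open>The operator $-i\partial_x\sigma_1 + m\sigma_3 + iWI_2$ with domain
  $H^1 \cap \mathrm{Dom}(WI_2)$.\<close>

definition dirac :: "real \<Rightarrow> (real \<Rightarrow> real) \<Rightarrow> operator" where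
  "dirac m W =
     (H1 \<inter> mult_dom W,
      \<lambda>u. abs_L2C2 (\<lambda>x.
        (- \<i>) *s (sigma1 *v rep_L2C2 (weak_deriv u) x)
        + complex_of_real m *s (sigma3 *v rep_L2C2 u x)
        + (\<i> * complex_of_real (W x)) *s rep_L2C2 u x))"

definition airy_dirac :: "real \<Rightarrow> operator" where
  "airy_dirac m = dirac m (\<lambda>x. x)"

section \<open>Potentials\<close>

definition lesssim_on :: "real set \<Rightarrow> (real \<Rightarrow> real) \<Rightarrow> (real \<Rightarrow> real) \<Rightarrow> bool" where
  "lesssim_on S f g \<longleftrightarrow> (\<exists>C>0. \<forall>x\<in>S. f x \<le> C * g x)"

definition approx_on :: "real set \<Rightarrow> (real \<Rightarrow> real) \<Rightarrow> (real \<Rightarrow> real) \<Rightarrow> bool" where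
  "approx_on S f g \<longleftrightarrow> lesssim_on S f g \<and> lesssim_on S g f"

definition admissible_potential :: "(real \<Rightarrow> real) \<Rightarrow> bool" where
  "admissible_potential V \<longleftrightarrow>
     V C1_differentiable_on UNIV \<and>
     (\<exists>\<epsilon> M\<^sub>\<epsilon>. 0 < \<epsilon> \<and> \<epsilon> < 1 \<and> 0 < M\<^sub>\<epsilon> \<and> (\<forall>x. \<bar>deriv V x\<bar> \<le> \<epsilon> * \<bar>V x\<bar>\<^sup>2 + M\<^sub>\<epsilon>)) \<and>
     filterlim V at_top at_top \<and>
     (\<exists>M. \<forall>x<0. V x \<le> M) \<and>
     (\<exists>x\<^sub>0\<ge>0.
        deriv V C1_differentiable_on {x\<^sub>0<..} \<and>
        (\<forall>x>x\<^sub>0. 0 < deriv V x) \<and>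
        approx_on {x\<^sub>0<..} (deriv V) (\<lambda>x. V x / x) \<and>
        lesssim_on {x\<^sub>0<..} (\<lambda>x. \<bar>deriv (deriv V) x\<bar>) (\<lambda>x. deriv V x / x))"

text \<open>The point $x_b$; it is well defined for all sufficiently large $b$ by the lemma below.\<close>

definition turning_point :: "(real \<Rightarrow> real) \<Rightarrow> real \<Rightarrow> real" where
  "turning_point V b = (THE x. 0 < x \<and> V x = b)"

lemma eventually_ex1_turning_point:
  assumes "admissible_potential V"
  shows "\<forall>\<^sub>F b in at_top. \<exists>!x. 0 < x \<and> V x = b"
proof -
  obtain x0 where x0: "0 \<le> x0" "\<And>x. x0 < x \<Longrightarrow> 0 < deriv V x"
    and lim: "filterlim V at_top at_top" and C1: "V C1_differentiable_on UNIV"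
    using assms by (auto simp: admissible_potential_def)
  have DV: "DERIV V x :> deriv V x" for x
    using C1 by (simp add: C1_differentiable_on_eq DERIV_deriv_iff_real_differentiable)
  then have cont: "continuous_on S V" for S
    by (meson DERIV_isCont continuous_at_imp_continuous_on)
  have mono: "V x < V y" if "x0 < x" "x < y" for x y
    by (rule DERIV_pos_imp_increasing[OF that(2)]) (use DV x0 that in force)
  obtain B where B: "\<And>x. 0 \<le> x \<Longrightarrow> x \<le> x0 + 1 \<Longrightarrow> V x \<le> B"
  proof -
    have "bdd_above (V ` {0..x0 + 1})"
      by (intro bounded_imp_bdd_above compact_imp_bounded compact_continuous_image cont) auto
    then obtain M where "\<forall>x\<in>{0..x0 + 1}. V x \<le> M"
      by (auto simp: bdd_above_def)
    then show ?thesis by (intro that[of M]) auto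
  qed
  have "\<exists>!x. 0 < x \<and> V x = b" if b: "B < b" for b
  proof (rule ex_ex1I)
    obtain N where N: "\<And>x. N \<le> x \<Longrightarrow> b \<le> V x"
      using lim by (auto simp: filterlim_at_top eventually_at_top_linorder)
    have "\<exists>x\<ge>x0 + 1. x \<le> max N (x0 + 1) \<and> V x = b"
      by (rule IVT') (use B[of "x0 + 1"] b N x0 cont in auto)
    then obtain x where "x0 + 1 \<le> x" "V x = b" by blast
    with x0 have "0 < x \<and> V x = b" by simp
    then show "\<exists>x. 0 < x \<and> V x = b" ..
  next
    fix x y assume xy: "0 < x \<and> V x = b" "0 < y \<and> V y = b"
    have "x0 < x" using B[of x] b xy by (cases "x \<le> x0 + 1") auto
    moreover have "x0 < y" using B[of y] b xy by (cases "y \<le> x0 + 1") auto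
    ultimately show "x = y"
      using mono[of x y] mono[of y x] xy by (cases x y rule: linorder_cases) auto
  qed
  then show ?thesis
    by (intro eventually_mono[OF eventually_gt_at_top[of B]])
qed

end

theory Submission
  imports Defs "HOL-Probability.Probability"
begin

text \<open>
For a real function \<open>W\<close> and real \<open>m\<close>, \<open>a\<close> put \<open>T\<^sub>W = -i d/dx sigma1 + m sigma3 + iW - a\<close>. Then
\<open>H - lambda\<^sub>b\<close> is \<open>T\<^sub>W\<close> with \<open>W = V - b\<close>, and translation by \<open>X = x\<^sub>b\<close> together with dilation by
\<open>s = V'(X)^(1/2)\<close> turns \<open>s (A - mu\<^sub>b)\<close>, where \<open>A\<close> is the Airy-Dirac operator of mass \<open>m/s\<close>, into \<open>T\<^sub>W\<close> with
the tangent line \<open>W = s\<^sup>2 (x - X)\<close> of \<open>V - b\<close>. The norm of a resolvent is the inverse of the best constant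
\<open>c\<close> in \<open>c |u| \<le> |T\<^sub>W u|\<close> (\<open>lower_bound\<close>), so the theorem says that these best constants \<open>c\<^sub>1\<close> for \<open>V - b\<close>
and \<open>c\<^sub>2\<close> for its tangent line differ by a factor \<open>1 + O(\<eta>)\<close>, \<open>\<eta> = X^(-1/2) + b^(-1/2)\<close>.

\<^emph>\<open>A positive lower bound gives an inverse\<close> (\<open>resolvent_dirac\<close>). The map \<open>u \<mapsto> sigma3 (cnj u)\<close> intertwines
\<open>T\<^sub>W\<close> with its formal adjoint \<open>T\<^bsub>-W\<^esub>\<close>, so the adjoint has the same lower bound, and Riesz' theorem on its range
yields a weak solution of \<open>T\<^sub>W u = f\<close>. The du Bois-Reymond lemma makes it absolutely continuous, and the graph
estimate, applied to cutoffs of it, shows that it lies in the domain.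

\<^emph>\<open>Graph estimate\<close> (\<open>graph_estimate\<close>). If \<open>|W'| \<le> M + \<epsilon> W\<^sup>2\<close> with \<open>\<epsilon> < 1\<close>, one integration by parts bounds \<open>|Wu|\<close>
by \<open>|T\<^sub>W u| + sqrt M |u|\<close>, up to a constant. The assumptions on \<open>V\<close> give this for \<open>V - b\<close> with \<open>M\<close> a multiple of
\<open>s\<^sup>2\<close>, uniformly in \<open>b\<close> (\<open>potential_global\<close>).

\<^emph>\<open>Comparison\<close> (\<open>lower_bound_comparison\<close>). Let \<open>|T\<^sub>W u| \<le> 2m |u|\<close> for one of the two potentials. Outside
\<open>|x - X| \<le> r\<close> one has \<open>|W| \<ge> s\<^sup>2 r / 2\<close>, so the graph estimate makes \<open>u\<close> small there, and cutting \<open>u\<close> off at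
distance \<open>r\<close> costs \<open>O(1 / (s r) + 1 / (s\<^sup>2 r)) |u|\<close>. Inside, the two potentials differ by \<open>O(s\<^sup>2 (x - X)\<^sup>2 / X)\<close>. As
\<open>|W| \<ge> s\<^sup>2 |x - X| / 2\<close>, this is at most \<open>O(1/X) |x - X| |W|\<close>, and the graph estimate for \<open>(x - X) u\<close>, cut off,
bounds the effect by \<open>O((r + 1 + 1/s) / X) |u|\<close>. Since \<open>1/s = O((X/b)^(1/2))\<close>, the choice \<open>r = \<eta> X\<close>
makes every error \<open>O(\<eta>) |u|\<close>. Hence \<open>|c\<^sub>1 - c\<^sub>2| = O(\<eta>)\<close>.

\<^emph>\<open>Lower bound for the Airy-Dirac operator\<close> (\<open>airy_lower_bound_scaled\<close>). To pass to a relative error, \<open>c\<^sub>2\<close> must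
stay away from 0 although the mass \<open>m/s\<close> may tend to 0 or to infinity; by scaling, the bound needed is
\<open>const * m/s\<close> for \<open>A - mu\<close>, \<open>|mu|\<close> bounded. For large mass it follows by testing \<open>(A - mu) u\<close> against
\<open>sigma3 u\<close>. For bounded mass suppose that it fails along a sequence; normalised almost-minimisers converge
in \<open>L\<^sup>2\<close> to some \<open>U \<noteq> 0\<close> with \<open>(A - mu) U = 0\<close> for the limiting parameters. The sum \<open>U\<^sub>1 + U\<^sub>2\<close> of
the components then solves an oscillator equation \<open>w'' = ((x + i mu)\<^sup>2 + e) w\<close>, \<open>e > 0\<close>, which has no nonzero solution in
\<open>L\<^sup>2\<close> (\<open>shifted_oscillator_no_negative_eigenvalue\<close>). So the limiting mass is 0 and \<open>U\<close> is an explicit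
Gaussian. Pairing the equations of the sequence with the Gaussian in the kernel of the adjoint massless
operator and dividing by the mass shows that \<open>U\<close> is orthogonal to a Gaussian to which it is not
orthogonal, because the integral of \<open>exp (-x\<^sup>2) cos (2 mu x)\<close> is positive.
\<close>

section \<open>Absolutely continuous functions\<close>

definition locally_integrable :: "(real \<Rightarrow> 'a::euclidean_space) \<Rightarrow> bool" where
  "locally_integrable v \<longleftrightarrow>
     v \<in> borel_measurable borel \<and> (\<forall>a b. set_integrable lborel {a..b} v)"

text \<open>The function \<open>v\<close> is a locally integrable derivative of \<open>u\<close>, in integrated form. Keeping \<open>u\<close> and
  \<open>v\<close> together avoids pointwise derivatives, which exist only almost everywhere.\<close>

definition ac_deriv :: "(real \<Rightarrow> 'a::euclidean_space) \<Rightarrow> (real \<Rightarrow> 'a) \<Rightarrow> bool" where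
  "ac_deriv u v \<longleftrightarrow> locally_integrable v \<and>
     (\<forall>a b. a \<le> b \<longrightarrow> (LINT x:{a..b}|lborel. v x) = u b - u a)"

lemma locally_integrable_integral:
  assumes "locally_integrable v"
  shows "v integrable_on {a..b}" "(LINT x:{a..b}|lborel. v x) = integral {a..b} v"
  using assms set_borel_integral_eq_integral[of "{a..b}" v] by (auto simp: locally_integrable_def)

lemma locally_integrable_continuous:
  assumes "continuous_on UNIV v"
  shows "locally_integrable v"
  using assms by (auto simp: locally_integrable_def intro!: borel_integrable_atLeastAtMost'
      borel_measurable_continuous_onI intro: continuous_on_subset)

lemma locally_integrable_norm:
  assumes "locally_integrable v"
  shows "locally_integrable (\<lambda>x. norm (v x))"
  using assms unfolding locally_integrable_def
  by (auto intro: set_integrable_norm)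

lemma locally_integrable_add:
  assumes "locally_integrable v" "locally_integrable w"
  shows "locally_integrable (\<lambda>x. v x + w x)"
  using assms unfolding locally_integrable_def by (auto intro!: set_integral_add)

lemma locally_integrable_linear:
  fixes T :: "'a::euclidean_space \<Rightarrow> 'b::euclidean_space"
  assumes "bounded_linear T" "locally_integrable v"
  shows "locally_integrable (\<lambda>x. T (v x))"
proof -
  interpret bounded_linear T by fact
  have "set_integrable lborel {a..b} (\<lambda>x. T (v x))" for a b
    using integrable_bounded_linear[OF assms(1), of lborel "\<lambda>x. indicator {a..b} x *\<^sub>R v x"] assms(2)
    by (simp add: set_integrable_def locally_integrable_def scaleR)
  moreover have "(\<lambda>x. T (v x)) \<in> borel_measurable borel"
    using assms(2) borel_measurable_continuous_onI[OF linear_continuous_on[OF assms(1)]]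
    by (auto simp: locally_integrable_def intro: measurable_compose)
  ultimately show ?thesis by (simp add: locally_integrable_def)
qed

lemma locally_integrable_bound:
  fixes w :: "real \<Rightarrow> 'b::euclidean_space" and v :: "real \<Rightarrow> 'a::euclidean_space"
  assumes "locally_integrable v" "w \<in> borel_measurable borel"
    and bd: "\<And>R. \<exists>B. \<forall>x. \<bar>x\<bar> \<le> R \<longrightarrow> norm (w x) \<le> B * norm (v x)"
  shows "locally_integrable w"
proof -
  have "set_integrable lborel {a..b} w" for a b
  proof -
    obtain B where B: "\<And>x. \<bar>x\<bar> \<le> max \<bar>a\<bar> \<bar>b\<bar> \<Longrightarrow> norm (w x) \<le> B * norm (v x)"
      using bd by blast
    have "set_integrable lborel {a..b} (\<lambda>x. B *\<^sub>R v x)"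
      using assms(1) by (simp add: locally_integrable_def)
    then show ?thesis
      by (rule set_integrable_bound)
        (use assms(2) B in \<open>auto simp: set_borel_measurable_def intro!: order_trans[OF B] mult_right_mono\<close>)
  qed
  then show ?thesis using assms(2) by (simp add: locally_integrable_def)
qed

lemma locally_integrable_bilinear:
  fixes prod :: "'a::euclidean_space \<Rightarrow> 'b::euclidean_space \<Rightarrow> 'c::euclidean_space"
  assumes "bounded_bilinear prod" "continuous_on UNIV u" "locally_integrable w"
  shows "locally_integrable (\<lambda>x. prod (u x) (w x))"
proof (rule locally_integrable_bound[OF assms(3)])
  interpret bounded_bilinear prod by fact
  have um: "u \<in> borel_measurable borel" and wm: "w \<in> borel_measurable borel"
    using assms(2,3) by (auto simp: locally_integrable_def intro: borel_measurable_continuous_onI)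
  have "continuous_on UNIV (\<lambda>z. prod (fst z) (snd z))"
    by (intro continuous_on continuous_on_fst continuous_on_snd continuous_on_id)
  from borel_measurable_continuous_Pair[OF um wm this]
  show "(\<lambda>x. prod (u x) (w x)) \<in> borel_measurable borel" by simp
  fix R
  have "compact (u ` {-R..R})"
    by (intro compact_continuous_image continuous_on_subset[OF assms(2)]) auto
  then have "bounded (u ` {-R..R})" by (rule compact_imp_bounded)
  then obtain A where "\<forall>y\<in>u ` {-R..R}. norm y \<le> A" unfolding bounded_iff by blast
  then have A: "norm (u x) \<le> A" if "\<bar>x\<bar> \<le> R" for x using that by (auto simp: abs_le_iff)
  obtain K where K: "K \<ge> 0" "\<And>a b. norm (prod a b) \<le> norm a * norm b * K"
    using nonneg_bounded by blast
  show "\<exists>B. \<forall>x. \<bar>x\<bar> \<le> R \<longrightarrow> norm (prod (u x) (w x)) \<le> B * norm (w x)"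
  proof (intro exI[of _ "A * K"] allI impI)
    fix x assume "\<bar>x\<bar> \<le> R"
    then have "norm (u x) * norm (w x) * K \<le> A * norm (w x) * K"
      using A K by (intro mult_right_mono) auto
    then show "norm (prod (u x) (w x)) \<le> A * K * norm (w x)"
      using K(2)[of "u x" "w x"] by (simp add: algebra_simps)
  qed
qed

lemma ac_deriv_locally_integrable: "ac_deriv u v \<Longrightarrow> locally_integrable v"
  by (simp add: ac_deriv_def)

lemma ac_deriv_integral:
  assumes "ac_deriv u v" "a \<le> b"
  shows "(v has_integral (u b - u a)) {a..b}"
  using assms locally_integrable_integral[of v a b] by (auto simp: ac_deriv_def has_integral_iff)

lemma ac_derivI:
  assumes "locally_integrable v" "\<And>a b. a \<le> b \<Longrightarrow> (v has_integral (u b - u a)) {a..b}"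
  shows "ac_deriv u v"
  using assms locally_integrable_integral[of v] by (auto simp: ac_deriv_def has_integral_iff)

lemma ac_deriv_continuous:
  assumes "ac_deriv u v"
  shows "continuous_on S u"
proof (rule continuous_on_subset)
  have "isCont u x" for x
  proof -
    have int: "v integrable_on {x - 1..x + 1}"
      using assms by (auto intro: locally_integrable_integral ac_deriv_locally_integrable)
    have "continuous_on {x-1..x+1} (\<lambda>y. u (x-1) + integral {x-1..y} v)"
      by (intro continuous_intros indefinite_integral_continuous_1 int)
    then have "continuous_on {x-1..x+1} u"
      by (rule continuous_on_eq) (use ac_deriv_integral[OF assms] in \<open>auto simp: has_integral_iff\<close>)
    then show ?thesis by (rule continuous_on_interior) auto
  qed
  then show "continuous_on UNIV u" by (simp add: continuous_at_imp_continuous_on)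
qed auto

lemma ac_deriv_C1:
  assumes "\<And>x. (u has_vector_derivative v x) (at x)" "continuous_on UNIV v"
  shows "ac_deriv u v"
  using assms
  by (intro ac_derivI locally_integrable_continuous fundamental_theorem_of_calculus)
     (auto intro: has_vector_derivative_at_within)

lemma ac_deriv_has_vector_derivative:
  assumes "ac_deriv u v" "continuous_on UNIV v"
  shows "(u has_vector_derivative v x) (at x)"
proof -
  have "((\<lambda>y. integral {x-1..y} v) has_vector_derivative v x) (at x within {x-1..x+1})"
    by (rule integral_has_vector_derivative) (use assms(2) in \<open>auto intro: continuous_on_subset\<close>)
  then have "((\<lambda>y. u (x-1) + integral {x-1..y} v) has_vector_derivative 0 + v x) (at x within {x-1..x+1})"
    by (intro derivative_intros)
  then have d: "((\<lambda>y. u (x-1) + integral {x-1..y} v) has_vector_derivative v x) (at x within {x-1..x+1})"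
    by simp
  have "(u has_vector_derivative v x) (at x within {x-1..x+1})"
    by (rule has_vector_derivative_transform[OF _ _ d])
       (use ac_deriv_integral[OF assms(1)] in \<open>auto simp: has_integral_iff\<close>)
  moreover have "at x within {x-1..x+1} = at x"
    by (rule at_within_interior) auto
  ultimately show ?thesis by simp
qed

lemma ac_deriv_linear:
  fixes T :: "'a::euclidean_space \<Rightarrow> 'b::euclidean_space"
  assumes "bounded_linear T" "ac_deriv u v"
  shows "ac_deriv (\<lambda>x. T (u x)) (\<lambda>x. T (v x))"
proof (rule ac_derivI)
  interpret bounded_linear T by fact
  show "locally_integrable (\<lambda>x. T (v x))"
    by (rule locally_integrable_linear[OF assms(1) ac_deriv_locally_integrable[OF assms(2)]])
  fix a b :: real assume "a \<le> b"
  from has_integral_linear[OF ac_deriv_integral[OF assms(2) this] assms(1)]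
  show "((\<lambda>x. T (v x)) has_integral (T (u b) - T (u a))) {a..b}"
    by (simp add: o_def diff)
qed

lemma ac_deriv_add:
  assumes "ac_deriv u v" "ac_deriv u' v'"
  shows "ac_deriv (\<lambda>x. u x + u' x) (\<lambda>x. v x + v' x)"
proof (rule ac_derivI)
  show "locally_integrable (\<lambda>x. v x + v' x)"
    by (rule locally_integrable_add[OF assms[THEN ac_deriv_locally_integrable]])
  fix a b :: real assume "a \<le> b"
  from has_integral_add[OF ac_deriv_integral[OF assms(1) this] ac_deriv_integral[OF assms(2) this]]
  show "((\<lambda>x. v x + v' x) has_integral (u b + u' b - (u a + u' a))) {a..b}"
    by (simp add: algebra_simps)
qed

lemma ac_deriv_diff:
  assumes "ac_deriv u v" "ac_deriv u' v'"
  shows "ac_deriv (\<lambda>x. u x - u' x) (\<lambda>x. v x - v' x)"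
  using ac_deriv_add[OF assms(1) ac_deriv_linear[OF bounded_linear_minus[OF bounded_linear_ident] assms(2)]]
  by simp

lemma locally_integrable_ac_deriv_exists:
  assumes "locally_integrable v"
  obtains u where "ac_deriv u v" "u 0 = 0"
proof
  define u where "u x = (if 0 \<le> x then integral {0..x} v else - integral {x..0} v)" for x
  note int = locally_integrable_integral(1)[OF assms]
  show "ac_deriv u v"
  proof (rule ac_derivI[OF assms])
    fix a b :: real assume "a \<le> b"
    have "integral {a..b} v = u b - u a"
    proof (cases "0 \<le> a")
      case True
      then have "integral {0..a} v + integral {a..b} v = integral {0..b} v"
        using \<open>a \<le> b\<close> by (intro Henstock_Kurzweil_Integration.integral_combine int)
      then show ?thesis using True \<open>a \<le> b\<close> by (simp add: u_def algebra_simps)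
    next
      case False
      show ?thesis
      proof (cases "0 \<le> b")
        case True
        then have "integral {a..0} v + integral {0..b} v = integral {a..b} v"
          using False by (intro Henstock_Kurzweil_Integration.integral_combine int) auto
        then show ?thesis using True False by (simp add: u_def algebra_simps)
      next
        case b: False
        then have "integral {a..b} v + integral {b..0} v = integral {a..0} v"
          using \<open>a \<le> b\<close> by (intro Henstock_Kurzweil_Integration.integral_combine int) auto
        then show ?thesis using b False by (simp add: u_def algebra_simps)
      qed
    qed
    then show "(v has_integral (u b - u a)) {a..b}" using int by (auto simp: has_integral_iff)
  qed
  show "u 0 = 0" by (simp add: u_def)
qed

text \<open>Subdivide \<open>[a, b]\<close> into steps shorter than \<open>\<delta>\<close> and add: \<open>|F b - F a| \<le> \<epsilon> (G b - G
  a)\<close> for every \<open>\<epsilon>\<close>. This proves the product rule below without differentiating anything.\<close>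

lemma eq_if_small_increments:
  fixes F :: "real \<Rightarrow> 'a::real_normed_vector" and G :: "real \<Rightarrow> real"
  assumes "a \<le> b"
    and small: "\<And>\<epsilon>. \<epsilon> > 0 \<Longrightarrow> \<exists>\<delta>>0. \<forall>s t. a \<le> s \<and> s \<le> t \<and> t \<le> b \<and> t - s < \<delta> \<longrightarrow>
                  norm (F t - F s) \<le> \<epsilon> * (G t - G s)"
  shows "F a = F b"
proof -
  have bound: "norm (F b - F a) \<le> \<epsilon> * (G b - G a)" if "\<epsilon> > 0" for \<epsilon>
  proof -
    from small[OF that] obtain \<delta> where \<delta>: "\<delta> > 0"
      "\<And>s t. a \<le> s \<Longrightarrow> s \<le> t \<Longrightarrow> t \<le> b \<Longrightarrow> t - s < \<delta> \<Longrightarrow> norm (F t - F s) \<le> \<epsilon> * (G t - G s)"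
      by blast
    obtain n :: nat where n: "(b - a) / \<delta> < real n" using reals_Archimedean2 by blast
    define p where "p k = a + real k * ((b - a) / real n)" for k
    have "n > 0"
    proof (rule ccontr)
      assume "\<not> n > 0" then have "(b - a) / \<delta> < 0" using n by simp
      then show False using assms(1) \<delta>(1) by (simp add: divide_less_0_iff)
    qed
    have step: "p (Suc k) - p k = (b - a) / real n" for k
      unfolding p_def of_nat_Suc distrib_right by simp
    have lt: "(b - a) / real n < \<delta>" using n \<open>n > 0\<close> \<delta>(1) by (simp add: field_simps)
    have "norm (F (p k) - F a) \<le> \<epsilon> * (G (p k) - G a)" if "k \<le> n" for k
      using that
    proof (induction k)
      case 0 then show ?case by (simp add: p_def)
    next
      case (Suc k)
      have "0 \<le> (b - a) / real n" using assms(1) by simp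
      then have le: "p k \<le> p (Suc k)" using step[of k] by linarith
      have "p (Suc k) \<le> a + real n * ((b - a) / real n)"
        unfolding p_def using Suc.prems assms(1) by (intro add_left_mono mult_right_mono) (auto)
      then have "p (Suc k) \<le> b" using \<open>n > 0\<close> by simp
      moreover have "a \<le> p k" using assms(1) by (simp add: p_def)
      ultimately have "norm (F (p (Suc k)) - F (p k)) \<le> \<epsilon> * (G (p (Suc k)) - G (p k))"
        using \<delta>(2)[of "p k" "p (Suc k)"] le step[of k] lt by simp
      moreover have "norm (F (p (Suc k)) - F a) \<le> norm (F (p (Suc k)) - F (p k)) + norm (F (p k) - F a)"
        using norm_triangle_ineq[of "F (p (Suc k)) - F (p k)" "F (p k) - F a"] by simp
      ultimately show ?case using Suc by (simp add: algebra_simps)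
    qed
    from this[of n] show ?thesis using \<open>n > 0\<close> by (simp add: p_def)
  qed
  have "norm (F b - F a) \<le> 0"
  proof (rule field_le_epsilon)
    fix e :: real assume "e > 0"
    define d where "d = \<bar>G b - G a\<bar> + 1"
    have "d > 0" "\<bar>G b - G a\<bar> \<le> d" by (auto simp: d_def)
    have "norm (F b - F a) \<le> (e / d) * (G b - G a)" using bound[of "e/d"] \<open>e > 0\<close> \<open>d > 0\<close> by simp
    also have "\<dots> \<le> (e / d) * d" using \<open>e > 0\<close> \<open>d > 0\<close> \<open>\<bar>G b - G a\<bar> \<le> d\<close> by (intro mult_left_mono) auto
    finally show "norm (F b - F a) \<le> 0 + e" using \<open>d > 0\<close> by simp
  qed
  then show ?thesis by simp
qed

text \<open>The difference of the product and of a primitive of the expected derivative satisfies \<open>eq_if_small_increments\<close>: over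
  \<open>[s, t]\<close> its increment is the integral of \<open>prod (u s - u r) (y r) + prod (v r) (x t - x r)\<close>, which uniform continuity of
  \<open>u\<close> and \<open>x\<close> makes small compared with the integral of \<open>|v| + |y|\<close>.\<close>

lemma ac_deriv_bilinear:
  fixes prod :: "'a::euclidean_space \<Rightarrow> 'b::euclidean_space \<Rightarrow> 'c::euclidean_space"
  assumes bil: "bounded_bilinear prod" and u: "ac_deriv u v" and x: "ac_deriv x y"
  shows "ac_deriv (\<lambda>t. prod (u t) (x t)) (\<lambda>t. prod (u t) (y t) + prod (v t) (x t))"
proof (rule ac_derivI)
  interpret bounded_bilinear prod by fact
  define g where "g t = prod (u t) (y t) + prod (v t) (x t)" for t
  note lu = ac_deriv_locally_integrable[OF u] and lx = ac_deriv_locally_integrable[OF x]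
  note cu = ac_deriv_continuous[OF u] and cx = ac_deriv_continuous[OF x]
  have lg: "locally_integrable g"
    unfolding g_def
    using locally_integrable_bilinear[OF bil cu lx] locally_integrable_bilinear[OF flip cx lu]
    by (intro locally_integrable_add)
  then show "locally_integrable (\<lambda>t. prod (u t) (y t) + prod (v t) (x t))" by (simp add: g_def[abs_def])
  define h where "h t = norm (y t) + norm (v t)" for t
  have lh: "locally_integrable h"
    unfolding h_def by (intro locally_integrable_add locally_integrable_norm lu lx)
  fix a b :: real assume ab: "a \<le> b"
  obtain P where P: "ac_deriv P g" using locally_integrable_ac_deriv_exists[OF lg] by blast
  obtain Q where Q: "ac_deriv Q h" using locally_integrable_ac_deriv_exists[OF lh] by blast
  obtain K where K: "K > 0" "\<And>a b. norm (prod a b) \<le> norm a * norm b * K" using pos_bounded by blast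
  define F where "F t = prod (u t) (x t) - P t" for t
  have "F a = F b"
  proof (rule eq_if_small_increments[OF ab])
    fix \<epsilon> :: real assume "\<epsilon> > 0"
    then have eK: "\<epsilon> / K > 0" using K by simp
    have "uniformly_continuous_on {a..b} u" "uniformly_continuous_on {a..b} x"
      by (intro compact_uniformly_continuous cu cx compact_Icc)+
    note uc = this[unfolded uniformly_continuous_on_def, rule_format, OF eK]
    obtain d1 where d1: "d1 > 0"
      "\<forall>s\<in>{a..b}. \<forall>t\<in>{a..b}. dist t s < d1 \<longrightarrow> dist (u t) (u s) < \<epsilon> / K" using uc(1) by blast
    obtain d2 where d2: "d2 > 0"
      "\<forall>s\<in>{a..b}. \<forall>t\<in>{a..b}. dist t s < d2 \<longrightarrow> dist (x t) (x s) < \<epsilon> / K" using uc(2) by blast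
    note d = d1(1) d2(1) d1(2)[rule_format] d2(2)[rule_format]
    show "\<exists>\<delta>>0. \<forall>s t. a \<le> s \<and> s \<le> t \<and> t \<le> b \<and> t - s < \<delta> \<longrightarrow> norm (F t - F s) \<le> \<epsilon> * (Q t - Q s)"
    proof (intro exI[of _ "min d1 d2"] conjI allI impI)
      show "min d1 d2 > 0" using d by simp
      fix s t assume st: "a \<le> s \<and> s \<le> t \<and> t \<le> b \<and> t - s < min d1 d2"
      have 1: "((\<lambda>r. prod (u s) (y r)) has_integral (prod (u s) (x t - x s))) {s..t}"
        using has_integral_linear[OF ac_deriv_integral[OF x] bounded_linear_right] st by (auto simp: o_def)
      have 2: "((\<lambda>r. prod (v r) (x t)) has_integral (prod (u t - u s) (x t))) {s..t}"
        using has_integral_linear[OF ac_deriv_integral[OF u] bounded_linear_left] st by (auto simp: o_def)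
      have 3: "(g has_integral (P t - P s)) {s..t}" using ac_deriv_integral[OF P] st by blast
      have i: "((\<lambda>r. prod (u s - u r) (y r) + prod (v r) (x t - x r)) has_integral (F t - F s)) {s..t}"
        using has_integral_diff[OF has_integral_add[OF 1 2] 3]
        by (simp add: g_def F_def diff_left diff_right algebra_simps)
      have "norm (F t - F s) \<le> integral {s..t} (\<lambda>r. \<epsilon> * h r)"
        unfolding integral_unique[OF i, symmetric]
      proof (rule integral_norm_bound_integral)
        show "(\<lambda>r. \<epsilon> * h r) integrable_on {s..t}"
          using locally_integrable_integral(1)[OF lh] by (intro integrable_on_mult_right) auto
        fix r assume r: "r \<in> {s..t}"
        have bu: "norm (u s - u r) \<le> \<epsilon> / K" and bx: "norm (x t - x r) \<le> \<epsilon> / K"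
          using d(3)[of r s] d(4)[of r t] st r by (auto simp: dist_norm)
        have "norm (prod (u s - u r) (y r) + prod (v r) (x t - x r)) \<le>
              norm (u s - u r) * norm (y r) * K + norm (v r) * norm (x t - x r) * K"
          by (intro norm_triangle_le add_mono K)
        also have "\<dots> \<le> (\<epsilon> / K) * norm (y r) * K + norm (v r) * (\<epsilon> / K) * K"
          using bu bx K by (intro add_mono mult_right_mono mult_left_mono) auto
        also have "\<dots> = \<epsilon> * h r" using K by (simp add: h_def algebra_simps)
        finally show "norm (prod (u s - u r) (y r) + prod (v r) (x t - x r)) \<le> \<epsilon> * h r" .
      qed (use i in blast)
      also have "\<dots> = \<epsilon> * (Q t - Q s)"
        using ac_deriv_integral[OF Q, of s t] st by (auto simp: has_integral_iff)
      finally show "norm (F t - F s) \<le> \<epsilon> * (Q t - Q s)" .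
    qed
  qed
  then have "prod (u b) (x b) - prod (u a) (x a) = P b - P a"
    by (simp add: F_def algebra_simps)
  then show "((\<lambda>t. prod (u t) (y t) + prod (v t) (x t)) has_integral prod (u b) (x b) - prod (u a) (x a)) {a..b}"
    using ac_deriv_integral[OF P ab] by (simp add: g_def[abs_def])
qed

lemma ac_deriv_scaleR:
  assumes "ac_deriv c d" "ac_deriv u (v :: real \<Rightarrow> 'a::euclidean_space)"
  shows "ac_deriv (\<lambda>t. c t *\<^sub>R u t) (\<lambda>t. c t *\<^sub>R v t + d t *\<^sub>R u t)"
  by (rule ac_deriv_bilinear[OF bounded_bilinear_scaleR assms])

lemma ac_deriv_inner:
  assumes "ac_deriv u v" "ac_deriv x (y :: real \<Rightarrow> 'a::euclidean_space)"
  shows "ac_deriv (\<lambda>t. u t \<bullet> x t) (\<lambda>t. u t \<bullet> y t + v t \<bullet> x t)"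
  by (rule ac_deriv_bilinear[OF bounded_bilinear_inner assms])

lemma integral_interval_tendsto:
  fixes g :: "real \<Rightarrow> 'a::euclidean_space"
  assumes "integrable lborel g"
  shows "(\<lambda>n::nat. LINT x:{- real n..real n}|lborel. g x) \<longlonglongrightarrow> (LINT x|lborel. g x)"
  unfolding set_lebesgue_integral_def
proof (rule integral_dominated_convergence[where w = "\<lambda>x. norm (g x)"])
  show "AE x in lborel. (\<lambda>n. indicator {- real n..real n} x *\<^sub>R g x) \<longlonglongrightarrow> g x"
  proof (rule AE_I2, rule tendsto_eventually)
    fix x :: real
    obtain N :: nat where N: "\<bar>x\<bar> \<le> real N" using real_arch_simple by blast
    show "\<forall>\<^sub>F n in sequentially. indicator {- real n..real n} x *\<^sub>R g x = g x"
      using eventually_ge_at_top[of N] by eventually_elim (use N in \<open>auto simp: indicator_def\<close>)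
  qed
qed (use assms in \<open>auto simp: indicator_def\<close>)

lemma not_integrable_if_bounded_below:
  fixes h :: "real \<Rightarrow> real"
  assumes i: "integrable lborel h" and nn: "\<And>x. 0 \<le> h x" and d: "0 < \<delta>" and le: "\<And>x. y \<le> x \<Longrightarrow> \<delta> \<le> h x"
  shows False
proof -
  define B where "B = (LINT x|lborel. h x)"
  have le: "real k * \<delta> \<le> B" for k :: nat
  proof -
    have "real k * \<delta> = (LINT t:{y..y + real k}|lborel. \<delta>)" by (simp add: set_integral_const)
    also have "\<dots> \<le> B"
      unfolding B_def set_lebesgue_integral_def
    proof (rule integral_mono)
      show "integrable lborel (\<lambda>t. indicat_real {y..y + real k} t *\<^sub>R \<delta>)"
        by (intro integrable_scaleR_left integrable_real_indicator) auto
    qed (use i nn le in \<open>auto simp: indicator_def\<close>)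
    finally show ?thesis .
  qed
  obtain k :: nat where "B / \<delta> < real k" using reals_Archimedean2 by blast
  with le[of k] d show False by (simp add: field_simps)
qed

text \<open>The substitute for boundary terms at infinity: \<open>G\<close> has limits at both ends because \<open>g\<close> is integrable, and they
  vanish because \<open>G\<close> is integrable. If the integral \<open>I\<close> of \<open>g\<close> were not 0, then \<open>|G t| + |G (-t)|\<close>
  would stay above \<open>|I| / 2\<close> for large \<open>t\<close>.\<close>

lemma integral_ac_deriv_eq_0:
  fixes G :: "real \<Rightarrow> real"
  assumes ac: "ac_deriv G g" and g: "integrable lborel g" and G: "integrable lborel G"
  shows "(LINT x|lborel. g x) = 0"
proof (rule ccontr)
  define I where "I = (LINT x|lborel. g x)"
  assume "(LINT x|lborel. g x) \<noteq> 0"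
  then have I: "\<bar>I\<bar> > 0" by (simp add: I_def)
  have lim: "(\<lambda>n::nat. LINT x:{- real n..real n}|lborel. g x) \<longlonglongrightarrow> I"
    unfolding I_def by (rule integral_interval_tendsto[OF g])
  have lim2: "(\<lambda>n::nat. LINT x:{- real n..real n}|lborel. \<bar>g x\<bar>) \<longlonglongrightarrow> (LINT x|lborel. \<bar>g x\<bar>)"
    by (rule integral_interval_tendsto) (use g in simp)
  define A where "A = (LINT x|lborel. \<bar>g x\<bar>)"
  have e: "\<bar>I\<bar> / 8 > 0" using I by simp
  obtain N1 where N1: "\<And>n. n \<ge> N1 \<Longrightarrow> \<bar>(LINT x:{- real n..real n}|lborel. g x) - I\<bar> < \<bar>I\<bar> / 8"
    using LIMSEQ_D[OF lim e] by auto
  obtain N2 where N2: "\<And>n. n \<ge> N2 \<Longrightarrow> \<bar>(LINT x:{- real n..real n}|lborel. \<bar>g x\<bar>) - A\<bar> < \<bar>I\<bar> / 8"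
    using LIMSEQ_D[OF lim2 e] by (auto simp: A_def)
  define N where "N = max N1 N2"
  have sint: "set_integrable lborel S g" if "S \<in> sets borel" for S
    using g that unfolding set_integrable_def by (intro integrable_mult_indicator) auto
  have sintn: "set_integrable lborel S (\<lambda>x. \<bar>g x\<bar>)" if "S \<in> sets borel" for S
    using g that unfolding set_integrable_def by (intro integrable_mult_indicator) auto
  have inc: "\<bar>G t - G s\<bar> \<le> \<bar>I\<bar> / 8" if st: "s \<le> t" "real N \<le> s \<or> t \<le> - real N" for s t
  proof -
    have "\<bar>G t - G s\<bar> = \<bar>LINT x:{s..t}|lborel. g x\<bar>" using ac st by (simp add: ac_deriv_def)
    also have "\<dots> = \<bar>LINT x:{s<..<t}|lborel. g x\<bar>"
      by (rule arg_cong[where f=abs], unfold set_lebesgue_integral_def, rule integral_cong_AE)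
         (use g AE_lborel_singleton[of s] AE_lborel_singleton[of t] in \<open>auto elim!: eventually_elim2 simp: indicator_def\<close>)
    also have "\<dots> \<le> (LINT x:{s<..<t}|lborel. \<bar>g x\<bar>)"
      using set_integral_norm_bound[OF sint, of "{s<..<t}"] by simp
    also have "\<dots> = (LINT x:{s<..<t} \<union> {- real N..real N}|lborel. \<bar>g x\<bar>) - (LINT x:{- real N..real N}|lborel. \<bar>g x\<bar>)"
      by (subst set_integral_Un) (use st sintn in auto)
    also have "(LINT x:{s<..<t} \<union> {- real N..real N}|lborel. \<bar>g x\<bar>) \<le> A"
      unfolding A_def set_lebesgue_integral_def
      by (rule integral_mono) (use sintn[of "{s<..<t} \<union> {- real N..real N}"] g in \<open>auto simp: set_integrable_def indicator_def\<close>)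
    finally show ?thesis using N2[of N] by (simp add: N_def)
  qed
  have GN: "\<bar>G (real N) - G (- real N)\<bar> \<ge> \<bar>I\<bar> * 7 / 8"
    using N1[of N] ac abs_triangle_ineq2[of I "G (real N) - G (- real N)"]
      abs_minus_commute[of I "G (real N) - G (- real N)"]
    by (simp add: N_def ac_deriv_def)
  have big: "\<bar>G t\<bar> + \<bar>G (- t)\<bar> \<ge> \<bar>I\<bar> / 2" if "t \<ge> real N" for t
    using inc[of "real N" t] inc[of "- t" "- real N"] GN that by linarith
  have int2: "integrable lborel (\<lambda>t. \<bar>G t\<bar> + \<bar>G (- t)\<bar>)"
    using lborel_integrable_real_affine[OF G, of "-1" 0] G by simp
  show False
    by (rule not_integrable_if_bounded_below[OF int2 _ _ big]) (use I in auto)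
qed

text \<open>Intervals form an intersection-stable generator of the Borel sets, so the integral of \<open>h\<close> over every bounded Borel set
  vanishes.\<close>

lemma AE_eq_0_if_integral_intervals_0:
  fixes h :: "real \<Rightarrow> 'a::euclidean_space"
  assumes loc: "locally_integrable h" and zero: "\<And>a b. a \<le> b \<Longrightarrow> (LINT x:{a..b}|lborel. h x) = 0"
  shows "AE x in lborel. h x = 0"
proof -
  have intervals: "sets (borel :: real measure) = sigma_sets UNIV (range (\<lambda>(a, b). {a..b}))"
    by (subst borel_eq_atLeastAtMost) simp
  have n: "AE x in lborel. indicator {- real n..real n} x *\<^sub>R h x = 0" for n
  proof (rule sigma_finite_measure.density_zero[OF sigma_finite_lborel])
    let ?f = "\<lambda>x. indicator {- real n..real n} x *\<^sub>R h x"
    show int: "integrable lborel ?f"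
      using loc by (auto simp: locally_integrable_def set_integrable_def)
    fix A assume "A \<in> sets (lborel :: real measure)"
    then have mem: "A \<in> sigma_sets UNIV (range (\<lambda>(a, b). {a..b::real}))"
      by (simp add: intervals)
    have "Int_stable (range (\<lambda>(a, b). {a..b::real}))" by (auto simp: Int_stable_def)
    moreover have "range (\<lambda>(a, b). {a..b::real}) \<subseteq> Pow UNIV" by simp
    moreover note mem
    ultimately show "set_lebesgue_integral lborel A ?f = 0"
    proof (induction rule: sigma_sets_induct_disjoint)
      case (basic A)
      then obtain a b where A: "A = {a..b}" by auto
      have "set_lebesgue_integral lborel A ?f = (LINT x:{max a (- real n)..min b (real n)}|lborel. h x)"
        unfolding set_lebesgue_integral_def A by (intro Bochner_Integration.integral_cong) (auto simp: indicator_def)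
      also have "\<dots> = 0"
      proof (cases "max a (- real n) \<le> min b (real n)")
        case True then show ?thesis by (rule zero)
      next
        case False
        then have "{max a (- real n)..min b (real n)} = {}" by auto
        then show ?thesis unfolding set_lebesgue_integral_def by simp
      qed
      finally show ?case .
    next
      case empty then show ?case by (simp add: set_lebesgue_integral_def)
    next
      case (compl A)
      then have Ab: "A \<in> sets borel" by (simp add: intervals)
      have "set_lebesgue_integral lborel (A \<union> (UNIV - A)) ?f = set_lebesgue_integral lborel A ?f + set_lebesgue_integral lborel (UNIV - A) ?f"
      proof (rule set_integral_Un)
        show "set_integrable lborel A ?f" "set_integrable lborel (UNIV - A) ?f"
          unfolding set_integrable_def by (rule integrable_mult_indicator[OF _ int]; use Ab in auto)+
      qed auto
      moreover have "set_lebesgue_integral lborel (A \<union> (UNIV - A)) ?f = (LINT x:{- real n..real n}|lborel. h x)"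
        unfolding set_lebesgue_integral_def by (simp add: Un_Diff_cancel)
      ultimately show ?case using compl zero[of "- real n" "real n"] by simp
    next
      case (union A)
      then have Ab: "A i \<in> sets borel" for i by (auto simp: intervals)
      have "set_lebesgue_integral lborel (\<Union>i. A i) ?f = (\<Sum>i. set_lebesgue_integral lborel (A i) ?f)"
      proof (rule lebesgue_integral_countable_add)
        show "set_integrable lborel (\<Union>i. A i) ?f"
          unfolding set_integrable_def by (rule integrable_mult_indicator) (use int Ab in auto)
      qed (use union.hyps Ab in \<open>auto simp: disjoint_family_on_def\<close>)
      then show ?case using union.IH by simp
    qed
  qed
  have "AE x in lborel. \<forall>n::nat. indicator {- real n..real n} x *\<^sub>R h x = 0"
    using n by (subst AE_all_countable) blast
  then show ?thesis
  proof (rule AE_mp, intro AE_I2 impI)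
    fix x :: real assume a: "\<forall>n::nat. indicator {- real n..real n} x *\<^sub>R h x = 0"
    obtain n :: nat where "\<bar>x\<bar> \<le> real n" using real_arch_simple by blast
    then show "h x = 0" using spec[OF a, of n] by (auto simp: indicator_def)
  qed
qed

section \<open>Spinors and square-integrable functions\<close>

text \<open>The matrix \<open>-i sigma1\<close> in front of the derivative. It is an isometry with square \<open>-1\<close>, so that an equation
  \<open>J u' = g\<close> can be solved for \<open>u'\<close>.\<close>

definition J :: "complex ^ 2 \<Rightarrow> complex ^ 2" where
  "J v = (- \<i>) *s (sigma1 *v v)"

lemma sigma1_component: "(sigma1 *v v) $ 1 = v $ 2" "(sigma1 *v v) $ 2 = v $ 1"
  by (simp_all add: sigma1_def matrix_vector_mult_def sum_2)

lemma sigma3_component: "(sigma3 *v v) $ 1 = v $ 1" "(sigma3 *v v) $ 2 = - v $ 2"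
  by (simp_all add: sigma3_def matrix_vector_mult_def sum_2)

lemma J_component: "J v $ 1 = - \<i> * v $ 2" "J v $ 2 = - \<i> * v $ 1"
  by (simp_all add: J_def sigma1_component)

lemma inner_spinor: "(u :: complex ^ 2) \<bullet> v = u $ 1 \<bullet> v $ 1 + u $ 2 \<bullet> v $ 2"
  by (simp add: inner_vec_def sum_2)

lemma norm_spinor: "(norm (u :: complex ^ 2))\<^sup>2 = (cmod (u $ 1))\<^sup>2 + (cmod (u $ 2))\<^sup>2"
  by (simp add: power2_norm_eq_inner inner_spinor)

lemma bounded_linear_matrix: "bounded_linear (\<lambda>v :: complex ^ 2. A *v v)"
  for A :: "complex ^ 2 ^ 2"
proof -
  have "A *v (r *\<^sub>R v) = r *\<^sub>R (A *v v)" for r and v :: "complex ^ 2"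
    by (simp add: vec_eq_iff matrix_vector_mult_def scaleR_sum_right)
  then have "linear (\<lambda>v :: complex ^ 2. A *v v)"
    by (intro linearI) (simp_all add: matrix_vector_right_distrib)
  then show ?thesis by (simp add: linear_conv_bounded_linear)
qed

lemma bounded_linear_J: "bounded_linear J"
  unfolding J_def[abs_def]
  by (rule bounded_linear_compose[OF bounded_linear_vector_scalar_mult bounded_linear_matrix])

lemmas spinor_simps = J_component sigma1_component sigma3_component inner_spinor
  vec_eq_iff forall_2 inner_complex_def

lemma J_J [simp]: "J (J v) = - v"
  by (simp add: spinor_simps)

lemma norm_sigma [simp]: "norm (sigma1 *v v) = norm v" "norm (sigma3 *v v) = norm v" "norm (J v) = norm v"
  by (simp_all add: power2_eq_iff_nonneg[symmetric, of "norm _" "norm v"] norm_spinor spinor_simps(1-6)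
      norm_mult del: power2_eq_iff_nonneg)

lemma sigma3_sigma3 [simp]: "sigma3 *v (sigma3 *v v) = v"
  by (simp add: spinor_simps)

definition l2 :: "(real \<Rightarrow> complex ^ 2) \<Rightarrow> real" where
  "l2 u = sqrt (LINT x|lborel. (norm (u x))\<^sup>2)"

lemma l2_nonneg [simp]: "0 \<le> l2 u"
  by (simp add: l2_def)

lemma l2_square: "(l2 u)\<^sup>2 = (LINT x|lborel. (norm (u x))\<^sup>2)"
  by (simp add: l2_def)

lemma ae_eq_refl [simp]: "ae_eq u u \<longleftrightarrow> square_integrable u"
  by (simp add: ae_eq_def)

lemma abs_eq_iff:
  assumes "square_integrable u" "square_integrable v"
  shows "abs_L2C2 u = abs_L2C2 v \<longleftrightarrow> (AE x in lborel. u x = v x)"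
  using Quotient3_rel[OF Quotient3_L2C2, of u v] assms by (auto simp: ae_eq_def)

lemma inner_abs:
  assumes "square_integrable u" "square_integrable v"
  shows "abs_L2C2 u \<bullet> abs_L2C2 v = (LINT x|lborel. u x \<bullet> v x)"
  using assms by (subst inner_L2C2.abs_eq) (simp_all)

lemma norm_abs:
  assumes "square_integrable u"
  shows "norm (abs_L2C2 u) = l2 u"
  using assms by (simp add: norm_eq_sqrt_inner inner_abs l2_def power2_norm_eq_inner)

lemma add_abs:
  assumes "square_integrable u" "square_integrable v"
  shows "abs_L2C2 u + abs_L2C2 v = abs_L2C2 (\<lambda>x. u x + v x)"
  using assms by (subst plus_L2C2.abs_eq) simp_all

lemma scaleR_abs:
  assumes "square_integrable u"
  shows "r *\<^sub>R abs_L2C2 u = abs_L2C2 (\<lambda>x. r *\<^sub>R u x)"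
  using assms by (subst scaleR_L2C2.abs_eq) simp_all

lemma square_integrable_rep [simp]: "square_integrable (rep_L2C2 z)"
  using Quotient3_rel_rep[OF Quotient3_L2C2, of z z] by simp

lemma abs_rep [simp]: "abs_L2C2 (rep_L2C2 z) = z"
  using Quotient3_abs_rep[OF Quotient3_L2C2] .

lemma rep_abs_AE:
  assumes "square_integrable u"
  shows "AE x in lborel. rep_L2C2 (abs_L2C2 u) x = u x"
  using assms abs_eq_iff[of "rep_L2C2 (abs_L2C2 u)" u] by simp

lemma square_integrable_diff:
  assumes "square_integrable u" "square_integrable v"
  shows "square_integrable (\<lambda>x. u x - v x)"
  using square_integrable_add[OF assms(1) square_integrable_scaleR[OF assms(2), of "-1"]] by simp

lemma diff_abs:
  assumes "square_integrable u" "square_integrable v"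
  shows "abs_L2C2 u - abs_L2C2 v = abs_L2C2 (\<lambda>x. u x - v x)"
proof -
  have "abs_L2C2 u - abs_L2C2 v = abs_L2C2 u + (-1) *\<^sub>R abs_L2C2 v" by simp
  also have "\<dots> = abs_L2C2 (\<lambda>x. u x - v x)"
    using assms by (simp only: scaleR_abs add_abs square_integrable_scaleR) simp
  finally show ?thesis .
qed

lemma square_integrable_measurable: "square_integrable u \<Longrightarrow> u \<in> borel_measurable borel"
  by (simp add: square_integrable_def)

lemma square_integrable_norm: "square_integrable u \<Longrightarrow> integrable lborel (\<lambda>x. (norm (u x))\<^sup>2)"
  by (simp add: square_integrable_def)

lemma square_integrable_bound:
  assumes "square_integrable u" "w \<in> borel_measurable borel" "\<And>x. norm (w x) \<le> B * norm (u x)"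
  shows "square_integrable w" "l2 w \<le> \<bar>B\<bar> * l2 u"
proof -
  have le: "(norm (w x))\<^sup>2 \<le> B\<^sup>2 * (norm (u x))\<^sup>2" for x
    using power_mono[OF assms(3)[of x] norm_ge_zero, of 2] by (simp add: power_mult_distrib)
  have int: "integrable lborel (\<lambda>x. B\<^sup>2 * (norm (u x))\<^sup>2)"
    using assms(1) by (simp add: square_integrable_def)
  have "integrable lborel (\<lambda>x. (norm (w x))\<^sup>2)"
    by (rule Bochner_Integration.integrable_bound[OF int]) (use assms(2) le in \<open>auto intro!: AE_I2\<close>)
  then show w: "square_integrable w" using assms(2) by (simp add: square_integrable_def)
  have "(LINT x|lborel. (norm (w x))\<^sup>2) \<le> (LINT x|lborel. B\<^sup>2 * (norm (u x))\<^sup>2)"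
    by (rule integral_mono) (use w int le in \<open>auto simp: square_integrable_def\<close>)
  then have "(l2 w)\<^sup>2 \<le> (\<bar>B\<bar> * l2 u)\<^sup>2" by (simp add: l2_square power_mult_distrib)
  then show "l2 w \<le> \<bar>B\<bar> * l2 u" by (rule power2_le_imp_le) simp
qed

lemma square_integrable_linear:
  assumes "square_integrable u" "bounded_linear T"
  shows "square_integrable (\<lambda>x. T (u x))"
proof -
  obtain K where K: "\<And>x. norm (T x) \<le> K * norm x"
    using bounded_linear.bounded[OF assms(2)] by (metis mult.commute)
  have "(\<lambda>x. T (u x)) \<in> borel_measurable borel"
    using assms(1) borel_measurable_continuous_onI[OF linear_continuous_on[OF assms(2)]]
    by (auto simp: square_integrable_def intro: measurable_compose)
  then show ?thesis by (rule square_integrable_bound(1)[OF assms(1) _ K])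
qed

lemma square_integrable_J: "square_integrable u \<Longrightarrow> square_integrable (\<lambda>x. J (u x))"
  by (rule square_integrable_linear[OF _ bounded_linear_J])

lemma square_integrable_sigma: "square_integrable u \<Longrightarrow> square_integrable (\<lambda>x. A *v u x)"
  by (rule square_integrable_linear[OF _ bounded_linear_matrix])

lemma l2_triangle:
  assumes "square_integrable u" "square_integrable v"
  shows "l2 (\<lambda>x. u x + v x) \<le> l2 u + l2 v"
  using norm_triangle_ineq[of "abs_L2C2 u" "abs_L2C2 v"] assms
  by (simp add: add_abs norm_abs square_integrable_add)

lemma l2_triangle_diff:
  assumes "square_integrable u" "square_integrable v"
  shows "l2 (\<lambda>x. u x - v x) \<le> l2 u + l2 v"
  using norm_triangle_ineq4[of "abs_L2C2 u" "abs_L2C2 v"] assms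
  by (simp add: diff_abs norm_abs square_integrable_diff)

lemma l2_scaleR: "l2 (\<lambda>x. r *\<^sub>R u x) = \<bar>r\<bar> * l2 u"
  by (simp add: l2_def power_mult_distrib real_sqrt_mult)

lemma l2_cong_norm: "(\<And>x. norm (u x) = norm (v x)) \<Longrightarrow> l2 u = l2 v"
  by (simp add: l2_def)

lemma Cauchy_Schwarz_l2:
  assumes "square_integrable u" "square_integrable v"
  shows "\<bar>LINT x|lborel. u x \<bullet> v x\<bar> \<le> l2 u * l2 v"
  using Cauchy_Schwarz_ineq2[of "abs_L2C2 u" "abs_L2C2 v"] assms by (simp add: inner_abs norm_abs)

lemma integrable_inner_bound:
  fixes g :: "real \<Rightarrow> real"
  assumes "square_integrable u" "square_integrable v" "g \<in> borel_measurable borel"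
    "\<And>x. \<bar>g x\<bar> \<le> B * (norm (u x) * norm (v x))"
  shows "integrable lborel g"
proof (rule Bochner_Integration.integrable_bound)
  show "integrable lborel (\<lambda>x. \<bar>B\<bar> * ((norm (u x))\<^sup>2 + (norm (v x))\<^sup>2))"
    using assms(1,2) by (simp add: square_integrable_def)
  show "AE x in lborel. norm (g x) \<le> norm (\<bar>B\<bar> * ((norm (u x))\<^sup>2 + (norm (v x))\<^sup>2))"
  proof (rule AE_I2)
    fix x
    have 1: "norm (u x) * norm (v x) \<le> (norm (u x))\<^sup>2 + (norm (v x))\<^sup>2"
      using sum_squares_bound[of "norm (u x)" "norm (v x)"] mult_nonneg_nonneg[OF norm_ge_zero[of "u x"] norm_ge_zero[of "v x"]] by linarith
    have "\<bar>g x\<bar> \<le> \<bar>B\<bar> * (norm (u x) * norm (v x))"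
      by (rule order_trans[OF assms(4) mult_right_mono]) auto
    also have "\<dots> \<le> \<bar>B\<bar> * ((norm (u x))\<^sup>2 + (norm (v x))\<^sup>2)"
      by (rule mult_left_mono[OF 1]) simp
    finally show "norm (g x) \<le> norm (\<bar>B\<bar> * ((norm (u x))\<^sup>2 + (norm (v x))\<^sup>2))" by simp
  qed
qed (use assms(3) in simp)

section \<open>The Dirac expression and the graph estimate\<close>

text \<open>The expression \<open>(-i d/dx sigma1 + m sigma3 + iW - a) u\<close>, with \<open>v\<close> in the place of \<open>u'\<close>.\<close>

definition dirac_expr :: "real \<Rightarrow> (real \<Rightarrow> real) \<Rightarrow> real \<Rightarrow> (real \<Rightarrow> complex ^ 2) \<Rightarrow> (real \<Rightarrow> complex ^ 2) \<Rightarrow> real \<Rightarrow> complex ^ 2"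
  where "dirac_expr m W a u v x =
    J (v x) + m *\<^sub>R (sigma3 *v u x) + W x *\<^sub>R (\<i> *s u x) - a *\<^sub>R u x"

text \<open>Here \<open>u\<close> is the continuous representative of an element of the operator domain and \<open>v\<close> its derivative. All
  estimates are carried out on such pairs.\<close>

definition dirac_pair :: "(real \<Rightarrow> real) \<Rightarrow> (real \<Rightarrow> complex ^ 2) \<Rightarrow> (real \<Rightarrow> complex ^ 2) \<Rightarrow> bool" where
  "dirac_pair W u v \<longleftrightarrow> ac_deriv u v \<and> square_integrable u \<and> square_integrable v \<and>
     square_integrable (\<lambda>x. W x *\<^sub>R u x)"

text \<open>The best constant \<open>c\<close> is the inverse of the norm of the resolvent; see \<open>resolvent_dirac\<close>.\<close>

definition lower_bound :: "real \<Rightarrow> (real \<Rightarrow> real) \<Rightarrow> real \<Rightarrow> real \<Rightarrow> bool" where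
  "lower_bound m W a c \<longleftrightarrow> (\<forall>u v. dirac_pair W u v \<longrightarrow> c * l2 u \<le> l2 (dirac_expr m W a u v))"

lemma dirac_pairD:
  assumes "dirac_pair W u v"
  shows "ac_deriv u v" "square_integrable u" "square_integrable v"
    "square_integrable (\<lambda>x. W x *\<^sub>R u x)"
  using assms by (auto simp: dirac_pair_def)

lemma norm_i [simp]: "norm (\<i> *s v) = norm (v :: complex ^ 'n)"
  by (simp add: norm_vector_scalar_mult)

lemma square_integrable_dirac_expr:
  assumes "dirac_pair W u v"
  shows "square_integrable (dirac_expr m W a u v)"
proof -
  note d = dirac_pairD[OF assms]
  have "square_integrable (\<lambda>x. W x *\<^sub>R (\<i> *s u x))"
  proof -
    have "(\<lambda>x. W x *\<^sub>R (\<i> *s u x)) = (\<lambda>x. \<i> *s (W x *\<^sub>R u x))" by (simp add: fun_eq_iff vec_eq_iff)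
    then show ?thesis using square_integrable_cscale[OF d(4)] by simp
  qed
  then show ?thesis
    unfolding dirac_expr_def[abs_def]
    by (intro square_integrable_diff square_integrable_add square_integrable_J d
        square_integrable_scaleR square_integrable_sigma)
qed

lemma dirac_expr_norm_square:
  "(norm (J v + m *\<^sub>R (sigma3 *v u) + w *\<^sub>R (\<i> *s u) - a *\<^sub>R u))\<^sup>2 =
   (norm (J v + m *\<^sub>R (sigma3 *v u) - a *\<^sub>R u))\<^sup>2 + w\<^sup>2 * (norm u)\<^sup>2 - w * (u \<bullet> (sigma1 *v v) + v \<bullet> (sigma1 *v u))"
  unfolding power2_norm_eq_inner
  by (simp add: spinor_simps(1-7) inner_complex_def algebra_simps power2_eq_square)

text \<open>Write \<open>T\<^sub>W u = S u + iW u\<close> with \<open>S\<close> symmetric. The cross term in \<open>|T\<^sub>W u|\<^sup>2\<close> is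
  \<open>- W h'\<close> with \<open>h = \<langle>u, sigma1 u\<rangle>\<close>, because the mass term and \<open>a\<close> contribute nothing to it;
  integrated by parts it becomes \<open>W' h\<close>, and \<open>|h| \<le> |u|\<^sup>2\<close>. The hypothesis on \<open>W'\<close> lets the positive
  term \<open>W\<^sup>2 |u|\<^sup>2\<close> absorb it.\<close>

lemma graph_estimate:
  assumes dom: "dirac_pair W u v" and W: "\<And>x. (W has_real_derivative W' x) (at x)" "continuous_on UNIV W'"
    and bd: "\<And>x. \<bar>W' x\<bar> \<le> M + \<epsilon> * (W x)\<^sup>2"
  shows "(l2 (\<lambda>x. J (v x) + m *\<^sub>R (sigma3 *v u x) - a *\<^sub>R u x))\<^sup>2 + (1 - \<epsilon>) * (l2 (\<lambda>x. W x *\<^sub>R u x))\<^sup>2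
          \<le> (l2 (dirac_expr m W a u v))\<^sup>2 + M * (l2 u)\<^sup>2"
proof -
  note d = dirac_pairD[OF dom]
  define h where "h x = u x \<bullet> (sigma1 *v u x)" for x
  define h' where "h' x = u x \<bullet> (sigma1 *v v x) + v x \<bullet> (sigma1 *v u x)" for x
  define S where "S x = J (v x) + m *\<^sub>R (sigma3 *v u x) - a *\<^sub>R u x" for x
  have [measurable]: "u \<in> borel_measurable borel" "v \<in> borel_measurable borel"
    using d by (auto intro: square_integrable_measurable)
  have Wm: "W \<in> borel_measurable borel" "W' \<in> borel_measurable borel"
    using W DERIV_isCont by (auto intro!: borel_measurable_continuous_onI continuous_at_imp_continuous_on)
  have s1m: "(\<lambda>x. sigma1 *v u x) \<in> borel_measurable borel" "(\<lambda>x. sigma1 *v v x) \<in> borel_measurable borel"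
    using d by (auto intro!: square_integrable_measurable square_integrable_sigma)
  have ach: "ac_deriv h h'"
    unfolding h_def[abs_def] h'_def[abs_def]
    by (rule ac_deriv_inner[OF d(1) ac_deriv_linear[OF bounded_linear_matrix d(1)]])
  have acW: "ac_deriv W W'"
    by (rule ac_deriv_C1) (use W in \<open>auto simp: has_real_derivative_iff_has_vector_derivative\<close>)
  have acWh: "ac_deriv (\<lambda>x. W x * h x) (\<lambda>x. W x * h' x + W' x * h x)"
    using ac_deriv_scaleR[OF acW ach] by simp
  have hm: "h \<in> borel_measurable borel" "h' \<in> borel_measurable borel"
    using s1m unfolding h_def[abs_def] h'_def[abs_def] by measurable
  have h_le: "\<bar>h x\<bar> \<le> (norm (u x))\<^sup>2" for x
    using Cauchy_Schwarz_ineq2[of "u x" "sigma1 *v u x"] by (simp add: h_def power2_eq_square)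
  have h'_le: "\<bar>h' x\<bar> \<le> 2 * (norm (u x) * norm (v x))" for x
    using Cauchy_Schwarz_ineq2[of "u x" "sigma1 *v v x"] Cauchy_Schwarz_ineq2[of "v x" "sigma1 *v u x"]
    by (simp add: h'_def mult.commute)
  have Wu_int: "integrable lborel (\<lambda>x. (W x)\<^sup>2 * (norm (u x))\<^sup>2)"
    using square_integrable_norm[OF d(4)] by (simp add: power_mult_distrib)
  have u_int: "integrable lborel (\<lambda>x. (norm (u x))\<^sup>2)" by (rule square_integrable_norm[OF d(2)])
  have i1: "integrable lborel (\<lambda>x. W x * h x)"
    by (rule integrable_inner_bound[OF d(4) d(2), where B = 1])
       (use Wm hm mult_left_mono[OF h_le abs_ge_zero] in \<open>auto simp: abs_mult power2_eq_square mult.assoc\<close>)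
  have i2: "integrable lborel (\<lambda>x. W x * h' x)"
    by (rule integrable_inner_bound[OF d(4) d(3), where B = 2])
       (use Wm hm mult_left_mono[OF h'_le abs_ge_zero] in \<open>auto simp: abs_mult mult_ac\<close>)
  have W'h_le: "\<bar>W' x * h x\<bar> \<le> M * (norm (u x))\<^sup>2 + \<epsilon> * ((W x)\<^sup>2 * (norm (u x))\<^sup>2)" for x
  proof -
    have "\<bar>W' x * h x\<bar> \<le> (M + \<epsilon> * (W x)\<^sup>2) * (norm (u x))\<^sup>2"
      unfolding abs_mult using bd[of x] by (intro mult_mono bd h_le) (auto intro: order_trans[OF abs_ge_zero])
    then show ?thesis by (simp add: algebra_simps)
  qed
  have i3: "integrable lborel (\<lambda>x. W' x * h x)"
    by (rule Bochner_Integration.integrable_bound[of _ "\<lambda>x. M * (norm (u x))\<^sup>2 + \<epsilon> * ((W x)\<^sup>2 * (norm (u x))\<^sup>2)"])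
       (use u_int Wu_int Wm hm in \<open>auto intro!: AE_I2 order_trans[OF W'h_le]\<close>)
  have zero: "(LINT x|lborel. W x * h' x) + (LINT x|lborel. W' x * h x) = 0"
    using integral_ac_deriv_eq_0[OF acWh _ i1] i2 i3 by simp
  have Sint: "square_integrable S"
    unfolding S_def[abs_def]
    by (intro square_integrable_diff square_integrable_add square_integrable_J d square_integrable_scaleR square_integrable_sigma)
  have pt: "(norm (dirac_expr m W a u v x))\<^sup>2 = (norm (S x))\<^sup>2 + (W x)\<^sup>2 * (norm (u x))\<^sup>2 - W x * h' x" for x
    unfolding dirac_expr_def S_def h'_def by (rule dirac_expr_norm_square)
  have "(l2 (dirac_expr m W a u v))\<^sup>2 = (l2 S)\<^sup>2 + (LINT x|lborel. (W x)\<^sup>2 * (norm (u x))\<^sup>2) - (LINT x|lborel. W x * h' x)"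
    unfolding l2_square pt using square_integrable_norm[OF Sint] Wu_int i2 by simp
  then have 1: "(l2 (dirac_expr m W a u v))\<^sup>2 = (l2 S)\<^sup>2 + (LINT x|lborel. (W x)\<^sup>2 * (norm (u x))\<^sup>2) + (LINT x|lborel. W' x * h x)"
    using zero by simp
  have "\<bar>LINT x|lborel. W' x * h x\<bar> \<le> (LINT x|lborel. M * (norm (u x))\<^sup>2 + \<epsilon> * ((W x)\<^sup>2 * (norm (u x))\<^sup>2))"
    by (rule order_trans[OF integral_abs_bound], rule integral_mono)
       (use i3 u_int Wu_int W'h_le in auto)
  also have "\<dots> = M * (l2 u)\<^sup>2 + \<epsilon> * (LINT x|lborel. (W x)\<^sup>2 * (norm (u x))\<^sup>2)"
    using u_int Wu_int by (simp add: l2_square)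
  finally have 2: "\<bar>LINT x|lborel. W' x * h x\<bar> \<le> M * (l2 u)\<^sup>2 + \<epsilon> * (LINT x|lborel. (W x)\<^sup>2 * (norm (u x))\<^sup>2)" .
  have 3: "(l2 (\<lambda>x. W x *\<^sub>R u x))\<^sup>2 = (LINT x|lborel. (W x)\<^sup>2 * (norm (u x))\<^sup>2)"
    by (simp add: l2_square power_mult_distrib)
  show ?thesis
    unfolding S_def[symmetric] 3 using 1 2 by (simp add: algebra_simps S_def[abs_def])
qed

section \<open>Smooth test functions\<close>

text \<open>A function with \<open>n\<close> successive derivatives. Quantified over \<open>n\<close> it expresses smoothness, in a form that is
  closed under products by induction.\<close>

fun times_differentiable :: "nat \<Rightarrow> (real \<Rightarrow> real) \<Rightarrow> bool" where
  "times_differentiable 0 f = True"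
| "times_differentiable (Suc n) f = (\<exists>g. (\<forall>x. (f has_real_derivative g x) (at x)) \<and> times_differentiable n g)"

lemma times_differentiable_Suc_imp: "times_differentiable (Suc n) f \<Longrightarrow> times_differentiable n f"
proof (induction n arbitrary: f)
  case (Suc n)
  then obtain g where "\<forall>x. (f has_real_derivative g x) (at x)" "times_differentiable (Suc n) g" by auto
  with Suc.IH[of g] show ?case by auto
qed simp

lemma times_differentiable_add: "times_differentiable n f \<Longrightarrow> times_differentiable n g \<Longrightarrow> times_differentiable n (\<lambda>x. f x + g x)"
proof (induction n arbitrary: f g)
  case (Suc n)
  then obtain f' g' where d: "\<forall>x. (f has_real_derivative f' x) (at x)" "times_differentiable n f'"
    "\<forall>x. (g has_real_derivative g' x) (at x)" "times_differentiable n g'" by auto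
  have "\<forall>x. ((\<lambda>x. f x + g x) has_real_derivative f' x + g' x) (at x)"
    using d by (auto intro!: derivative_intros)
  with Suc.IH[OF d(2,4)] show ?case by (auto intro!: exI[of _ "\<lambda>x. f' x + g' x"])
qed simp

lemma times_differentiable_mult: "times_differentiable n f \<Longrightarrow> times_differentiable n g \<Longrightarrow> times_differentiable n (\<lambda>x. f x * g x)"
proof (induction n arbitrary: f g)
  case (Suc n)
  then obtain f' g' where d: "\<forall>x. (f has_real_derivative f' x) (at x)" "times_differentiable n f'"
    "\<forall>x. (g has_real_derivative g' x) (at x)" "times_differentiable n g'" by auto
  have "\<forall>x. ((\<lambda>x. f x * g x) has_real_derivative f' x * g x + g' x * f x) (at x)"
    using d by (auto intro!: derivative_intros)
  moreover have "times_differentiable n (\<lambda>x. f' x * g x + g' x * f x)"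
    by (rule times_differentiable_add[OF Suc.IH[OF d(2) times_differentiable_Suc_imp[OF Suc.prems(2)]]
          Suc.IH[OF d(4) times_differentiable_Suc_imp[OF Suc.prems(1)]]])
  ultimately show ?case by (auto intro!: exI[of _ "\<lambda>x. f' x * g x + g' x * f x"])
qed simp

lemma times_differentiable_const: "times_differentiable n (\<lambda>x. c)"
proof (induction n arbitrary: c)
  case (Suc n)
  show ?case using Suc[of 0] by (auto intro!: exI[of _ "\<lambda>x. 0"])
qed simp

lemma times_differentiable_affine: "times_differentiable n f \<Longrightarrow> times_differentiable n (\<lambda>x. f (c * x + d))"
proof (induction n arbitrary: f)
  case (Suc n)
  then obtain f' where d: "\<forall>x. (f has_real_derivative f' x) (at x)" "times_differentiable n f'" by auto
  have "((\<lambda>x. f (c * x + d)) has_real_derivative c * f' (c * x + d)) (at x)" for x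
  proof -
    have "((\<lambda>x. c * x + d) has_real_derivative c) (at x)" by (auto intro!: derivative_eq_intros)
    then show ?thesis using DERIV_chain2[of f "f' (c * x + d)" "\<lambda>x. c * x + d" x c UNIV] d(1)
      by (simp add: mult.commute)
  qed
  moreover have "times_differentiable n (\<lambda>x. c * f' (c * x + d))"
    by (rule times_differentiable_mult[OF times_differentiable_const Suc.IH[OF d(2)]])
  ultimately show ?case by (auto intro!: exI[of _ "\<lambda>x. c * f' (c * x + d)"])
qed simp

lemma times_differentiable_deriv: "(\<And>n. times_differentiable n f) \<Longrightarrow> (deriv ^^ n) f differentiable (at x)"
proof (induction n arbitrary: f)
  case 0
  from 0[of "Suc 0"] show ?case by (auto simp: real_differentiable_def)
next
  case (Suc n)
  have "times_differentiable k (deriv f)" for k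
  proof -
    obtain g where g: "\<forall>x. (f has_real_derivative g x) (at x)" "times_differentiable k g"
      using Suc.prems[of "Suc k"] by auto
    then have "deriv f = g" by (auto simp: DERIV_imp_deriv)
    with g show ?thesis by simp
  qed
  from Suc.IH[OF this] show ?case by (simp add: funpow_Suc_right del: funpow.simps)
qed

text \<open>The derivatives of \<open>exp (-1/x)\<close> on \<open>x > 0\<close> are polynomials in \<open>1/x\<close> times \<open>exp
  (-1/x)\<close>. This class of functions, extended by 0, is closed under differentiation, also at 0, hence all its members are smooth.\<close>

definition flat_poly :: "real poly \<Rightarrow> real \<Rightarrow> real" where
  "flat_poly p x = (if 0 < x then poly p (1 / x) * exp (- (1 / x)) else 0)"

lemma poly_times_exp_tendsto_0: "((\<lambda>y::real. y ^ k * poly p y * exp (- y)) \<longlongrightarrow> 0) at_top"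
proof (induction p arbitrary: k)
  case (pCons a p)
  have "((\<lambda>y. a * (y ^ k / exp y) + y ^ Suc k * poly p y * exp (- y)) \<longlongrightarrow> a * 0 + 0) at_top"
    by (intro tendsto_intros pCons.IH tendsto_power_div_exp_0)
  then show ?case by (simp add: algebra_simps exp_minus divide_inverse)
qed simp

lemma flat_poly_deriv:
  "(flat_poly p has_real_derivative flat_poly ([:0, 0, 1:] * (p - pderiv p)) x) (at x)"
proof (cases x "0::real" rule: linorder_cases)
  case greater
  have "((\<lambda>x. poly p (1 / x) * exp (- (1 / x))) has_real_derivative
      flat_poly ([:0, 0, 1:] * (p - pderiv p)) x) (at x)"
    using greater
    by (auto intro!: derivative_eq_intros DERIV_chain2[OF poly_DERIV] simp: flat_poly_def field_simps power2_eq_square)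
  then show ?thesis
    by (rule has_field_derivative_transform_within_open[of _ _ _ "{0<..}"]) (use greater in \<open>auto simp: flat_poly_def\<close>)
next
  case less
  have "((\<lambda>x. 0) has_real_derivative flat_poly ([:0, 0, 1:] * (p - pderiv p)) x) (at x)"
    using less by (simp add: flat_poly_def)
  then show ?thesis
    by (rule has_field_derivative_transform_within_open[of _ _ _ "{..<0}"]) (use less in \<open>auto simp: flat_poly_def\<close>)
next
  case equal
  have "((\<lambda>h. flat_poly p h / h) \<longlongrightarrow> 0) (at_right 0)"
  proof -
    have "((\<lambda>h. inverse h ^ 1 * poly p (inverse h) * exp (- inverse h)) \<longlongrightarrow> 0) (at_right 0)"
      by (rule filterlim_compose[OF poly_times_exp_tendsto_0 filterlim_inverse_at_top_right])
    then show ?thesis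
      by (rule Lim_transform_eventually)
         (auto simp: eventually_at_filter flat_poly_def divide_inverse)
  qed
  moreover have "((\<lambda>h. flat_poly p h / h) \<longlongrightarrow> 0) (at_left 0)"
    by (rule tendsto_eventually) (auto simp: eventually_at_filter flat_poly_def)
  ultimately have "((\<lambda>h. flat_poly p h / h) \<longlongrightarrow> 0) (at 0)"
    by (simp add: filterlim_split_at)
  then show ?thesis using equal by (simp add: DERIV_def flat_poly_def)
qed

lemma times_differentiable_flat_poly: "times_differentiable n (flat_poly p)"
  by (induction n arbitrary: p) (auto intro: flat_poly_deriv)

definition flat_exp :: "real \<Rightarrow> real" where
  "flat_exp x = (if 0 < x then exp (- (1 / x)) else 0)"

lemma times_differentiable_flat_exp: "times_differentiable n flat_exp"
proof -
  have "flat_exp = flat_poly 1" by (auto simp: flat_exp_def flat_poly_def)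
  then show ?thesis by (metis times_differentiable_flat_poly)
qed

lemma flat_exp_bounds: "0 \<le> flat_exp x" "flat_exp x \<le> 1"
  by (auto simp: flat_exp_def)

text \<open>Smooth, supported in \<open>[\<alpha>, \<beta>]\<close>, with values in \<open>[0, 1]\<close>, and converging to the indicator of the open
  interval as \<open>k\<close> grows. The arguments are written as affine functions of \<open>x\<close> so that
  \<open>times_differentiable_affine\<close> applies.\<close>

definition bump :: "real \<Rightarrow> real \<Rightarrow> nat \<Rightarrow> real \<Rightarrow> real" where
  "bump \<alpha> \<beta> k x = flat_exp (real k * x + - real k * \<alpha>) * flat_exp (- real k * x + real k * \<beta>)"

lemma times_differentiable_bump: "times_differentiable n (bump \<alpha> \<beta> k)"
  unfolding bump_def[abs_def]
  by (rule times_differentiable_mult[OF times_differentiable_affine[OF times_differentiable_flat_exp] times_differentiable_affine[OF times_differentiable_flat_exp]])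

lemma continuous_bump: "continuous_on S (bump \<alpha> \<beta> k)"
proof -
  have "times_differentiable (Suc 0) (bump \<alpha> \<beta> k)" by (rule times_differentiable_bump)
  then show ?thesis
    by (auto intro!: continuous_at_imp_continuous_on dest: DERIV_isCont)
qed

lemma bump_bounds: "0 \<le> bump \<alpha> \<beta> k x" "bump \<alpha> \<beta> k x \<le> 1"
  by (auto simp: bump_def flat_exp_bounds intro!: mult_le_one)

lemma bump_eq_0: "x \<le> \<alpha> \<or> \<beta> \<le> x \<Longrightarrow> bump \<alpha> \<beta> k x = 0"
proof -
  assume "x \<le> \<alpha> \<or> \<beta> \<le> x"
  then have "real k * x \<le> real k * \<alpha> \<or> real k * \<beta> \<le> real k * x" by (auto intro: mult_left_mono)
  then show ?thesis by (auto simp: bump_def flat_exp_def)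
qed

lemma bump_shift: "bump (\<alpha> + d) (\<beta> + d) k (x + d) = bump \<alpha> \<beta> k x"
  by (simp add: bump_def algebra_simps)

lemma flat_exp_scale_tendsto:
  assumes "x > 0"
  shows "(\<lambda>k. flat_exp (real k * x)) \<longlonglongrightarrow> 1"
proof -
  have "(\<lambda>k. exp (- (inverse (real k) * (1 / x)))) \<longlonglongrightarrow> exp (- (0 * (1 / x)))"
    by (intro tendsto_intros lim_inverse_n)
  then have "(\<lambda>k. exp (- (inverse (real k) * (1 / x)))) \<longlonglongrightarrow> 1" by simp
  then show ?thesis
  proof (rule Lim_transform_eventually)
    show "\<forall>\<^sub>F k in sequentially. exp (- (inverse (real k) * (1 / x))) = flat_exp (real k * x)"
      using eventually_gt_at_top[of "0::nat"]
    proof eventually_elim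
      case (elim k)
      have "inverse (real k) * (1 / x) = 1 / (real k * x)" by (simp add: divide_inverse)
      then show ?case using elim assms by (simp only: flat_exp_def) simp
    qed
  qed
qed

lemma bump_tendsto: "(\<lambda>k. bump \<alpha> \<beta> k x) \<longlonglongrightarrow> indicator {\<alpha><..<\<beta>} x"
proof (cases "x \<in> {\<alpha><..<\<beta>}")
  case True
  have "(\<lambda>k. flat_exp (real k * (x - \<alpha>)) * flat_exp (real k * (\<beta> - x))) \<longlonglongrightarrow> 1 * 1"
    by (intro tendsto_mult flat_exp_scale_tendsto) (use True in auto)
  moreover have "(\<lambda>k. bump \<alpha> \<beta> k x) = (\<lambda>k. flat_exp (real k * (x - \<alpha>)) * flat_exp (real k * (\<beta> - x)))"
    by (simp add: bump_def fun_eq_iff algebra_simps)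
  ultimately show ?thesis using True by simp
next
  case False
  then show ?thesis by (simp add: bump_eq_0 not_less)
qed

lemma integral_bump_tendsto:
  fixes w :: "real \<Rightarrow> 'a::euclidean_space"
  assumes "locally_integrable w"
  shows "integrable lborel (\<lambda>x. bump \<alpha> \<beta> k x *\<^sub>R w x)"
    "(\<lambda>k. LINT x|lborel. bump \<alpha> \<beta> k x *\<^sub>R w x) \<longlonglongrightarrow> (LINT x:{\<alpha>..\<beta>}|lborel. w x)"
proof -
  have i: "integrable lborel (\<lambda>x. indicator {\<alpha>..\<beta>} x *\<^sub>R w x)" and wm: "w \<in> borel_measurable borel"
    using assms by (auto simp: locally_integrable_def set_integrable_def)
  have bm: "bump \<alpha> \<beta> k \<in> borel_measurable borel" for k
    by (intro borel_measurable_continuous_onI continuous_bump)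
  have dom: "norm (bump \<alpha> \<beta> k x *\<^sub>R w x) \<le> norm (indicator {\<alpha>..\<beta>} x *\<^sub>R w x)" for k x
  proof (cases "x \<in> {\<alpha>..\<beta>}")
    case True
    then show ?thesis using bump_bounds[of \<alpha> \<beta> k x] mult_right_mono[of "bump \<alpha> \<beta> k x" 1 "norm (w x)"] by simp
  next
    case False
    then have "bump \<alpha> \<beta> k x = 0" by (intro bump_eq_0) auto
    then show ?thesis by simp
  qed
  have m: "(\<lambda>x. bump \<alpha> \<beta> k x *\<^sub>R w x) \<in> borel_measurable lborel" for k
    using bm wm by simp
  show "integrable lborel (\<lambda>x. bump \<alpha> \<beta> k x *\<^sub>R w x)"
    by (rule Bochner_Integration.integrable_bound[OF i m]) (use dom in \<open>auto intro!: AE_I2\<close>)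
  have "(\<lambda>k. LINT x|lborel. bump \<alpha> \<beta> k x *\<^sub>R w x) \<longlonglongrightarrow> (LINT x|lborel. indicator {\<alpha><..<\<beta>} x *\<^sub>R w x)"
  proof (rule integral_dominated_convergence[where w = "\<lambda>x. norm (indicator {\<alpha>..\<beta>} x *\<^sub>R w x)"])
    show "integrable lborel (\<lambda>x. norm (indicator {\<alpha>..\<beta>} x *\<^sub>R w x))" using i by (rule integrable_norm)
  qed (use m wm dom bump_tendsto in \<open>auto intro!: AE_I2 tendsto_intros\<close>)
  also have "(LINT x|lborel. indicator {\<alpha><..<\<beta>} x *\<^sub>R w x) = (LINT x:{\<alpha>..\<beta>}|lborel. w x)"
    unfolding set_lebesgue_integral_def
    by (rule integral_cong_AE)
       (use wm AE_lborel_singleton[of \<alpha>] AE_lborel_singleton[of \<beta>] in \<open>auto elim!: eventually_elim2 simp: indicator_def\<close>)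
  finally show "(\<lambda>k. LINT x|lborel. bump \<alpha> \<beta> k x *\<^sub>R w x) \<longlonglongrightarrow> (LINT x:{\<alpha>..\<beta>}|lborel. w x)" .
qed

lemma test_function_bump: "test_function (bump \<alpha> \<beta> k)"
  unfolding test_function_def
proof (intro conjI exI[of _ "\<bar>\<alpha>\<bar> + \<bar>\<beta>\<bar>"] allI impI)
  show "(deriv ^^ n) (bump \<alpha> \<beta> k) differentiable (at x)" for n x
    by (intro times_differentiable_deriv times_differentiable_bump)
  show "bump \<alpha> \<beta> k x = 0" if "\<bar>\<alpha>\<bar> + \<bar>\<beta>\<bar> < \<bar>x\<bar>" for x
    by (rule bump_eq_0) (use that in linarith)
qed

text \<open>The primitive that vanishes at \<open>-R\<close> also vanishes beyond \<open>R\<close>, because the integral is 0. The lemma is meant for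
  differences of translated bumps.\<close>

lemma test_function_primitive:
  assumes diff: "\<And>n. times_differentiable n \<psi>" and supp: "\<And>x. R < \<bar>x\<bar> \<Longrightarrow> \<psi> x = 0" and R: "R > 0"
    and zero: "(LINT x:{-R..R}|lborel. \<psi> x) = 0"
  obtains \<phi> where "test_function \<phi>" "\<And>x. (\<phi> has_real_derivative \<psi> x) (at x)"
proof -
  have "times_differentiable (Suc 0) \<psi>" by (rule diff)
  then have c: "continuous_on UNIV \<psi>"
    by (auto intro!: continuous_at_imp_continuous_on dest: DERIV_isCont)
  obtain P where P: "ac_deriv P \<psi>"
    using locally_integrable_ac_deriv_exists[OF locally_integrable_continuous[OF c]] by blast
  define \<phi> where "\<phi> x = P x - P (- R)" for x
  have D: "(\<phi> has_real_derivative \<psi> x) (at x)" for x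
    using ac_deriv_has_vector_derivative[OF P c, of x] unfolding \<phi>_def
    by (auto simp: has_real_derivative_iff_has_vector_derivative intro!: derivative_eq_intros)
  have "\<phi> x = 0" if x: "R < \<bar>x\<bar>" for x
  proof (cases "x < 0")
    case True
    have "(\<psi> has_integral (P (-R) - P x)) {x..-R}" using ac_deriv_integral[OF P] True x by simp
    moreover have "(\<psi> has_integral 0) {x..-R}"
      by (rule has_integral_spike[OF negligible_sing[of "-R"] _ has_integral_0]) (use supp in auto)
    ultimately have "P (-R) - P x = 0" by (rule has_integral_unique)
    then show ?thesis by (simp add: \<phi>_def)
  next
    case False
    have "(\<psi> has_integral (P x - P R)) {R..x}" using ac_deriv_integral[OF P] False x by simp
    moreover have "(\<psi> has_integral 0) {R..x}"
      by (rule has_integral_spike[OF negligible_sing[of "R"] _ has_integral_0]) (use supp in auto)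
    ultimately have "P x - P R = 0" by (rule has_integral_unique)
    moreover have "P R - P (-R) = 0" using P zero R by (simp add: ac_deriv_def)
    ultimately show ?thesis by (simp add: \<phi>_def)
  qed
  moreover have "times_differentiable n \<phi>" for n
    by (cases n) (use D diff in auto)
  ultimately have "test_function \<phi>"
    unfolding test_function_def by (auto intro: times_differentiable_deriv)
  with D show thesis by (rule that[rotated])
qed

section \<open>Weak derivatives\<close>

lemma test_functionD:
  assumes "test_function \<phi>"
  shows "\<And>x. (\<phi> has_real_derivative deriv \<phi> x) (at x)" "continuous_on S (deriv \<phi>)" "continuous_on S \<phi>"
    "ac_deriv \<phi> (deriv \<phi>)" "\<exists>R>0. \<forall>x. R \<le> \<bar>x\<bar> \<longrightarrow> \<phi> x = 0 \<and> deriv \<phi> x = 0"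
proof -
  have d: "(deriv ^^ n) \<phi> differentiable (at x)" for n x using assms by (simp add: test_function_def)
  show D: "(\<phi> has_real_derivative deriv \<phi> x) (at x)" for x
    using d[of 0 x] by (simp add: DERIV_deriv_iff_real_differentiable)
  have "isCont (deriv \<phi>) x" for x
    using d[of 1 x] by (auto intro: differentiable_imp_continuous_within)
  then show c: "continuous_on S (deriv \<phi>)" for S by (simp add: continuous_at_imp_continuous_on)
  show "continuous_on S \<phi>"
    using D by (auto intro!: continuous_at_imp_continuous_on dest: DERIV_isCont)
  show "ac_deriv \<phi> (deriv \<phi>)"
    by (rule ac_deriv_C1[OF _ c]) (use D in \<open>simp add: has_real_derivative_iff_has_vector_derivative\<close>)
  obtain R where R: "\<And>x. R < \<bar>x\<bar> \<Longrightarrow> \<phi> x = 0" using assms by (auto simp: test_function_def)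
  have "deriv \<phi> x = 0" if "R < \<bar>x\<bar>" for x
  proof -
    have "open {x::real. R < \<bar>x\<bar>}" by (intro open_Collect_less continuous_intros)
    then have "(\<phi> has_real_derivative 0) (at x)"
      by (intro has_field_derivative_transform_within_open[OF DERIV_const[of 0]]) (use R that in auto)
    then show ?thesis by (rule DERIV_imp_deriv)
  qed
  with R show "\<exists>R>0. \<forall>x. R \<le> \<bar>x\<bar> \<longrightarrow> \<phi> x = 0 \<and> deriv \<phi> x = 0"
    by (intro exI[of _ "\<bar>R\<bar> + 1"]) auto
qed

lemma integrable_compact_support:
  fixes w :: "real \<Rightarrow> 'a::euclidean_space"
  assumes "continuous_on UNIV \<phi>" "\<And>x. R \<le> \<bar>x\<bar> \<Longrightarrow> \<phi> x = 0" "locally_integrable w"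
  shows "integrable lborel (\<lambda>x. \<phi> x *\<^sub>R w x)"
    "(LINT x|lborel. \<phi> x *\<^sub>R w x) = (LINT x:{-R..R}|lborel. \<phi> x *\<^sub>R w x)"
proof -
  have l: "locally_integrable (\<lambda>x. \<phi> x *\<^sub>R w x)"
    by (rule locally_integrable_bilinear[OF bounded_bilinear_scaleR assms(1,3)])
  have e: "(\<lambda>x. \<phi> x *\<^sub>R w x) = (\<lambda>x. indicator {-R..R} x *\<^sub>R (\<phi> x *\<^sub>R w x))"
  proof
    fix x show "\<phi> x *\<^sub>R w x = indicator {-R..R} x *\<^sub>R (\<phi> x *\<^sub>R w x)"
      using assms(2)[of x] by (cases "R \<le> \<bar>x\<bar>") (auto simp: indicator_def)
  qed
  show "integrable lborel (\<lambda>x. \<phi> x *\<^sub>R w x)"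
    by (subst e) (use l in \<open>auto simp: locally_integrable_def set_integrable_def\<close>)
  show "(LINT x|lborel. \<phi> x *\<^sub>R w x) = (LINT x:{-R..R}|lborel. \<phi> x *\<^sub>R w x)"
    unfolding set_lebesgue_integral_def by (subst e) simp
qed

lemma test_function_parts:
  fixes u :: "real \<Rightarrow> 'a::euclidean_space"
  assumes "ac_deriv u v" "test_function \<phi>"
  shows "(LINT x|lborel. deriv \<phi> x *\<^sub>R u x) = - (LINT x|lborel. \<phi> x *\<^sub>R v x)"
proof -
  obtain R where R: "R > 0" "\<And>x. R \<le> \<bar>x\<bar> \<Longrightarrow> \<phi> x = 0 \<and> deriv \<phi> x = 0"
    using test_functionD(5)[OF assms(2)] by blast
  note t = test_functionD[OF assms(2)]
  have lu: "locally_integrable u" by (rule locally_integrable_continuous[OF ac_deriv_continuous[OF assms(1)]])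
  have lv: "locally_integrable v" by (rule ac_deriv_locally_integrable[OF assms(1)])
  have z: "\<And>x. R \<le> \<bar>x\<bar> \<Longrightarrow> deriv \<phi> x = 0" "\<And>x. R \<le> \<bar>x\<bar> \<Longrightarrow> \<phi> x = 0" using R(2) by auto
  have i1: "integrable lborel (\<lambda>x. deriv \<phi> x *\<^sub>R u x)"
    "(LINT x|lborel. deriv \<phi> x *\<^sub>R u x) = (LINT x:{-R..R}|lborel. deriv \<phi> x *\<^sub>R u x)"
    using integrable_compact_support[OF t(2) _ lu, of R] z(1) by blast+
  have i2: "integrable lborel (\<lambda>x. \<phi> x *\<^sub>R v x)"
    "(LINT x|lborel. \<phi> x *\<^sub>R v x) = (LINT x:{-R..R}|lborel. \<phi> x *\<^sub>R v x)"
    using integrable_compact_support[OF t(3) _ lv, of R] z(2) by blast+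
  have "ac_deriv (\<lambda>x. \<phi> x *\<^sub>R u x) (\<lambda>x. \<phi> x *\<^sub>R v x + deriv \<phi> x *\<^sub>R u x)"
    by (rule ac_deriv_scaleR[OF t(4) assms(1)])
  then have "(LINT x:{-R..R}|lborel. \<phi> x *\<^sub>R v x + deriv \<phi> x *\<^sub>R u x) = \<phi> R *\<^sub>R u R - \<phi> (-R) *\<^sub>R u (-R)"
    using R(1) by (simp add: ac_deriv_def)
  also have "\<dots> = 0" using R by simp
  also have "(LINT x:{-R..R}|lborel. \<phi> x *\<^sub>R v x + deriv \<phi> x *\<^sub>R u x) =
      (LINT x:{-R..R}|lborel. \<phi> x *\<^sub>R v x) + (LINT x:{-R..R}|lborel. deriv \<phi> x *\<^sub>R u x)"
  proof (rule set_integral_add)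
    show "set_integrable lborel {-R..R} (\<lambda>x. \<phi> x *\<^sub>R v x)"
      unfolding set_integrable_def by (rule integrable_mult_indicator[OF _ i2(1)]) auto
    show "set_integrable lborel {-R..R} (\<lambda>x. deriv \<phi> x *\<^sub>R u x)"
      unfolding set_integrable_def by (rule integrable_mult_indicator[OF _ i1(1)]) auto
  qed
  finally show ?thesis unfolding i1(2) i2(2) by (simp add: eq_neg_iff_add_eq_0 add.commute)
qed

lemma AE_eq_0_if_test_0:
  fixes w :: "real \<Rightarrow> 'a::euclidean_space"
  assumes "locally_integrable w" "\<And>\<phi>. test_function \<phi> \<Longrightarrow> (LINT x|lborel. \<phi> x *\<^sub>R w x) = 0"
  shows "AE x in lborel. w x = 0"
proof (rule AE_eq_0_if_integral_intervals_0[OF assms(1)])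
  fix a b :: real
  have "(\<lambda>k. 0) \<longlonglongrightarrow> (LINT x:{a..b}|lborel. w x)"
    using integral_bump_tendsto(2)[OF assms(1), of a b] assms(2)[OF test_function_bump] by simp
  then show "(LINT x:{a..b}|lborel. w x) = 0" by (metis LIMSEQ_unique tendsto_const)
qed

text \<open>The du Bois-Reymond lemma. Testing with primitives of \<open>bump (\<alpha>+d) (\<beta>+d) k - bump \<alpha> \<beta> k\<close> and letting
  \<open>k\<close> grow shows that the integral of \<open>w\<close> over an interval depends only on its length. The primitive \<open>H\<close> with
  \<open>H 0 = 0\<close> is thus additive, and a continuous additive function is linear; its slope is the constant.\<close>

lemma AE_const_if_weak_deriv_0:
  fixes w :: "real \<Rightarrow> 'a::euclidean_space"
  assumes w: "locally_integrable w" and zero: "\<And>\<phi>. test_function \<phi> \<Longrightarrow> (LINT x|lborel. deriv \<phi> x *\<^sub>R w x) = 0"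
  obtains c where "AE x in lborel. w x = c"
proof -
  obtain H where H: "ac_deriv H w" "H 0 = 0" using locally_integrable_ac_deriv_exists[OF w] by blast
  have shift: "(LINT x:{\<alpha>+d..\<beta>+d}|lborel. w x) = (LINT x:{\<alpha>..\<beta>}|lborel. w x)" for \<alpha> \<beta> d
  proof -
    have eq: "(LINT x|lborel. bump (\<alpha>+d) (\<beta>+d) k x *\<^sub>R w x) = (LINT x|lborel. bump \<alpha> \<beta> k x *\<^sub>R w x)" for k
    proof -
      define \<psi> where "\<psi> x = bump (\<alpha>+d) (\<beta>+d) k x + (-1) * bump \<alpha> \<beta> k x" for x
      define R where "R = \<bar>\<alpha>\<bar> + \<bar>\<beta>\<bar> + \<bar>d\<bar> + 1"
      have one: "locally_integrable (\<lambda>x. 1 :: real)" by (rule locally_integrable_continuous) simp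
      have bz: "bump \<alpha> \<beta> k x = 0" "bump (\<alpha>+d) (\<beta>+d) k x = 0" if "R \<le> \<bar>x\<bar>" for x
        using that by (auto simp: R_def intro!: bump_eq_0)
      note b1 = integrable_compact_support[OF continuous_bump bz(1) one]
      note b2 = integrable_compact_support[OF continuous_bump bz(2) one]
      have sh: "(LINT x|lborel. bump (\<alpha>+d) (\<beta>+d) k x) = (LINT x|lborel. bump \<alpha> \<beta> k x)"
        by (subst lborel_integral_real_affine[of 1 _ d]) (simp_all add: bump_shift add.commute[of d])
      have "(LINT x:{-R..R}|lborel. \<psi> x) = (LINT x:{-R..R}|lborel. bump (\<alpha>+d) (\<beta>+d) k x) - (LINT x:{-R..R}|lborel. bump \<alpha> \<beta> k x)"
        unfolding \<psi>_def using set_integral_diff(2)[OF borel_integrable_atLeastAtMost'[OF continuous_bump] borel_integrable_atLeastAtMost'[OF continuous_bump]]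
        by simp
      also have "\<dots> = 0" using b1(2) b2(2) sh by simp
      finally have z: "(LINT x:{-R..R}|lborel. \<psi> x) = 0" .
      have "times_differentiable n \<psi>" for n
        unfolding \<psi>_def[abs_def]
        by (rule times_differentiable_add[OF times_differentiable_bump times_differentiable_mult[OF times_differentiable_const times_differentiable_bump]])
      then obtain \<phi> where \<phi>: "test_function \<phi>" "\<And>x. (\<phi> has_real_derivative \<psi> x) (at x)"
        by (rule test_function_primitive[of \<psi> R]) (use z bz in \<open>auto simp: R_def \<psi>_def\<close>)
      have "deriv \<phi> = \<psi>" using \<phi>(2) by (auto simp: DERIV_imp_deriv)
      with zero[OF \<phi>(1)] have "(LINT x|lborel. \<psi> x *\<^sub>R w x) = 0" by simp
      then show ?thesis
        using integral_bump_tendsto(1)[OF w] by (simp add: \<psi>_def scaleR_diff_left)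
    qed
    show ?thesis
      using integral_bump_tendsto(2)[OF w, of "\<alpha>+d" "\<beta>+d"] integral_bump_tendsto(2)[OF w, of \<alpha> \<beta>]
      unfolding eq by (rule LIMSEQ_unique)
  qed
  have add: "H (x + 1) - H x = H 1" for x
    using shift[of 0 x 1] H by (simp add: ac_deriv_def add.commute)
  have add2: "H (x + y) = H x + H y" if "0 \<le> y" for x y
  proof -
    have "(LINT t:{x..x + y}|lborel. w t) = H (x + y) - H x" "(LINT t:{0..y}|lborel. w t) = H y"
      using H that by (simp_all add: ac_deriv_def)
    then show ?thesis using shift[of 0 x y] by (simp add: add.commute algebra_simps)
  qed
  have cH: "continuous_on UNIV H" by (rule ac_deriv_continuous[OF H(1)])
  \<comment> \<open>Integrating \<open>H (x + y) = H x + H y\<close> over \<open>y\<close> in \<open>[0, 1]\<close> expresses \<open>H\<close> by its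
    own primitive \<open>K\<close>, so \<open>H\<close> is continuously differentiable, with derivative \<open>H (x + 1) - H x = H 1\<close>.\<close>
  obtain K where K: "ac_deriv K H" using locally_integrable_ac_deriv_exists[OF locally_integrable_continuous[OF cH]] by blast
  have K': "(K has_vector_derivative H x) (at x)" for x by (rule ac_deriv_has_vector_derivative[OF K cH])
  have H_eq: "H x = (K (x + 1) - K x) - (K 1 - K 0)" for x
  proof -
    have "(H has_integral (K (x + 1) - K x)) {x..x+1}" using ac_deriv_integral[OF K] by simp
    then have A: "((\<lambda>y. H (y + x)) has_integral (K (x + 1) - K x)) {0..1}"
      using has_integral_affinity[of H _ x "x+1" 1 x] by (simp add: o_def add.commute)
    have "((\<lambda>y. H x + H y) has_integral (H x + (K 1 - K 0))) {0..1}"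
      using has_integral_add[OF has_integral_const_real[of "H x" 0 1] ac_deriv_integral[OF K, of 0 1]] by simp
    then have B: "((\<lambda>y. H (y + x)) has_integral (H x + (K 1 - K 0))) {0..1}"
    proof (rule has_integral_eq[rotated])
      fix y :: real assume "y \<in> {0..1}"
      then have "0 \<le> y" by simp
      from add2[OF this, of x] show "H x + H y = H (y + x)"
        unfolding add.commute[of y x] by (rule sym)
    qed
    show ?thesis using has_integral_unique[OF A B] by (simp add: algebra_simps)
  qed
  have "(H has_vector_derivative H 1) (at x)" for x
  proof -
    have 1: "((\<lambda>x. K (x + 1)) has_vector_derivative H (x + 1)) (at x)"
    proof -
      have "((\<lambda>x. x + 1) has_vector_derivative (1 :: real)) (at x)"
        by (auto intro!: derivative_eq_intros)
      from vector_diff_chain_at[OF this K'] show ?thesis by (simp add: o_def)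
    qed
    have "((\<lambda>x. (K (x + 1) - K x) - (K 1 - K 0)) has_vector_derivative H (x + 1) - H x) (at x)"
      using 1 K'[of x] by (auto intro!: derivative_eq_intros)
    then show ?thesis by (simp add: H_eq[symmetric, abs_def] add)
  qed
  then have "ac_deriv H (\<lambda>x. H 1)" by (intro ac_deriv_C1) auto
  from ac_deriv_diff[OF H(1) this] have z: "ac_deriv (\<lambda>x. 0) (\<lambda>x. w x - H 1)" by simp
  then have "AE x in lborel. w x - H 1 = 0"
    by (intro AE_eq_0_if_integral_intervals_0) (auto simp: ac_deriv_def)
  then show thesis by (intro that[of "H 1"]) simp
qed

text \<open>Subtracting a primitive of the weak derivative leaves a function with weak derivative 0.\<close>

lemma weak_deriv_imp_ac_deriv:
  fixes h g :: "real \<Rightarrow> 'a::euclidean_space"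
  assumes h: "locally_integrable h" and g: "locally_integrable g"
    and weak: "\<And>\<phi>. test_function \<phi> \<Longrightarrow> (LINT x|lborel. deriv \<phi> x *\<^sub>R h x) = - (LINT x|lborel. \<phi> x *\<^sub>R g x)"
  obtains u where "ac_deriv u g" "AE x in lborel. h x = u x"
proof -
  obtain U where U: "ac_deriv U g" using locally_integrable_ac_deriv_exists[OF g] by blast
  have lU: "locally_integrable U" by (rule locally_integrable_continuous[OF ac_deriv_continuous[OF U]])
  have l: "locally_integrable (\<lambda>x. h x + - U x)"
    by (rule locally_integrable_add[OF h locally_integrable_linear[OF bounded_linear_minus[OF bounded_linear_ident] lU]])
  obtain c where c: "AE x in lborel. h x + - U x = c"
  proof (rule AE_const_if_weak_deriv_0[OF l])
    fix \<phi> assume \<phi>: "test_function \<phi>"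
    then obtain R where R: "R > 0" "\<And>x. R \<le> \<bar>x\<bar> \<Longrightarrow> \<phi> x = 0 \<and> deriv \<phi> x = 0"
      using test_functionD(5) by blast
    have "(LINT x|lborel. deriv \<phi> x *\<^sub>R (h x + - U x)) = (LINT x|lborel. deriv \<phi> x *\<^sub>R h x) - (LINT x|lborel. deriv \<phi> x *\<^sub>R U x)"
      using integrable_compact_support(1)[OF test_functionD(2)[OF \<phi>] conjunct2[OF R(2)] h]
        integrable_compact_support(1)[OF test_functionD(2)[OF \<phi>] conjunct2[OF R(2)] lU]
      by (simp add: scaleR_diff_right)
    then show "(LINT x|lborel. deriv \<phi> x *\<^sub>R (h x + - U x)) = 0"
      using weak[OF \<phi>] test_function_parts[OF U \<phi>] by simp
  qed
  have "ac_deriv (\<lambda>x. U x + c) (\<lambda>x. g x + 0)"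
    by (rule ac_deriv_add[OF U ac_deriv_C1]) auto
  then show thesis by (intro that[of "\<lambda>x. U x + c"]) (use c in \<open>auto elim!: eventually_mono simp: algebra_simps\<close>)
qed

lemma square_integrable_locally_integrable:
  assumes "square_integrable u"
  shows "locally_integrable u"
proof -
  have m: "u \<in> borel_measurable borel" by (rule square_integrable_measurable[OF assms])
  have "set_integrable lborel {a..b} u" for a b
    unfolding set_integrable_def
  proof (rule Bochner_Integration.integrable_bound)
    show "integrable lborel (\<lambda>x. indicat_real {a..b} x + (norm (u x))\<^sup>2)"
      by (intro Bochner_Integration.integrable_add square_integrable_norm assms integrable_real_indicator)
         (auto simp: emeasure_lborel_Icc_eq)
    show "(\<lambda>x. indicat_real {a..b} x *\<^sub>R u x) \<in> borel_measurable lborel" using m by simp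
    have "norm (u x) \<le> 1 + (norm (u x))\<^sup>2" for x
      using zero_le_power2[of "norm (u x) - 1"] norm_ge_zero[of "u x"] unfolding power2_diff power_one mult_1_right by linarith
    then show "AE x in lborel. norm (indicat_real {a..b} x *\<^sub>R u x) \<le> norm (indicat_real {a..b} x + (norm (u x))\<^sup>2)"
      by (intro AE_I2) (auto simp: indicator_def)
  qed
  with m show ?thesis by (simp add: locally_integrable_def)
qed

section \<open>The Dirac operator on representatives\<close>

lemma dirac_pairI:
  assumes "ac_deriv u v" "square_integrable u" "square_integrable v" "square_integrable (\<lambda>x. W x *\<^sub>R u x)"
  shows "dirac_pair W u v"
  using assms by (simp add: dirac_pair_def)

lemma has_weak_derivI:
  assumes "ac_deriv u v" "square_integrable u" "square_integrable v"
  shows "has_weak_deriv (abs_L2C2 u) (abs_L2C2 v)"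
  unfolding has_weak_deriv_def
proof (intro allI impI)
  fix \<phi> assume \<phi>: "test_function \<phi>"
  have m: "rep_L2C2 z \<in> borel_measurable borel" for z by (rule square_integrable_measurable) simp
  have um: "u \<in> borel_measurable borel" "v \<in> borel_measurable borel"
    using assms square_integrable_measurable by auto
  have pm: "\<phi> \<in> borel_measurable borel" "deriv \<phi> \<in> borel_measurable borel"
    using test_functionD[OF \<phi>] by (auto intro: borel_measurable_continuous_onI)
  have "(LINT x|lborel. deriv \<phi> x *\<^sub>R rep_L2C2 (abs_L2C2 u) x) = (LINT x|lborel. deriv \<phi> x *\<^sub>R u x)"
    by (rule integral_cong_AE) (use rep_abs_AE[OF assms(2)] m um pm in \<open>auto elim!: eventually_mono\<close>)
  also have "\<dots> = - (LINT x|lborel. \<phi> x *\<^sub>R v x)" by (rule test_function_parts[OF assms(1) \<phi>])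
  also have "(LINT x|lborel. \<phi> x *\<^sub>R v x) = (LINT x|lborel. \<phi> x *\<^sub>R rep_L2C2 (abs_L2C2 v) x)"
    by (rule integral_cong_AE) (use rep_abs_AE[OF assms(3)] m um pm in \<open>auto elim!: eventually_mono\<close>)
  finally show "(LINT x|lborel. deriv \<phi> x *\<^sub>R rep_L2C2 (abs_L2C2 u) x) = - (LINT x|lborel. \<phi> x *\<^sub>R rep_L2C2 (abs_L2C2 v) x)" .
qed

lemma has_weak_derivE:
  assumes "has_weak_deriv z w"
  obtains u where "ac_deriv u (rep_L2C2 w)" "AE x in lborel. rep_L2C2 z x = u x" "square_integrable u" "z = abs_L2C2 u"
proof -
  obtain u where u: "ac_deriv u (rep_L2C2 w)" "AE x in lborel. rep_L2C2 z x = u x"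
    using weak_deriv_imp_ac_deriv[of "rep_L2C2 z" "rep_L2C2 w"] assms
    by (auto simp: square_integrable_locally_integrable has_weak_deriv_def)
  have um: "u \<in> borel_measurable borel"
    by (rule borel_measurable_continuous_onI[OF ac_deriv_continuous[OF u(1)]])
  have "integrable lborel (\<lambda>x. (norm (u x))\<^sup>2)"
    by (rule integrable_cong_AE_imp[OF square_integrable_norm[OF square_integrable_rep[of z]]])
       (use u(2) um in \<open>auto elim!: eventually_mono\<close>)
  then have s: "square_integrable u" using um by (simp add: square_integrable_def)
  have "z = abs_L2C2 u" using u(2) s abs_eq_iff[of "rep_L2C2 z" u] by simp
  with u s show thesis by (rule that)
qed

lemma has_weak_deriv_unique:
  assumes "has_weak_deriv z w" "has_weak_deriv z w'"
  shows "w = w'"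
proof -
  have l: "locally_integrable (rep_L2C2 w)" "locally_integrable (rep_L2C2 w')"
    by (auto intro: square_integrable_locally_integrable)
  have "AE x in lborel. rep_L2C2 w x - rep_L2C2 w' x = 0"
  proof (rule AE_eq_0_if_test_0)
    show "locally_integrable (\<lambda>x. rep_L2C2 w x - rep_L2C2 w' x)"
      by (intro square_integrable_locally_integrable square_integrable_diff) auto
    fix \<phi> assume \<phi>: "test_function \<phi>"
    then obtain R where R: "R > 0" "\<And>x. R \<le> \<bar>x\<bar> \<Longrightarrow> \<phi> x = 0 \<and> deriv \<phi> x = 0"
      using test_functionD(5) by blast
    have i: "integrable lborel (\<lambda>x. \<phi> x *\<^sub>R rep_L2C2 w x)" "integrable lborel (\<lambda>x. \<phi> x *\<^sub>R rep_L2C2 w' x)"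
      using integrable_compact_support(1)[OF test_functionD(3)[OF \<phi>] _ l(1), of R]
        integrable_compact_support(1)[OF test_functionD(3)[OF \<phi>] _ l(2), of R] R by auto
    then have "(LINT x|lborel. \<phi> x *\<^sub>R (rep_L2C2 w x - rep_L2C2 w' x)) =
        (LINT x|lborel. \<phi> x *\<^sub>R rep_L2C2 w x) - (LINT x|lborel. \<phi> x *\<^sub>R rep_L2C2 w' x)"
      by (simp add: scaleR_diff_right)
    also have "\<dots> = 0" using assms \<phi> by (simp add: has_weak_deriv_def)
    finally show "(LINT x|lborel. \<phi> x *\<^sub>R (rep_L2C2 w x - rep_L2C2 w' x)) = 0" .
  qed
  then show ?thesis using abs_eq_iff[of "rep_L2C2 w" "rep_L2C2 w'"] by (simp add: eventually_mono)
qed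

lemma weak_deriv_eq: "has_weak_deriv z w \<Longrightarrow> weak_deriv z = w"
  unfolding weak_deriv_def by (rule the_equality) (auto intro: has_weak_deriv_unique)

lemma dirac_pair_shift:
  assumes "dirac_pair W u v" shows "dirac_pair (\<lambda>x. W x + b) u v"
  using dirac_pairD[OF assms] square_integrable_add[OF dirac_pairD(4)[OF assms] square_integrable_scaleR[OF dirac_pairD(2)[OF assms], of b]]
  by (simp add: dirac_pair_def scaleR_add_left)

lemma complex_scaleR_spinor: "complex_of_real r *s (v :: complex ^ 2) = r *\<^sub>R v"
  by (simp add: vec_eq_iff scaleR_conv_of_real[where 'a = complex])

lemma square_integrable_cong_AE:
  assumes "square_integrable u" "AE x in lborel. u x = w x" "w \<in> borel_measurable borel"
  shows "square_integrable w"
  unfolding square_integrable_def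
proof
  show "integrable lborel (\<lambda>x. (norm (w x))\<^sup>2)"
    by (rule integrable_cong_AE_imp[OF square_integrable_norm[OF assms(1)]])
       (use assms in \<open>auto elim!: eventually_mono\<close>)
qed (use assms in simp)

text \<open>This lemma and \<open>dirac_dom_pairE\<close> translate between elements of the Hilbert space and pairs of functions, so that all
  statements about the operator become statements about pairs.\<close>

lemma dirac_on_pair:
  assumes dom: "dirac_pair (\<lambda>x. V x - b) u v" and V: "V \<in> borel_measurable borel"
  shows "abs_L2C2 u \<in> fst (dirac m V)"
    "snd (dirac m V) (abs_L2C2 u) - Complex a b *\<^sub>C abs_L2C2 u = abs_L2C2 (dirac_expr m (\<lambda>x. V x - b) a u v)"
proof -
  note d = dirac_pairD[OF dom]
  have domV: "dirac_pair V u v" using dirac_pair_shift[OF dom, of b] by simp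
  note dV = dirac_pairD[OF domV]
  have w: "has_weak_deriv (abs_L2C2 u) (abs_L2C2 v)" by (rule has_weak_derivI[OF d(1-3)])
  note wd = weak_deriv_eq[OF w]
  have rm: "rep_L2C2 z \<in> borel_measurable borel" for z by (rule square_integrable_measurable) simp
  note ru = rep_abs_AE[OF d(2)] and rv = rep_abs_AE[OF d(3)]
  have "square_integrable (\<lambda>x. V x *\<^sub>R rep_L2C2 (abs_L2C2 u) x)"
    by (rule square_integrable_cong_AE[OF dV(4)]) (use ru V rm in \<open>auto elim!: eventually_mono\<close>)
  then show "abs_L2C2 u \<in> fst (dirac m V)"
    using w by (auto simp: dirac_def H1_def mult_dom_def complex_scaleR_spinor)
  let ?f = "\<lambda>u v x. J (v x) + m *\<^sub>R (sigma3 *v u x) + V x *\<^sub>R (\<i> *s u x)"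
  have e: "(- \<i>) *s (sigma1 *v v) + complex_of_real m *s (sigma3 *v u) + (\<i> * complex_of_real r) *s u =
      J v + m *\<^sub>R (sigma3 *v u) + r *\<^sub>R (\<i> *s u)" for u v r
    by (simp add: J_def vec_eq_iff scaleR_conv_of_real[where 'a = complex] mult_ac)
  have fs: "square_integrable (?f u v)" if "dirac_pair V u v" for u v
    using square_integrable_dirac_expr[OF that, of m 0] by (simp add: dirac_expr_def[abs_def])
  have fr: "square_integrable (?f (rep_L2C2 (abs_L2C2 u)) (rep_L2C2 (abs_L2C2 v)))"
  proof (rule square_integrable_cong_AE[OF fs[OF domV]])
    show "AE x in lborel. ?f u v x = ?f (rep_L2C2 (abs_L2C2 u)) (rep_L2C2 (abs_L2C2 v)) x"
      using ru rv by eventually_elim simp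
    have "(\<lambda>x. J (rep_L2C2 (abs_L2C2 v) x)) \<in> borel_measurable borel"
      "(\<lambda>x. sigma3 *v rep_L2C2 (abs_L2C2 u) x) \<in> borel_measurable borel"
      "(\<lambda>x. \<i> *s rep_L2C2 (abs_L2C2 u) x) \<in> borel_measurable borel"
      by (auto intro!: square_integrable_measurable square_integrable_J square_integrable_sigma square_integrable_cscale)
    then show "?f (rep_L2C2 (abs_L2C2 u)) (rep_L2C2 (abs_L2C2 v)) \<in> borel_measurable borel"
      using V by measurable
  qed
  have "snd (dirac m V) (abs_L2C2 u) = abs_L2C2 (?f (rep_L2C2 (abs_L2C2 u)) (rep_L2C2 (abs_L2C2 v)))"
    unfolding dirac_def snd_conv wd e ..
  also have "\<dots> = abs_L2C2 (?f u v)"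
    unfolding abs_eq_iff[OF fr fs[OF domV]] using ru rv by eventually_elim simp
  finally have 1: "snd (dirac m V) (abs_L2C2 u) = abs_L2C2 (?f u v)" .
  have 2: "Complex a b *\<^sub>C abs_L2C2 u = abs_L2C2 (\<lambda>x. Complex a b *s u x)"
    using d(2) by (subst scaleC.abs_eq) simp_all
  show "snd (dirac m V) (abs_L2C2 u) - Complex a b *\<^sub>C abs_L2C2 u = abs_L2C2 (dirac_expr m (\<lambda>x. V x - b) a u v)"
    unfolding 1 2 diff_abs[OF fs[OF domV] square_integrable_cscale[OF d(2)]]
    by (rule arg_cong[where f = abs_L2C2])
       (simp add: fun_eq_iff dirac_expr_def vec_eq_iff scaleR_conv_of_real[where 'a = complex] Complex_eq algebra_simps)
qed

lemma dirac_dom_pairE: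
  assumes "z \<in> fst (dirac m V)" and V: "V \<in> borel_measurable borel"
  obtains u v where "dirac_pair (\<lambda>x. V x - b) u v" "z = abs_L2C2 u"
proof -
  from assms obtain w where w: "has_weak_deriv z w" and s: "square_integrable (\<lambda>x. V x *\<^sub>R rep_L2C2 z x)"
    by (auto simp: dirac_def H1_def mult_dom_def complex_scaleR_spinor)
  obtain u where u: "ac_deriv u (rep_L2C2 w)" "AE x in lborel. rep_L2C2 z x = u x" "square_integrable u" "z = abs_L2C2 u"
    by (rule has_weak_derivE[OF w])
  have "square_integrable (\<lambda>x. V x *\<^sub>R u x)"
    by (rule square_integrable_cong_AE[OF s]) (use u V square_integrable_measurable[OF u(3)] in \<open>auto elim!: eventually_mono\<close>)
  then have "dirac_pair V u (rep_L2C2 w)" using u by (intro dirac_pairI) auto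
  from dirac_pair_shift[OF this, of "- b"] u(4) show thesis by (intro that) simp_all
qed

section \<open>Completeness and the Riesz representation\<close>

lemma square_integrable_Fatou:
  fixes w :: "real \<Rightarrow> complex ^ 2"
  assumes m: "w \<in> borel_measurable borel" and s: "\<And>n. square_integrable (f n)"
    and lim: "AE x in lborel. (\<lambda>n::nat. f n x) \<longlonglongrightarrow> w x" and C: "eventually (\<lambda>n. l2 (f n) \<le> C) sequentially"
  shows "square_integrable w" "l2 w \<le> C"
proof -
  have fm: "f n \<in> borel_measurable borel" for n by (rule square_integrable_measurable[OF s])
  obtain n where "l2 (f n) \<le> C" using C by (auto simp: eventually_sequentially)
  then have C0: "0 \<le> C" using l2_nonneg[of "f n"] by linarith
  have "(\<integral>\<^sup>+x. ennreal ((norm (w x))\<^sup>2) \<partial>lborel) = (\<integral>\<^sup>+x. liminf (\<lambda>n. ennreal ((norm (f n x))\<^sup>2)) \<partial>lborel)"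
  proof (rule nn_integral_cong_AE, use lim in eventually_elim)
    case (elim x)
    then have "(\<lambda>n. ennreal ((norm (f n x))\<^sup>2)) \<longlonglongrightarrow> ennreal ((norm (w x))\<^sup>2)"
      by (intro tendsto_ennrealI tendsto_intros)
    from lim_imp_Liminf[OF sequentially_bot this] show ?case by (rule sym)
  qed
  also have "\<dots> \<le> liminf (\<lambda>n. \<integral>\<^sup>+x. ennreal ((norm (f n x))\<^sup>2) \<partial>lborel)"
    by (rule nn_integral_liminf) (use fm in measurable)
  also have "(\<lambda>n. \<integral>\<^sup>+x. ennreal ((norm (f n x))\<^sup>2) \<partial>lborel) = (\<lambda>n. ennreal ((l2 (f n))\<^sup>2))"
    unfolding l2_square using square_integrable_norm[OF s] by (simp add: nn_integral_eq_integral)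
  also have "liminf (\<lambda>n. ennreal ((l2 (f n))\<^sup>2)) \<le> ennreal (C\<^sup>2)"
  proof -
    have "eventually (\<lambda>n. ennreal ((l2 (f n))\<^sup>2) \<le> ennreal (C\<^sup>2)) sequentially"
      using C by eventually_elim (intro ennreal_leI power_mono, auto)
    then have "liminf (\<lambda>n. ennreal ((l2 (f n))\<^sup>2)) \<le> liminf (\<lambda>n::nat. ennreal (C\<^sup>2))"
      by (rule Liminf_mono)
    then show ?thesis by (simp add: Liminf_const)
  qed
  finally have le: "(\<integral>\<^sup>+x. ennreal ((norm (w x))\<^sup>2) \<partial>lborel) \<le> ennreal (C\<^sup>2)" .
  then have "integrable lborel (\<lambda>x. (norm (w x))\<^sup>2)"
    by (intro integrableI_bounded) (use m in \<open>auto intro: le_less_trans ennreal_less_top\<close>)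
  with m show w: "square_integrable w" by (simp add: square_integrable_def)
  have "ennreal ((l2 w)\<^sup>2) \<le> ennreal (C\<^sup>2)"
    unfolding l2_square using le square_integrable_norm[OF w] by (simp add: nn_integral_eq_integral)
  then have "(l2 w)\<^sup>2 \<le> C\<^sup>2" by (simp add: ennreal_le_iff)
  then show "l2 w \<le> C" by (rule power2_le_imp_le) (rule C0)
qed

text \<open>The series of \<open>2^n |f (n+1) - f n|\<^sup>2\<close> has a finite integral, hence converges almost everywhere, and \<open>d \<le>
  2^(-n) + 2^n d\<^sup>2\<close> turns this into absolute convergence of the telescoping series.\<close>

lemma AE_convergent_if_l2_fast:
  assumes s: "\<And>n. square_integrable (f n)"
    and fast: "\<And>n. l2 (\<lambda>x. f (Suc n) x - f n x) \<le> (1 / 4) ^ n"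
  shows "AE x in lborel. convergent (\<lambda>n. f n x)"
proof -
  define d where "d n x = norm (f (Suc n) x - f n x)" for n x
  have sd: "square_integrable (\<lambda>x. f (Suc n) x - f n x)" for n by (intro square_integrable_diff s)
  have dm [measurable]: "d n \<in> borel_measurable borel" for n
    unfolding d_def[abs_def] using square_integrable_measurable[OF sd] by measurable
  have int: "(\<integral>\<^sup>+x. ennreal (2 ^ n * (d n x)\<^sup>2) \<partial>lborel) \<le> ennreal ((1 / 2) ^ n)" for n
  proof -
    have "(\<integral>\<^sup>+x. ennreal (2 ^ n * (d n x)\<^sup>2) \<partial>lborel) = ennreal (2 ^ n * (l2 (\<lambda>x. f (Suc n) x - f n x))\<^sup>2)"
      unfolding l2_square d_def using square_integrable_norm[OF sd] by (subst nn_integral_eq_integral) auto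
    also have "\<dots> \<le> ennreal (2 ^ n * ((1 / 4) ^ n)\<^sup>2)"
      by (intro ennreal_leI mult_left_mono power_mono fast) auto
    also have "(2::real) ^ n * ((1 / 4) ^ n)\<^sup>2 = (1 / 8) ^ n"
    proof -
      have "(2::real) ^ n * ((1 / 4) ^ n)\<^sup>2 = (2 * (1 / 4) * (1 / 4)) ^ n"
        by (simp only: power_mult_distrib power2_eq_square mult.assoc)
      then show ?thesis by simp
    qed
    also have "ennreal ((1 / 8) ^ n) \<le> ennreal ((1 / 2) ^ n)" by (intro ennreal_leI power_mono) auto
    finally show ?thesis .
  qed
  have "(\<integral>\<^sup>+x. (\<Sum>n. ennreal (2 ^ n * (d n x)\<^sup>2)) \<partial>lborel) = (\<Sum>n. \<integral>\<^sup>+x. ennreal (2 ^ n * (d n x)\<^sup>2) \<partial>lborel)"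
    by (rule nn_integral_suminf) measurable
  also have "\<dots> \<le> (\<Sum>n. ennreal ((1 / 2) ^ n))" by (intro suminf_le int summableI)
  also have "\<dots> < \<top>"
    by (subst less_top[symmetric]) (rule ennreal_suminf_neq_top; simp add: summable_geometric)
  finally have "(\<integral>\<^sup>+x. (\<Sum>n. ennreal (2 ^ n * (d n x)\<^sup>2)) \<partial>lborel) \<noteq> \<infinity>" by simp
  then have "AE x in lborel. (\<Sum>n. ennreal (2 ^ n * (d n x)\<^sup>2)) \<noteq> \<infinity>"
    by (rule nn_integral_PInf_AE[rotated]) measurable
  then show ?thesis
  proof eventually_elim
    case (elim x)
    have sm: "summable (\<lambda>n. 2 ^ n * (d n x)\<^sup>2)"
      by (rule summable_suminf_not_top) (use elim in auto)
    have "summable (\<lambda>n. d n x)"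
    proof (rule summable_comparison_test')
      show "summable (\<lambda>n. (1 / 2) ^ n + 2 ^ n * (d n x)\<^sup>2)"
        by (intro summable_add sm summable_geometric) auto
      fix n
      define p where "p = (2::real) ^ n"
      have p: "p > 0" by (simp add: p_def)
      have "0 \<le> (p * d n x - 1)\<^sup>2 / p" using p by simp
      also have "\<dots> = p * (d n x)\<^sup>2 + 1 / p - 2 * d n x"
        using p by (simp add: power2_eq_square field_simps)
      finally have "d n x \<le> 1 / p + p * (d n x)\<^sup>2" using norm_ge_zero[of "f (Suc n) x - f n x"] unfolding d_def by linarith
      then show "norm (d n x) \<le> (1 / 2) ^ n + 2 ^ n * (d n x)\<^sup>2"
        by (simp add: p_def d_def power_one_over)
    qed
    then have "summable (\<lambda>n. f (Suc n) x - f n x)" unfolding d_def by (rule summable_norm_cancel)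
    then have "convergent (\<lambda>n. \<Sum>k<n. f (Suc k) x - f k x)" by (simp add: summable_iff_convergent)
    then have "convergent (\<lambda>n. f n x - f 0 x)" by (simp add: sum_lessThan_telescope[of "\<lambda>n. f n x"])
    from convergent_add[OF this convergent_const[of "f 0 x"]] show ?case by simp
  qed
qed

instance L2C2 :: complete_space
proof
  fix X :: "nat \<Rightarrow> L2C2" assume X: "Cauchy X"
  have "\<exists>r. strict_mono r \<and> (\<forall>n. \<forall>k\<ge>r n. norm (X k - X (r n)) \<le> (1 / 4) ^ n)"
  proof -
    have "\<exists>N. \<forall>k\<ge>N. norm (X k - X N) \<le> (1 / 4) ^ n" for n
    proof -
      obtain N where "\<forall>k\<ge>N. dist (X k) (X N) < (1 / 4) ^ n"
        using X[unfolded Cauchy_altdef2, rule_format, of "(1 / 4) ^ n"] by auto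
      then show ?thesis by (intro exI[of _ N]) (auto simp: dist_norm less_imp_le)
    qed
    then have "\<exists>N. \<forall>k\<ge>N. \<forall>j\<ge>N. norm (X k - X j) \<le> (1 / 4) ^ n" for n
    proof -
      obtain N where N: "\<And>k. k \<ge> N \<Longrightarrow> norm (X k - X N) \<le> (1 / 4) ^ (Suc n)"
        using \<open>\<And>n. \<exists>N. \<forall>k\<ge>N. norm (X k - X N) \<le> (1 / 4) ^ n\<close>[of "Suc n"] by blast
      have "norm (X k - X j) \<le> (1 / 4) ^ n" if "k \<ge> N" "j \<ge> N" for k j
      proof -
        have "norm (X k - X j) \<le> norm (X k - X N) + norm (X j - X N)"
          using norm_triangle_ineq4[of "X k - X N" "X j - X N"] by simp
        also have "\<dots> \<le> (1 / 4) ^ Suc n + (1 / 4) ^ Suc n" using N that by (intro add_mono)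
        also have "\<dots> \<le> (1 / 4) ^ n" by simp
        finally show ?thesis .
      qed
      then show ?thesis by blast
    qed
    then have "\<forall>n. \<exists>N. \<forall>k\<ge>N. \<forall>j\<ge>N. norm (X k - X j) \<le> (1 / 4) ^ n" by blast
    from choice[OF this] obtain g where g: "\<forall>n. \<forall>k\<ge>g n. \<forall>j\<ge>g n. norm (X k - X j) \<le> (1 / 4) ^ n" by blast
    define r where "r n = n + (\<Sum>i\<le>n. g i)" for n
    have "strict_mono r" by (rule strict_monoI_Suc) (simp add: r_def)
    moreover have gr: "g n \<le> r n" for n
      using member_le_sum[of n "{..n}" g] by (simp add: r_def)
    have "norm (X k - X (r n)) \<le> (1 / 4) ^ n" if "r n \<le> k" for n k
      using g[rule_format, of n k "r n"] gr[of n] that by linarith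
    ultimately show ?thesis by blast
  qed
  then obtain r where r: "strict_mono r" "\<And>n k. k \<ge> r n \<Longrightarrow> norm (X k - X (r n)) \<le> (1 / 4) ^ n" by blast
  define f where "f n = rep_L2C2 (X (r n))" for n
  have s: "square_integrable (f n)" for n by (simp add: f_def)
  have nf: "l2 (\<lambda>x. f k x - f n x) = norm (X (r k) - X (r n))" for n k
    unfolding f_def by (subst norm_abs[symmetric]) (simp_all add: square_integrable_diff flip: diff_abs)
  have close: "l2 (\<lambda>x. f k x - f n x) \<le> (1 / 4) ^ n" if "n \<le> k" for n k
    unfolding nf by (rule r(2)) (use r(1) that in \<open>simp add: strict_mono_less_eq\<close>)
  have conv: "AE x in lborel. convergent (\<lambda>n. f n x)"
    by (rule AE_convergent_if_l2_fast[OF s close]) simp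
  define U where "U x = lim (\<lambda>n. f n x)" for x
  have fm: "f n \<in> borel_measurable borel" for n by (rule square_integrable_measurable[OF s])
  then have Um: "U \<in> borel_measurable borel" unfolding U_def[abs_def] by measurable
  have dist: "square_integrable (\<lambda>x. U x - f n x)" "l2 (\<lambda>x. U x - f n x) \<le> (1 / 4) ^ n" for n
  proof -
    have lim: "AE x in lborel. (\<lambda>k. f k x - f n x) \<longlonglongrightarrow> U x - f n x"
      using conv by eventually_elim (intro tendsto_intros, simp add: U_def convergent_LIMSEQ_iff)
    have ev: "eventually (\<lambda>k. l2 (\<lambda>x. f k x - f n x) \<le> (1 / 4) ^ n) sequentially"
      using eventually_ge_at_top[of n] by eventually_elim (rule close)
    have m: "(\<lambda>x. U x - f n x) \<in> borel_measurable borel" using Um fm by measurable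
    show "square_integrable (\<lambda>x. U x - f n x)" "l2 (\<lambda>x. U x - f n x) \<le> (1 / 4) ^ n"
      using square_integrable_Fatou[OF m square_integrable_diff[OF s s] lim ev] by auto
  qed
  have Us: "square_integrable U" using square_integrable_add[OF dist(1)[of 0] s[of 0]] by simp
  have "norm (X (r n) - abs_L2C2 U) \<le> (1 / 4) ^ n" for n
  proof -
    have "norm (X (r n) - abs_L2C2 U) = norm (abs_L2C2 U - abs_L2C2 (f n))"
      by (simp add: f_def norm_minus_commute)
    also have "\<dots> = l2 (\<lambda>x. U x - f n x)" using Us s dist(1) by (simp add: diff_abs norm_abs)
    finally show ?thesis using dist(2) by simp
  qed
  note near = this
  have "X \<longlonglongrightarrow> abs_L2C2 U"
  proof (rule LIMSEQ_I)
    fix e :: real assume e: "e > 0"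
    have "(\<lambda>n. (1 / 4 :: real) ^ n) \<longlonglongrightarrow> 0" by (intro LIMSEQ_power_zero) simp
    then obtain n where n: "(1 / 4 :: real) ^ n < e / 2"
      using LIMSEQ_D[of "\<lambda>n. (1 / 4 :: real) ^ n" 0 "e / 2"] e by auto
    show "\<exists>N. \<forall>k\<ge>N. norm (X k - abs_L2C2 U) < e"
    proof (intro exI allI impI)
      fix k assume "r n \<le> k"
      have "norm (X k - abs_L2C2 U) \<le> norm (X k - X (r n)) + norm (X (r n) - abs_L2C2 U)"
        using norm_triangle_ineq[of "X k - X (r n)" "X (r n) - abs_L2C2 U"] by simp
      then show "norm (X k - abs_L2C2 U) < e"
        using r(2)[OF \<open>r n \<le> k\<close>] near[of n] n by linarith
    qed
  qed
  then show "convergent X" by (rule convergentI)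
qed

text \<open>A minimising sequence in \<open>M\<close> of \<open>|y|\<^sup>2 - 2 l y\<close> is Cauchy by the parallelogram law, and its limit, a point
  of the closure of \<open>M\<close>, represents \<open>l\<close> on \<open>M\<close>.\<close>

lemma Riesz_on_subspace:
  fixes M :: "'a::{real_inner, complete_space} set" and l :: "'a \<Rightarrow> real"
  assumes M: "subspace M" and add: "\<And>x y. x \<in> M \<Longrightarrow> y \<in> M \<Longrightarrow> l (x + y) = l x + l y"
    and scale: "\<And>x r. x \<in> M \<Longrightarrow> l (r *\<^sub>R x) = r * l x"
    and bd: "\<And>x. x \<in> M \<Longrightarrow> \<bar>l x\<bar> \<le> C * norm x"
  shows "\<exists>z. \<forall>y\<in>M. z \<bullet> y = l y"
proof -
  define F where "F y = (norm y)\<^sup>2 - 2 * l y" for y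
  have F_lower: "- C\<^sup>2 \<le> F y" if "y \<in> M" for y
  proof -
    have "0 \<le> (norm y - C)\<^sup>2" by simp
    then show ?thesis using bd[OF that] by (simp add: F_def power2_diff mult.commute)
  qed
  define I where "I = (INF y\<in>M. F y)"
  have bdd: "bdd_below (F ` M)" using F_lower by (auto intro!: bdd_belowI2)
  have M0: "M \<noteq> {}" using subspace_0[OF M] by blast
  have I_le: "I \<le> F y" if "y \<in> M" for y unfolding I_def by (rule cINF_lower[OF bdd that])
  have "\<exists>y\<in>M. F y < I + 1 / real (Suc n)" for n
    using cINF_less_iff[OF M0 bdd, of "I + 1 / real (Suc n)"] by (simp add: I_def)
  then have "\<forall>n. \<exists>y. y \<in> M \<and> F y < I + 1 / real (Suc n)" by blast
  from choice[OF this] obtain y where y: "\<And>n. y n \<in> M" "\<And>n. F (y n) < I + 1 / real (Suc n)" by blast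
  have dist: "(norm (y n - y k))\<^sup>2 \<le> 2 / real (Suc n) + 2 / real (Suc k)" for n k
  proof -
    have mid: "(1/2) *\<^sub>R (y n + y k) \<in> M" by (intro subspace_scale[OF M] subspace_add[OF M] y)
    have l_mid: "l ((1/2) *\<^sub>R (y n + y k)) = (l (y n) + l (y k)) / 2"
      by (simp add: scale add y subspace_add[OF M])
    have "(norm (y n - y k))\<^sup>2 = 2 * F (y n) + 2 * F (y k) - 4 * F ((1/2) *\<^sub>R (y n + y k))"
    proof -
      have "(norm (y n - y k))\<^sup>2 = (norm (y n))\<^sup>2 + (norm (y k))\<^sup>2 - 2 * (y n \<bullet> y k)"
        by (simp add: power2_norm_eq_inner inner_diff inner_commute)
      moreover have "(norm ((1/2) *\<^sub>R (y n + y k)))\<^sup>2 = ((norm (y n))\<^sup>2 + (norm (y k))\<^sup>2 + 2 * (y n \<bullet> y k)) / 4"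
        unfolding power2_norm_eq_inner by (simp only: inner_scaleR_left inner_scaleR_right inner_add inner_commute[of "y k" "y n"]) (simp add: field_simps)
      ultimately show ?thesis unfolding F_def l_mid by (simp only:) (simp add: field_simps)
    qed
    then show ?thesis using I_le[OF mid] y(2)[of n] y(2)[of k] by simp
  qed
  have "Cauchy y"
  proof (rule CauchyI)
    fix e :: real assume e: "e > 0"
    obtain N where N: "inverse (real (Suc N)) < e\<^sup>2 / 4" using reals_Archimedean[of "e\<^sup>2 / 4"] e by auto
    show "\<exists>N. \<forall>n\<ge>N. \<forall>k\<ge>N. norm (y n - y k) < e"
    proof (intro exI allI impI)
      fix n k assume nk: "n \<ge> N" "k \<ge> N"
      have le: "1 / real (Suc j) \<le> inverse (real (Suc N))" if "j \<ge> N" for j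
        using that by (simp add: field_simps)
      have "(norm (y n - y k))\<^sup>2 < e\<^sup>2" using dist[of n k] le[OF nk(1)] le[OF nk(2)] N by simp
      then show "norm (y n - y k) < e" by (rule power2_less_imp_less) (use e in simp)
    qed
  qed
  then obtain z where z: "y \<longlonglongrightarrow> z" using Cauchy_convergent convergent_def by blast
  have "z \<bullet> x = l x" if x: "x \<in> M" for x
  proof -
    have ineq: "0 \<le> 2 * t * (z \<bullet> x - l x) + t\<^sup>2 * (norm x)\<^sup>2" for t
    proof (rule LIMSEQ_le_const)
      show "(\<lambda>n. 2 * t * (y n \<bullet> x - l x) + t\<^sup>2 * (norm x)\<^sup>2 + inverse (real (Suc n))) \<longlonglongrightarrow> 2 * t * (z \<bullet> x - l x) + t\<^sup>2 * (norm x)\<^sup>2"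
      proof -
        have "(\<lambda>n. 2 * t * (y n \<bullet> x - l x) + t\<^sup>2 * (norm x)\<^sup>2) \<longlonglongrightarrow> 2 * t * (z \<bullet> x - l x) + t\<^sup>2 * (norm x)\<^sup>2"
          by (intro tendsto_intros z)
        from tendsto_add[OF this LIMSEQ_inverse_real_of_nat] show ?thesis by simp
      qed
      show "\<exists>N. \<forall>n\<ge>N. 0 \<le> 2 * t * (y n \<bullet> x - l x) + t\<^sup>2 * (norm x)\<^sup>2 + inverse (real (Suc n))"
      proof (intro exI allI impI)
        fix n
        have "I \<le> F (y n + t *\<^sub>R x)" by (intro I_le subspace_add[OF M] subspace_scale[OF M] y x)
        also have "F (y n + t *\<^sub>R x) = F (y n) + 2 * t * (y n \<bullet> x - l x) + t\<^sup>2 * (norm x)\<^sup>2"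
        proof -
          have "(norm (y n + t *\<^sub>R x))\<^sup>2 = (norm (y n))\<^sup>2 + 2 * t * (y n \<bullet> x) + t\<^sup>2 * (norm x)\<^sup>2"
            unfolding power2_norm_eq_inner
            by (simp add: inner_add_left inner_add_right inner_commute[of x "y n"] power2_eq_square distrib_left mult.assoc)
          then show ?thesis by (simp add: F_def add scale y x subspace_scale[OF M] algebra_simps)
        qed
        finally show "0 \<le> 2 * t * (y n \<bullet> x - l x) + t\<^sup>2 * (norm x)\<^sup>2 + inverse (real (Suc n))"
          using y(2)[of n] by (simp add: inverse_eq_divide)
      qed
    qed
    show ?thesis
    proof (cases "x = 0")
      case True
      then show ?thesis using bd[OF x] by simp
    next
      case False
      define D where "D = z \<bullet> x - l x"
      define N where "N = (norm x)\<^sup>2"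
      have N: "N > 0" using False by (simp add: N_def)
      have "0 \<le> 2 * (- D / N) * D + (- D / N)\<^sup>2 * N" using ineq[of "- D / N"] by (simp add: D_def N_def)
      also have "\<dots> = - (D\<^sup>2 / N)" using N by (simp add: power2_eq_square field_simps)
      finally have "D\<^sup>2 / N \<le> 0" by simp
      then have "D = 0" using N by (simp add: divide_le_0_iff)
      then show ?thesis by (simp add: D_def)
    qed
  qed
  then show ?thesis by blast
qed

section \<open>Cutoff functions and operations on domain pairs\<close>

text \<open>This shape is chosen because both the derivative of the cutoff and its distance from 1 vanish at \<open>X\<close>: they are bounded by
  \<open>|x - X| / r\<^sup>2\<close> and \<open>|x - X| / r\<close>, up to constants, and a factor \<open>|x - X|\<close> can be absorbed by a
  potential with a simple zero at \<open>X\<close>.\<close>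

definition cutoff :: "real \<Rightarrow> real \<Rightarrow> real \<Rightarrow> real" where
  "cutoff X r x = (max 0 (1 - ((x - X) / r)\<^sup>2))\<^sup>2"

definition cutoff' :: "real \<Rightarrow> real \<Rightarrow> real \<Rightarrow> real" where
  "cutoff' X r x = - 4 * max 0 (1 - ((x - X) / r)\<^sup>2) * ((x - X) / r) / r"

lemma DERIV_pos_part_square: "((\<lambda>y. (max 0 y)\<^sup>2) has_real_derivative 2 * max 0 y) (at (y::real))"
proof (cases y "0::real" rule: linorder_cases)
  case greater
  have "((\<lambda>y. y\<^sup>2) has_real_derivative 2 * max 0 y) (at y)"
    using greater by (auto intro!: derivative_eq_intros)
  then show ?thesis
    by (rule has_field_derivative_transform_within_open[of _ _ _ "{0<..}"]) (use greater in auto)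
next
  case less
  have "((\<lambda>y. 0) has_real_derivative 2 * max 0 y) (at y)"
    using less by (auto intro!: derivative_eq_intros)
  then show ?thesis
    by (rule has_field_derivative_transform_within_open[of _ _ _ "{..<0}"]) (use less in auto)
next
  case equal
  have "((\<lambda>h. max 0 h) \<longlongrightarrow> max 0 0) (at (0::real))" by (intro tendsto_intros)
  moreover have "eventually (\<lambda>h. max 0 h = (max 0 h)\<^sup>2 / h) (at (0::real))"
    by (auto simp: eventually_at_filter max_def power2_eq_square)
  ultimately have "((\<lambda>h. (max 0 h)\<^sup>2 / h) \<longlongrightarrow> max 0 0) (at (0::real))"
    by (rule Lim_transform_eventually)
  then show ?thesis using equal by (simp add: DERIV_def)
qed

lemma cutoff_deriv:
  assumes "r > 0"
  shows "(cutoff X r has_real_derivative cutoff' X r x) (at x)"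
proof -
  have "((\<lambda>x. 1 - ((x - X) / r)\<^sup>2) has_real_derivative - (2 * ((x - X) / r) / r)) (at x)"
    using assms by (auto intro!: derivative_eq_intros simp: power2_eq_square)
  note D = DERIV_chain2[OF DERIV_pos_part_square this]
  show ?thesis
    unfolding cutoff_def[abs_def] by (rule DERIV_cong[OF D]) (simp add: cutoff'_def)
qed

lemma cutoff_continuous: "continuous_on S (cutoff X r)" "continuous_on S (cutoff' X r)"
  unfolding cutoff_def[abs_def] cutoff'_def[abs_def] divide_inverse by (intro continuous_intros)+

lemma cutoff_outside:
  assumes "r > 0" "r \<le> \<bar>x - X\<bar>"
  shows "cutoff X r x = 0" "cutoff' X r x = 0"
proof -
  have "1 \<le> ((x - X) / r)\<^sup>2"
    using assms power_mono[of 1 "\<bar>(x - X) / r\<bar>" 2] by (simp add: field_simps)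
  then show "cutoff X r x = 0" "cutoff' X r x = 0" by (simp_all add: cutoff_def cutoff'_def max_def)
qed

lemma cutoff_bounds:
  assumes "r > 0"
  shows "0 \<le> cutoff X r x" "cutoff X r x \<le> 1" "\<bar>cutoff' X r x\<bar> \<le> 4 * \<bar>x - X\<bar> / r\<^sup>2" "\<bar>cutoff' X r x\<bar> \<le> 4 / r"
    "1 - cutoff X r x \<le> 2 * \<bar>x - X\<bar> / r"
proof -
  define y where "y = max 0 (1 - ((x - X) / r)\<^sup>2)"
  have y: "0 \<le> y" "y \<le> 1" by (auto simp: y_def)
  show "0 \<le> cutoff X r x" by (simp add: cutoff_def)
  show "cutoff X r x \<le> 1" unfolding cutoff_def y_def[symmetric] using y by (simp add: power_le_one)
  show *: "\<bar>cutoff' X r x\<bar> \<le> 4 * \<bar>x - X\<bar> / r\<^sup>2"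
  proof -
    have "\<bar>cutoff' X r x\<bar> = (4 * \<bar>x - X\<bar> / r\<^sup>2) * y"
      unfolding cutoff'_def y_def[symmetric] using assms y by (simp add: abs_mult power2_eq_square)
    also have "\<dots> \<le> (4 * \<bar>x - X\<bar> / r\<^sup>2) * 1" using y by (intro mult_left_mono) auto
    finally show ?thesis by simp
  qed
  show "\<bar>cutoff' X r x\<bar> \<le> 4 / r"
  proof (cases "\<bar>x - X\<bar> < r")
    case True
    have "4 * \<bar>x - X\<bar> / r\<^sup>2 \<le> 4 * r / r\<^sup>2" using True assms by (intro divide_right_mono) auto
    then show ?thesis using * assms by (simp add: power2_eq_square)
  qed (use cutoff_outside[OF assms, of x X] assms in simp)
  show "1 - cutoff X r x \<le> 2 * \<bar>x - X\<bar> / r"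
  proof (cases "\<bar>x - X\<bar> < r")
    case True
    define q where "q = \<bar>x - X\<bar> / r"
    have q: "0 \<le> q" "q \<le> 1" "((x - X) / r)\<^sup>2 = q\<^sup>2" using True assms by (auto simp: q_def power_divide)
    have q2: "q\<^sup>2 \<le> q" using q mult_left_le[of q q] by (simp add: power2_eq_square)
    have "cutoff X r x = (1 - q\<^sup>2)\<^sup>2" using q by (simp add: cutoff_def power_le_one)
    also have "\<dots> \<ge> 1 - 2 * q\<^sup>2" by (simp add: power2_diff)
    finally show ?thesis using q2 by (simp add: q_def)
  next
    case False
    then have "1 \<le> \<bar>x - X\<bar> / r" using assms by simp
    then show ?thesis using cutoff_outside[OF assms, of x X] False by simp
  qed
qed

lemma ac_deriv_cutoff: "r > 0 \<Longrightarrow> ac_deriv (cutoff X r) (cutoff' X r)"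
  by (rule ac_deriv_C1) (auto simp: cutoff_continuous cutoff_deriv simp flip: has_real_derivative_iff_has_vector_derivative)

lemma square_integrable_mult:
  assumes "square_integrable u" "g \<in> borel_measurable borel" "\<And>x. \<bar>g x\<bar> \<le> B"
  shows "square_integrable (\<lambda>x. g x *\<^sub>R u x)" "l2 (\<lambda>x. g x *\<^sub>R u x) \<le> B * l2 u"
proof -
  have m: "(\<lambda>x. g x *\<^sub>R u x) \<in> borel_measurable borel"
    using assms square_integrable_measurable[OF assms(1)] by measurable
  have B: "norm (g x *\<^sub>R u x) \<le> B * norm (u x)" for x using assms(3) by (simp add: mult_right_mono)
  have "0 \<le> B" using assms(3)[of 0] by linarith
  then show "square_integrable (\<lambda>x. g x *\<^sub>R u x)" "l2 (\<lambda>x. g x *\<^sub>R u x) \<le> B * l2 u"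
    using square_integrable_bound[OF assms(1) m B] by simp_all
qed

lemma square_integrable_mult_compact:
  fixes g :: "real \<Rightarrow> real"
  assumes w: "square_integrable w" and g: "continuous_on UNIV g" and supp: "\<And>x. R \<le> \<bar>x - X\<bar> \<Longrightarrow> g x = 0"
  shows "square_integrable (\<lambda>x. g x *\<^sub>R w x)"
proof -
  have "compact (g ` {X - R..X + R})"
    by (intro compact_continuous_image continuous_on_subset[OF g]) auto
  then have "bounded (g ` {X - R..X + R})" by (rule compact_imp_bounded)
  then obtain K where K: "\<forall>y\<in>g ` {X - R..X + R}. norm y \<le> K" unfolding bounded_iff by blast
  have "\<bar>g x\<bar> \<le> max 0 K" for x
  proof (cases "\<bar>x - X\<bar> \<le> R")
    case True
    then have "g x \<in> g ` {X - R..X + R}" by (intro imageI) auto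
    with K have "norm (g x) \<le> K" by blast
    then show ?thesis unfolding real_norm_def by linarith
  qed (use supp in auto)
  then show ?thesis
    by (intro square_integrable_mult(1)[OF w borel_measurable_continuous_onI[OF g]])
qed

lemma dirac_expr_mult:
  "dirac_expr m W a (\<lambda>x. c x *\<^sub>R u x) (\<lambda>x. c x *\<^sub>R v x + d x *\<^sub>R u x) x =
     c x *\<^sub>R dirac_expr m W a u v x + d x *\<^sub>R J (u x)"
  by (simp add: dirac_expr_def vec_eq_iff forall_2 J_component sigma3_component scaleR_conv_of_real[where 'a = complex] algebra_simps)

lemma dirac_pair_mult:
  assumes dom: "dirac_pair W u v" and c: "ac_deriv c d" "continuous_on UNIV d" and bd: "\<And>x. \<bar>c x\<bar> \<le> B" "\<And>x. \<bar>d x\<bar> \<le> D"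
  shows "dirac_pair W (\<lambda>x. c x *\<^sub>R u x) (\<lambda>x. c x *\<^sub>R v x + d x *\<^sub>R u x)"
proof (rule dirac_pairI)
  note d = dirac_pairD[OF dom]
  have cm: "c \<in> borel_measurable borel" "d \<in> borel_measurable borel"
    using c ac_deriv_continuous[OF c(1)] by (auto intro: borel_measurable_continuous_onI)
  show "ac_deriv (\<lambda>x. c x *\<^sub>R u x) (\<lambda>x. c x *\<^sub>R v x + d x *\<^sub>R u x)" by (rule ac_deriv_scaleR[OF c(1) d(1)])
  show "square_integrable (\<lambda>x. c x *\<^sub>R u x)" by (rule square_integrable_mult(1)[OF d(2) cm(1) bd(1)])
  show "square_integrable (\<lambda>x. c x *\<^sub>R v x + d x *\<^sub>R u x)"
    by (rule square_integrable_add[OF square_integrable_mult(1)[OF d(3) cm(1) bd(1)] square_integrable_mult(1)[OF d(2) cm(2) bd(2)]])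
  have "square_integrable (\<lambda>x. c x *\<^sub>R (W x *\<^sub>R u x))" by (rule square_integrable_mult(1)[OF d(4) cm(1) bd(1)])
  then show "square_integrable (\<lambda>x. W x *\<^sub>R c x *\<^sub>R u x)" by (simp add: mult.commute)
qed

lemma dirac_pair_add:
  assumes "dirac_pair W u v" "dirac_pair W u' v'"
  shows "dirac_pair W (\<lambda>x. u x + u' x) (\<lambda>x. v x + v' x)"
  using dirac_pairD[OF assms(1)] dirac_pairD[OF assms(2)]
  by (simp add: dirac_pair_def ac_deriv_add square_integrable_add scaleR_add_right)

lemma dirac_pair_scaleR:
  assumes "dirac_pair W u v"
  shows "dirac_pair W (\<lambda>x. r *\<^sub>R u x) (\<lambda>x. r *\<^sub>R v x)"
proof -
  note d = dirac_pairD[OF assms]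
  have "square_integrable (\<lambda>x. W x *\<^sub>R r *\<^sub>R u x)"
    using square_integrable_scaleR[OF d(4), of r] by (simp add: mult.commute)
  then show ?thesis
    using d ac_deriv_linear[OF bounded_linear_scaleR_right d(1)] by (simp add: dirac_pair_def square_integrable_scaleR)
qed

lemma dirac_expr_add:
  "dirac_expr m W a (\<lambda>x. u x + u' x) (\<lambda>x. v x + v' x) x = dirac_expr m W a u v x + dirac_expr m W a u' v' x"
  by (simp add: dirac_expr_def vec_eq_iff forall_2 J_component sigma3_component scaleR_conv_of_real[where 'a = complex] algebra_simps)

lemma dirac_expr_scaleR:
  "dirac_expr m W a (\<lambda>x. r *\<^sub>R u x) (\<lambda>x. r *\<^sub>R v x) x = r *\<^sub>R dirac_expr m W a u v x"
  by (simp add: dirac_expr_def vec_eq_iff forall_2 J_component sigma3_component scaleR_conv_of_real[where 'a = complex] algebra_simps)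

text \<open>The antiunitary symmetry \<open>u \<mapsto> sigma3 (cnj u)\<close>. It commutes with \<open>-i d/dx sigma1\<close>, with
  \<open>sigma3\<close> and with real scalars and reverses the sign of \<open>i\<close> times a real function; hence it maps the operator with
  potential \<open>W\<close> to the one with \<open>-W\<close>, its formal adjoint.\<close>

definition spinor_cnj :: "complex ^ 2 \<Rightarrow> complex ^ 2" where
  "spinor_cnj v = sigma3 *v (\<chi> i. cnj (v $ i))"

lemma spinor_cnj_component: "spinor_cnj v $ 1 = cnj (v $ 1)" "spinor_cnj v $ 2 = - cnj (v $ 2)"
  by (simp_all add: spinor_cnj_def sigma3_component)

lemma norm_spinor_cnj [simp]: "norm (spinor_cnj v) = norm v"
  by (simp add: power2_eq_iff_nonneg[symmetric, of "norm _" "norm v"] norm_spinor spinor_cnj_component del: power2_eq_iff_nonneg)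

lemma bounded_linear_spinor_cnj: "bounded_linear spinor_cnj"
  by (rule bounded_linear_intro[where K = 1])
     (simp_all add: vec_eq_iff forall_2 spinor_cnj_component scaleR_conv_of_real[where 'a = complex])

lemma lower_bound_adjoint:
  assumes "lower_bound m W a c"
  shows "lower_bound m (\<lambda>x. - W x) a c"
  unfolding lower_bound_def
proof (intro allI impI)
  fix u v assume dom: "dirac_pair (\<lambda>x. - W x) u v"
  note d = dirac_pairD[OF dom]
  have "square_integrable (\<lambda>x. W x *\<^sub>R spinor_cnj (u x))"
    using square_integrable_linear[OF square_integrable_scaleR[OF d(4), of "-1"] bounded_linear_spinor_cnj]
    by (simp add: linear_simps(5)[OF bounded_linear_spinor_cnj])
  then have "dirac_pair W (\<lambda>x. spinor_cnj (u x)) (\<lambda>x. spinor_cnj (v x))"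
    by (intro dirac_pairI ac_deriv_linear[OF bounded_linear_spinor_cnj] d
        square_integrable_linear[OF _ bounded_linear_spinor_cnj])
  then have "c * l2 (\<lambda>x. spinor_cnj (u x)) \<le> l2 (dirac_expr m W a (\<lambda>x. spinor_cnj (u x)) (\<lambda>x. spinor_cnj (v x)))"
    using assms by (simp add: lower_bound_def)
  also have "dirac_expr m W a (\<lambda>x. spinor_cnj (u x)) (\<lambda>x. spinor_cnj (v x)) = (\<lambda>x. spinor_cnj (dirac_expr m (\<lambda>x. - W x) a u v x))"
    by (simp add: fun_eq_iff dirac_expr_def vec_eq_iff forall_2 J_component sigma3_component spinor_cnj_component scaleR_conv_of_real[where 'a = complex])
  also have "l2 \<dots> = l2 (dirac_expr m (\<lambda>x. - W x) a u v)" by (rule l2_cong_norm) simp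
  also have "l2 (\<lambda>x. spinor_cnj (u x)) = l2 u" by (rule l2_cong_norm) simp
  finally show "c * l2 u \<le> l2 (dirac_expr m (\<lambda>x. - W x) a u v)" .
qed

section \<open>Lower bounds, solvability and the norm of the resolvent\<close>

lemma l2_cong_AE:
  assumes "AE x in lborel. u x = w x" "u \<in> borel_measurable borel" "w \<in> borel_measurable borel"
  shows "l2 u = l2 w"
  unfolding l2_def
  by (rule arg_cong[where f = sqrt], rule integral_cong_AE) (use assms in \<open>auto elim!: eventually_mono\<close>)

lemma square_integrable_compact_support:
  assumes c: "continuous_on UNIV w" and supp: "\<And>x. R \<le> \<bar>x\<bar> \<Longrightarrow> w x = 0"
  shows "square_integrable w"
proof -
  have "locally_integrable (\<lambda>x. 1 :: real)" by (rule locally_integrable_continuous) simp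
  moreover have "continuous_on UNIV (\<lambda>x. (norm (w x))\<^sup>2)" by (intro continuous_intros c)
  ultimately have "integrable lborel (\<lambda>x. (norm (w x))\<^sup>2 *\<^sub>R (1::real))"
    by (intro integrable_compact_support(1)[where R = R]) (auto simp: supp)
  then show ?thesis
    using borel_measurable_continuous_onI[OF c] by (simp add: square_integrable_def)
qed

lemma lower_bound_inj:
  assumes lb: "lower_bound m W a c" "c > 0" and d1: "dirac_pair W u1 v1" and d2: "dirac_pair W u2 v2"
    and eq: "abs_L2C2 (dirac_expr m W a u1 v1) = abs_L2C2 (dirac_expr m W a u2 v2)"
  shows "abs_L2C2 u1 = abs_L2C2 u2"
proof -
  let ?T = "dirac_expr m W a"
  note s1 = square_integrable_dirac_expr[OF d1, of m a] and s2 = square_integrable_dirac_expr[OF d2, of m a]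
  have dom: "dirac_pair W (\<lambda>x. u1 x + (-1) *\<^sub>R u2 x) (\<lambda>x. v1 x + (-1) *\<^sub>R v2 x)"
    by (rule dirac_pair_add[OF d1 dirac_pair_scaleR[OF d2]])
  have T: "?T (\<lambda>x. u1 x + (-1) *\<^sub>R u2 x) (\<lambda>x. v1 x + (-1) *\<^sub>R v2 x) = (\<lambda>x. ?T u1 v1 x - ?T u2 v2 x)"
  proof
    fix x
    have "?T (\<lambda>x. u1 x + (-1) *\<^sub>R u2 x) (\<lambda>x. v1 x + (-1) *\<^sub>R v2 x) x = ?T u1 v1 x + (-1) *\<^sub>R ?T u2 v2 x"
      unfolding dirac_expr_add dirac_expr_scaleR ..
    then show "?T (\<lambda>x. u1 x + (-1) *\<^sub>R u2 x) (\<lambda>x. v1 x + (-1) *\<^sub>R v2 x) x = ?T u1 v1 x - ?T u2 v2 x"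
      by simp
  qed
  have "c * l2 (\<lambda>x. u1 x - u2 x) \<le> l2 (\<lambda>x. ?T u1 v1 x - ?T u2 v2 x)"
    using lb(1)[unfolded lower_bound_def, rule_format, OF dom] unfolding T by simp
  also have "\<dots> = norm (abs_L2C2 (?T u1 v1) - abs_L2C2 (?T u2 v2))"
    using s1 s2 by (simp add: diff_abs norm_abs square_integrable_diff)
  also have "\<dots> = 0" using eq by simp
  finally have "c * l2 (\<lambda>x. u1 x - u2 x) \<le> 0" .
  then have "l2 (\<lambda>x. u1 x - u2 x) = 0" using lb(2) l2_nonneg[of "\<lambda>x. u1 x - u2 x"]
    by (simp add: mult_le_0_iff)
  moreover have "norm (abs_L2C2 u1 - abs_L2C2 u2) = l2 (\<lambda>x. u1 x - u2 x)"
    using dirac_pairD(2)[OF d1] dirac_pairD(2)[OF d2] by (simp add: diff_abs norm_abs square_integrable_diff)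
  ultimately show ?thesis by simp
qed

lemma dirac_pair_zero: "dirac_pair W (\<lambda>x. 0) (\<lambda>x. 0)"
  by (rule dirac_pairI) (auto intro!: ac_deriv_C1 simp: square_integrable_zero)

text \<open>By the lower bound for the adjoint expression \<open>T'\<close>, the map \<open>T' u \<mapsto> \<langle>f, u\<rangle>\<close> is well
  defined and bounded on the range of \<open>T'\<close>; the vector that represents it is a weak solution.\<close>

lemma weak_solution_exists:
  assumes lb: "lower_bound m W a c" "c > 0" and f: "square_integrable f"
  obtains z where "square_integrable z"
    "\<And>u v. dirac_pair (\<lambda>x. - W x) u v \<Longrightarrow>
       (LINT x|lborel. z x \<bullet> dirac_expr m (\<lambda>x. - W x) a u v x) = (LINT x|lborel. f x \<bullet> u x)"
proof -
  let ?W = "\<lambda>x. - W x"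
  let ?T = "dirac_expr m ?W a"
  have lb': "lower_bound m ?W a c" by (rule lower_bound_adjoint[OF lb(1)])
  define M where "M = {abs_L2C2 (?T u v) | u v. dirac_pair ?W u v}"
  \<comment> \<open>The inverse of \<open>T'\<close> on its range; injectivity makes the choice irrelevant.\<close>
  define G where "G y = abs_L2C2 (SOME u. \<exists>v. dirac_pair ?W u v \<and> y = abs_L2C2 (?T u v))" for y
  have G: "G (abs_L2C2 (?T u v)) = abs_L2C2 u" if "dirac_pair ?W u v" for u v
  proof -
    have "\<exists>u' v'. dirac_pair ?W u' v' \<and> abs_L2C2 (?T u v) = abs_L2C2 (?T u' v')" using that by blast
    from someI_ex[OF this]
    obtain v' where *: "dirac_pair ?W (SOME u'. \<exists>v'. dirac_pair ?W u' v' \<and> abs_L2C2 (?T u v) = abs_L2C2 (?T u' v')) v'"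
      "abs_L2C2 (?T u v) = abs_L2C2 (?T (SOME u'. \<exists>v'. dirac_pair ?W u' v' \<and> abs_L2C2 (?T u v) = abs_L2C2 (?T u' v')) v')"
      by (elim exE conjE)
    show ?thesis
      unfolding G_def by (rule lower_bound_inj[OF lb' lb(2) that *, symmetric])
  qed
  have add: "abs_L2C2 (?T u v) + abs_L2C2 (?T u' v') = abs_L2C2 (?T (\<lambda>x. u x + u' x) (\<lambda>x. v x + v' x))"
    if "dirac_pair ?W u v" "dirac_pair ?W u' v'" for u v u' v'
    using that by (simp add: add_abs square_integrable_dirac_expr dirac_expr_add[abs_def])
  have scale: "r *\<^sub>R abs_L2C2 (?T u v) = abs_L2C2 (?T (\<lambda>x. r *\<^sub>R u x) (\<lambda>x. r *\<^sub>R v x))"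
    if "dirac_pair ?W u v" for r u v
    using that by (simp add: scaleR_abs square_integrable_dirac_expr dirac_expr_scaleR[abs_def])
  have MI: "abs_L2C2 (?T u v) \<in> M" if "dirac_pair ?W u v" for u v
    using that unfolding M_def by auto
  have sub: "subspace M"
  proof (rule subspaceI)
    have "?T (\<lambda>x. 0) (\<lambda>x. 0) = (\<lambda>x. 0)"
      by (simp add: fun_eq_iff dirac_expr_def linear_simps[OF bounded_linear_J])
    then have "0 = abs_L2C2 (?T (\<lambda>x. 0) (\<lambda>x. 0))" by (simp add: zero_L2C2_def)
    then show "0 \<in> M" using MI[OF dirac_pair_zero] by simp
  next
    fix x y assume "x \<in> M" "y \<in> M"
    then obtain u v u' v' where *: "dirac_pair ?W u v" "dirac_pair ?W u' v'" "x = abs_L2C2 (?T u v)" "y = abs_L2C2 (?T u' v')"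
      unfolding M_def by auto
    show "x + y \<in> M" unfolding *(3,4) add[OF *(1,2)] by (rule MI[OF dirac_pair_add[OF *(1,2)]])
  next
    fix x r assume "x \<in> M"
    then obtain u v where *: "dirac_pair ?W u v" "x = abs_L2C2 (?T u v)"
      unfolding M_def by auto
    show "r *\<^sub>R x \<in> M" unfolding *(2) scale[OF *(1)] by (rule MI[OF dirac_pair_scaleR[OF *(1)]])
  qed
  define l where "l y = abs_L2C2 f \<bullet> G y" for y
  have "\<exists>z. \<forall>y\<in>M. z \<bullet> y = l y"
  proof (rule Riesz_on_subspace[OF sub, where C = "norm (abs_L2C2 f) * (1 / c)"])
    fix x y assume "x \<in> M" "y \<in> M"
    then obtain u v u' v' where *: "dirac_pair ?W u v" "dirac_pair ?W u' v'" "x = abs_L2C2 (?T u v)" "y = abs_L2C2 (?T u' v')"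
      unfolding M_def by auto
    have "G (x + y) = G x + G y"
      unfolding *(3,4) add[OF *(1,2)] G[OF dirac_pair_add[OF *(1,2)]] G[OF *(1)] G[OF *(2)]
      using dirac_pairD(2)[OF *(1)] dirac_pairD(2)[OF *(2)] by (simp add: add_abs)
    then show "l (x + y) = l x + l y" by (simp add: l_def inner_add_right)
  next
    fix x r assume "x \<in> M"
    then obtain u v where *: "dirac_pair ?W u v" "x = abs_L2C2 (?T u v)"
      unfolding M_def by auto
    have "G (r *\<^sub>R x) = r *\<^sub>R G x"
      unfolding *(2) scale[OF *(1)] G[OF dirac_pair_scaleR[OF *(1)]] G[OF *(1)]
      using dirac_pairD(2)[OF *(1)] by (simp add: scaleR_abs)
    then show "l (r *\<^sub>R x) = r * l x" by (simp add: l_def)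
  next
    fix x assume "x \<in> M"
    then obtain u v where *: "dirac_pair ?W u v" "x = abs_L2C2 (?T u v)"
      unfolding M_def by auto
    have "c * l2 u \<le> l2 (?T u v)" using lb' *(1) by (simp add: lower_bound_def)
    then have "norm (G x) \<le> 1 / c * norm x"
      unfolding *(2) G[OF *(1)] using lb(2) dirac_pairD(2)[OF *(1)] square_integrable_dirac_expr[OF *(1)]
      by (simp add: norm_abs field_simps)
    then have "norm (abs_L2C2 f) * norm (G x) \<le> norm (abs_L2C2 f) * (1 / c * norm x)"
      by (intro mult_left_mono) auto
    then show "\<bar>l x\<bar> \<le> norm (abs_L2C2 f) * (1 / c) * norm x"
      using Cauchy_Schwarz_ineq2[of "abs_L2C2 f" "G x"] by (simp add: l_def)
  qed
  then obtain z where z: "\<And>y. y \<in> M \<Longrightarrow> z \<bullet> y = l y" by blast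
  show thesis
  proof (rule that[of "rep_L2C2 z"])
    fix u v assume d: "dirac_pair ?W u v"
    have "z \<bullet> abs_L2C2 (?T u v) = abs_L2C2 f \<bullet> abs_L2C2 u"
      using z[OF MI[OF d]] G[OF d] by (simp add: l_def)
    moreover have "z \<bullet> abs_L2C2 (?T u v) = (LINT x|lborel. rep_L2C2 z x \<bullet> ?T u v x)"
      by (subst abs_rep[symmetric, of z], subst inner_abs) (auto intro: square_integrable_dirac_expr[OF d])
    ultimately show "(LINT x|lborel. rep_L2C2 z x \<bullet> ?T u v x) = (LINT x|lborel. f x \<bullet> u x)"
      using f dirac_pairD(2)[OF d] by (simp add: inner_abs)
  qed simp
qed

text \<open>The weak solution \<open>z\<close> satisfies \<open>J z' = g\<close> weakly with a locally integrable \<open>g\<close>, so it has an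
  absolutely continuous representative \<open>u\<close>. What is missing for the domain is \<open>W u \<in> L\<^sup>2\<close>; the graph estimate
  bounds the norm of \<open>W\<close> times a cutoff of \<open>u\<close> independently of the cutoff, and Fatou's lemma removes the cutoff.\<close>

lemma dirac_solvable:
  assumes W: "\<And>x. (W has_real_derivative W' x) (at x)" "continuous_on UNIV W'"
    and bd: "\<And>x. \<bar>W' x\<bar> \<le> M + \<epsilon> * (W x)\<^sup>2" and \<epsilon>: "\<epsilon> < 1"
    and lb: "lower_bound m W a c" "c > 0" and f: "square_integrable f"
  obtains u v where "dirac_pair W u v" "AE x in lborel. dirac_expr m W a u v x = f x"
proof -
  obtain z where z: "square_integrable z" and weak: "\<And>u v. dirac_pair (\<lambda>x. - W x) u v \<Longrightarrow>
       (LINT x|lborel. z x \<bullet> dirac_expr m (\<lambda>x. - W x) a u v x) = (LINT x|lborel. f x \<bullet> u x)"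
    using weak_solution_exists[OF lb f] by blast
  have Wc: "continuous_on S W" for S
    using W(1) by (auto intro!: continuous_at_imp_continuous_on dest: DERIV_isCont)
  have Wm: "W \<in> borel_measurable borel" by (rule borel_measurable_continuous_onI[OF Wc])
  define B where "B x s = m *\<^sub>R (sigma3 *v s) + W x *\<^sub>R (\<i> *s s) - a *\<^sub>R s" for x and s :: "complex ^ 2"
  \<comment> \<open>The equation reads \<open>J z' = g\<close>.\<close>
  define g where "g x = f x - B x (z x)" for x
  have lz: "locally_integrable z" and lf: "locally_integrable f"
    using z f by (auto intro: square_integrable_locally_integrable)
  have lBz: "locally_integrable (\<lambda>x. B x (z x))"
  proof -
    have l1: "locally_integrable (\<lambda>x. m *\<^sub>R (sigma3 *v z x) + (- a) *\<^sub>R z x)"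
      by (intro square_integrable_locally_integrable square_integrable_add square_integrable_scaleR square_integrable_sigma z)
    have l2: "locally_integrable (\<lambda>x. W x *\<^sub>R (\<i> *s z x))"
      by (rule locally_integrable_bilinear[OF bounded_bilinear_scaleR Wc])
         (intro square_integrable_locally_integrable square_integrable_cscale z)
    show ?thesis using locally_integrable_add[OF l1 l2] by (simp add: B_def algebra_simps)
  qed
  have lg: "locally_integrable g"
    unfolding g_def[abs_def]
    using locally_integrable_add[OF lf locally_integrable_linear[OF bounded_linear_minus[OF bounded_linear_ident] lBz]] by simp
  have lJz: "locally_integrable (\<lambda>x. J (z x))" by (intro square_integrable_locally_integrable square_integrable_J z)
  have wd: "(LINT x|lborel. deriv \<phi> x *\<^sub>R J (z x)) = - (LINT x|lborel. \<phi> x *\<^sub>R g x)" if \<phi>: "test_function \<phi>" for \<phi>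
  proof -
    obtain R where R: "R > 0" "\<And>x. R \<le> \<bar>x\<bar> \<Longrightarrow> \<phi> x = 0 \<and> deriv \<phi> x = 0"
      using test_functionD(5)[OF \<phi>] by blast
    note t = test_functionD[OF \<phi>]
    have int: "integrable lborel (\<lambda>x. \<phi> x *\<^sub>R w x)" "integrable lborel (\<lambda>x. deriv \<phi> x *\<^sub>R w x)"
      if "locally_integrable w" for w :: "real \<Rightarrow> complex ^ 2"
      using integrable_compact_support(1)[OF t(3) _ that, of R] integrable_compact_support(1)[OF t(2) _ that, of R] R by auto
    have e: "(LINT x|lborel. deriv \<phi> x *\<^sub>R J (z x)) \<bullet> e = (- (LINT x|lborel. \<phi> x *\<^sub>R g x)) \<bullet> e" for e
    proof -
      define u where "u x = \<phi> x *\<^sub>R e" for x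
      define v where "v x = \<phi> x *\<^sub>R 0 + deriv \<phi> x *\<^sub>R e" for x
      have "ac_deriv u v"
        unfolding u_def[abs_def] v_def[abs_def] by (rule ac_deriv_scaleR[OF t(4) ac_deriv_C1]) auto
      moreover have "square_integrable u" "square_integrable v" "square_integrable (\<lambda>x. - W x *\<^sub>R u x)"
        unfolding u_def[abs_def] v_def[abs_def]
        by (rule square_integrable_compact_support[where R = R], intro continuous_intros t(2,3) Wc, simp add: R)+
      ultimately have d: "dirac_pair (\<lambda>x. - W x) u v" by (intro dirac_pairI)
      have pt: "z x \<bullet> dirac_expr m (\<lambda>x. - W x) a u v x = - (deriv \<phi> x *\<^sub>R J (z x)) \<bullet> e + (\<phi> x *\<^sub>R B x (z x)) \<bullet> e" for x
        unfolding dirac_expr_def u_def v_def B_def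
        by (simp add: spinor_simps(1-7) inner_complex_def algebra_simps)
      have "(LINT x|lborel. - (deriv \<phi> x *\<^sub>R J (z x)) \<bullet> e + (\<phi> x *\<^sub>R B x (z x)) \<bullet> e) = (LINT x|lborel. (\<phi> x *\<^sub>R f x) \<bullet> e)"
        using weak[OF d] unfolding pt by (simp add: u_def inner_commute)
      then have "- ((LINT x|lborel. deriv \<phi> x *\<^sub>R J (z x)) \<bullet> e) + (LINT x|lborel. \<phi> x *\<^sub>R B x (z x)) \<bullet> e = (LINT x|lborel. \<phi> x *\<^sub>R f x) \<bullet> e"
        using int(1)[OF lBz] int(1)[OF lf] int(2)[OF lJz] by (simp del: inner_scaleR_left)
      moreover have "(LINT x|lborel. \<phi> x *\<^sub>R g x) = (LINT x|lborel. \<phi> x *\<^sub>R f x) - (LINT x|lborel. \<phi> x *\<^sub>R B x (z x))"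
        unfolding g_def using int(1)[OF lBz] int(1)[OF lf] by (simp add: scaleR_diff_right)
      ultimately show ?thesis by (simp add: inner_diff_left)
    qed
    from e show ?thesis by (rule iffD1[OF vector_eq_rdot, OF allI])
  qed
  obtain U where U: "ac_deriv U g" "AE x in lborel. J (z x) = U x"
    using weak_deriv_imp_ac_deriv[OF lJz lg wd] by blast
  have blJ: "bounded_linear (\<lambda>x. - J x)" by (rule bounded_linear_minus[OF bounded_linear_J])
  define u where "u x = - J (U x)" for x
  define v where "v x = - J (g x)" for x
  have uv: "ac_deriv u v"
    unfolding u_def[abs_def] v_def[abs_def] by (rule ac_deriv_linear[OF blJ U(1)])
  have zu: "AE x in lborel. z x = u x"
    using U(2)
  proof eventually_elim
    case (elim x)
    then show ?case unfolding u_def elim[symmetric] by simp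
  qed
  have um: "u \<in> borel_measurable borel" by (rule borel_measurable_continuous_onI[OF ac_deriv_continuous[OF uv]])
  have us: "square_integrable u" by (rule square_integrable_cong_AE[OF z zu um])
  have sol: "AE x in lborel. dirac_expr m W a u v x = f x"
    using zu by eventually_elim (simp add: dirac_expr_def v_def g_def B_def linear_simps[OF bounded_linear_J] algebra_simps)
  have Bz_sq: "square_integrable (\<lambda>x. k x *\<^sub>R g x)"
    if k: "k \<in> borel_measurable borel" "\<And>x. \<bar>k x\<bar> \<le> 1" and kW: "square_integrable (\<lambda>x. (k x * W x) *\<^sub>R z x)" for k
  proof -
    have eq: "(\<lambda>x. k x *\<^sub>R g x) = (\<lambda>x. k x *\<^sub>R f x - (m *\<^sub>R (sigma3 *v (k x *\<^sub>R z x)) + \<i> *s ((k x * W x) *\<^sub>R z x) - a *\<^sub>R (k x *\<^sub>R z x)))"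
      by (simp add: fun_eq_iff g_def B_def vec_eq_iff forall_2 sigma3_component scaleR_conv_of_real[where 'a = complex] algebra_simps)
    show ?thesis unfolding eq
      by (intro square_integrable_diff square_integrable_add square_integrable_scaleR square_integrable_sigma
          square_integrable_cscale square_integrable_mult(1)[OF f k] square_integrable_mult(1)[OF z k] kW)
  qed
  define cut where "cut n = cutoff 0 (real (Suc n))" for n
  define dcut where "dcut n = cutoff' 0 (real (Suc n))" for n
  have cc: "continuous_on S (cut n)" "continuous_on S (dcut n)" for n S
    by (simp_all add: cut_def dcut_def cutoff_continuous)
  have cm: "cut n \<in> borel_measurable borel" "dcut n \<in> borel_measurable borel" for n
    by (auto intro!: borel_measurable_continuous_onI cc)
  have cb: "\<bar>cut n x\<bar> \<le> 1" "\<bar>dcut n x\<bar> \<le> 4" for n x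
  proof -
    show "\<bar>cut n x\<bar> \<le> 1" using cutoff_bounds(1,2)[of "real (Suc n)" 0 x] by (simp add: cut_def)
    have "4 / real (Suc n) \<le> 4" by (simp add: field_simps)
    then show "\<bar>dcut n x\<bar> \<le> 4" using cutoff_bounds(4)[of "real (Suc n)" 0 x] by (simp add: dcut_def)
  qed
  have kWs: "square_integrable (\<lambda>x. (cut n x * W x) *\<^sub>R w x)" if w: "square_integrable w" for n w
    by (rule square_integrable_mult_compact[OF w, where R = "real (Suc n)" and X = 0])
       (use cutoff_outside(1)[of "real (Suc n)" _ 0] in \<open>auto simp: cut_def intro!: continuous_intros cutoff_continuous Wc\<close>)
  define K where "K = sqrt (((l2 f + 4 * l2 u)\<^sup>2 + \<bar>M\<bar> * (l2 u)\<^sup>2) / (1 - \<epsilon>))"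
  have bound: "l2 (\<lambda>x. (cut n x * W x) *\<^sub>R u x) \<le> K" for n
  proof -
    define un where "un x = cut n x *\<^sub>R u x" for x
    define vn where "vn x = cut n x *\<^sub>R v x + dcut n x *\<^sub>R u x" for x
    have "square_integrable (\<lambda>x. cut n x *\<^sub>R v x)"
      using square_integrable_linear[OF Bz_sq[OF cm(1) cb(1) kWs[OF z]] blJ]
      by (simp add: v_def linear_simps(5)[OF bounded_linear_J])
    then have dn: "dirac_pair W un vn" unfolding un_def[abs_def] vn_def[abs_def]
    proof (intro dirac_pairI)
      show "ac_deriv (\<lambda>x. cut n x *\<^sub>R u x) (\<lambda>x. cut n x *\<^sub>R v x + dcut n x *\<^sub>R u x)"
        unfolding cut_def dcut_def by (rule ac_deriv_scaleR[OF ac_deriv_cutoff uv]) simp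
      show "square_integrable (\<lambda>x. cut n x *\<^sub>R u x)" by (rule square_integrable_mult(1)[OF us cm(1) cb(1)])
      show "square_integrable (\<lambda>x. cut n x *\<^sub>R v x + dcut n x *\<^sub>R u x)"
        by (rule square_integrable_add[OF _ square_integrable_mult(1)[OF us cm(2) cb(2)]]) fact
      show "square_integrable (\<lambda>x. W x *\<^sub>R cut n x *\<^sub>R u x)"
        using kWs[OF us, of n] by (simp add: mult.commute)
    qed
    have sT: "square_integrable (\<lambda>x. cut n x *\<^sub>R f x + dcut n x *\<^sub>R J (u x))"
      by (intro square_integrable_add square_integrable_mult(1)[OF f cm(1) cb(1)] square_integrable_mult(1)[OF square_integrable_J[OF us] cm(2) cb(2)])
    have "AE x in lborel. dirac_expr m W a un vn x = cut n x *\<^sub>R f x + dcut n x *\<^sub>R J (u x)"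
      using sol
    proof eventually_elim
      case (elim x)
      show ?case unfolding un_def[abs_def] vn_def[abs_def] dirac_expr_mult elim ..
    qed
    then have "l2 (dirac_expr m W a un vn) = l2 (\<lambda>x. cut n x *\<^sub>R f x + dcut n x *\<^sub>R J (u x))"
      by (rule l2_cong_AE) (use sT square_integrable_dirac_expr[OF dn] square_integrable_measurable in auto)
    also have "\<dots> \<le> l2 (\<lambda>x. cut n x *\<^sub>R f x) + l2 (\<lambda>x. dcut n x *\<^sub>R J (u x))"
      by (intro l2_triangle square_integrable_mult(1)[OF f cm(1) cb(1)] square_integrable_mult(1)[OF square_integrable_J[OF us] cm(2) cb(2)])
    also have "\<dots> \<le> 1 * l2 f + 4 * l2 (\<lambda>x. J (u x))"
      by (intro add_mono square_integrable_mult(2)[OF f cm(1) cb(1)] square_integrable_mult(2)[OF square_integrable_J[OF us] cm(2) cb(2)])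
    also have "l2 (\<lambda>x. J (u x)) = l2 u" by (rule l2_cong_norm) simp
    finally have T: "l2 (dirac_expr m W a un vn) \<le> l2 f + 4 * l2 u" by simp
    have un: "l2 un \<le> l2 u" unfolding un_def[abs_def] using square_integrable_mult(2)[OF us cm(1) cb(1)] by simp
    have "(1 - \<epsilon>) * (l2 (\<lambda>x. W x *\<^sub>R un x))\<^sup>2 \<le> (l2 (dirac_expr m W a un vn))\<^sup>2 + M * (l2 un)\<^sup>2"
      using graph_estimate[OF dn W bd, of m a] zero_le_power2[of "l2 (\<lambda>x. J (vn x) + m *\<^sub>R (sigma3 *v un x) - a *\<^sub>R un x)"] by linarith
    also have "\<dots> \<le> (l2 f + 4 * l2 u)\<^sup>2 + \<bar>M\<bar> * (l2 u)\<^sup>2"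
      by (intro add_mono mult_mono power_mono T un) auto
    finally have "(l2 (\<lambda>x. W x *\<^sub>R un x))\<^sup>2 \<le> ((l2 f + 4 * l2 u)\<^sup>2 + \<bar>M\<bar> * (l2 u)\<^sup>2) / (1 - \<epsilon>)"
      using \<epsilon> by (simp add: field_simps)
    then have "l2 (\<lambda>x. W x *\<^sub>R un x) \<le> K" unfolding K_def by (rule real_le_rsqrt)
    then show ?thesis by (simp add: un_def mult.commute)
  qed
  have Wu: "square_integrable (\<lambda>x. W x *\<^sub>R u x)"
  proof (rule square_integrable_Fatou(1)[of _ "\<lambda>n x. (cut n x * W x) *\<^sub>R u x" K])
    show "(\<lambda>x. W x *\<^sub>R u x) \<in> borel_measurable borel" using Wm um by measurable
    show "square_integrable (\<lambda>x. (cut n x * W x) *\<^sub>R u x)" for n by (rule kWs[OF us])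
    have "(\<lambda>n. cut n x) \<longlonglongrightarrow> 1" for x
    proof -
      have l: "(\<lambda>n. 1 - 2 * \<bar>x\<bar> * inverse (real (Suc n))) \<longlonglongrightarrow> 1 - 2 * \<bar>x\<bar> * 0"
        by (intro tendsto_intros LIMSEQ_inverse_real_of_nat)
      show ?thesis
      proof (rule tendsto_sandwich[of "\<lambda>n. 1 - 2 * \<bar>x\<bar> * inverse (real (Suc n))" _ _ "\<lambda>n. 1"])
        show "\<forall>\<^sub>F n in sequentially. 1 - 2 * \<bar>x\<bar> * inverse (real (Suc n)) \<le> cut n x"
        proof (rule always_eventually, rule allI)
          fix n
          show "1 - 2 * \<bar>x\<bar> * inverse (real (Suc n)) \<le> cut n x"
            using cutoff_bounds(5)[of "real (Suc n)" 0 x] by (simp add: cut_def divide_inverse)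
        qed
        show "\<forall>\<^sub>F n in sequentially. cut n x \<le> 1" using cb(1)[of _ x] by (auto simp: abs_le_iff intro!: always_eventually)
      qed (use l in auto)
    qed
    then have "(\<lambda>n. (cut n x * W x) *\<^sub>R u x) \<longlonglongrightarrow> (1 * W x) *\<^sub>R u x" for x by (intro tendsto_intros)
    then show "AE x in lborel. (\<lambda>n. (cut n x * W x) *\<^sub>R u x) \<longlonglongrightarrow> W x *\<^sub>R u x" by simp
    show "\<forall>\<^sub>F n in sequentially. l2 (\<lambda>x. (cut n x * W x) *\<^sub>R u x) \<le> K" by (intro always_eventually allI bound)
  qed
  have Wz: "square_integrable (\<lambda>x. (1 * W x) *\<^sub>R z x)"
    by (rule square_integrable_cong_AE[OF Wu]) (use zu Wm square_integrable_measurable[OF z] in \<open>auto elim!: eventually_mono\<close>)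
  have "square_integrable (\<lambda>x. 1 *\<^sub>R g x)" by (rule Bz_sq[of "\<lambda>x. 1"]) (use Wz in auto)
  then have "square_integrable v" using square_integrable_linear[OF _ blJ, of g] by (simp add: v_def[abs_def])
  with uv us Wu have "dirac_pair W u v" by (intro dirac_pairI)
  then show thesis using sol by (rule that)
qed

text \<open>A positive lower bound gives injectivity and the norm bound, \<open>dirac_solvable\<close> surjectivity. The third claim makes \<open>1 /
  norm\<close> the best lower bound.\<close>

lemma resolvent_dirac:
  assumes V: "\<And>x. (V has_real_derivative V' x) (at x)" "continuous_on UNIV V'"
    and bd: "\<And>x. \<bar>V' x\<bar> \<le> M + \<epsilon> * (V x - b)\<^sup>2" and \<epsilon>: "\<epsilon> < 1"
    and lb: "lower_bound m (\<lambda>x. V x - b) a c" "c > 0"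
  shows "Complex a b \<in> resolvent_set (dirac m V)"
    "0 < onorm (resolvent (dirac m V) (Complex a b))"
    "\<And>c'. c' > 0 \<Longrightarrow> lower_bound m (\<lambda>x. V x - b) a c' \<longleftrightarrow> onorm (resolvent (dirac m V) (Complex a b)) \<le> 1 / c'"
proof -
  let ?W = "\<lambda>x. V x - b"
  let ?T = "dirac_expr m ?W a"
  define A where "A z = snd (dirac m V) z - Complex a b *\<^sub>C z" for z
  define D where "D = fst (dirac m V)"
  define R where "R = resolvent (dirac m V) (Complex a b)"
  have R_inv: "R = inv_into D A" by (simp add: R_def resolvent_def D_def A_def[abs_def])
  have Vm: "V \<in> borel_measurable borel"
    using V(1) by (auto intro!: borel_measurable_continuous_onI continuous_at_imp_continuous_on dest: DERIV_isCont)
  have W: "((\<lambda>x. V x - b) has_real_derivative V' x) (at x)" for x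
    using V(1)[of x] by (auto intro!: derivative_eq_intros)
  have AD: "abs_L2C2 u \<in> D" "A (abs_L2C2 u) = abs_L2C2 (?T u v)" if "dirac_pair ?W u v" for u v
    using dirac_on_pair[OF that Vm] by (simp_all add: A_def D_def)
  have DE: "\<exists>u v. dirac_pair ?W u v \<and> z = abs_L2C2 u" if "z \<in> D" for z
    using dirac_dom_pairE[OF that[unfolded D_def] Vm, of b] by metis
  have inj: "inj_on A D"
  proof (rule inj_onI)
    fix z1 z2 assume z: "z1 \<in> D" "z2 \<in> D" "A z1 = A z2"
    obtain u1 v1 where 1: "dirac_pair ?W u1 v1" "z1 = abs_L2C2 u1" using DE[OF z(1)] by auto
    obtain u2 v2 where 2: "dirac_pair ?W u2 v2" "z2 = abs_L2C2 u2" using DE[OF z(2)] by auto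
    have "abs_L2C2 (?T u1 v1) = abs_L2C2 (?T u2 v2)"
      using z(3) unfolding 1(2) 2(2) AD(2)[OF 1(1)] AD(2)[OF 2(1)] .
    from lower_bound_inj[OF lb 1(1) 2(1) this] show "z1 = z2" by (simp add: 1 2)
  qed
  have Rabs: "R (abs_L2C2 (?T u v)) = abs_L2C2 u" if d: "dirac_pair ?W u v" for u v
    unfolding R_inv AD(2)[OF d, symmetric] by (rule inv_into_f_f[OF inj AD(1)[OF d]])
  have sol: "\<exists>u v. dirac_pair ?W u v \<and> y = abs_L2C2 (?T u v)" for y
  proof -
    obtain u v where uv: "dirac_pair ?W u v" "AE x in lborel. ?T u v x = rep_L2C2 y x"
      using dirac_solvable[OF W V(2) bd \<epsilon> lb square_integrable_rep[of y]] by blast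
    then have "abs_L2C2 (?T u v) = abs_L2C2 (rep_L2C2 y)"
      by (subst abs_eq_iff) (auto intro: square_integrable_dirac_expr)
    with uv(1) show ?thesis by (intro exI[of _ u] exI[of _ v]) simp
  qed
  have bij: "bij_betw A D UNIV"
  proof (rule bij_betwI'[of D A UNIV])
    show "(A x = A y) = (x = y)" if "x \<in> D" "y \<in> D" for x y using inj that by (auto dest: inj_onD)
    show "\<exists>x\<in>D. y = A x" for y
    proof -
      obtain u v where "dirac_pair ?W u v" "y = abs_L2C2 (?T u v)" using sol[of y] by auto
      then show ?thesis using AD[of u v] by (intro bexI[of _ "abs_L2C2 u"]) auto
    qed
  qed auto
  have bound: "norm (R y) \<le> norm y * (1 / c')" if lb': "lower_bound m ?W a c'" "c' > 0" for y c'
  proof -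
    obtain u v where uv: "dirac_pair ?W u v" "y = abs_L2C2 (?T u v)" using sol[of y] by auto
    have "c' * l2 u \<le> l2 (?T u v)" using lb'(1) uv(1) by (simp add: lower_bound_def)
    then show ?thesis
      unfolding uv(2) Rabs[OF uv(1)] using lb'(2) dirac_pairD(2)[OF uv(1)] square_integrable_dirac_expr[OF uv(1)]
      by (simp add: norm_abs field_simps)
  qed
  have R_add: "R (x + y) = R x + R y" for x y
  proof -
    obtain u v where 1: "dirac_pair ?W u v" "x = abs_L2C2 (?T u v)" using sol[of x] by auto
    obtain u' v' where 2: "dirac_pair ?W u' v'" "y = abs_L2C2 (?T u' v')" using sol[of y] by auto
    have "x + y = abs_L2C2 (?T (\<lambda>x. u x + u' x) (\<lambda>x. v x + v' x))"
      using 1 2 by (simp add: add_abs square_integrable_dirac_expr dirac_expr_add[abs_def])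
    then have "R (x + y) = abs_L2C2 (\<lambda>x. u x + u' x)" using Rabs[OF dirac_pair_add[OF 1(1) 2(1)]] by simp
    also have "\<dots> = R x + R y"
      unfolding 1(2) 2(2) Rabs[OF 1(1)] Rabs[OF 2(1)] using dirac_pairD(2)[OF 1(1)] dirac_pairD(2)[OF 2(1)] by (simp add: add_abs)
    finally show ?thesis .
  qed
  have R_scale: "R (r *\<^sub>R x) = r *\<^sub>R R x" for r x
  proof -
    obtain u v where 1: "dirac_pair ?W u v" "x = abs_L2C2 (?T u v)" using sol[of x] by auto
    have "r *\<^sub>R x = abs_L2C2 (?T (\<lambda>x. r *\<^sub>R u x) (\<lambda>x. r *\<^sub>R v x))"
      using 1 by (simp add: scaleR_abs square_integrable_dirac_expr dirac_expr_scaleR[abs_def])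
    then have "R (r *\<^sub>R x) = abs_L2C2 (\<lambda>x. r *\<^sub>R u x)" using Rabs[OF dirac_pair_scaleR[OF 1(1)]] by simp
    also have "\<dots> = r *\<^sub>R R x"
      unfolding 1(2) Rabs[OF 1(1)] using dirac_pairD(2)[OF 1(1)] by (simp add: scaleR_abs)
    finally show ?thesis .
  qed
  have blR: "bounded_linear R"
    by (rule bounded_linear_intro[OF R_add R_scale bound[OF lb]])
  show "Complex a b \<in> resolvent_set (dirac m V)"
    using bij blR by (simp add: resolvent_set_def A_def[abs_def] D_def R_def)
  show "0 < onorm (resolvent (dirac m V) (Complex a b))"
  proof -
    \<comment> \<open>Some nonzero vector is needed to see that the resolvent is not 0.\<close>
    define w where "w x = indicat_real {0..1} x *\<^sub>R (axis 1 1 :: complex ^ 2)" for x :: real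
    have nw: "(norm (w x))\<^sup>2 = indicat_real {0..1} x" for x
      by (simp add: w_def indicator_def)
    have ws: "square_integrable w"
      unfolding square_integrable_def nw
      by (auto simp: w_def[abs_def] emeasure_lborel_Icc_eq intro!: integrable_real_indicator borel_measurable_scaleR)
    have "(l2 w)\<^sup>2 = 1" unfolding l2_square nw by simp
    then have y0: "norm (abs_L2C2 w) \<noteq> 0" using ws by (simp add: norm_abs) (metis power_zero_numeral zero_neq_one)
    obtain u v where uv: "dirac_pair ?W u v" "abs_L2C2 w = abs_L2C2 (?T u v)" using sol[of "abs_L2C2 w"] by auto
    have "R (abs_L2C2 w) \<noteq> 0"
    proof
      assume "R (abs_L2C2 w) = 0"
      then have "abs_L2C2 u = abs_L2C2 (\<lambda>x. 0)" using uv Rabs[OF uv(1)] by (simp add: zero_L2C2_def)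
      then have "A (abs_L2C2 u) = abs_L2C2 (?T (\<lambda>x. 0) (\<lambda>x. 0))" using AD(2)[OF dirac_pair_zero] by simp
      also have "?T (\<lambda>x. 0) (\<lambda>x. 0) = (\<lambda>x. 0)"
        by (simp add: fun_eq_iff dirac_expr_def linear_simps[OF bounded_linear_J])
      finally have "abs_L2C2 w = 0" using uv AD(2)[OF uv(1)] by (simp add: zero_L2C2_def)
      then show False using y0 by simp
    qed
    then show ?thesis using onorm_pos_lt[OF blR] by (auto simp: R_def)
  qed
  fix c' :: real assume c': "c' > 0"
  show "lower_bound m ?W a c' \<longleftrightarrow> onorm (resolvent (dirac m V) (Complex a b)) \<le> 1 / c'"
    unfolding R_def[symmetric]
  proof
    assume "lower_bound m ?W a c'"
    then show "onorm R \<le> 1 / c'"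
      using bound[OF _ c'] c' by (intro onorm_bound) (auto simp: mult.commute)
  next
    assume le: "onorm R \<le> 1 / c'"
    show "lower_bound m ?W a c'"
      unfolding lower_bound_def
    proof (intro allI impI)
      fix u v assume d: "dirac_pair ?W u v"
      have "norm (R (abs_L2C2 (?T u v))) \<le> onorm R * norm (abs_L2C2 (?T u v))" by (rule onorm[OF blR])
      also have "\<dots> \<le> 1 / c' * norm (abs_L2C2 (?T u v))" by (rule mult_right_mono[OF le]) simp
      finally show "c' * l2 u \<le> l2 (?T u v)"
        unfolding Rabs[OF d] using c' dirac_pairD(2)[OF d] square_integrable_dirac_expr[OF d]
        by (simp add: norm_abs field_simps)
    qed
  qed
qed

section \<open>The mass as a lower bound, and scaling\<close>

text \<open>Test with \<open>sigma3 u\<close>: in the real part of \<open>\<langle>T u, sigma3 u\<rangle>\<close> the potential drops out, the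
  derivative term is a total derivative, and \<open>m |u|\<^sup>2 - a \<langle>u, sigma3 u\<rangle>\<close> remains.\<close>

lemma lower_bound_mass: "lower_bound m W a (m - \<bar>a\<bar>)"
  unfolding lower_bound_def
proof (intro allI impI)
  fix u v assume dom: "dirac_pair W u v"
  note d = dirac_pairD[OF dom]
  let ?T = "dirac_expr m W a u v"
  have T: "square_integrable ?T" by (rule square_integrable_dirac_expr[OF dom])
  define k where "k x = u x \<bullet> J (sigma3 *v u x)" for x
  define k' where "k' x = u x \<bullet> J (sigma3 *v v x) + v x \<bullet> J (sigma3 *v u x)" for x
  have bl: "bounded_linear (\<lambda>v. J (sigma3 *v v))"
    by (rule bounded_linear_compose[OF bounded_linear_J bounded_linear_matrix])
  have ac: "ac_deriv k k'"
    unfolding k_def[abs_def] k'_def[abs_def] by (rule ac_deriv_inner[OF d(1) ac_deriv_linear[OF bl d(1)]])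
  have sJ: "square_integrable (\<lambda>x. J (sigma3 *v u x))" "square_integrable (\<lambda>x. J (sigma3 *v v x))"
    using d square_integrable_linear[OF _ bl] by auto
  have ik: "integrable lborel k" "integrable lborel k'"
    unfolding k_def[abs_def] k'_def[abs_def] using d sJ by (auto intro!: square_integrable_inner)
  have zero: "(LINT x|lborel. k' x) = 0" by (rule integral_ac_deriv_eq_0[OF ac ik(2,1)])
  have s3: "square_integrable (\<lambda>x. sigma3 *v u x)" by (rule square_integrable_sigma[OF d(2)])
  have pt: "?T x \<bullet> (sigma3 *v u x) = m * (norm (u x))\<^sup>2 - a * (u x \<bullet> (sigma3 *v u x)) - k' x / 2" for x
  proof -
    have "2 * (?T x \<bullet> (sigma3 *v u x)) = 2 * (m * (u x \<bullet> u x)) - 2 * (a * (u x \<bullet> (sigma3 *v u x))) - k' x"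
      unfolding dirac_expr_def k'_def by (simp add: spinor_simps(1-7) inner_complex_def algebra_simps)
    then show ?thesis unfolding power2_norm_eq_inner by linarith
  qed
  have "(LINT x|lborel. ?T x \<bullet> (sigma3 *v u x)) = m * (l2 u)\<^sup>2 - a * (LINT x|lborel. u x \<bullet> (sigma3 *v u x))"
    unfolding pt l2_square using square_integrable_norm[OF d(2)] square_integrable_inner[OF d(2) s3] ik(2) zero by simp
  moreover have "a * (LINT x|lborel. u x \<bullet> (sigma3 *v u x)) \<le> \<bar>a\<bar> * (l2 u * l2 u)"
  proof -
    have "\<bar>LINT x|lborel. u x \<bullet> (sigma3 *v u x)\<bar> \<le> l2 u * l2 u"
      using Cauchy_Schwarz_l2[OF d(2) s3] l2_cong_norm[of "\<lambda>x. sigma3 *v u x" u] by simp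
    then have "\<bar>a * (LINT x|lborel. u x \<bullet> (sigma3 *v u x))\<bar> \<le> \<bar>a\<bar> * (l2 u * l2 u)"
      unfolding abs_mult by (rule mult_left_mono) simp
    then show ?thesis by linarith
  qed
  moreover have "(LINT x|lborel. ?T x \<bullet> (sigma3 *v u x)) \<le> l2 ?T * l2 u"
    using Cauchy_Schwarz_l2[OF T s3] l2_cong_norm[of "\<lambda>x. sigma3 *v u x" u] by simp
  ultimately have le: "(m - \<bar>a\<bar>) * l2 u * l2 u \<le> l2 ?T * l2 u"
    by (simp add: power2_eq_square algebra_simps)
  show "(m - \<bar>a\<bar>) * l2 u \<le> l2 ?T"
  proof (cases "l2 u = 0")
    case False
    then have "l2 u > 0" using l2_nonneg[of u] by linarith
    with le show ?thesis by (rule mult_right_le_imp_le)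
  qed simp
qed

lemma ac_deriv_affine:
  assumes ac: "ac_deriv u v" and k: "k > 0"
  shows "ac_deriv (\<lambda>y. u (d + k * y)) (\<lambda>y. k *\<^sub>R v (d + k * y))"
proof -
  have l: "locally_integrable v" by (rule ac_deriv_locally_integrable[OF ac])
  then have vm: "v \<in> borel_measurable borel" by (simp add: locally_integrable_def)
  have ind: "indicator {d + k * a..d + k * b} (d + k * x) = (indicator {a..b} x :: real)" for a b x
    using k by (auto simp: indicator_def)
  have int: "integrable lborel (\<lambda>x. indicator {d + k * a..d + k * b} x *\<^sub>R v x)" for a b
    using l by (simp add: locally_integrable_def set_integrable_def)
  have s: "set_integrable lborel {a..b} (\<lambda>y. k *\<^sub>R v (d + k * y))" for a b
  proof -
    have "integrable lborel (\<lambda>x. indicator {d + k * a..d + k * b} (d + k * x) *\<^sub>R v (d + k * x))"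
      using lborel_integrable_real_affine[OF int, where c = k and t = d] k by simp
    then have "integrable lborel (\<lambda>x. k *\<^sub>R (indicator {a..b} x *\<^sub>R v (d + k * x)))"
      unfolding ind by (rule integrable_scaleR_right)
    then show ?thesis by (simp add: set_integrable_def mult.commute)
  qed
  have "(LINT y:{a..b}|lborel. k *\<^sub>R v (d + k * y)) = u (d + k * b) - u (d + k * a)" if "a \<le> b" for a b
  proof -
    have "u (d + k * b) - u (d + k * a) = (LINT x:{d + k * a..d + k * b}|lborel. v x)"
      using ac that k by (simp add: ac_deriv_def)
    also have "\<dots> = k *\<^sub>R (LINT x|lborel. indicator {a..b} x *\<^sub>R v (d + k * x))"
      unfolding set_lebesgue_integral_def using k
      by (subst lborel_integral_real_affine[of k _ d]) (simp_all add: ind)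
    also have "\<dots> = (LINT y:{a..b}|lborel. k *\<^sub>R v (d + k * y))"
      unfolding set_lebesgue_integral_def by (subst integral_scaleR_right[symmetric]) (simp add: mult.commute)
    finally show ?thesis by simp
  qed
  moreover have "(\<lambda>y. k *\<^sub>R v (d + k * y)) \<in> borel_measurable borel"
    using vm by measurable
  ultimately show ?thesis using s by (simp add: ac_deriv_def locally_integrable_def)
qed

lemma square_integrable_affine:
  assumes u: "square_integrable u" and k: "k > 0"
  shows "square_integrable (\<lambda>y. u (d + k * y))" "l2 (\<lambda>y. u (d + k * y)) = l2 u / sqrt k"
proof -
  have um: "u \<in> borel_measurable borel" by (rule square_integrable_measurable[OF u])
  have i: "integrable lborel (\<lambda>x. (norm (u x))\<^sup>2)" by (rule square_integrable_norm[OF u])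
  have "integrable lborel (\<lambda>y. (norm (u (d + k * y)))\<^sup>2)"
    using lborel_integrable_real_affine[OF i, of k d] k by simp
  moreover have "(\<lambda>y. u (d + k * y)) \<in> borel_measurable lborel" using um by measurable
  ultimately show "square_integrable (\<lambda>y. u (d + k * y))" by (simp add: square_integrable_def)
  have "(LINT x|lborel. (norm (u x))\<^sup>2) = k * (LINT y|lborel. (norm (u (d + k * y)))\<^sup>2)"
    using k by (subst lborel_integral_real_affine[of k _ d]) simp_all
  then show "l2 (\<lambda>y. u (d + k * y)) = l2 u / sqrt k"
    using k by (simp add: l2_def real_sqrt_mult)
qed

lemma lower_bound_scale:
  assumes lb: "lower_bound (k * m) (\<lambda>y. k * W (d + k * y)) (k * a) (k * c)" and k: "k > 0"
  shows "lower_bound m W a c"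
  unfolding lower_bound_def
proof (intro allI impI)
  fix u v assume dom: "dirac_pair W u v"
  note f = dirac_pairD[OF dom]
  let ?u = "\<lambda>y. u (d + k * y)" and ?v = "\<lambda>y. k *\<^sub>R v (d + k * y)" and ?W = "\<lambda>y. k * W (d + k * y)"
  have "square_integrable (\<lambda>y. k *\<^sub>R (W (d + k * y) *\<^sub>R u (d + k * y)))"
    by (rule square_integrable_scaleR[OF square_integrable_affine(1)[OF f(4) k]])
  then have "dirac_pair ?W ?u ?v"
    by (intro dirac_pairI ac_deriv_affine[OF f(1) k] square_integrable_affine(1)[OF f(2) k]
        square_integrable_scaleR[OF square_integrable_affine(1)[OF f(3) k]]) simp
  then have "k * c * l2 ?u \<le> l2 (dirac_expr (k * m) ?W (k * a) ?u ?v)"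
    using lb by (simp add: lower_bound_def)
  also have "dirac_expr (k * m) ?W (k * a) ?u ?v = (\<lambda>y. k *\<^sub>R dirac_expr m W a u v (d + k * y))"
    by (simp add: fun_eq_iff dirac_expr_def linear_simps[OF bounded_linear_J] algebra_simps)
  also have "l2 \<dots> = k * (l2 (dirac_expr m W a u v) / sqrt k)"
    using k square_integrable_affine(2)[OF square_integrable_dirac_expr[OF dom] k] by (simp add: l2_scaleR)
  finally show "c * l2 u \<le> l2 (dirac_expr m W a u v)"
    using k square_integrable_affine(2)[OF f(2) k, of d] by (simp add: field_simps)
qed

text \<open>The dilation that relates the tangent line of slope \<open>s\<^sup>2\<close> to the Airy-Dirac operator of mass \<open>m /
  s\<close>.\<close>

lemma lower_bound_linear_iff:
  assumes "s > 0"
  shows "lower_bound m (\<lambda>x. s\<^sup>2 * (x - X)) a c \<longleftrightarrow> lower_bound (m / s) (\<lambda>x. x) (a / s) (c / s)"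
proof
  assume "lower_bound m (\<lambda>x. s\<^sup>2 * (x - X)) a c"
  moreover have "(\<lambda>y. s * (- (s * X) + s * y)) = (\<lambda>x. s\<^sup>2 * (x - X))"
    by (simp add: fun_eq_iff power2_eq_square algebra_simps)
  ultimately show "lower_bound (m / s) (\<lambda>x. x) (a / s) (c / s)"
    using assms by - (rule lower_bound_scale[where k = s and d = "- (s * X)"], simp_all)
next
  assume "lower_bound (m / s) (\<lambda>x. x) (a / s) (c / s)"
  moreover have "(\<lambda>y. 1 / s * (s\<^sup>2 * (X + 1 / s * y - X))) = (\<lambda>x. x)"
    using assms by (simp add: fun_eq_iff power2_eq_square)
  ultimately show "lower_bound m (\<lambda>x. s\<^sup>2 * (x - X)) a c"
    using assms by - (rule lower_bound_scale[where k = "1 / s" and d = X], simp_all)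
qed

section \<open>Comparison of two potentials\<close>

text \<open>The form of the graph estimate used for the comparison: \<open>s\<^sup>2\<close> is the size of \<open>W'\<close> near the zero of
  \<open>W\<close>.\<close>

lemma graph_estimate_sqrt:
  assumes dom: "dirac_pair W u v" and W: "\<And>x. (W has_real_derivative W' x) (at x)" "continuous_on UNIV W'"
    and bd: "\<And>x. \<bar>W' x\<bar> \<le> K * s\<^sup>2 + \<epsilon> * (W x)\<^sup>2" and c: "\<epsilon> < 1" "0 \<le> K" "0 < s"
  shows "l2 (\<lambda>x. W x *\<^sub>R u x) \<le> sqrt ((1 + K) / (1 - \<epsilon>)) * (l2 (dirac_expr m W a u v) + s * l2 u)"
proof -
  let ?f = "l2 (dirac_expr m W a u v)"
  have "(1 - \<epsilon>) * (l2 (\<lambda>x. W x *\<^sub>R u x))\<^sup>2 \<le> ?f\<^sup>2 + K * s\<^sup>2 * (l2 u)\<^sup>2"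
    using graph_estimate[OF dom W bd, of m a] zero_le_power2[of "l2 (\<lambda>x. J (v x) + m *\<^sub>R (sigma3 *v u x) - a *\<^sub>R u x)"] by linarith
  also have "\<dots> \<le> (1 + K) * (?f + s * l2 u)\<^sup>2"
  proof -
    have "0 \<le> (1 + K) * (2 * ?f * (s * l2 u)) + (s * l2 u)\<^sup>2 + K * ?f\<^sup>2" using c by simp
    then show ?thesis by (simp add: power2_sum power_mult_distrib algebra_simps)
  qed
  finally have "(l2 (\<lambda>x. W x *\<^sub>R u x))\<^sup>2 \<le> (1 + K) / (1 - \<epsilon>) * (?f + s * l2 u)\<^sup>2"
    using c by (simp add: field_simps)
  then have "l2 (\<lambda>x. W x *\<^sub>R u x) \<le> sqrt ((1 + K) / (1 - \<epsilon>) * (?f + s * l2 u)\<^sup>2)" by (rule real_le_rsqrt)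
  also have "\<dots> = sqrt ((1 + K) / (1 - \<epsilon>)) * (?f + s * l2 u)"
    using c by (subst real_sqrt_mult) (simp add: abs_of_nonneg)
  finally show ?thesis .
qed

lemma l2_mult_le:
  assumes w: "square_integrable (\<lambda>x. W x *\<^sub>R u x)" and m: "(\<lambda>x. g x *\<^sub>R y x) \<in> borel_measurable borel"
    and le: "\<And>x. \<bar>g x\<bar> \<le> B * \<bar>W x\<bar>" and n: "\<And>x. norm (y x) = norm (u x)" and B: "0 \<le> B"
  shows "l2 (\<lambda>x. g x *\<^sub>R y x) \<le> B * l2 (\<lambda>x. W x *\<^sub>R u x)"
proof -
  have "norm (g x *\<^sub>R y x) \<le> B * norm (W x *\<^sub>R u x)" for x
    using mult_right_mono[OF le[of x] norm_ge_zero[of "u x"]] by (simp add: n)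
  from square_integrable_bound(2)[OF w m this] B show ?thesis by simp
qed

text \<open>The lower bound for \<open>W2\<close> is applied to the cutoff \<open>p\<close> of \<open>u\<close> at radius \<open>r\<close>. Three
  errors occur: \<open>u - p\<close>, the commutator of the cutoff, and \<open>(W2 - W) p\<close>. The first two are controlled by \<open>|Wu| \<le>
  N\<close>, since \<open>1 - cutoff\<close> and the derivative of the cutoff are dominated by multiples of \<open>|W|\<close>. In the third, one
  factor \<open>x - X\<close> of the quadratic bound on \<open>W2 - W\<close> is dominated by \<open>|W|\<close>, and \<open>W (x - X) cutoff
  u\<close> is controlled by the graph estimate for \<open>(x - X) cutoff u\<close>.\<close>

lemma lower_bound_comparison:
  fixes W W2 :: "real \<Rightarrow> real"
  assumes dom: "dirac_pair W u v" and W: "\<And>x. (W has_real_derivative W' x) (at x)" "continuous_on UNIV W'"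
    and bd: "\<And>x. \<bar>W' x\<bar> \<le> K * s\<^sup>2 + \<epsilon> * (W x)\<^sup>2"
    and const: "\<epsilon> < 1" "0 \<le> K" "0 < s" "0 < r" "0 < Y" "0 \<le> c"
    and near: "\<And>x. \<bar>x - X\<bar> \<le> r \<Longrightarrow> s\<^sup>2 * \<bar>x - X\<bar> / 2 \<le> \<bar>W x\<bar>"
    and far: "\<And>x. r \<le> \<bar>x - X\<bar> \<Longrightarrow> s\<^sup>2 * r / 2 \<le> \<bar>W x\<bar>"
    and diff: "\<And>x. \<bar>x - X\<bar> \<le> r \<Longrightarrow> \<bar>W2 x - W x\<bar> \<le> K * s\<^sup>2 * (x - X)\<^sup>2 / Y"
    and W2: "continuous_on UNIV W2" and lb: "lower_bound m W2 a c"
    and C: "C = sqrt ((1 + K) / (1 - \<epsilon>))" and N: "N = C * (l2 (dirac_expr m W a u v) + s * l2 u)"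
  shows "c * l2 u \<le> l2 (dirac_expr m W a u v) + (4 * c / (s\<^sup>2 * r) + 8 / (s\<^sup>2 * r\<^sup>2)) * N
     + (2 * K / Y) * C * (r * l2 (dirac_expr m W a u v) + 5 * l2 u + (2 / s) * N)"
proof -
  note d = dirac_pairD[OF dom]
  let ?f = "dirac_expr m W a u v"
  let ?\<eta> = "cutoff X r" and ?\<eta>' = "cutoff' X r"
  note cb = cutoff_bounds[OF const(4), of X]
  have f: "square_integrable ?f" by (rule square_integrable_dirac_expr[OF dom])
  have Wc: "continuous_on S W" for S
    using W(1) by (auto intro!: continuous_at_imp_continuous_on dest: DERIV_isCont)
  have meas: "W \<in> borel_measurable borel" "W2 \<in> borel_measurable borel" "u \<in> borel_measurable borel"
    "?\<eta> \<in> borel_measurable borel" "?\<eta>' \<in> borel_measurable borel"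
    using Wc W2 cutoff_continuous square_integrable_measurable[OF d(2)] by (auto intro!: borel_measurable_continuous_onI)
  have Jm: "(\<lambda>x. J (u x)) \<in> borel_measurable borel" "(\<lambda>x. \<i> *s u x) \<in> borel_measurable borel"
    by (auto intro!: square_integrable_measurable square_integrable_J square_integrable_cscale d)
  have C0: "0 \<le> C" unfolding C using const by simp
  have WN: "l2 (\<lambda>x. W x *\<^sub>R u x) \<le> N"
    unfolding N C by (rule graph_estimate_sqrt[OF dom W bd const(1-3)])
  have s2: "s\<^sup>2 > 0" using const by simp
  have near': "\<bar>x - X\<bar> \<le> 2 / s\<^sup>2 * \<bar>W x\<bar>" if "\<bar>x - X\<bar> \<le> r" for x
    using near[OF that] s2 by (simp add: field_simps)
  have b1: "\<bar>1 - ?\<eta> x\<bar> \<le> 4 / (s\<^sup>2 * r) * \<bar>W x\<bar>" for x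
  proof (cases "\<bar>x - X\<bar> \<le> r")
    case True
    have "\<bar>1 - ?\<eta> x\<bar> \<le> 2 * \<bar>x - X\<bar> / r" using cb(2,5)[of x] by simp
    also have "\<dots> \<le> 2 * (2 / s\<^sup>2 * \<bar>W x\<bar>) / r" using near'[OF True] const by (intro divide_right_mono) auto
    finally show ?thesis by simp
  next
    case False
    have "\<bar>1 - ?\<eta> x\<bar> \<le> 1" using cb(1,2)[of x] by simp
    also have "1 \<le> 2 / (s\<^sup>2 * r) * \<bar>W x\<bar>" using far[of x] False s2 const by (simp add: field_simps)
    also have "\<dots> \<le> 4 / (s\<^sup>2 * r) * \<bar>W x\<bar>" using s2 const by (intro mult_right_mono divide_right_mono) auto
    finally show ?thesis .
  qed
  have b2: "\<bar>?\<eta>' x\<bar> \<le> 8 / (s\<^sup>2 * r\<^sup>2) * \<bar>W x\<bar>" for x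
  proof (cases "\<bar>x - X\<bar> \<le> r")
    case True
    have "\<bar>?\<eta>' x\<bar> \<le> 4 * \<bar>x - X\<bar> / r\<^sup>2" by (rule cb(3))
    also have "\<dots> \<le> 4 * (2 / s\<^sup>2 * \<bar>W x\<bar>) / r\<^sup>2" using near'[OF True] by (intro divide_right_mono) auto
    finally show ?thesis by simp
  next
    case False
    then have "?\<eta>' x = 0" by (intro cutoff_outside const) auto
    then show ?thesis using s2 by simp
  qed
  define g where "g x = (x - X) * ?\<eta> x" for x
  define g' where "g' x = (x - X) * ?\<eta>' x + 1 * ?\<eta> x" for x
  have ac_g: "ac_deriv g g'"
  proof -
    have "ac_deriv (\<lambda>x. x - X) (\<lambda>x. 1)" by (rule ac_deriv_C1) (auto intro!: derivative_eq_intros)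
    from ac_deriv_scaleR[OF this ac_deriv_cutoff[OF const(4), of X]]
    show ?thesis by (simp add: g_def[abs_def] g'_def[abs_def])
  qed
  have cg': "continuous_on UNIV g'" unfolding g'_def[abs_def] by (intro continuous_intros cutoff_continuous)
  have gb: "\<bar>g x\<bar> \<le> r" "\<bar>g x\<bar> \<le> 2 / s\<^sup>2 * \<bar>W x\<bar>" "\<bar>g' x\<bar> \<le> 5" for x
  proof -
    have small: "\<bar>g x\<bar> \<le> \<bar>x - X\<bar>" unfolding g_def abs_mult using cb(1,2)[of x] by (intro mult_left_le) auto
    have "\<bar>g x\<bar> \<le> r \<and> \<bar>g x\<bar> \<le> 2 / s\<^sup>2 * \<bar>W x\<bar> \<and> \<bar>g' x\<bar> \<le> 5"
    proof (cases "\<bar>x - X\<bar> \<le> r")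
      case True
      have 1: "\<bar>g x\<bar> \<le> r" using small True by simp
      have 2: "\<bar>g x\<bar> \<le> 2 / s\<^sup>2 * \<bar>W x\<bar>" using small near'[OF True] by simp
      have "\<bar>(x - X) * ?\<eta>' x\<bar> \<le> r * (4 / r)"
        unfolding abs_mult using True cb(4)[of x] const by (intro mult_mono) auto
      then have "\<bar>g' x\<bar> \<le> 5" unfolding g'_def using const cb(1,2)[of x] by simp
      with 1 2 show ?thesis by blast
    next
      case False
      then have z: "?\<eta> x = 0" "?\<eta>' x = 0" using cutoff_outside[OF const(4), of x X] by auto
      show ?thesis using z const by (simp add: g_def g'_def)
    qed
    then show "\<bar>g x\<bar> \<le> r" "\<bar>g x\<bar> \<le> 2 / s\<^sup>2 * \<bar>W x\<bar>" "\<bar>g' x\<bar> \<le> 5" by blast+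
  qed
  have gm: "g \<in> borel_measurable borel" "g' \<in> borel_measurable borel"
    using ac_deriv_continuous[OF ac_g] cg' by (auto intro: borel_measurable_continuous_onI)
  \<comment> \<open>The graph estimate for the weighted function \<open>g u\<close>, with \<open>|g| \<le> r\<close>, \<open>|g'| \<le> 5\<close>.\<close>
  define w where "w x = g x *\<^sub>R u x" for x
  define w' where "w' x = g x *\<^sub>R v x + g' x *\<^sub>R u x" for x
  have dw: "dirac_pair W w w'"
    unfolding w_def[abs_def] w'_def[abs_def] by (rule dirac_pair_mult[OF dom ac_g cg' gb(1,3)])
  have Tw: "l2 (dirac_expr m W a w w') \<le> r * l2 ?f + 5 * l2 u"
  proof -
    have "dirac_expr m W a w w' = (\<lambda>x. g x *\<^sub>R ?f x + g' x *\<^sub>R J (u x))"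
      unfolding w_def[abs_def] w'_def[abs_def] by (simp add: fun_eq_iff dirac_expr_mult)
    then have "l2 (dirac_expr m W a w w') \<le> l2 (\<lambda>x. g x *\<^sub>R ?f x) + l2 (\<lambda>x. g' x *\<^sub>R J (u x))"
      by (simp add: l2_triangle square_integrable_mult(1)[OF f gm(1) gb(1)] square_integrable_mult(1)[OF square_integrable_J[OF d(2)] gm(2) gb(3)])
    also have "\<dots> \<le> r * l2 ?f + 5 * l2 (\<lambda>x. J (u x))"
      by (intro add_mono square_integrable_mult(2)[OF f gm(1) gb(1)] square_integrable_mult(2)[OF square_integrable_J[OF d(2)] gm(2) gb(3)])
    also have "l2 (\<lambda>x. J (u x)) = l2 u" by (rule l2_cong_norm) simp
    finally show ?thesis .
  qed
  have lw: "s * l2 w \<le> 2 / s * N"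
  proof -
    have "l2 w \<le> 2 / s\<^sup>2 * l2 (\<lambda>x. W x *\<^sub>R u x)"
      unfolding w_def[abs_def] by (rule l2_mult_le[OF d(4) _ gb(2)]) (use gm meas in auto)
    also have "\<dots> \<le> 2 / s\<^sup>2 * N" using WN by (intro mult_left_mono) auto
    finally have "s * l2 w \<le> s * (2 / s\<^sup>2 * N)" using const by (intro mult_left_mono) auto
    also have "\<dots> = 2 / s * N" using const by (simp add: power2_eq_square)
    finally show ?thesis .
  qed
  have Ww: "l2 (\<lambda>x. W x *\<^sub>R w x) \<le> C * (r * l2 ?f + 5 * l2 u + 2 / s * N)"
  proof -
    have "l2 (\<lambda>x. W x *\<^sub>R w x) \<le> C * (l2 (dirac_expr m W a w w') + s * l2 w)"
      unfolding C by (rule graph_estimate_sqrt[OF dw W bd const(1-3)])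
    also have "\<dots> \<le> C * ((r * l2 ?f + 5 * l2 u) + 2 / s * N)" by (intro mult_left_mono add_mono Tw lw C0)
    finally show ?thesis .
  qed
  \<comment> \<open>The cutoff \<open>p\<close> lies in both domains, because \<open>W2\<close> is bounded on its support.\<close>
  define p where "p x = ?\<eta> x *\<^sub>R u x" for x
  define p' where "p' x = ?\<eta> x *\<^sub>R v x + ?\<eta>' x *\<^sub>R u x" for x
  have \<eta>b: "\<bar>?\<eta> x\<bar> \<le> 1" for x using cb(1,2)[of x] by simp
  have dp: "dirac_pair W p p'"
    unfolding p_def[abs_def] p'_def[abs_def]
    by (rule dirac_pair_mult[OF dom ac_deriv_cutoff[OF const(4)] cutoff_continuous(2) \<eta>b cb(4)])
  have W2p: "square_integrable (\<lambda>x. (?\<eta> x * W2 x) *\<^sub>R u x)"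
    by (rule square_integrable_mult_compact[OF d(2), of _ r X])
       (use cutoff_outside[OF const(4)] in \<open>auto intro!: continuous_intros cutoff_continuous W2\<close>)
  have dp2: "dirac_pair W2 p p'"
    using dirac_pairD(1-3)[OF dp] W2p by (intro dirac_pairI) (simp_all add: p_def mult.commute)
  define q where "q x = (?\<eta> x * (W2 x - W x)) *\<^sub>R (\<i> *s u x)" for x
  have T2: "dirac_expr m W2 a p p' x = (?\<eta> x *\<^sub>R ?f x + ?\<eta>' x *\<^sub>R J (u x)) + q x" for x
  proof -
    have "dirac_expr m W2 a p p' x = dirac_expr m W a p p' x + (W2 x - W x) *\<^sub>R (\<i> *s p x)"
      by (simp add: dirac_expr_def algebra_simps)
    also have "dirac_expr m W a p p' x = ?\<eta> x *\<^sub>R ?f x + ?\<eta>' x *\<^sub>R J (u x)"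
      unfolding p_def[abs_def] p'_def[abs_def] by (rule dirac_expr_mult)
    also have "(W2 x - W x) *\<^sub>R (\<i> *s p x) = q x"
      by (simp add: p_def q_def vec_eq_iff scaleR_conv_of_real[where 'a = complex])
    finally show ?thesis .
  qed
  have s1: "square_integrable (\<lambda>x. ?\<eta> x *\<^sub>R ?f x)" by (rule square_integrable_mult(1)[OF f meas(4) \<eta>b])
  have s2': "square_integrable (\<lambda>x. ?\<eta>' x *\<^sub>R J (u x))"
    by (rule square_integrable_mult(1)[OF square_integrable_J[OF d(2)] meas(5) cb(4)])
  have sq: "square_integrable q"
    unfolding q_def[abs_def]
    by (rule square_integrable_mult_compact[OF square_integrable_cscale[OF d(2)], of _ r X])
       (use cutoff_outside[OF const(4)] in \<open>auto intro!: continuous_intros cutoff_continuous W2 Wc\<close>)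
  have q_le: "l2 q \<le> 2 * K / Y * l2 (\<lambda>x. W x *\<^sub>R w x)"
  proof -
    have "\<bar>?\<eta> x * (W2 x - W x)\<bar> \<le> 2 * K / Y * \<bar>W x * g x\<bar>" for x
    proof (cases "\<bar>x - X\<bar> \<le> r")
      case True
      have "\<bar>W2 x - W x\<bar> \<le> K * s\<^sup>2 * (x - X)\<^sup>2 / Y" by (rule diff[OF True])
      also have "\<dots> = K / Y * \<bar>x - X\<bar> * (s\<^sup>2 * \<bar>x - X\<bar>)" by (simp add: power2_eq_square)
      also have "\<dots> \<le> K / Y * \<bar>x - X\<bar> * (2 * \<bar>W x\<bar>)"
        using near[OF True] const by (intro mult_left_mono) auto
      finally have "?\<eta> x * \<bar>W2 x - W x\<bar> \<le> ?\<eta> x * (K / Y * \<bar>x - X\<bar> * (2 * \<bar>W x\<bar>))"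
        using cb(1)[of x] by (intro mult_left_mono) auto
      also have "\<dots> = 2 * K / Y * \<bar>W x * g x\<bar>" using cb(1)[of x] by (simp add: g_def abs_mult)
      finally show ?thesis using cb(1)[of x] by (simp add: abs_mult)
    next
      case False
      then have "?\<eta> x = 0" by (intro cutoff_outside const) auto
      then show ?thesis by (simp add: g_def)
    qed
    note le = this
    have wW: "square_integrable (\<lambda>x. (W x * g x) *\<^sub>R u x)" using dirac_pairD(4)[OF dw] by (simp add: w_def)
    have "l2 q \<le> 2 * K / Y * l2 (\<lambda>x. (W x * g x) *\<^sub>R u x)"
      unfolding q_def[abs_def] by (rule l2_mult_le[OF wW _ le])
        (use square_integrable_measurable[OF sq, unfolded q_def[abs_def]] const in auto)
    then show ?thesis by (simp add: w_def)
  qed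
  have "c * l2 p \<le> l2 (dirac_expr m W2 a p p')" using lb dp2 by (simp add: lower_bound_def)
  also have "\<dots> \<le> (l2 (\<lambda>x. ?\<eta> x *\<^sub>R ?f x) + l2 (\<lambda>x. ?\<eta>' x *\<^sub>R J (u x))) + l2 q"
    unfolding T2[abs_def]
    by (rule order_trans[OF l2_triangle[OF square_integrable_add[OF s1 s2'] sq] add_right_mono[OF l2_triangle[OF s1 s2']]])
  also have "\<dots> \<le> (1 * l2 ?f + 8 / (s\<^sup>2 * r\<^sup>2) * N) + 2 * K / Y * (C * (r * l2 ?f + 5 * l2 u + 2 / s * N))"
  proof (intro add_mono)
    show "l2 (\<lambda>x. ?\<eta> x *\<^sub>R ?f x) \<le> 1 * l2 ?f" by (rule square_integrable_mult(2)[OF f meas(4) \<eta>b])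
    have "l2 (\<lambda>x. ?\<eta>' x *\<^sub>R J (u x)) \<le> 8 / (s\<^sup>2 * r\<^sup>2) * l2 (\<lambda>x. W x *\<^sub>R u x)"
      by (rule l2_mult_le[OF d(4) _ b2]) (use meas Jm in auto)
    also have "\<dots> \<le> 8 / (s\<^sup>2 * r\<^sup>2) * N" using WN by (intro mult_left_mono) auto
    finally show "l2 (\<lambda>x. ?\<eta>' x *\<^sub>R J (u x)) \<le> 8 / (s\<^sup>2 * r\<^sup>2) * N" .
    have "2 * K / Y * l2 (\<lambda>x. W x *\<^sub>R w x) \<le> 2 * K / Y * (C * (r * l2 ?f + 5 * l2 u + 2 / s * N))"
      using Ww const by (intro mult_left_mono) auto
    with q_le show "l2 q \<le> 2 * K / Y * (C * (r * l2 ?f + 5 * l2 u + 2 / s * N))" by linarith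
  qed
  finally have main: "c * l2 p \<le> l2 ?f + 8 / (s\<^sup>2 * r\<^sup>2) * N + 2 * K / Y * (C * (r * l2 ?f + 5 * l2 u + 2 / s * N))" by simp
  have "l2 u \<le> l2 p + l2 (\<lambda>x. (1 - ?\<eta> x) *\<^sub>R u x)"
  proof -
    have b: "\<bar>1 - ?\<eta> x\<bar> \<le> 1" for x using cb(1,2)[of x] by simp
    have "u = (\<lambda>x. p x + (1 - ?\<eta> x) *\<^sub>R u x)" by (simp add: fun_eq_iff p_def algebra_simps)
    moreover have "l2 (\<lambda>x. p x + (1 - ?\<eta> x) *\<^sub>R u x) \<le> l2 p + l2 (\<lambda>x. (1 - ?\<eta> x) *\<^sub>R u x)"
      by (rule l2_triangle[OF dirac_pairD(2)[OF dp] square_integrable_mult(1)[OF d(2) _ b]]) (use meas in measurable)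
    ultimately show ?thesis by simp
  qed
  also have "l2 (\<lambda>x. (1 - ?\<eta> x) *\<^sub>R u x) \<le> 4 / (s\<^sup>2 * r) * N"
  proof -
    have "l2 (\<lambda>x. (1 - ?\<eta> x) *\<^sub>R u x) \<le> 4 / (s\<^sup>2 * r) * l2 (\<lambda>x. W x *\<^sub>R u x)"
      by (rule l2_mult_le[OF d(4) _ b1]) (use meas const in auto)
    also have "\<dots> \<le> 4 / (s\<^sup>2 * r) * N" using WN const by (intro mult_left_mono) auto
    finally show ?thesis .
  qed
  finally have "c * l2 u \<le> c * (l2 p + 4 / (s\<^sup>2 * r) * N)" using const by (intro mult_left_mono) auto
  then have "c * l2 u \<le> c * l2 p + 4 * c / (s\<^sup>2 * r) * N" by (simp add: distrib_left mult_ac)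
  with main show ?thesis by (simp add: distrib_right mult.assoc)
qed

section \<open>Gaussian spinors\<close>

lemma integrable_gaussian_moment:
  "integrable lborel (\<lambda>x::real. x ^ (2 * k) * exp (- (x\<^sup>2)))"
proof -
  have "integrable lborel (\<lambda>x. sqrt (2 * pi) * (std_normal_density x * x ^ (2 * k)))"
    by (intro integrable_mult_right integrable_std_normal_moment)
  then show ?thesis
  proof (rule Bochner_Integration.integrable_bound)
    show "(\<lambda>x::real. x ^ (2 * k) * exp (- (x\<^sup>2))) \<in> borel_measurable lborel" by measurable
    have "x ^ (2 * k) * exp (- (x\<^sup>2)) \<le> sqrt (2 * pi) * (std_normal_density x * x ^ (2 * k))" for x :: real
    proof -
      have "exp (- (x\<^sup>2)) \<le> exp (- x\<^sup>2 / 2)" by simp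
      moreover have "0 \<le> x ^ (2 * k)" by (simp add: power_mult)
      ultimately have "x ^ (2 * k) * exp (- (x\<^sup>2)) \<le> x ^ (2 * k) * exp (- x\<^sup>2 / 2)" by (rule mult_left_mono)
      then show ?thesis by (simp add: std_normal_density_def mult_ac)
    qed
    moreover have "0 \<le> x ^ (2 * k) * exp (- (x\<^sup>2))" for x :: real by (simp add: power_mult)
    ultimately show "AE x in lborel. norm (x ^ (2 * k) * exp (- (x\<^sup>2))) \<le> norm (sqrt (2 * pi) * (std_normal_density x * x ^ (2 * k)))"
      by (intro AE_I2) (simp only: real_norm_def abs_of_nonneg, force)
  qed
qed

text \<open>The integral is a positive multiple of the characteristic function of the standard normal distribution at \<open>sqrt 2 \<alpha>\<close>,
  which is a positive number.\<close>

lemma integral_gaussian_cos_pos: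
  fixes \<alpha> :: real
  shows "0 < (LINT x|lborel. exp (- (x\<^sup>2)) * cos (2 * \<alpha> * x))"
proof -
  define t where "t = sqrt 2 * \<alpha>"
  have i: "integrable lborel (\<lambda>x. std_normal_density x *\<^sub>R iexp (t * x))"
  proof (rule Bochner_Integration.integrable_bound[of _ std_normal_density])
    show "integrable lborel std_normal_density" using integrable_std_normal_moment[of 0] by simp
    show "(\<lambda>x. std_normal_density x *\<^sub>R iexp (t * x)) \<in> borel_measurable lborel" by measurable
  qed (auto intro!: AE_I2)
  have "Re (char std_normal_distribution t) = Re (LINT x|lborel. std_normal_density x *\<^sub>R iexp (t * x))"
    unfolding char_def by (subst integral_density) auto
  also have "\<dots> = (LINT x|lborel. std_normal_density x * cos (t * x))"
    using integral_Re[OF i] by (simp add: Re_exp)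
  finally have "(LINT x|lborel. std_normal_density x * cos (t * x)) = exp (- (t\<^sup>2) / 2)"
    by (simp add: char_std_normal_distribution Re_exp)
  then have pos: "0 < (LINT x|lborel. std_normal_density x * cos (t * x))" by simp
  also have "(LINT x|lborel. std_normal_density x * cos (t * x)) =
      sqrt 2 * (LINT x|lborel. std_normal_density (sqrt 2 * x) * cos (t * (sqrt 2 * x)))"
    by (subst lborel_integral_real_affine[of "sqrt 2" _ 0]) simp_all
  also have "(\<lambda>x. std_normal_density (sqrt 2 * x) * cos (t * (sqrt 2 * x))) =
      (\<lambda>x. (1 / sqrt (2 * pi)) * (exp (- (x\<^sup>2)) * cos (2 * \<alpha> * x)))"
  proof
    fix x :: real
    have t: "t * (sqrt 2 * x) = 2 * \<alpha> * x"
      using real_sqrt_mult_self[of 2] by (simp add: t_def algebra_simps)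
    show "std_normal_density (sqrt 2 * x) * cos (t * (sqrt 2 * x)) = (1 / sqrt (2 * pi)) * (exp (- (x\<^sup>2)) * cos (2 * \<alpha> * x))"
      unfolding t by (simp add: std_normal_density_def power_mult_distrib)
  qed
  finally show ?thesis by (simp add: zero_less_mult_iff zero_less_divide_iff)
qed

text \<open>For \<open>e = (1, -1)\<close> and \<open>\<alpha> = -a\<close> this spans the kernel of the massless Airy-Dirac operator minus
  \<open>a\<close>; for \<open>e = (1, 1)\<close> and \<open>\<alpha> = a\<close> it spans the kernel of the adjoint.\<close>

definition gauss :: "real \<Rightarrow> complex ^ 2 \<Rightarrow> real \<Rightarrow> complex ^ 2" where
  "gauss \<alpha> e x = (complex_of_real (exp (- (x\<^sup>2) / 2)) * cis (\<alpha> * x)) *s e"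

definition gauss' :: "real \<Rightarrow> complex ^ 2 \<Rightarrow> real \<Rightarrow> complex ^ 2" where
  "gauss' \<alpha> e x = (\<i> * complex_of_real \<alpha> - complex_of_real x) *s gauss \<alpha> e x"

lemma gauss_deriv: "(gauss \<alpha> e has_vector_derivative gauss' \<alpha> e x) (at x)"
proof -
  have c: "((\<lambda>x. complex_of_real (exp (- (x\<^sup>2) / 2)) * cis (\<alpha> * x)) has_vector_derivative
      (\<i> * complex_of_real \<alpha> - complex_of_real x) * (complex_of_real (exp (- (x\<^sup>2) / 2)) * cis (\<alpha> * x))) (at x)"
  proof -
    have e1: "((\<lambda>x. exp (- (x\<^sup>2) / 2)) has_real_derivative (- x * exp (- (x\<^sup>2) / 2))) (at x)"
      by (auto intro!: derivative_eq_intros)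
    have e1': "((\<lambda>x. complex_of_real (exp (- (x\<^sup>2) / 2))) has_vector_derivative complex_of_real (- x * exp (- (x\<^sup>2) / 2))) (at x)"
      using e1 by (simp only: has_vector_derivative_of_real has_real_derivative_iff_has_vector_derivative[symmetric])
    have e2: "((\<lambda>x. cis (\<alpha> * x)) has_vector_derivative \<alpha> *\<^sub>R (\<i> * cis (\<alpha> * x))) (at x)"
      by (auto simp: cis_conv_exp scaleR_conv_of_real mult_ac intro!: derivative_eq_intros has_vector_derivative_real_field exp_scaleR_has_vector_derivative_left)
    show ?thesis
      using has_vector_derivative_mult[OF e1' e2] by (rule has_vector_derivative_eq_rhs) (simp add: scaleR_conv_of_real algebra_simps)
  qed
  have bl: "bounded_linear (\<lambda>c :: complex. c *s e)"
    by (rule bounded_linear_intro[where K = "norm e"])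
       (simp_all add: vec_eq_iff algebra_simps norm_vector_scalar_mult scaleR_conv_of_real[where 'a = complex])
  from bounded_linear.has_vector_derivative[OF bl c]
  show ?thesis by (simp add: gauss_def[abs_def] gauss'_def vector_smult_assoc)
qed

lemma gauss_continuous: "continuous_on S (gauss \<alpha> e)"
  using gauss_deriv has_vector_derivative_continuous by (blast intro: continuous_at_imp_continuous_on)

lemma gauss'_continuous: "continuous_on S (gauss' \<alpha> e)"
proof -
  have "gauss' \<alpha> e = (\<lambda>x. \<alpha> *\<^sub>R (\<i> *s gauss \<alpha> e x) - x *\<^sub>R gauss \<alpha> e x)"
    by (simp add: fun_eq_iff gauss'_def vec_eq_iff scaleR_conv_of_real[where 'a = complex] algebra_simps)
  moreover have "continuous_on S (\<lambda>x. \<i> *s gauss \<alpha> e x)"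
    by (rule continuous_on_compose2[OF linear_continuous_on[OF bounded_linear_vector_scalar_mult] gauss_continuous]) auto
  ultimately show ?thesis by (auto intro!: continuous_intros gauss_continuous)
qed

lemma norm_gauss: "norm (gauss \<alpha> e x) = exp (- (x\<^sup>2) / 2) * norm e"
  by (simp add: gauss_def norm_vector_scalar_mult norm_mult)

lemma norm_gauss_square: "(norm (gauss \<alpha> e x))\<^sup>2 = exp (- (x\<^sup>2)) * (norm e)\<^sup>2"
  by (simp add: norm_gauss power_mult_distrib flip: exp_double)

lemma square_integrable_gauss: "square_integrable (gauss \<alpha> e)" "square_integrable (\<lambda>x. x *\<^sub>R gauss \<alpha> e x)"
proof -
  have m: "gauss \<alpha> e \<in> borel_measurable borel" by (rule borel_measurable_continuous_onI[OF gauss_continuous])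
  show "square_integrable (gauss \<alpha> e)"
    using integrable_gaussian_moment[of 0] m by (simp add: square_integrable_def norm_gauss_square)
  have "(\<lambda>x. (norm (x *\<^sub>R gauss \<alpha> e x))\<^sup>2) = (\<lambda>x. (x\<^sup>2 * exp (- (x\<^sup>2))) * (norm e)\<^sup>2)"
    by (simp add: fun_eq_iff power_mult_distrib norm_gauss_square)
  then show "square_integrable (\<lambda>x. x *\<^sub>R gauss \<alpha> e x)"
    using integrable_gaussian_moment[of 1] m by (simp add: square_integrable_def del: norm_scaleR)
qed

lemma dirac_pair_gauss: "dirac_pair (\<lambda>x. x) (gauss \<alpha> e) (gauss' \<alpha> e)"
proof (rule dirac_pairI)
  show "ac_deriv (gauss \<alpha> e) (gauss' \<alpha> e)" by (rule ac_deriv_C1[OF gauss_deriv gauss'_continuous])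
  have "gauss' \<alpha> e = (\<lambda>x. \<alpha> *\<^sub>R (\<i> *s gauss \<alpha> e x) - x *\<^sub>R gauss \<alpha> e x)"
    by (simp add: fun_eq_iff gauss'_def vec_eq_iff scaleR_conv_of_real[where 'a = complex] algebra_simps)
  then show "square_integrable (gauss' \<alpha> e)"
    by (simp add: square_integrable_diff square_integrable_scaleR square_integrable_cscale square_integrable_gauss)
qed (rule square_integrable_gauss)+

lemma l2_gauss_pos:
  assumes "e \<noteq> 0"
  shows "0 < l2 (gauss \<alpha> e)"
proof -
  have "0 < (LINT x|lborel. exp (- (x\<^sup>2)) * (norm e)\<^sup>2)"
    using mult_pos_pos[OF integral_gaussian_cos_pos[of 0], of "(norm e)\<^sup>2"] assms by simp
  then show ?thesis by (simp add: l2_def norm_gauss_square)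
qed

text \<open>On the Gaussian in the kernel of the massless operator only the mass term survives.\<close>

lemma airy_lower_bound_le_mass:
  assumes "lower_bound m (\<lambda>x. x) a c"
  shows "c \<le> \<bar>m\<bar>"
proof -
  define e :: "complex ^ 2" where "e = (\<chi> i. if i = 1 then 1 else -1)"
  have e: "e $ 1 = 1" "e $ 2 = -1" by (simp_all add: e_def)
  have "e \<noteq> 0"
  proof
    assume "e = 0"
    with e(1) show False by simp
  qed
  then have pos: "0 < l2 (gauss (- a) e)" by (rule l2_gauss_pos)
  have "dirac_expr m (\<lambda>x. x) a (gauss (- a) e) (gauss' (- a) e) = (\<lambda>x. m *\<^sub>R (sigma3 *v gauss (- a) e x))"
    by (simp add: fun_eq_iff dirac_expr_def gauss'_def gauss_def vec_eq_iff forall_2 J_component sigma3_component e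
        scaleR_conv_of_real[where 'a = complex] algebra_simps)
  then have "l2 (dirac_expr m (\<lambda>x. x) a (gauss (- a) e) (gauss' (- a) e)) = \<bar>m\<bar> * l2 (gauss (- a) e)"
    using l2_cong_norm[of "\<lambda>x. sigma3 *v gauss (- a) e x" "gauss (- a) e"] by (simp add: l2_scaleR)
  then have "c * l2 (gauss (- a) e) \<le> \<bar>m\<bar> * l2 (gauss (- a) e)"
    using assms dirac_pair_gauss[of "- a" e] unfolding lower_bound_def by fastforce
  then show ?thesis using pos by simp
qed

section \<open>The harmonic oscillator with complex shift\<close>

text \<open>Otherwise \<open>h\<close> would eventually lie above a line of positive slope.\<close>

lemma integrable_convex_decreasing:
  fixes h :: "real \<Rightarrow> real"
  assumes h1: "\<And>x. (h has_real_derivative h' x) (at x)" and h2: "\<And>x. (h' has_real_derivative h'' x) (at x)"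
    and nn: "\<And>x. 0 \<le> h x" and i: "integrable lborel h" and convex: "\<And>x. R \<le> x \<Longrightarrow> 0 \<le> h'' x" and y: "R \<le> y"
  shows "h' y \<le> 0"
proof (rule ccontr)
  assume "\<not> h' y \<le> 0"
  then have pos: "0 < h' y" by simp
  have mono: "h' y \<le> h' x" if "y \<le> x" for x
    by (rule DERIV_nonneg_imp_nondecreasing[OF that]) (use h2 convex y in force)
  have "h' y * 1 \<le> h x" if x: "y + 1 \<le> x" for x
  proof -
    have "h y - h' y * y \<le> h x - h' y * x"
    proof (rule DERIV_nonneg_imp_nondecreasing[of y x "\<lambda>z. h z - h' y * z"])
      show "y \<le> x" using x by simp
      fix z assume z: "y \<le> z" "z \<le> x"
      have "((\<lambda>z. h z - h' y * z) has_real_derivative h' z - h' y) (at z)"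
        by (auto intro!: derivative_eq_intros h1)
      then show "\<exists>d. ((\<lambda>z. h z - h' y * z) has_real_derivative d) (at z) \<and> 0 \<le> d"
        using mono[OF z(1)] by (intro exI[of _ "h' z - h' y"]) simp
    qed
    moreover have "h' y * 1 \<le> h' y * (x - y)" using pos x by (intro mult_left_mono) auto
    ultimately show ?thesis using nn[of y] by (simp add: algebra_simps)
  qed
  then show False using not_integrable_if_bounded_below[OF i nn pos, of "y + 1"] by simp
qed

lemma integral_le_if_convex:
  fixes h :: "real \<Rightarrow> real"
  assumes h1: "\<And>x. (h has_real_derivative h' x) (at x)" and h2: "\<And>x. (h' has_real_derivative h'' x) (at x)"
    and nn: "\<And>x. 0 \<le> h x" and i: "integrable lborel h" and convex: "\<And>x. R \<le> x \<Longrightarrow> 0 \<le> h'' x"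
    and g: "continuous_on UNIV g" "\<And>x. R \<le> x \<Longrightarrow> g x \<le> h'' x" and T: "R \<le> T"
  shows "integral {R..T} g \<le> - h' R"
proof -
  have I: "(h'' has_integral (h' T - h' R)) {R..T}"
    by (rule fundamental_theorem_of_calculus[OF T])
       (use h2 in \<open>auto simp: has_real_derivative_iff_has_vector_derivative intro: has_vector_derivative_at_within\<close>)
  have "integral {R..T} g \<le> h' T - h' R"
    by (rule has_integral_le[OF integrable_integral I])
       (use g in \<open>auto intro: integrable_continuous_interval continuous_on_subset\<close>)
  then show ?thesis using integrable_convex_decreasing[OF h1 h2 nn i convex T] by simp
qed

lemma integrable_if_intervals_bounded:
  fixes g :: "real \<Rightarrow> real"
  assumes g: "continuous_on UNIV g" and nn: "\<And>x. 0 \<le> g x" and C: "\<And>n::nat. N \<le> n \<Longrightarrow> integral {- real n..real n} g \<le> C"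
  shows "integrable lborel g"
proof -
  have gm: "g \<in> borel_measurable borel" by (rule borel_measurable_continuous_onI[OF g])
  have int: "set_integrable lborel {- real n..real n} g" for n
    by (rule borel_integrable_atLeastAtMost'[OF continuous_on_subset[OF g]]) simp
  have I: "(\<integral>\<^sup>+x. ennreal (indicator {- real n..real n} x * g x) \<partial>lborel) \<le> ennreal C" if "N \<le> n" for n
  proof -
    have "(\<integral>\<^sup>+x. ennreal (indicator {- real n..real n} x * g x) \<partial>lborel) = ennreal (LINT x:{- real n..real n}|lborel. g x)"
      unfolding set_lebesgue_integral_def using int[of n] nn
      by (subst nn_integral_eq_integral) (auto simp: set_integrable_def)
    also have "\<dots> \<le> ennreal C"
      using C[OF that] set_borel_integral_eq_integral(2)[OF int] by (intro ennreal_leI) simp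
    finally show ?thesis .
  qed
  have "(\<integral>\<^sup>+x. ennreal (g x) \<partial>lborel) = (\<integral>\<^sup>+x. liminf (\<lambda>n. ennreal (indicator {- real n..real n} x * g x)) \<partial>lborel)"
  proof (rule nn_integral_cong)
    fix x :: real
    obtain k :: nat where k: "\<bar>x\<bar> \<le> real k" using real_arch_simple by blast
    have "(\<lambda>n. ennreal (indicator {- real n..real n} x * g x)) \<longlonglongrightarrow> ennreal (g x)"
      by (rule tendsto_eventually, rule eventually_mono[OF eventually_ge_at_top[of k]])
         (use k in \<open>auto simp: indicator_def\<close>)
    from lim_imp_Liminf[OF sequentially_bot this]
    show "ennreal (g x) = liminf (\<lambda>n. ennreal (indicator {- real n..real n} x * g x))" by (rule sym)
  qed
  also have "\<dots> \<le> liminf (\<lambda>n. \<integral>\<^sup>+x. ennreal (indicator {- real n..real n} x * g x) \<partial>lborel)"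
    by (rule nn_integral_liminf) (use gm in measurable)
  also have "\<dots> \<le> liminf (\<lambda>n::nat. ennreal C)"
    by (rule Liminf_mono, rule eventually_mono[OF eventually_ge_at_top[of N]]) (rule I)
  also have "\<dots> = ennreal C" by (simp add: Liminf_const)
  finally show ?thesis
    using gm nn by (intro integrableI_bounded) (auto intro: le_less_trans ennreal_less_top)
qed

text \<open>The real part of \<open>(x + i \<mu>)\<^sup>2 + e\<close> is \<open>x\<^sup>2 - \<mu>\<^sup>2 + e\<close>, so for \<open>e \<ge> 0\<close>
  the function \<open>|w|\<^sup>2\<close> is convex outside \<open>|x| \<le> |\<mu>|\<close>, and everywhere if \<open>\<mu>\<^sup>2 \<le>
  e\<close>.\<close>

lemma shifted_oscillator_convexity:
  fixes w w1 :: "real \<Rightarrow> complex"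
  assumes w: "\<And>x. (w has_vector_derivative w1 x) (at x)"
    and w1: "\<And>x. (w1 has_vector_derivative ((Complex x \<mu>)\<^sup>2 + of_real e) * w x) (at x)"
  shows "((\<lambda>x. w x \<bullet> w x) has_real_derivative 2 * (w x \<bullet> w1 x)) (at x)"
    "((\<lambda>x. 2 * (w x \<bullet> w1 x)) has_real_derivative
       2 * (w1 x \<bullet> w1 x) + 2 * (x\<^sup>2 - \<mu>\<^sup>2 + e) * (w x \<bullet> w x)) (at x)"
proof -
  have D: "((\<lambda>x. f x \<bullet> g x) has_vector_derivative f x \<bullet> g' + f' \<bullet> g x) (at x)"
    if "(f has_vector_derivative f') (at x)" "(g has_vector_derivative g') (at x)" for f g :: "real \<Rightarrow> complex" and f' g'
    using bounded_bilinear.has_vector_derivative[OF bounded_bilinear_inner that] .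
  show "((\<lambda>x. w x \<bullet> w x) has_real_derivative 2 * (w x \<bullet> w1 x)) (at x)"
    using D[OF w w] by (simp add: has_real_derivative_iff_has_vector_derivative inner_commute)
  have "((\<lambda>x. 2 * (w x \<bullet> w1 x)) has_vector_derivative
      2 * (w x \<bullet> (((Complex x \<mu>)\<^sup>2 + of_real e) * w x) + w1 x \<bullet> w1 x)) (at x)"
    using has_vector_derivative_mult_right[OF D[OF w w1], of 2] .
  moreover have eq: "w x \<bullet> (((Complex x \<mu>)\<^sup>2 + of_real e) * w x) = (x\<^sup>2 - \<mu>\<^sup>2 + e) * (w x \<bullet> w x)"
    by (simp add: inner_complex_def power2_eq_square algebra_simps)
  ultimately have "((\<lambda>x. 2 * (w x \<bullet> w1 x)) has_vector_derivative
      2 * ((x\<^sup>2 - \<mu>\<^sup>2 + e) * (w x \<bullet> w x) + w1 x \<bullet> w1 x)) (at x)" by (simp only:)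
  then show "((\<lambda>x. 2 * (w x \<bullet> w1 x)) has_real_derivative
       2 * (w1 x \<bullet> w1 x) + 2 * (x\<^sup>2 - \<mu>\<^sup>2 + e) * (w x \<bullet> w x)) (at x)"
    by (simp add: has_real_derivative_iff_has_vector_derivative algebra_simps)
qed

lemma reflect_oscillator:
  fixes w w1 :: "real \<Rightarrow> complex"
  assumes w: "\<And>x. (w has_vector_derivative w1 x) (at x)"
    and w1: "\<And>x. (w1 has_vector_derivative ((Complex x \<mu>)\<^sup>2 + of_real e) * w x) (at x)"
  shows "((\<lambda>x. w (- x)) has_vector_derivative - w1 (- x)) (at x)"
    "((\<lambda>x. - w1 (- x)) has_vector_derivative ((Complex x (- \<mu>))\<^sup>2 + of_real e) * w (- x)) (at x)"
proof -
  have m: "((\<lambda>x. - x) has_vector_derivative (-1::real)) (at x)" for x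
    by (auto intro!: derivative_eq_intros)
  show "((\<lambda>x. w (- x)) has_vector_derivative - w1 (- x)) (at x)"
    using vector_diff_chain_at[OF m w, of x] by (simp add: o_def)
  have sq: "(Complex (- x) \<mu>)\<^sup>2 = (Complex x (- \<mu>))\<^sup>2"
    by (simp add: power2_eq_square complex_eq_iff)
  have "((\<lambda>x. w1 (- x)) has_vector_derivative - (((Complex x (- \<mu>))\<^sup>2 + of_real e) * w (- x))) (at x)"
    using vector_diff_chain_at[OF m w1, of x] by (simp add: o_def sq)
  from has_vector_derivative_minus[OF this]
  show "((\<lambda>x. - w1 (- x)) has_vector_derivative ((Complex x (- \<mu>))\<^sup>2 + of_real e) * w (- x)) (at x)" by simp
qed

lemma half_line_bound:
  fixes w w1 :: "real \<Rightarrow> complex"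
  assumes w: "\<And>x. (w has_vector_derivative w1 x) (at x)"
    and w1: "\<And>x. (w1 has_vector_derivative ((Complex x \<mu>)\<^sup>2 + of_real e) * w x) (at x)"
    and i: "integrable lborel (\<lambda>x. w x \<bullet> w x)" and e: "0 \<le> e"
  obtains C where "\<And>T. \<bar>\<mu>\<bar> \<le> T \<Longrightarrow> integral {\<bar>\<mu>\<bar>..T} (\<lambda>x. 2 * (w1 x \<bullet> w1 x) + 2 * (x\<^sup>2 - \<mu>\<^sup>2) * (w x \<bullet> w x)) \<le> C"
proof
  fix T assume T: "\<bar>\<mu>\<bar> \<le> T"
  note c = shifted_oscillator_convexity[OF w w1]
  have wc: "continuous_on UNIV w" "continuous_on UNIV w1"
    using w w1 has_vector_derivative_continuous by (blast intro: continuous_at_imp_continuous_on)+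
  have le: "\<mu>\<^sup>2 \<le> x\<^sup>2" if "\<bar>\<mu>\<bar> \<le> x" for x using that by (metis abs_ge_self abs_le_square_iff order_trans)
  show "integral {\<bar>\<mu>\<bar>..T} (\<lambda>x. 2 * (w1 x \<bullet> w1 x) + 2 * (x\<^sup>2 - \<mu>\<^sup>2) * (w x \<bullet> w x)) \<le> - (2 * (w \<bar>\<mu>\<bar> \<bullet> w1 \<bar>\<mu>\<bar>))"
    by (rule integral_le_if_convex[OF c _ i _ _ _ T])
       (use le e in \<open>auto intro!: continuous_intros wc mult_right_mono\<close>)
qed

text \<open>Outside \<open>|x| \<le> |\<mu>|\<close> the second derivative of \<open>|w|\<^sup>2\<close> dominates \<open>2 |w'|\<^sup>2 + 2
  (x\<^sup>2 - \<mu>\<^sup>2) |w|\<^sup>2\<close>, and its integral over a half-line is bounded by the first derivative at the end point. Up to a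
  multiple of \<open>|w|\<^sup>2\<close> this dominates \<open>|w' + (x + i \<mu>) w|\<^sup>2\<close>.\<close>

lemma square_integrable_lowering:
  fixes w w1 :: "real \<Rightarrow> complex"
  assumes w: "\<And>x. (w has_vector_derivative w1 x) (at x)"
    and w1: "\<And>x. (w1 has_vector_derivative ((Complex x \<mu>)\<^sup>2 + of_real e) * w x) (at x)"
    and i: "integrable lborel (\<lambda>x. w x \<bullet> w x)" and e: "0 \<le> e"
  shows "integrable lborel (\<lambda>x. (w1 x + Complex x \<mu> * w x) \<bullet> (w1 x + Complex x \<mu> * w x))"
proof -
  define G where "G x = 2 * (w1 x \<bullet> w1 x) + 2 * (x\<^sup>2 - \<mu>\<^sup>2) * (w x \<bullet> w x)" for x
  define y where "y x = w1 x + Complex x \<mu> * w x" for x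
  have wc: "continuous_on S w" "continuous_on S w1" for S
    using w w1 has_vector_derivative_continuous by (blast intro: continuous_at_imp_continuous_on)+
  have "continuous_on S (\<lambda>x. w1 x + (complex_of_real x + \<i> * complex_of_real \<mu>) * w x)" for S
    by (intro continuous_intros wc)
  then have yc: "continuous_on S y" for S by (simp add: y_def[abs_def] Complex_eq)
  have Gc: "continuous_on S G" for S unfolding G_def[abs_def] by (intro continuous_intros wc)
  have y_le: "y x \<bullet> y x \<le> G x + 4 * \<mu>\<^sup>2 * (w x \<bullet> w x)" for x
  proof -
    have n: "z \<bullet> z = (cmod z)\<^sup>2" for z by (simp add: power2_norm_eq_inner)
    have "(cmod (y x))\<^sup>2 \<le> (cmod (w1 x) + cmod (Complex x \<mu> * w x))\<^sup>2"
      unfolding y_def by (intro power_mono norm_triangle_ineq) simp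
    also have "\<dots> \<le> 2 * (cmod (w1 x))\<^sup>2 + 2 * (cmod (Complex x \<mu> * w x))\<^sup>2"
      using sum_squares_bound[of "cmod (w1 x)" "cmod (Complex x \<mu> * w x)"] by (simp add: power2_sum)
    also have "(cmod (Complex x \<mu> * w x))\<^sup>2 = (x\<^sup>2 + \<mu>\<^sup>2) * (cmod (w x))\<^sup>2"
      by (simp add: norm_mult power_mult_distrib cmod_power2)
    finally show ?thesis unfolding G_def n by (simp add: algebra_simps)
  qed
  define I where "I = (LINT x|lborel. w x \<bullet> w x)"
  have int_w: "integral {a..b} (\<lambda>x. w x \<bullet> w x) \<le> I" for a b
  proof -
    have si: "set_integrable lborel {a..b} (\<lambda>x. w x \<bullet> w x)"
      unfolding set_integrable_def by (rule integrable_mult_indicator[OF _ i]) simp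
    have "(LINT x:{a..b}|lborel. w x \<bullet> w x) \<le> I"
      unfolding I_def set_lebesgue_integral_def
      by (rule integral_mono) (use si i in \<open>auto simp: set_integrable_def indicator_def\<close>)
    then show ?thesis using set_borel_integral_eq_integral(2)[OF si] by simp
  qed
  obtain C1 where C1: "\<And>T. \<bar>\<mu>\<bar> \<le> T \<Longrightarrow> integral {\<bar>\<mu>\<bar>..T} G \<le> C1"
    using half_line_bound[OF w w1 i e] unfolding G_def[abs_def] by blast
  have i': "integrable lborel (\<lambda>x. w (- x) \<bullet> w (- x))"
    using lborel_integrable_real_affine[OF i, of "-1" 0] by simp
  obtain C2 where C2: "\<And>T. \<bar>\<mu>\<bar> \<le> T \<Longrightarrow> integral {\<bar>\<mu>\<bar>..T} (\<lambda>x. G (- x)) \<le> C2"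
    using half_line_bound[OF reflect_oscillator[OF w w1] i' e] unfolding G_def[abs_def] by auto
  have ii: "f integrable_on {a..b}" if "continuous_on UNIV f" for f :: "real \<Rightarrow> real" and a b
    by (rule integrable_continuous_interval[OF continuous_on_subset[OF that]]) simp
  have Gneg: "integral {- T..- \<bar>\<mu>\<bar>} G \<le> C2" if "\<bar>\<mu>\<bar> \<le> T" for T
    using C2[OF that] Henstock_Kurzweil_Integration.integral_reflect_real[of T "\<bar>\<mu>\<bar>" "\<lambda>x. G (- x)"] by simp
  define C where "C = C1 + C2 + integral {- \<bar>\<mu>\<bar>..\<bar>\<mu>\<bar>} G + 4 * \<mu>\<^sup>2 * I"
  have "integrable lborel (\<lambda>x. y x \<bullet> y x)"
  proof (rule integrable_if_intervals_bounded[where N = "nat \<lceil>\<bar>\<mu>\<bar>\<rceil>" and C = C])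
    show "continuous_on UNIV (\<lambda>x. y x \<bullet> y x)" by (intro continuous_intros yc)
    fix n :: nat assume "nat \<lceil>\<bar>\<mu>\<bar>\<rceil> \<le> n"
    then have n: "\<bar>\<mu>\<bar> \<le> real n" by linarith
    have "integral {- real n..real n} (\<lambda>x. y x \<bullet> y x) \<le> integral {- real n..real n} (\<lambda>x. G x + 4 * \<mu>\<^sup>2 * (w x \<bullet> w x))"
      by (rule integral_le) (auto intro!: ii continuous_intros yc Gc wc y_le)
    also have "\<dots> = integral {- real n..real n} G + 4 * \<mu>\<^sup>2 * integral {- real n..real n} (\<lambda>x. w x \<bullet> w x)"
    proof -
      have "integral {- real n..real n} (\<lambda>x. G x + 4 * \<mu>\<^sup>2 * (w x \<bullet> w x)) =
         integral {- real n..real n} G + integral {- real n..real n} (\<lambda>x. 4 * \<mu>\<^sup>2 * (w x \<bullet> w x))"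
        by (rule Henstock_Kurzweil_Integration.integral_add) (auto intro!: ii continuous_intros Gc wc)
      then show ?thesis by simp
    qed
    also have "integral {- real n..real n} G = integral {- real n..- \<bar>\<mu>\<bar>} G + integral {- \<bar>\<mu>\<bar>..\<bar>\<mu>\<bar>} G + integral {\<bar>\<mu>\<bar>..real n} G"
    proof -
      have "integral {- real n..- \<bar>\<mu>\<bar>} G + integral {- \<bar>\<mu>\<bar>..real n} G = integral {- real n..real n} G"
        by (rule Henstock_Kurzweil_Integration.integral_combine) (use n in \<open>auto intro: ii Gc\<close>)
      moreover have "integral {- \<bar>\<mu>\<bar>..\<bar>\<mu>\<bar>} G + integral {\<bar>\<mu>\<bar>..real n} G = integral {- \<bar>\<mu>\<bar>..real n} G"
        by (rule Henstock_Kurzweil_Integration.integral_combine) (use n in \<open>auto intro: ii Gc\<close>)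
      ultimately show ?thesis by simp
    qed
    also have "\<dots> + 4 * \<mu>\<^sup>2 * integral {- real n..real n} (\<lambda>x. w x \<bullet> w x) \<le> C"
    proof -
      have "4 * \<mu>\<^sup>2 * integral {- real n..real n} (\<lambda>x. w x \<bullet> w x) \<le> 4 * \<mu>\<^sup>2 * I"
        by (rule mult_left_mono[OF int_w]) simp
      then show ?thesis using C1[OF n] Gneg[OF n] unfolding C_def by linarith
    qed
    finally show "integral {- real n..real n} (\<lambda>x. y x \<bullet> y x) \<le> C" .
  qed simp
  then show ?thesis by (simp add: y_def)
qed

text \<open>The operator \<open>- d\<^sup>2/dx\<^sup>2 + (x + i \<mu>)\<^sup>2\<close> has the eigenvalues 1, 3, 5 and so on, hence none is \<open>-e
  \<le> 0\<close>. The proof climbs a ladder: \<open>y = w' + (x + i \<mu>) w\<close> solves the same equation with \<open>e + 2\<close>, is again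
  square-integrable, and \<open>y = 0\<close> forces \<open>(e + 1) w = 0\<close>. After finitely many steps \<open>\<mu>\<^sup>2 \<le> e\<close>;
  then \<open>|w|\<^sup>2\<close> is convex and integrable on the line, hence 0. The number \<open>k\<close> counts the remaining steps.\<close>

lemma shifted_oscillator_no_negative_eigenvalue:
  fixes w w1 :: "real \<Rightarrow> complex"
  assumes "\<And>x. (w has_vector_derivative w1 x) (at x)"
    and "\<And>x. (w1 has_vector_derivative ((Complex x \<mu>)\<^sup>2 + of_real e) * w x) (at x)"
    and "integrable lborel (\<lambda>x. w x \<bullet> w x)" and "0 \<le> e" and "\<mu>\<^sup>2 \<le> e + 2 * real k"
  shows "w x = 0"
  using assms
proof (induction k arbitrary: w w1 e x)
  case 0
  note w = 0(1) and w1 = 0(2) and i = 0(3)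
  have e: "\<mu>\<^sup>2 \<le> e" using 0(5) by simp
  note c = shifted_oscillator_convexity[OF w w1]
  have convex: "0 \<le> 2 * (z \<bullet> z) + 2 * (x\<^sup>2 - \<mu>\<^sup>2 + e) * (z' \<bullet> z')" for x and z z' :: complex
  proof -
    have "0 \<le> x\<^sup>2 - \<mu>\<^sup>2 + e" using e zero_le_power2[of x] by linarith
    then have "0 \<le> 2 * (x\<^sup>2 - \<mu>\<^sup>2 + e) * (z' \<bullet> z')" by (intro mult_nonneg_nonneg) auto
    then show ?thesis using inner_ge_zero[of z] by linarith
  qed
  have "2 * (w x \<bullet> w1 x) \<le> 0" for x
    by (rule integrable_convex_decreasing[OF c _ i convex order_refl]) simp
  moreover have "0 \<le> 2 * (w x \<bullet> w1 x)" for x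
  proof -
    have i': "integrable lborel (\<lambda>x. w (- x) \<bullet> w (- x))"
      using lborel_integrable_real_affine[OF i, of "-1" 0] by simp
    note c' = shifted_oscillator_convexity[OF reflect_oscillator[OF w w1]]
    have "2 * (w (- (- x)) \<bullet> - w1 (- (- x))) \<le> 0"
      by (rule integrable_convex_decreasing[OF c' _ i' _ order_refl])
         (use convex[of "- w1 (- y)" _ "w (- y)" for y] in \<open>simp_all\<close>)
    then show ?thesis by simp
  qed
  ultimately have "2 * (w x \<bullet> w1 x) = 0" for x by (meson order_antisym)
  with c(1) have D: "((\<lambda>x. w x \<bullet> w x) has_real_derivative 0) (at x)" for x by metis
  have const: "w y \<bullet> w y = w x \<bullet> w x" for y
    using DERIV_isconst_all[of "\<lambda>x. w x \<bullet> w x" y x] D by blast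
  show ?case
  proof (rule ccontr)
    assume "w x \<noteq> 0"
    then have "0 < w x \<bullet> w x" by simp
    from not_integrable_if_bounded_below[OF i _ this, of 0] const show False by (metis inner_ge_zero order_refl)
  qed
next
  case (Suc k)
  note w = Suc.prems(1) and w1 = Suc.prems(2) and i = Suc.prems(3) and e = Suc.prems(4)
  define X where "X x = complex_of_real x + \<i> * complex_of_real \<mu>" for x
  have X: "Complex x \<mu> = X x" for x by (simp add: X_def Complex_eq)
  define y where "y x = w1 x + X x * w x" for x
  define y1 where "y1 x = ((X x)\<^sup>2 + of_real e) * w x + (X x * w1 x + 1 * w x)" for x
  have X': "(X has_vector_derivative 1) (at x)" for x
    unfolding X_def[abs_def] by (auto intro!: derivative_eq_intros simp: has_vector_derivative_of_real)
  have y: "(y has_vector_derivative y1 x) (at x)" for x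
    unfolding y_def[abs_def] y1_def
    by (intro has_vector_derivative_add has_vector_derivative_mult X' w w1[unfolded X])
  have X2: "((\<lambda>x. (X x)\<^sup>2 + of_real e) has_vector_derivative X x * 1 + 1 * X x) (at x)" for x
    using has_vector_derivative_add[OF has_vector_derivative_mult[OF X' X'] has_vector_derivative_const]
    by (simp add: power2_eq_square)
  have y1: "(y1 has_vector_derivative ((Complex x \<mu>)\<^sup>2 + of_real (e + 2)) * y x) (at x)" for x
  proof -
    have "(y1 has_vector_derivative (((X x)\<^sup>2 + of_real e) * w1 x + (X x * 1 + 1 * X x) * w x)
        + ((X x * (((X x)\<^sup>2 + of_real e) * w x) + 1 * w1 x) + (1 * w1 x + 0 * w x))) (at x)"
      unfolding y1_def[abs_def]
      by (intro has_vector_derivative_add has_vector_derivative_mult X' X2 w w1[unfolded X] has_vector_derivative_const)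
    then show ?thesis
      by (rule has_vector_derivative_eq_rhs) (simp add: y_def X algebra_simps power2_eq_square)
  qed
  have iy: "integrable lborel (\<lambda>x. y x \<bullet> y x)"
    using square_integrable_lowering[OF w w1 i e] by (simp add: y_def X)
  have y0: "y x = 0" for x
    by (rule Suc.IH[OF y y1 iy]) (use e Suc.prems(5) in auto)
  have "y1 x = 0"
  proof -
    have y_eq: "y = (\<lambda>x. 0)" using y0 by auto
    have "(y has_vector_derivative 0) (at x)" unfolding y_eq by (rule has_vector_derivative_const)
    from vector_derivative_unique_at[OF y this] show ?thesis .
  qed
  moreover have "y1 x = of_real (e + 1) * w x + X x * y x" by (simp add: y1_def y_def algebra_simps power2_eq_square)
  ultimately have "of_real (e + 1) * w x = 0" using y0 by simp
  then show ?case using e by (simp del: of_real_add)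
qed

text \<open>With \<open>p = U\<^sub>1 + U\<^sub>2\<close>, \<open>q = U\<^sub>1 - U\<^sub>2\<close> and \<open>X = x + i \<mu>\<close> the equation
  becomes \<open>p' = X p - i m q\<close>, \<open>q' = - X q + i m p\<close>, so \<open>p'' = (X\<^sup>2 + 1 + m\<^sup>2) p\<close> and \<open>p =
  0\<close>. Then \<open>m q = 0\<close>, and for \<open>m = 0\<close> the equation for \<open>q\<close> is explicitly solvable.\<close>

lemma airy_kernel:
  assumes U: "\<And>x. (U has_vector_derivative m *\<^sub>R J (sigma3 *v U x) + x *\<^sub>R (sigma1 *v U x) - \<mu> *\<^sub>R J (U x)) (at x)"
    and s: "square_integrable U"
  shows "U x $ 1 + U x $ 2 = 0" "m \<noteq> 0 \<Longrightarrow> U x = 0"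
    "m = 0 \<Longrightarrow> \<exists>\<kappa>. \<forall>x. U x = gauss (- \<mu>) (\<chi> i. if i = 1 then \<kappa> else - \<kappa>) x"
proof -
  have cmp: "((\<lambda>x. f x $ i) has_vector_derivative f' $ i) (at x)" if "(f has_vector_derivative f') (at x)"
    for f :: "real \<Rightarrow> complex ^ 2" and f' i x
    using bounded_linear.has_vector_derivative[OF bounded_linear_vec_nth that] .
  define X where "X x = complex_of_real x + \<i> * complex_of_real \<mu>" for x
  define p where "p x = U x $ 1 + U x $ 2" for x
  define q where "q x = U x $ 1 - U x $ 2" for x
  have p: "(p has_vector_derivative X x * p x - \<i> * of_real m * q x) (at x)" for x
    unfolding p_def[abs_def]
    by (rule has_vector_derivative_eq_rhs[OF has_vector_derivative_add[OF cmp[OF U] cmp[OF U]]])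
       (simp add: q_def X_def J_component sigma1_component sigma3_component scaleR_conv_of_real[where 'a = complex] algebra_simps)
  have q: "(q has_vector_derivative - (X x * q x) + \<i> * of_real m * p x) (at x)" for x
    unfolding q_def[abs_def]
    by (rule has_vector_derivative_eq_rhs[OF has_vector_derivative_diff[OF cmp[OF U] cmp[OF U]]])
       (simp add: p_def X_def J_component sigma1_component sigma3_component scaleR_conv_of_real[where 'a = complex] algebra_simps)
  have X': "(X has_vector_derivative 1) (at x)" for x
    unfolding X_def[abs_def] by (auto intro!: derivative_eq_intros simp: has_vector_derivative_of_real)
  have p1: "((\<lambda>x. X x * p x - \<i> * of_real m * q x) has_vector_derivative ((Complex x \<mu>)\<^sup>2 + of_real (1 + m\<^sup>2)) * p x) (at x)" for x
  proof (rule has_vector_derivative_eq_rhs[OF has_vector_derivative_diff[OF has_vector_derivative_mult[OF X' p] has_vector_derivative_mult_right[OF q]]])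
    show "X x * (X x * p x - \<i> * of_real m * q x) + 1 * p x - \<i> * of_real m * (- (X x * q x) + \<i> * of_real m * p x) =
        ((Complex x \<mu>)\<^sup>2 + of_real (1 + m\<^sup>2)) * p x"
      by (simp add: X_def Complex_eq algebra_simps power2_eq_square)
  qed
  have ip: "integrable lborel (\<lambda>x. p x \<bullet> p x)"
  proof (rule Bochner_Integration.integrable_bound)
    show "integrable lborel (\<lambda>x. 2 * (norm (U x))\<^sup>2)" using square_integrable_norm[OF s] by simp
    have "continuous_on UNIV p"
      using p has_vector_derivative_continuous by (blast intro: continuous_at_imp_continuous_on)
    then show "(\<lambda>x. p x \<bullet> p x) \<in> borel_measurable lborel"
      using borel_measurable_continuous_onI[of "\<lambda>x. p x \<bullet> p x"] by (auto intro!: continuous_intros)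
    show "AE x in lborel. norm (p x \<bullet> p x) \<le> norm (2 * (norm (U x))\<^sup>2)"
    proof (rule AE_I2)
      fix x
      have "(cmod (p x))\<^sup>2 \<le> (cmod (U x $ 1) + cmod (U x $ 2))\<^sup>2"
        unfolding p_def by (intro power_mono norm_triangle_ineq) simp
      also have "\<dots> \<le> 2 * (norm (U x))\<^sup>2"
        using sum_squares_bound[of "cmod (U x $ 1)" "cmod (U x $ 2)"] by (simp add: norm_spinor power2_sum)
      finally show "norm (p x \<bullet> p x) \<le> norm (2 * (norm (U x))\<^sup>2)" by (simp add: power2_norm_eq_inner)
    qed
  qed
  obtain k :: nat where k: "\<mu>\<^sup>2 \<le> real k" using real_arch_simple by blast
  have p0: "p x = 0" for x
    by (rule shifted_oscillator_no_negative_eigenvalue[OF p p1 ip, of k]) (use k in \<open>auto intro: order_trans\<close>)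
  show "U x $ 1 + U x $ 2 = 0" using p0[of x] by (simp add: p_def)
  have p_eq: "p = (\<lambda>x. 0)" using p0 by auto
  show "U x = 0" if m: "m \<noteq> 0"
  proof -
    have "(p has_vector_derivative 0) (at x)" unfolding p_eq by (rule has_vector_derivative_const)
    from vector_derivative_unique_at[OF this p] have "\<i> * of_real m * q x = 0" using p0 by simp
    then have "q x = 0" using m by simp
    then show ?thesis using p0[of x] by (simp add: p_def q_def vec_eq_iff forall_2)
  qed
  show "\<exists>\<kappa>. \<forall>x. U x = gauss (- \<mu>) (\<chi> i. if i = 1 then \<kappa> else - \<kappa>) x" if m: "m = 0"
  proof -
    define E where "E x = complex_of_real (exp (x\<^sup>2 / 2)) * cis (\<mu> * x)" for x
    have E: "(E has_vector_derivative X x * E x) (at x)" for x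
    proof -
      have e1: "((\<lambda>x. exp (x\<^sup>2 / 2)) has_real_derivative (x * exp (x\<^sup>2 / 2))) (at x)"
        by (auto intro!: derivative_eq_intros)
      have e1': "((\<lambda>x. complex_of_real (exp (x\<^sup>2 / 2))) has_vector_derivative complex_of_real (x * exp (x\<^sup>2 / 2))) (at x)"
        using e1 by (simp only: has_vector_derivative_of_real has_real_derivative_iff_has_vector_derivative[symmetric])
      have e2: "((\<lambda>x. cis (\<mu> * x)) has_vector_derivative \<mu> *\<^sub>R (\<i> * cis (\<mu> * x))) (at x)"
        by (auto simp: cis_conv_exp scaleR_conv_of_real mult_ac intro!: derivative_eq_intros has_vector_derivative_real_field exp_scaleR_has_vector_derivative_left)
      show ?thesis unfolding E_def[abs_def]
        using has_vector_derivative_mult[OF e1' e2] by (rule has_vector_derivative_eq_rhs) (simp add: E_def X_def scaleR_conv_of_real algebra_simps)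
    qed
    have "((\<lambda>x. E x * q x) has_vector_derivative 0) (at x)" for x
      by (rule has_vector_derivative_eq_rhs[OF has_vector_derivative_mult[OF E q]]) (simp add: m algebra_simps)
    then obtain c where c: "\<And>x. E x * q x = c"
      using has_vector_derivative_zero_constant[of UNIV "\<lambda>x. E x * q x"] by (auto intro: has_vector_derivative_at_within)
    have "U x = gauss (- \<mu>) (\<chi> i. if i = 1 then c / 2 else - (c / 2)) x" for x
    proof -
      have inv: "(complex_of_real (exp (- (x\<^sup>2) / 2)) * cis (- \<mu> * x)) * E x = 1"
        by (simp add: E_def cis_mult mult_ac flip: of_real_mult exp_add)
      have "q x = ((complex_of_real (exp (- (x\<^sup>2) / 2)) * cis (- \<mu> * x)) * E x) * q x" unfolding inv by simp
      also have "\<dots> = (complex_of_real (exp (- (x\<^sup>2) / 2)) * cis (- \<mu> * x)) * c" using c[of x] by (simp only: mult.assoc)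
      finally have q: "q x = (complex_of_real (exp (- (x\<^sup>2) / 2)) * cis (- \<mu> * x)) * c" .
      have "U x $ 1 = q x / 2" "U x $ 2 = - (q x / 2)"
        using p0[of x] by (simp_all add: p_def q_def add_eq_0_iff2)
      then show ?thesis unfolding q by (simp add: gauss_def vec_eq_iff forall_2)
    qed
    then show ?thesis by blast
  qed
qed

section \<open>Local bounds for solutions of the Airy-Dirac equation\<close>

lemma ac_deriv_reflect:
  assumes ac: "ac_deriv u v"
  shows "ac_deriv (\<lambda>x. u (- x)) (\<lambda>x. - v (- x))"
proof (rule ac_derivI)
  have l: "locally_integrable v" by (rule ac_deriv_locally_integrable[OF ac])
  then have vm: "v \<in> borel_measurable borel" by (simp add: locally_integrable_def)
  have s: "set_integrable lborel {a..b} (\<lambda>x. - v (- x))" for a b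
  proof -
    have "integrable lborel (\<lambda>x. indicator {- b..- a} x *\<^sub>R v x)"
      using l by (simp add: locally_integrable_def set_integrable_def)
    from lborel_integrable_real_affine[OF this, where c = "-1" and t = 0]
    have "integrable lborel (\<lambda>x. - (indicator {- b..- a} (- x) *\<^sub>R v (- x)))" by simp
    moreover have "indicator {- b..- a} (- x) = (indicator {a..b} x :: real)" for x by (auto simp: indicator_def)
    ultimately show ?thesis by (simp add: set_integrable_def)
  qed
  moreover have "(\<lambda>x. - v (- x)) \<in> borel_measurable borel" using vm by measurable
  ultimately show "locally_integrable (\<lambda>x. - v (- x))" by (simp add: locally_integrable_def)
  fix a b :: real assume "a \<le> b"
  then have "(v has_integral (u (- a) - u (- b))) {- b..- a}" using ac_deriv_integral[OF ac] by simp
  then have "((\<lambda>x. v (- x)) has_integral (u (- a) - u (- b))) {a..b}"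
    using has_integral_reflect_real[of v "u (- a) - u (- b)" "- a" "- b"] by simp
  from has_integral_neg[OF this]
  show "((\<lambda>x. - v (- x)) has_integral (u (- b) - u (- a))) {a..b}" by simp
qed

lemma Gronwall:
  fixes f :: "real \<Rightarrow> real"
  assumes f: "continuous_on UNIV f" and K: "0 \<le> K"
    and le: "\<And>x. 0 \<le> x \<Longrightarrow> x \<le> R \<Longrightarrow> f x \<le> B + K * integral {0..x} f"
    and x: "0 \<le> x" "x \<le> R"
  shows "f x \<le> B * exp (K * x)"
proof -
  obtain P where P: "ac_deriv P f" "P 0 = 0"
    using locally_integrable_ac_deriv_exists[OF locally_integrable_continuous[OF f]] by blast
  have P_int: "integral {0..x} f = P x" if "0 \<le> x" for x
    using ac_deriv_integral[OF P(1) that] P(2) by (simp add: has_integral_iff)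
  have P': "(P has_real_derivative f x) (at x)" for x
    using ac_deriv_has_vector_derivative[OF P(1) f] by (simp add: has_real_derivative_iff_has_vector_derivative)
  define \<Phi> where "\<Phi> x = exp (- K * x) * (B + K * P x)" for x
  have \<Phi>': "(\<Phi> has_real_derivative (exp (- K * x) * K) * (f x - (B + K * P x))) (at x)" for x
    unfolding \<Phi>_def[abs_def] by (auto intro!: derivative_eq_intros P' simp: algebra_simps)
  have "\<Phi> x \<le> \<Phi> 0"
  proof (rule DERIV_nonpos_imp_nonincreasing[OF x(1)])
    fix y assume y: "0 \<le> y" "y \<le> x"
    have "f y \<le> B + K * P y" using le[of y] P_int[of y] y x by simp
    then have "(exp (- K * y) * K) * (f y - (B + K * P y)) \<le> 0"
      using K by (intro mult_nonneg_nonpos) auto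
    then show "\<exists>d. (\<Phi> has_real_derivative d) (at y) \<and> d \<le> 0" using \<Phi>' by blast
  qed
  then have "exp (- K * x) * (B + K * P x) \<le> B" by (simp add: \<Phi>_def P(2))
  then have "exp (K * x) * (exp (- K * x) * (B + K * P x)) \<le> exp (K * x) * B" by (intro mult_left_mono) auto
  then have "B + K * P x \<le> B * exp (K * x)" by (simp add: mult.commute flip: mult.assoc exp_add)
  then show ?thesis using le[of x] P_int[of x] x by simp
qed

text \<open>This covers the half-line \<open>x \<ge> 0\<close> only; \<open>ac_deriv_reflect\<close> gives the other one.\<close>

lemma ode_bound_right:
  fixes d :: "real \<Rightarrow> complex ^ 2"
  assumes ac: "ac_deriv d w" and K: "0 \<le> K" and g: "locally_integrable \<gamma>"
    and le: "\<And>x. 0 \<le> x \<Longrightarrow> x \<le> R \<Longrightarrow> norm (w x) \<le> \<gamma> x + K * norm (d x)"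
    and G: "\<And>x. 0 \<le> x \<Longrightarrow> x \<le> R \<Longrightarrow> integral {0..x} \<gamma> \<le> G" and x: "0 \<le> x" "x \<le> R"
  shows "norm (d x) \<le> (norm (d 0) + G) * exp (K * x)"
proof (rule Gronwall[where R = R])
  show c: "continuous_on UNIV (\<lambda>x. norm (d x))" by (intro continuous_intros ac_deriv_continuous[OF ac])
  fix y assume y: "0 \<le> y" "y \<le> R"
  note w = ac_deriv_integral[OF ac y(1)]
  have int: "\<gamma> integrable_on {0..y}" "(\<lambda>x. K * norm (d x)) integrable_on {0..y}"
    using locally_integrable_integral(1)[OF g]
    by (auto intro!: integrable_continuous_interval continuous_intros continuous_on_subset[OF ac_deriv_continuous[OF ac]])
  have "norm (d y - d 0) \<le> integral {0..y} (\<lambda>x. \<gamma> x + K * norm (d x))"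
    unfolding integral_unique[OF w, symmetric]
    by (rule integral_norm_bound_integral) (use w le y int in \<open>auto intro: integrable_add\<close>)
  also have "\<dots> = integral {0..y} \<gamma> + K * integral {0..y} (\<lambda>x. norm (d x))"
    using Henstock_Kurzweil_Integration.integral_add[OF int] by simp
  finally show "norm (d y) \<le> norm (d 0) + G + K * integral {0..y} (\<lambda>x. norm (d x))"
    using G[OF y] norm_triangle_ineq2[of "d y" "d 0"] by linarith
qed (use K x in auto)

text \<open>The factor \<open>(b - a + 1) / 2\<close> instead of \<open>(b - a)^(1/2)\<close> comes from \<open>2 |u| \<le> \<tau> + |u|\<^sup>2 /
  \<tau>\<close>, integrated over \<open>[a, b]\<close>.\<close>

lemma integral_norm_le_l2:
  assumes u: "square_integrable u" and \<tau>: "0 < \<tau>" "l2 u \<le> \<tau>" and ab: "a \<le> b"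
  shows "integral {a..b} (\<lambda>x. norm (u x)) \<le> \<tau> * (b - a + 1) / 2"
proof -
  have l: "locally_integrable (\<lambda>x. norm (u x))"
    by (rule locally_integrable_norm[OF square_integrable_locally_integrable[OF u]])
  have i2: "integrable lborel (\<lambda>x. (norm (u x))\<^sup>2)" by (rule square_integrable_norm[OF u])
  have c: "integrable lborel (\<lambda>x. indicat_real {a..b} x * (\<tau> / 2))"
    by (intro integrable_mult_left integrable_real_indicator) (auto simp: emeasure_lborel_Icc_eq)
  have "integral {a..b} (\<lambda>x. norm (u x)) = (LINT x|lborel. indicator {a..b} x *\<^sub>R norm (u x))"
    using locally_integrable_integral(2)[OF l] by (simp add: set_lebesgue_integral_def)
  also have "\<dots> \<le> (LINT x|lborel. indicat_real {a..b} x * (\<tau> / 2) + (norm (u x))\<^sup>2 / (2 * \<tau>))"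
  proof (rule integral_mono)
    show "integrable lborel (\<lambda>x. indicat_real {a..b} x *\<^sub>R norm (u x))"
      using l by (simp add: locally_integrable_def set_integrable_def)
    show "integrable lborel (\<lambda>x. indicat_real {a..b} x * (\<tau> / 2) + (norm (u x))\<^sup>2 / (2 * \<tau>))"
      using c i2 by simp
    have "norm (u x) \<le> \<tau> / 2 + (norm (u x))\<^sup>2 / (2 * \<tau>)" for x
    proof -
      have "0 \<le> (\<tau> - norm (u x))\<^sup>2 / (2 * \<tau>)" using \<tau> by simp
      also have "\<dots> = \<tau> / 2 + (norm (u x))\<^sup>2 / (2 * \<tau>) - norm (u x)"
        using \<tau> by (simp add: power2_eq_square field_simps)
      finally show ?thesis by simp
    qed
    then show "indicat_real {a..b} x *\<^sub>R norm (u x) \<le> indicat_real {a..b} x * (\<tau> / 2) + (norm (u x))\<^sup>2 / (2 * \<tau>)" for x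
      using \<tau> by (auto simp: indicator_def)
  qed
  also have "\<dots> = (b - a) * (\<tau> / 2) + (l2 u)\<^sup>2 / (2 * \<tau>)"
    using c i2 ab by (simp add: l2_square)
  also have "\<dots> \<le> (b - a) * (\<tau> / 2) + \<tau>\<^sup>2 / (2 * \<tau>)"
    using \<tau> by (intro add_mono divide_right_mono power_mono) auto
  also have "\<dots> = \<tau> * (b - a + 1) / 2" using \<tau> by (simp add: power2_eq_square field_simps)
  finally show ?thesis .
qed

text \<open>The right-hand side of \<open>(A - \<mu>) u = 0\<close> solved for \<open>u'\<close>.\<close>

definition airy_matrix :: "real \<Rightarrow> real \<Rightarrow> real \<Rightarrow> complex ^ 2 \<Rightarrow> complex ^ 2" where
  "airy_matrix m \<mu> x s = m *\<^sub>R J (sigma3 *v s) + x *\<^sub>R (sigma1 *v s) - \<mu> *\<^sub>R J s"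

lemma airy_matrix_solve:
  "v x = - J (dirac_expr m (\<lambda>x. x) \<mu> u v x) + airy_matrix m \<mu> x (u x)"
  by (simp add: dirac_expr_def airy_matrix_def vec_eq_iff forall_2 J_component sigma1_component sigma3_component
      scaleR_conv_of_real[where 'a = complex] algebra_simps)

lemma airy_matrix_norm: "norm (airy_matrix m \<mu> x s) \<le> (\<bar>m\<bar> + \<bar>x\<bar> + \<bar>\<mu>\<bar>) * norm s"
proof -
  have "norm (airy_matrix m \<mu> x s) \<le> norm (m *\<^sub>R J (sigma3 *v s)) + norm (x *\<^sub>R (sigma1 *v s)) + norm (\<mu> *\<^sub>R J s)"
    unfolding airy_matrix_def
    using norm_triangle_ineq4[of "m *\<^sub>R J (sigma3 *v s) + x *\<^sub>R (sigma1 *v s)" "\<mu> *\<^sub>R J s"]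
      norm_triangle_ineq[of "m *\<^sub>R J (sigma3 *v s)" "x *\<^sub>R (sigma1 *v s)"] by linarith
  then show ?thesis by (simp add: algebra_simps)
qed

lemma airy_matrix_diff: "airy_matrix m \<mu> x (s - t) = airy_matrix m \<mu> x s - airy_matrix m \<mu> x t"
  by (simp add: airy_matrix_def linear_simps[OF bounded_linear_J] linear_simps[OF bounded_linear_matrix] algebra_simps)

lemma airy_matrix_continuous:
  assumes "continuous_on S u"
  shows "continuous_on S (\<lambda>x. airy_matrix m \<mu> x (u x))"
proof -
  have "continuous_on S (\<lambda>x. J (u x))" "continuous_on S (\<lambda>x. sigma1 *v u x)" "continuous_on S (\<lambda>x. J (sigma3 *v u x))"
    using continuous_on_compose2[OF linear_continuous_on[OF bounded_linear_J, of UNIV] assms]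
      continuous_on_compose2[OF linear_continuous_on[OF bounded_linear_matrix, of UNIV] assms]
      continuous_on_compose2[OF linear_continuous_on[OF bounded_linear_compose[OF bounded_linear_J bounded_linear_matrix], of UNIV] assms]
    by auto
  then show ?thesis unfolding airy_matrix_def by (intro continuous_intros)
qed

lemma airy_local_bound:
  assumes dom: "dirac_pair (\<lambda>x. x) u v" and \<tau>: "0 < \<tau>" "l2 (dirac_expr m (\<lambda>x. x) \<mu> u v) \<le> \<tau>" and x: "\<bar>x\<bar> \<le> R"
  shows "norm (u x) \<le> (norm (u 0) + \<tau> * (R + 1) / 2) * exp ((\<bar>m\<bar> + R + \<bar>\<mu>\<bar>) * R)"
proof -
  let ?g = "dirac_expr m (\<lambda>x. x) \<mu> u v"
  define K where "K = \<bar>m\<bar> + R + \<bar>\<mu>\<bar>"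
  have R: "0 \<le> R" using x by linarith
  have K: "0 \<le> K" using R by (simp add: K_def)
  have ac: "ac_deriv u v" by (rule dirac_pairD(1)[OF dom])
  have g: "square_integrable ?g" by (rule square_integrable_dirac_expr[OF dom])
  have lg: "locally_integrable (\<lambda>x. norm (?g x))"
    by (rule locally_integrable_norm[OF square_integrable_locally_integrable[OF g]])
  have v_le: "norm (v y) \<le> norm (?g y) + K * norm (u y)" if "\<bar>y\<bar> \<le> R" for y
  proof -
    have "norm (v y) \<le> norm (?g y) + norm (airy_matrix m \<mu> y (u y))"
      by (subst airy_matrix_solve[of v y m \<mu> u]) (rule norm_triangle_le, simp)
    also have "norm (airy_matrix m \<mu> y (u y)) \<le> (\<bar>m\<bar> + \<bar>y\<bar> + \<bar>\<mu>\<bar>) * norm (u y)" by (rule airy_matrix_norm)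
    also have "\<dots> \<le> K * norm (u y)" unfolding K_def using that by (intro mult_right_mono) auto
    finally show ?thesis by simp
  qed
  have int_le: "\<tau> * (y + 1) / 2 \<le> \<tau> * (R + 1) / 2" if "y \<le> R" for y
    using \<tau> that by (intro divide_right_mono mult_left_mono) auto
  have both: "norm (u y) \<le> (norm (u 0) + \<tau> * (R + 1) / 2) * exp (K * \<bar>y\<bar>)" if y: "\<bar>y\<bar> \<le> R" for y
  proof (cases "0 \<le> y")
    case True
    have "norm (u y) \<le> (norm (u 0) + \<tau> * (R + 1) / 2) * exp (K * y)"
    proof (rule ode_bound_right[OF ac K lg, where R = R])
      fix z assume z: "0 \<le> z" "z \<le> R"
      show "norm (v z) \<le> norm (?g z) + K * norm (u z)" by (rule v_le) (use z in auto)
      show "integral {0..z} (\<lambda>x. norm (?g x)) \<le> \<tau> * (R + 1) / 2"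
        using integral_norm_le_l2[OF g \<tau>, of 0 z] int_le[OF z(2)] z by simp
    qed (use True y in auto)
    then show ?thesis using True by simp
  next
    case False
    have lg': "locally_integrable (\<lambda>x. norm (?g (- x)))"
    proof -
      obtain P where "ac_deriv P ?g" using locally_integrable_ac_deriv_exists[OF square_integrable_locally_integrable[OF g]] by blast
      from locally_integrable_norm[OF ac_deriv_locally_integrable[OF ac_deriv_reflect[OF this]]] show ?thesis by simp
    qed
    have "norm (u (- (- y))) \<le> (norm (u (- 0)) + \<tau> * (R + 1) / 2) * exp (K * - y)"
    proof (rule ode_bound_right[OF ac_deriv_reflect[OF ac] K lg', where R = R])
      fix z assume z: "0 \<le> z" "z \<le> R"
      show "norm (- v (- z)) \<le> norm (?g (- z)) + K * norm (u (- z))" using v_le[of "- z"] z by simp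
      have "integral {0..z} (\<lambda>x. norm (?g (- x))) = integral {- z..0} (\<lambda>x. norm (?g x))"
        using Henstock_Kurzweil_Integration.integral_reflect_real[of 0 "- z" "\<lambda>x. norm (?g x)"] by simp
      then show "integral {0..z} (\<lambda>x. norm (?g (- x))) \<le> \<tau> * (R + 1) / 2"
        using integral_norm_le_l2[OF g \<tau>, of "- z" 0] int_le[OF z(2)] z by simp
    qed (use False y in auto)
    then show ?thesis using False by simp
  qed
  have B: "0 \<le> norm (u 0) + \<tau> * (R + 1) / 2" using \<tau> R by simp
  have "exp (K * \<bar>x\<bar>) \<le> exp (K * R)" using x K by (simp add: mult_left_mono)
  then have "(norm (u 0) + \<tau> * (R + 1) / 2) * exp (K * \<bar>x\<bar>) \<le> (norm (u 0) + \<tau> * (R + 1) / 2) * exp (K * R)"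
    using B by (rule mult_left_mono)
  with both[OF x] show ?thesis unfolding K_def by linarith
qed

text \<open>The graph estimate for \<open>W = x\<close>, where \<open>M = 1\<close> and \<open>\<epsilon> = 0\<close>; its other half bounds the
  derivative \<open>v\<close>.\<close>

lemma airy_graph_estimate:
  assumes dom: "dirac_pair (\<lambda>x. x) u v"
  shows "(l2 (\<lambda>x. x *\<^sub>R u x))\<^sup>2 \<le> (l2 (dirac_expr m (\<lambda>x. x) \<mu> u v))\<^sup>2 + (l2 u)\<^sup>2"
    "l2 v \<le> sqrt ((l2 (dirac_expr m (\<lambda>x. x) \<mu> u v))\<^sup>2 + (l2 u)\<^sup>2) + (\<bar>m\<bar> + \<bar>\<mu>\<bar>) * l2 u"
proof -
  note d = dirac_pairD[OF dom]
  define S where "S x = J (v x) + m *\<^sub>R (sigma3 *v u x) - \<mu> *\<^sub>R u x" for x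
  have "(l2 S)\<^sup>2 + (1 - 0) * (l2 (\<lambda>x. x *\<^sub>R u x))\<^sup>2 \<le> (l2 (dirac_expr m (\<lambda>x. x) \<mu> u v))\<^sup>2 + 1 * (l2 u)\<^sup>2"
    unfolding S_def[abs_def] by (rule graph_estimate[OF dom, where W' = "\<lambda>x. 1"]) auto
  then have g: "(l2 S)\<^sup>2 + (l2 (\<lambda>x. x *\<^sub>R u x))\<^sup>2 \<le> (l2 (dirac_expr m (\<lambda>x. x) \<mu> u v))\<^sup>2 + (l2 u)\<^sup>2" by simp
  then show "(l2 (\<lambda>x. x *\<^sub>R u x))\<^sup>2 \<le> (l2 (dirac_expr m (\<lambda>x. x) \<mu> u v))\<^sup>2 + (l2 u)\<^sup>2"
    using zero_le_power2[of "l2 S"] by linarith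
  have "(l2 S)\<^sup>2 \<le> (l2 (dirac_expr m (\<lambda>x. x) \<mu> u v))\<^sup>2 + (l2 u)\<^sup>2"
    using g zero_le_power2[of "l2 (\<lambda>x. x *\<^sub>R u x)"] by linarith
  then have S: "l2 S \<le> sqrt ((l2 (dirac_expr m (\<lambda>x. x) \<mu> u v))\<^sup>2 + (l2 u)\<^sup>2)" by (rule real_le_rsqrt)
  have s: "square_integrable S" "square_integrable (\<lambda>x. m *\<^sub>R (sigma3 *v u x))" "square_integrable (\<lambda>x. \<mu> *\<^sub>R u x)"
    unfolding S_def[abs_def]
    by (intro square_integrable_diff square_integrable_add square_integrable_J d square_integrable_scaleR square_integrable_sigma)+
  have "l2 v = l2 (\<lambda>x. J (v x))" by (rule l2_cong_norm) simp
  also have "(\<lambda>x. J (v x)) = (\<lambda>x. (S x - m *\<^sub>R (sigma3 *v u x)) + \<mu> *\<^sub>R u x)" by (simp add: S_def)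
  also have "l2 \<dots> \<le> (l2 S + l2 (\<lambda>x. m *\<^sub>R (sigma3 *v u x))) + l2 (\<lambda>x. \<mu> *\<^sub>R u x)"
    by (rule order_trans[OF l2_triangle[OF square_integrable_diff[OF s(1,2)] s(3)] add_right_mono[OF l2_triangle_diff[OF s(1,2)]]])
  also have "l2 (\<lambda>x. m *\<^sub>R (sigma3 *v u x)) = \<bar>m\<bar> * l2 u"
    using l2_cong_norm[of "\<lambda>x. sigma3 *v u x" u] by (simp add: l2_scaleR)
  also have "l2 (\<lambda>x. \<mu> *\<^sub>R u x) = \<bar>\<mu>\<bar> * l2 u" by (rule l2_scaleR)
  finally show "l2 v \<le> sqrt ((l2 (dirac_expr m (\<lambda>x. x) \<mu> u v))\<^sup>2 + (l2 u)\<^sup>2) + (\<bar>m\<bar> + \<bar>\<mu>\<bar>) * l2 u"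
    using S by (simp add: distrib_right)
qed

lemma l2_le_local_plus_tail:
  assumes u: "square_integrable u" and xu: "square_integrable (\<lambda>x. x *\<^sub>R u x)" and R: "0 < R"
    and loc: "\<And>x. \<bar>x\<bar> \<le> R \<Longrightarrow> norm (u x) \<le> b"
  shows "(l2 u)\<^sup>2 \<le> 2 * R * b\<^sup>2 + (l2 (\<lambda>x. x *\<^sub>R u x))\<^sup>2 / R\<^sup>2"
proof -
  have i1: "integrable lborel (\<lambda>x. indicat_real {- R..R} x * b\<^sup>2)"
    by (intro integrable_mult_left integrable_real_indicator) (auto simp: emeasure_lborel_Icc_eq)
  have i2: "integrable lborel (\<lambda>x. (norm (x *\<^sub>R u x))\<^sup>2 / R\<^sup>2)" using square_integrable_norm[OF xu] by simp
  have "(l2 u)\<^sup>2 \<le> (LINT x|lborel. indicat_real {- R..R} x * b\<^sup>2 + (norm (x *\<^sub>R u x))\<^sup>2 / R\<^sup>2)"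
    unfolding l2_square
  proof (rule integral_mono)
    show "integrable lborel (\<lambda>x. (norm (u x))\<^sup>2)" by (rule square_integrable_norm[OF u])
    show "integrable lborel (\<lambda>x. indicat_real {- R..R} x * b\<^sup>2 + (norm (x *\<^sub>R u x))\<^sup>2 / R\<^sup>2)"
      by (rule Bochner_Integration.integrable_add[OF i1 i2])
    fix x
    show "(norm (u x))\<^sup>2 \<le> indicat_real {- R..R} x * b\<^sup>2 + (norm (x *\<^sub>R u x))\<^sup>2 / R\<^sup>2"
    proof (cases "\<bar>x\<bar> \<le> R")
      case True
      then have "(norm (u x))\<^sup>2 \<le> b\<^sup>2" by (intro power_mono loc) auto
      moreover have "indicat_real {- R..R} x = 1" using True by (auto simp: indicator_def)
      ultimately show ?thesis by simp (smt (verit) divide_nonneg_nonneg zero_le_power2)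
    next
      case False
      then have "R\<^sup>2 \<le> x\<^sup>2" using R abs_le_square_iff[of R x] by simp
      then have "(norm (u x))\<^sup>2 * R\<^sup>2 \<le> (norm (u x))\<^sup>2 * x\<^sup>2" by (intro mult_left_mono) auto
      moreover have "indicat_real {- R..R} x = 0" using False by (auto simp: indicator_def)
      ultimately show ?thesis using R by (simp add: power_mult_distrib field_simps)
    qed
  qed
  also have "\<dots> = 2 * R * b\<^sup>2 + (l2 (\<lambda>x. x *\<^sub>R u x))\<^sup>2 / R\<^sup>2"
    unfolding l2_square using i1 i2 R by simp
  finally show ?thesis .
qed

text \<open>As \<open>|u|\<close> has norm at most 1, its value is at most 2 somewhere in \<open>[0, 1]\<close>; from there the derivative is
  integrated.\<close>

lemma initial_value_bound:
  assumes ac: "ac_deriv u v" and s: "square_integrable u" "square_integrable v" and u: "l2 u \<le> 1" and v: "l2 v \<le> \<tau>" "0 < \<tau>"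
  shows "norm (u 0) \<le> 2 + \<tau>"
proof -
  have "\<exists>y\<in>{0..1}. norm (u y) \<le> 2"
  proof (rule ccontr)
    assume "\<not> ?thesis"
    then have gt: "2 \<le> norm (u y)" if "0 \<le> y" "y \<le> 1" for y using that by force
    have "(LINT x|lborel. indicat_real {0..1::real} x * 4) \<le> (LINT x|lborel. (norm (u x))\<^sup>2)"
    proof (rule integral_mono)
      show "integrable lborel (\<lambda>x. indicat_real {0..1::real} x * 4)"
        by (intro integrable_mult_left integrable_real_indicator) (auto simp: emeasure_lborel_Icc_eq)
      show "integrable lborel (\<lambda>x. (norm (u x))\<^sup>2)" by (rule square_integrable_norm[OF s(1)])
      show "indicat_real {0..1} x * 4 \<le> (norm (u x))\<^sup>2" for x
        using power_mono[OF gt[of x], of 2] by (auto simp: indicator_def)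
    qed
    then have "4 \<le> (l2 u)\<^sup>2" by (simp add: l2_square)
    moreover have "(l2 u)\<^sup>2 \<le> 1" using u by (simp add: power_le_one)
    ultimately show False by simp
  qed
  then obtain y where y: "0 \<le> y" "y \<le> 1" "norm (u y) \<le> 2" by auto
  have lv: "locally_integrable (\<lambda>x. norm (v x))"
    by (rule locally_integrable_norm[OF square_integrable_locally_integrable[OF s(2)]])
  note I = ac_deriv_integral[OF ac y(1)]
  have "norm (u y - u 0) \<le> integral {0..y} (\<lambda>x. norm (v x))"
    unfolding integral_unique[OF I, symmetric]
    by (rule integral_norm_bound_integral) (use I locally_integrable_integral(1)[OF lv] in auto)
  also have "\<dots> \<le> \<tau> * (y - 0 + 1) / 2" by (rule integral_norm_le_l2[OF s(2) v(2,1) y(1)])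
  also have "\<dots> \<le> \<tau>" using mult_left_mono[OF y(2), of \<tau>] v(2) by (simp add: distrib_left)
  finally show ?thesis using y(3) norm_triangle_ineq2[of "u 0" "u y"] norm_minus_commute[of "u 0" "u y"] by linarith
qed

section \<open>A uniform lower bound for the Airy-Dirac operator\<close>

lemma dirac_pair_diff:
  assumes "dirac_pair W u v" "dirac_pair W u' v'"
  shows "dirac_pair W (\<lambda>x. u x - u' x) (\<lambda>x. v x - v' x)"
    "dirac_expr m W a (\<lambda>x. u x - u' x) (\<lambda>x. v x - v' x) = (\<lambda>x. dirac_expr m W a u v x - dirac_expr m W a u' v' x)"
proof -
  show "dirac_pair W (\<lambda>x. u x - u' x) (\<lambda>x. v x - v' x)"
    using dirac_pair_add[OF assms(1) dirac_pair_scaleR[OF assms(2), of "-1"]] by simp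
  show "dirac_expr m W a (\<lambda>x. u x - u' x) (\<lambda>x. v x - v' x) = (\<lambda>x. dirac_expr m W a u v x - dirac_expr m W a u' v' x)"
    by (simp add: fun_eq_iff dirac_expr_def vec_eq_iff forall_2 J_component sigma3_component scaleR_conv_of_real[where 'a = complex] algebra_simps)
qed

text \<open>Instead of a compact embedding, the equation itself gives convergence. The initial values \<open>u n 0\<close> are bounded, so a
  subsequence of them converges. By \<open>airy_local_bound\<close>, differences along it are then small on every bounded interval, and the graph
  estimate bounds \<open>|x u|\<close>, which makes the tails uniformly small.\<close>

lemma airy_compactness:
  assumes dom: "\<And>n::nat. dirac_pair (\<lambda>x. x) (u n) (v n)" and one: "\<And>n. l2 (u n) = 1"
    and lim: "(\<lambda>n. l2 (dirac_expr m (\<lambda>x. x) \<mu> (u n) (v n))) \<longlonglongrightarrow> 0"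
  obtains r U where "strict_mono r" "\<And>x. (U has_vector_derivative airy_matrix m \<mu> x (U x)) (at x)"
    "square_integrable U" "(\<lambda>n. l2 (\<lambda>x. U x - u (r n) x)) \<longlonglongrightarrow> 0"
proof -
  let ?g = "\<lambda>n. dirac_expr m (\<lambda>x. x) \<mu> (u n) (v n)"
  have gs: "square_integrable (?g n)" for n by (rule square_integrable_dirac_expr[OF dom])
  obtain B where B: "B > 0" "\<And>n. l2 (?g n) \<le> B"
    using convergent_imp_Bseq[OF convergentI[OF lim]] unfolding Bseq_def by auto
  define \<tau> where "\<tau> = sqrt (B\<^sup>2 + 1) + (\<bar>m\<bar> + \<bar>\<mu>\<bar>)"
  have sq: "(l2 (?g n))\<^sup>2 + (l2 (u n))\<^sup>2 \<le> B\<^sup>2 + 1" for n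
    using power_mono[OF B(2)[of n] l2_nonneg, of 2] one[of n] by simp
  have "0 < B\<^sup>2 + 1" using zero_le_power2[of B] by linarith
  then have "0 < sqrt (B\<^sup>2 + 1)" by simp
  then have \<tau>: "\<tau> > 0" unfolding \<tau>_def by linarith
  have vt: "l2 (v n) \<le> \<tau>" for n
  proof -
    have "sqrt ((l2 (?g n))\<^sup>2 + (l2 (u n))\<^sup>2) \<le> sqrt (B\<^sup>2 + 1)" by (rule real_sqrt_le_mono[OF sq])
    then show ?thesis
      using airy_graph_estimate(2)[OF dom[of n], of m \<mu>] unfolding \<tau>_def one mult_1_right by linarith
  qed
  have xt: "(l2 (\<lambda>x. x *\<^sub>R u n x))\<^sup>2 \<le> B\<^sup>2 + 1" for n
    using airy_graph_estimate(1)[OF dom[of n], of m \<mu>] sq[of n] by linarith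
  have "u n 0 \<in> cball 0 (2 + \<tau>)" for n
    using initial_value_bound[OF dirac_pairD(1-3)[OF dom[of n]] _ vt \<tau>] one[of n] by simp
  then obtain z r where r: "strict_mono r" "((\<lambda>n. u n 0) \<circ> r) \<longlonglongrightarrow> z"
    using compact_cball[of "0 :: complex ^ 2" "2 + \<tau>", unfolded compact_def] by meson
  define w where "w n = u (r n)" for n
  define w' where "w' n = v (r n)" for n
  define h where "h n = ?g (r n)" for n
  have wd: "dirac_pair (\<lambda>x. x) (w n) (w' n)" for n unfolding w_def w'_def by (rule dom)
  note wD = dirac_pairD[OF wd]
  have hs: "square_integrable (h n)" for n unfolding h_def by (rule gs)
  have h0: "(\<lambda>n. l2 (h n)) \<longlonglongrightarrow> 0"
    using LIMSEQ_subseq_LIMSEQ[OF lim r(1)] by (simp add: h_def o_def)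
  have w0: "Cauchy (\<lambda>n. w n 0)"
    using LIMSEQ_imp_Cauchy[OF r(2)] by (simp add: w_def o_def)
  have local_cauchy: "\<exists>N. \<forall>j\<ge>N. \<forall>k\<ge>N. \<forall>x. \<bar>x\<bar> \<le> R \<longrightarrow> norm (w j x - w k x) \<le> \<delta>" if \<delta>: "\<delta> > 0" and R: "R \<ge> 0" for \<delta> R :: real
  proof -
    define E where "E = exp ((\<bar>m\<bar> + R + \<bar>\<mu>\<bar>) * R)"
    define t where "t = \<delta> / (E * (1 + (R + 1) / 2))"
    have E: "E > 0" by (simp add: E_def)
    have "0 < (R + 1) / 2" using R by simp
    then have "0 < 1 + (R + 1) / 2" by linarith
    then have t: "t > 0" unfolding t_def using \<delta> E by (intro divide_pos_pos mult_pos_pos)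
    obtain N1 where N1: "\<And>j k. j \<ge> N1 \<Longrightarrow> k \<ge> N1 \<Longrightarrow> norm (w j 0 - w k 0) < t"
      using w0 t unfolding Cauchy_iff by blast
    obtain N2 where N2: "\<And>n. n \<ge> N2 \<Longrightarrow> l2 (h n) < t / 2"
      using LIMSEQ_D[OF h0, of "t / 2"] t by auto
    have "norm (w j x - w k x) \<le> \<delta>" if "j \<ge> max N1 N2" "k \<ge> max N1 N2" "\<bar>x\<bar> \<le> R" for j k x
    proof -
      note d = dirac_pair_diff[OF wd[of j] wd[of k]]
      have "l2 (dirac_expr m (\<lambda>x. x) \<mu> (\<lambda>x. w j x - w k x) (\<lambda>x. w' j x - w' k x)) \<le> l2 (h j) + l2 (h k)"
        unfolding d(2) using l2_triangle_diff[OF hs hs, of j k] by (simp add: h_def w_def w'_def)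
      also have "\<dots> \<le> t" using N2[of j] N2[of k] that by simp
      finally have "norm (w j x - w k x) \<le> (norm (w j 0 - w k 0) + t * (R + 1) / 2) * E"
        unfolding E_def by (rule airy_local_bound[OF d(1) t _ that(3)])
      also have "\<dots> \<le> (t + t * (R + 1) / 2) * E" using N1[of j k] that E by (intro mult_right_mono) auto
      also have "\<dots> = t * (E * (1 + (R + 1) / 2))" by (simp add: algebra_simps)
      also have "\<dots> = \<delta>"
      proof -
        have "E * (1 + (R + 1) / 2) \<noteq> 0" using E R by (simp add: add_nonneg_eq_0_iff)
        then show ?thesis unfolding t_def by (rule nonzero_eq_divide_eq[THEN iffD1, OF _ refl])
      qed
      finally show ?thesis .
    qed
    then show ?thesis by blast
  qed
  have xdiff: "(l2 (\<lambda>x. x *\<^sub>R (w j x - w k x)))\<^sup>2 \<le> 4 * (B\<^sup>2 + 1)" for j k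
  proof -
    have "l2 (\<lambda>x. x *\<^sub>R (w j x - w k x)) \<le> l2 (\<lambda>x. x *\<^sub>R w j x) + l2 (\<lambda>x. x *\<^sub>R w k x)"
      using l2_triangle_diff[OF wD(4) wD(4), of j k] by (simp add: scaleR_diff_right)
    also have "\<dots> \<le> sqrt (B\<^sup>2 + 1) + sqrt (B\<^sup>2 + 1)"
      unfolding w_def by (intro add_mono real_le_rsqrt xt)
    finally have "(l2 (\<lambda>x. x *\<^sub>R (w j x - w k x)))\<^sup>2 \<le> (2 * sqrt (B\<^sup>2 + 1))\<^sup>2" by (intro power_mono) auto
    then show ?thesis by (simp add: power_mult_distrib)
  qed
  have global_cauchy: "\<exists>N. \<forall>j\<ge>N. \<forall>k\<ge>N. l2 (\<lambda>x. w j x - w k x) \<le> \<epsilon>" if \<epsilon>: "\<epsilon> > 0" for \<epsilon>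
  proof -
    \<comment> \<open>\<open>R\<close> makes the tail at most \<open>\<epsilon>\<^sup>2 / 2\<close>, and \<open>\<delta>\<close> does the same for the
      part in \<open>[-R, R]\<close>.\<close>
    define R where "R = sqrt (8 * (B\<^sup>2 + 1)) / \<epsilon>"
    have R: "R > 0" using \<epsilon> by (simp add: R_def add_nonneg_pos)
    have R2: "4 * (B\<^sup>2 + 1) / R\<^sup>2 = \<epsilon>\<^sup>2 / 2"
    proof -
      have p: "B\<^sup>2 + 1 > 0" by (simp add: add_nonneg_pos)
      have R_eq: "R\<^sup>2 = 8 * (B\<^sup>2 + 1) / \<epsilon>\<^sup>2" using p by (simp add: R_def power_divide)
      have "4 * p / (8 * p / \<epsilon>\<^sup>2) = \<epsilon>\<^sup>2 / 2" if "p > 0" for p :: real using that \<epsilon> by (simp add: field_simps)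
      from this[OF p] show ?thesis unfolding R_eq .
    qed
    define \<delta> where "\<delta> = \<epsilon> / sqrt (4 * R)"
    have \<delta>: "\<delta> > 0" using \<epsilon> R by (simp add: \<delta>_def)
    have \<delta>2: "2 * R * \<delta>\<^sup>2 = \<epsilon>\<^sup>2 / 2" using R by (simp add: \<delta>_def power_divide)
    obtain N where N: "\<forall>j\<ge>N. \<forall>k\<ge>N. \<forall>x. \<bar>x\<bar> \<le> R \<longrightarrow> norm (w j x - w k x) \<le> \<delta>"
      using local_cauchy[OF \<delta>, of R] R by auto
    have "l2 (\<lambda>x. w j x - w k x) \<le> \<epsilon>" if "j \<ge> N" "k \<ge> N" for j k
    proof (rule power2_le_imp_le)
      note d = dirac_pairD[OF dirac_pair_diff(1)[OF wd[of j] wd[of k]]]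
      have "(l2 (\<lambda>x. w j x - w k x))\<^sup>2 \<le> 2 * R * \<delta>\<^sup>2 + (l2 (\<lambda>x. x *\<^sub>R (w j x - w k x)))\<^sup>2 / R\<^sup>2"
        by (rule l2_le_local_plus_tail[OF d(2) d(4) R]) (use N that in blast)
      also have "\<dots> \<le> 2 * R * \<delta>\<^sup>2 + 4 * (B\<^sup>2 + 1) / R\<^sup>2"
        using xdiff by (intro add_left_mono divide_right_mono) auto
      also have "\<dots> = \<epsilon>\<^sup>2" unfolding R2 \<delta>2 by simp
      finally show "(l2 (\<lambda>x. w j x - w k x))\<^sup>2 \<le> \<epsilon>\<^sup>2" .
    qed (use \<epsilon> in simp)
    then show ?thesis by blast
  qed
  have conv: "convergent (\<lambda>n. w n x)" for x
  proof (rule Cauchy_convergent, rule CauchyI)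
    fix e :: real assume "e > 0"
    then obtain N where N: "\<forall>j\<ge>N. \<forall>k\<ge>N. \<forall>y. \<bar>y\<bar> \<le> \<bar>x\<bar> \<longrightarrow> norm (w j y - w k y) \<le> e / 2"
      using local_cauchy[of "e / 2" "\<bar>x\<bar>"] by auto
    show "\<exists>N. \<forall>j\<ge>N. \<forall>k\<ge>N. norm (w j x - w k x) < e"
    proof (intro exI allI impI)
      fix j k assume "j \<ge> N" "k \<ge> N"
      then have "norm (w j x - w k x) \<le> e / 2" using N by blast
      then show "norm (w j x - w k x) < e" using \<open>e > 0\<close> by simp
    qed
  qed
  define U where "U x = lim (\<lambda>n. w n x)" for x
  have wU: "(\<lambda>n. w n x) \<longlonglongrightarrow> U x" for x using conv[of x] by (simp add: U_def convergent_LIMSEQ_iff)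
  have unif: "\<exists>N. \<forall>k\<ge>N. \<forall>x. \<bar>x\<bar> \<le> R \<longrightarrow> norm (w k x - U x) \<le> \<delta>" if \<delta>: "\<delta> > 0" and R: "R \<ge> 0" for \<delta> R :: real
  proof -
    obtain N where N: "\<forall>j\<ge>N. \<forall>k\<ge>N. \<forall>x. \<bar>x\<bar> \<le> R \<longrightarrow> norm (w j x - w k x) \<le> \<delta>" using local_cauchy[OF \<delta> R] by blast
    have "norm (w k x - U x) \<le> \<delta>" if "k \<ge> N" "\<bar>x\<bar> \<le> R" for k x
    proof (rule LIMSEQ_le_const2)
      show "(\<lambda>j. norm (w k x - w j x)) \<longlonglongrightarrow> norm (w k x - U x)" by (intro tendsto_intros wU)
      show "\<exists>N. \<forall>j\<ge>N. norm (w k x - w j x) \<le> \<delta>" using N that by blast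
    qed
    then show ?thesis by blast
  qed
  have Uc: "continuous_on UNIV U"
  proof -
    have "isCont U x" for x
    proof -
      define R where "R = \<bar>x\<bar> + 1"
      have "uniform_limit {-R..R} w U sequentially"
      proof (rule uniform_limitI)
        fix e :: real assume "e > 0"
        then obtain N where N: "\<forall>k\<ge>N. \<forall>y. \<bar>y\<bar> \<le> R \<longrightarrow> norm (w k y - U y) \<le> e / 2"
          using unif[of "e / 2" R] by (auto simp: R_def)
        show "\<forall>\<^sub>F n in sequentially. \<forall>y\<in>{-R..R}. dist (w n y) (U y) < e"
        proof (rule eventually_mono[OF eventually_ge_at_top[of N]], rule ballI)
          fix n y assume "N \<le> n" "y \<in> {-R..R}"
          then have "norm (w n y - U y) \<le> e / 2" using N by (auto simp: abs_le_iff)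
          then show "dist (w n y) (U y) < e" using \<open>e > 0\<close> by (simp add: dist_norm)
        qed
      qed
      then have "continuous_on {-R..R} U"
        by (rule uniform_limit_theorem[rotated]) (auto intro!: always_eventually ac_deriv_continuous[OF wD(1)])
      moreover have "x \<in> interior {-R..R}" by (auto simp: R_def abs_real_def)
      ultimately show ?thesis by (rule continuous_on_interior)
    qed
    then show ?thesis by (simp add: continuous_at_imp_continuous_on)
  qed
  have Um: "U \<in> borel_measurable borel" by (rule borel_measurable_continuous_onI[OF Uc])
  have Ud: "square_integrable (\<lambda>x. U x - w k x) \<and> l2 (\<lambda>x. U x - w k x) \<le> \<epsilon>"
    if N: "\<forall>j\<ge>N. \<forall>k\<ge>N. l2 (\<lambda>x. w j x - w k x) \<le> \<epsilon>" and k: "k \<ge> N" for N k \<epsilon>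
  proof -
    have m: "(\<lambda>x. U x - w k x) \<in> borel_measurable borel"
      using Um square_integrable_measurable[OF wD(2)[of k]] by measurable
    have l: "AE x in lborel. (\<lambda>n. w n x - w k x) \<longlonglongrightarrow> U x - w k x" by (intro AE_I2 tendsto_intros wU)
    have e: "eventually (\<lambda>n. l2 (\<lambda>x. w n x - w k x) \<le> \<epsilon>) sequentially"
      by (rule eventually_mono[OF eventually_ge_at_top[of N]]) (use N k in blast)
    show ?thesis using square_integrable_Fatou[OF m square_integrable_diff[OF wD(2) wD(2)] l e] by blast
  qed
  have Us: "square_integrable U"
  proof -
    obtain N where N: "\<forall>j\<ge>N. \<forall>k\<ge>N. l2 (\<lambda>x. w j x - w k x) \<le> 1" using global_cauchy[of 1] by auto
    have "square_integrable (\<lambda>x. U x - w N x)" using Ud[OF N order_refl] by blast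
    from square_integrable_add[OF this wD(2)[of N]] show ?thesis by simp
  qed
  have U_lim: "(\<lambda>n. l2 (\<lambda>x. U x - w n x)) \<longlonglongrightarrow> 0"
  proof (rule LIMSEQ_I)
    fix e :: real assume "e > 0"
    then obtain N where N: "\<forall>j\<ge>N. \<forall>k\<ge>N. l2 (\<lambda>x. w j x - w k x) \<le> e / 2" using global_cauchy[of "e / 2"] by auto
    show "\<exists>N. \<forall>n\<ge>N. norm (l2 (\<lambda>x. U x - w n x) - 0) < e"
    proof (intro exI allI impI)
      fix n assume "n \<ge> N"
      then have "l2 (\<lambda>x. U x - w n x) \<le> e / 2" using Ud[OF N] by blast
      then show "norm (l2 (\<lambda>x. U x - w n x) - 0) < e" using \<open>e > 0\<close> l2_nonneg[of "\<lambda>x. U x - w n x"] by simp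
    qed
  qed
  let ?A = "\<lambda>x. airy_matrix m \<mu> x (U x)"
  have Ac: "continuous_on UNIV ?A" by (rule airy_matrix_continuous[OF Uc])
  have "ac_deriv U ?A"
  proof (rule ac_derivI[OF locally_integrable_continuous[OF Ac]])
    fix a b :: real assume ab: "a \<le> b"
    have Ai: "?A integrable_on {a..b}" by (rule integrable_continuous_interval[OF continuous_on_subset[OF Ac]]) simp
    define R where "R = max \<bar>a\<bar> \<bar>b\<bar>"
    have R: "R \<ge> 0" "\<And>x. x \<in> {a..b} \<Longrightarrow> \<bar>x\<bar> \<le> R" by (auto simp: R_def)
    define K where "K = \<bar>m\<bar> + R + \<bar>\<mu>\<bar>"
    have K: "K \<ge> 0" using R by (simp add: K_def)
    have "(\<lambda>n. (w n b - w n a) - integral {a..b} ?A) \<longlonglongrightarrow> 0"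
    proof (rule LIMSEQ_I)
      fix e :: real assume e: "e > 0"
      define t where "t = e / ((b - a + 1) / 2 + K * (b - a) + 1)"
      have den: "(b - a + 1) / 2 + K * (b - a) + 1 > 0" using ab K by (simp add: add_nonneg_pos)
      have t: "t > 0" using e den by (simp add: t_def)
      obtain N1 where N1: "\<And>n. n \<ge> N1 \<Longrightarrow> l2 (h n) < t" using LIMSEQ_D[OF h0 t] by auto
      obtain N2 where N2: "\<forall>k\<ge>N2. \<forall>x. \<bar>x\<bar> \<le> R \<longrightarrow> norm (w k x - U x) \<le> t" using unif[OF t R(1)] by blast
      show "\<exists>N. \<forall>n\<ge>N. norm ((w n b - w n a) - integral {a..b} ?A - 0) < e"
      proof (intro exI allI impI)
        fix n assume n: "n \<ge> max N1 N2"
        have I: "((\<lambda>x. w' n x - ?A x) has_integral ((w n b - w n a) - integral {a..b} ?A)) {a..b}"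
          by (rule has_integral_diff[OF ac_deriv_integral[OF wD(1) ab] integrable_integral[OF Ai]])
        have lh: "(\<lambda>x. norm (h n x)) integrable_on {a..b}"
          by (rule locally_integrable_integral(1)[OF locally_integrable_norm[OF square_integrable_locally_integrable[OF hs]]])
        have "norm ((w n b - w n a) - integral {a..b} ?A) \<le> integral {a..b} (\<lambda>x. norm (h n x) + K * t)"
          unfolding integral_unique[OF I, symmetric]
        proof (rule integral_norm_bound_integral)
          show "(\<lambda>x. w' n x - ?A x) integrable_on {a..b}" using I by blast
          show "(\<lambda>x. norm (h n x) + K * t) integrable_on {a..b}" using lh by (intro integrable_add) auto
          fix x assume x: "x \<in> {a..b}"
          have "w' n x - ?A x = - J (h n x) + airy_matrix m \<mu> x (w n x - U x)"
            using airy_matrix_solve[of "w' n" x m \<mu> "w n"] by (simp add: h_def w_def w'_def airy_matrix_diff)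
          then have "norm (w' n x - ?A x) \<le> norm (h n x) + norm (airy_matrix m \<mu> x (w n x - U x))"
            using norm_triangle_ineq[of "- J (h n x)" "airy_matrix m \<mu> x (w n x - U x)"] by simp
          also have "norm (airy_matrix m \<mu> x (w n x - U x)) \<le> (\<bar>m\<bar> + \<bar>x\<bar> + \<bar>\<mu>\<bar>) * norm (w n x - U x)"
            by (rule airy_matrix_norm)
          also have "\<dots> \<le> K * t"
            using R(2)[OF x] N2 n by (intro mult_mono) (auto simp: K_def)
          finally show "norm (w' n x - ?A x) \<le> norm (h n x) + K * t" by simp
        qed
        also have "\<dots> = integral {a..b} (\<lambda>x. norm (h n x)) + K * t * (b - a)"
          using Henstock_Kurzweil_Integration.integral_add[OF lh integrable_const_ivl[of "K * t"]] ab by (simp add: mult.commute)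
        also have "integral {a..b} (\<lambda>x. norm (h n x)) \<le> t * (b - a + 1) / 2"
          by (rule integral_norm_le_l2[OF hs t _ ab]) (use N1[of n] n in simp)
        also have "t * (b - a + 1) / 2 + K * t * (b - a) < t * ((b - a + 1) / 2 + K * (b - a) + 1)"
          using t by (simp add: algebra_simps)
        also have "\<dots> = e" using den by (simp add: t_def)
        finally show "norm ((w n b - w n a) - integral {a..b} ?A - 0) < e" by simp
      qed
    qed
    moreover have "(\<lambda>n. (w n b - w n a) - integral {a..b} ?A) \<longlonglongrightarrow> (U b - U a) - integral {a..b} ?A"
      by (intro tendsto_intros wU)
    ultimately have "(U b - U a) - integral {a..b} ?A = 0" using LIMSEQ_unique by blast
    then show "(?A has_integral (U b - U a)) {a..b}" using integrable_integral[OF Ai] by simp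
  qed
  then have "\<And>x. (U has_vector_derivative ?A x) (at x)" by (rule ac_deriv_has_vector_derivative[OF _ Ac])
  with r(1) Us U_lim show thesis by (intro that[of r U]) (simp_all add: w_def)
qed

text \<open>For \<open>e = (1, 1)\<close>, up to a factor, the Gaussian lies in the kernel of the adjoint of the massless part, so only the mass term
  is left.\<close>

lemma gauss_pairing:
  assumes dom: "dirac_pair (\<lambda>x. x) u v" and e: "e $ 2 = e $ 1"
  shows "(LINT x|lborel. dirac_expr m (\<lambda>x. x) \<mu> u v x \<bullet> gauss \<mu> e x) = m * (LINT x|lborel. u x \<bullet> (sigma3 *v gauss \<mu> e x))"
proof -
  note d = dirac_pairD[OF dom] and G = dirac_pairD[OF dirac_pair_gauss[of \<mu> e]]
  let ?p = "gauss \<mu> e" and ?p' = "gauss' \<mu> e"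
  define k where "k x = u x \<bullet> J (?p x)" for x
  define k' where "k' x = u x \<bullet> J (?p' x) + v x \<bullet> J (?p x)" for x
  have ac: "ac_deriv k k'"
    unfolding k_def[abs_def] k'_def[abs_def] by (rule ac_deriv_inner[OF d(1) ac_deriv_linear[OF bounded_linear_J G(1)]])
  have i: "integrable lborel k" "integrable lborel k'"
    unfolding k_def[abs_def] k'_def[abs_def]
    using d G by (auto intro!: square_integrable_inner square_integrable_J)
  have zero: "(LINT x|lborel. k' x) = 0" by (rule integral_ac_deriv_eq_0[OF ac i(2,1)])
  have iu: "integrable lborel (\<lambda>x. u x \<bullet> (sigma3 *v ?p x))"
    by (intro square_integrable_inner square_integrable_sigma d G)
  have pt: "dirac_expr m (\<lambda>x. x) \<mu> u v x \<bullet> ?p x = m * (u x \<bullet> (sigma3 *v ?p x)) - k' x" for x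
    unfolding dirac_expr_def k'_def gauss'_def
    by (simp add: spinor_simps(1-7) inner_complex_def gauss_def e algebra_simps)
  show ?thesis unfolding pt using i iu zero by simp
qed

lemma l2_gauss_diff:
  obtains D where "\<And>\<mu> \<mu>'. l2 (\<lambda>x. gauss \<mu> e x - gauss \<mu>' e x) \<le> \<bar>\<mu> - \<mu>'\<bar> * D"
proof
  fix \<mu> \<mu>' :: real
  have m: "(\<lambda>x. gauss \<mu> e x - gauss \<mu>' e x) \<in> borel_measurable borel"
    by (intro square_integrable_measurable square_integrable_diff square_integrable_gauss)
  have le: "norm (gauss \<mu> e x - gauss \<mu>' e x) \<le> \<bar>\<mu> - \<mu>'\<bar> * norm (x *\<^sub>R gauss 0 e x)" for x
  proof -
    have "cmod (cis (\<mu> * x) - cis (\<mu>' * x)) \<le> \<bar>\<mu> * x - \<mu>' * x\<bar>"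
    proof -
      have "cis (\<mu> * x) - cis (\<mu>' * x) = cis (\<mu>' * x) * (iexp (\<mu> * x - \<mu>' * x) - 1)"
        by (simp add: cis_conv_exp algebra_simps flip: exp_add)
      then have "cmod (cis (\<mu> * x) - cis (\<mu>' * x)) = cmod (iexp (\<mu> * x - \<mu>' * x) - 1)" by (simp add: norm_mult)
      also have "\<dots> \<le> \<bar>\<mu> * x - \<mu>' * x\<bar>" using iexp_approx1[of "\<mu> * x - \<mu>' * x" 0] by simp
      finally show ?thesis .
    qed
    moreover have "gauss \<mu> e x - gauss \<mu>' e x = (complex_of_real (exp (- (x\<^sup>2) / 2)) * (cis (\<mu> * x) - cis (\<mu>' * x))) *s e"
      by (simp add: gauss_def vec_eq_iff algebra_simps)
    ultimately have "norm (gauss \<mu> e x - gauss \<mu>' e x) \<le> exp (- (x\<^sup>2) / 2) * \<bar>\<mu> * x - \<mu>' * x\<bar> * norm e"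
      by (simp add: norm_vector_scalar_mult norm_mult mult_left_mono mult_right_mono)
    also have "\<mu> * x - \<mu>' * x = (\<mu> - \<mu>') * x" by (simp add: algebra_simps)
    finally show ?thesis by (simp add: norm_gauss abs_mult mult_ac)
  qed
  show "l2 (\<lambda>x. gauss \<mu> e x - gauss \<mu>' e x) \<le> \<bar>\<mu> - \<mu>'\<bar> * l2 (\<lambda>x. x *\<^sub>R gauss 0 e x)"
    using square_integrable_bound(2)[OF square_integrable_gauss(2) m le] by simp
qed

text \<open>The bound is proportional to the mass, as it must be by \<open>airy_lower_bound_le_mass\<close>; the difficulty is small mass. Let
  \<open>u n\<close> be normalised counterexamples for constants tending to 0. Compactness gives a limit \<open>U\<close>, and
  \<open>airy_kernel\<close> shows that the limit of the masses is 0 and \<open>U\<close> a Gaussian. By \<open>gauss_pairing\<close>, \<open>m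
  n\<close> times the pairing of \<open>u n\<close> with \<open>sigma3\<close> of a Gaussian is of smaller order than \<open>m n\<close>, so the limit
  \<open>Q\<close> of these pairings is 0. But \<open>Q\<close> is a positive multiple of the integral of \<open>exp (-x\<^sup>2) cos (2 \<mu>'
  x)\<close>.\<close>

lemma airy_uniform_lower_bound:
  assumes C: "0 \<le> C" and M0: "0 < M0"
  shows "\<exists>c>0. \<forall>m \<mu>. 0 < m \<and> m \<le> M0 \<and> \<bar>\<mu>\<bar> \<le> C \<longrightarrow> lower_bound m (\<lambda>x. x) \<mu> (c * m)"
proof (rule ccontr)
  let ?T = "\<lambda>m \<mu>. dirac_expr m (\<lambda>x. x) \<mu>"
  assume neg: "\<not> ?thesis"
  have "\<exists>m \<mu> u v. 0 < m \<and> m \<le> M0 \<and> \<bar>\<mu>\<bar> \<le> C \<and> dirac_pair (\<lambda>x. x) u v \<and> l2 u = 1 \<and>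
      l2 (?T m \<mu> u v) \<le> m / real (Suc n)" for n
  proof -
    have "1 / real (Suc n) > 0" by simp
    with neg obtain m \<mu> where m: "0 < m" "m \<le> M0" "\<bar>\<mu>\<bar> \<le> C" "\<not> lower_bound m (\<lambda>x. x) \<mu> (1 / real (Suc n) * m)"
      by blast
    then obtain u v where uv: "dirac_pair (\<lambda>x. x) u v" "l2 (?T m \<mu> u v) < 1 / real (Suc n) * m * l2 u"
      unfolding lower_bound_def by (auto simp: not_le)
    have "0 < 1 / real (Suc n) * m * l2 u" using uv(2) l2_nonneg[of "?T m \<mu> u v"] by linarith
    then have pos: "0 < l2 u" using m(1) by (simp add: zero_less_mult_iff zero_less_divide_iff)
    define k where "k = 1 / l2 u"
    have k: "k > 0" using pos by (simp add: k_def)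
    have d: "dirac_pair (\<lambda>x. x) (\<lambda>x. k *\<^sub>R u x) (\<lambda>x. k *\<^sub>R v x)" by (rule dirac_pair_scaleR[OF uv(1)])
    have "l2 (\<lambda>x. k *\<^sub>R u x) = 1" using pos k by (simp add: l2_scaleR k_def)
    moreover have "l2 (?T m \<mu> (\<lambda>x. k *\<^sub>R u x) (\<lambda>x. k *\<^sub>R v x)) \<le> m / real (Suc n)"
    proof -
      have "l2 (?T m \<mu> (\<lambda>x. k *\<^sub>R u x) (\<lambda>x. k *\<^sub>R v x)) = k * l2 (?T m \<mu> u v)"
        using k by (simp add: dirac_expr_scaleR[abs_def] l2_scaleR)
      also have "\<dots> \<le> k * (1 / real (Suc n) * m * l2 u)" using uv(2) k by (intro mult_left_mono) auto
      also have "\<dots> = m / real (Suc n)" using pos by (simp add: k_def)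
      finally show ?thesis .
    qed
    ultimately show ?thesis using m(1-3) d by blast
  qed
  then have "\<forall>n. \<exists>q. 0 < fst q \<and> fst q \<le> M0 \<and> \<bar>fst (snd q)\<bar> \<le> C \<and>
      dirac_pair (\<lambda>x. x) (fst (snd (snd q))) (snd (snd (snd q))) \<and> l2 (fst (snd (snd q))) = 1 \<and>
      l2 (?T (fst q) (fst (snd q)) (fst (snd (snd q))) (snd (snd (snd q)))) \<le> fst q / real (Suc n)"
    by (simp only: split_paired_Ex fst_conv snd_conv) blast
  from choice[OF this] obtain q where q: "\<forall>n. 0 < fst (q n) \<and> fst (q n) \<le> M0 \<and> \<bar>fst (snd (q n))\<bar> \<le> C \<and>
      dirac_pair (\<lambda>x. x) (fst (snd (snd (q n)))) (snd (snd (snd (q n)))) \<and> l2 (fst (snd (snd (q n)))) = 1 \<and>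
      l2 (?T (fst (q n)) (fst (snd (q n))) (fst (snd (snd (q n)))) (snd (snd (snd (q n))))) \<le> fst (q n) / real (Suc n)"
    by blast
  define par where "par n = (fst (q n), fst (snd (q n)))" for n
  have "par n \<in> {0..M0} \<times> {-C..C}" for n using q[rule_format, of n] by (auto simp: par_def abs_le_iff)
  moreover have "compact ({0..M0} \<times> {-C..C})" by (intro compact_Times compact_Icc)
  ultimately obtain l s where s: "strict_mono s" "(par \<circ> s) \<longlonglongrightarrow> l"
    unfolding compact_def by meson
  define m' \<mu>' where "m' = fst l" and "\<mu>' = snd l"
  define m where "m n = fst (q (s n))" for n
  define \<mu> where "\<mu> n = fst (snd (q (s n)))" for n
  define u where "u n = fst (snd (snd (q (s n))))" for n
  define v where "v n = snd (snd (snd (q (s n))))" for n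
  have m_lim: "m \<longlonglongrightarrow> m'" using tendsto_fst[OF s(2)] by (simp add: m_def[abs_def] par_def o_def m'_def)
  have \<mu>_lim: "\<mu> \<longlonglongrightarrow> \<mu>'" using tendsto_snd[OF s(2)] by (simp add: \<mu>_def[abs_def] par_def o_def \<mu>'_def)
  have m: "0 < m n" "m n \<le> M0" and dom: "dirac_pair (\<lambda>x. x) (u n) (v n)" and one: "l2 (u n) = 1"
    and T: "l2 (?T (m n) (\<mu> n) (u n) (v n)) \<le> m n * inverse (real (Suc (s n)))" for n
    using q[rule_format, of "s n"] by (simp_all add: m_def \<mu>_def u_def v_def divide_inverse)
  have inv_lim: "(\<lambda>n. inverse (real (Suc (s n)))) \<longlonglongrightarrow> 0"
    using LIMSEQ_subseq_LIMSEQ[OF LIMSEQ_inverse_real_of_nat s(1)] by (simp add: o_def)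
  note d = dirac_pairD[OF dom]
  have T_lim: "(\<lambda>n. l2 (?T m' \<mu>' (u n) (v n))) \<longlonglongrightarrow> 0"
  proof (rule tendsto_sandwich[of "\<lambda>n. 0" _ _ "\<lambda>n. M0 * inverse (real (Suc (s n))) + \<bar>m' - m n\<bar> + \<bar>\<mu>' - \<mu> n\<bar>"])
    have "l2 (?T m' \<mu>' (u n) (v n)) \<le> M0 * inverse (real (Suc (s n))) + \<bar>m' - m n\<bar> + \<bar>\<mu>' - \<mu> n\<bar>" for n
    proof -
      have sT: "square_integrable (?T (m n) (\<mu> n) (u n) (v n))" by (rule square_integrable_dirac_expr[OF dom])
      have s3: "square_integrable (\<lambda>x. (m' - m n) *\<^sub>R (sigma3 *v u n x))" "square_integrable (\<lambda>x. (\<mu>' - \<mu> n) *\<^sub>R u n x)"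
        by (intro square_integrable_scaleR square_integrable_sigma d)+
      have "?T m' \<mu>' (u n) (v n) = (\<lambda>x. (?T (m n) (\<mu> n) (u n) (v n) x + (m' - m n) *\<^sub>R (sigma3 *v u n x)) - (\<mu>' - \<mu> n) *\<^sub>R u n x)"
        by (simp add: fun_eq_iff dirac_expr_def algebra_simps)
      then have "l2 (?T m' \<mu>' (u n) (v n)) \<le> (l2 (?T (m n) (\<mu> n) (u n) (v n)) + l2 (\<lambda>x. (m' - m n) *\<^sub>R (sigma3 *v u n x))) + l2 (\<lambda>x. (\<mu>' - \<mu> n) *\<^sub>R u n x)"
        using order_trans[OF l2_triangle_diff[OF square_integrable_add[OF sT s3(1)] s3(2)] add_right_mono[OF l2_triangle[OF sT s3(1)]]] by simp
      also have "l2 (\<lambda>x. (m' - m n) *\<^sub>R (sigma3 *v u n x)) = \<bar>m' - m n\<bar>"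
        using l2_cong_norm[of "\<lambda>x. sigma3 *v u n x" "u n"] one[of n] by (simp add: l2_scaleR)
      also have "l2 (\<lambda>x. (\<mu>' - \<mu> n) *\<^sub>R u n x) = \<bar>\<mu>' - \<mu> n\<bar>" using one[of n] by (simp add: l2_scaleR)
      finally have "l2 (?T m' \<mu>' (u n) (v n)) \<le> l2 (?T (m n) (\<mu> n) (u n) (v n)) + \<bar>m' - m n\<bar> + \<bar>\<mu>' - \<mu> n\<bar>" .
      moreover have "m n * inverse (real (Suc (s n))) \<le> M0 * inverse (real (Suc (s n)))"
        using m(2)[of n] by (intro mult_right_mono) auto
      ultimately show ?thesis using T[of n] by linarith
    qed
    then show "\<forall>\<^sub>F n in sequentially. l2 (?T m' \<mu>' (u n) (v n)) \<le> M0 * inverse (real (Suc (s n))) + \<bar>m' - m n\<bar> + \<bar>\<mu>' - \<mu> n\<bar>"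
      by simp
    have "(\<lambda>n. M0 * inverse (real (Suc (s n))) + \<bar>m' - m n\<bar> + \<bar>\<mu>' - \<mu> n\<bar>) \<longlonglongrightarrow> M0 * 0 + \<bar>m' - m'\<bar> + \<bar>\<mu>' - \<mu>'\<bar>"
      by (intro tendsto_intros inv_lim m_lim \<mu>_lim)
    then show "(\<lambda>n. M0 * inverse (real (Suc (s n))) + \<bar>m' - m n\<bar> + \<bar>\<mu>' - \<mu> n\<bar>) \<longlonglongrightarrow> 0" by simp
  qed auto
  obtain r U where r: "strict_mono r" and U: "\<And>x. (U has_vector_derivative airy_matrix m' \<mu>' x (U x)) (at x)"
    and Us: "square_integrable U" and U_lim: "(\<lambda>n. l2 (\<lambda>x. U x - u (r n) x)) \<longlonglongrightarrow> 0"
    using airy_compactness[OF dom one T_lim] by blast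
  note ker = airy_kernel[OF U[unfolded airy_matrix_def] Us]
  have U1: "1 \<le> l2 U"
  proof (rule LIMSEQ_le_const[of "\<lambda>n. l2 (\<lambda>x. U x - u (r n) x) + l2 U"])
    show "(\<lambda>n. l2 (\<lambda>x. U x - u (r n) x) + l2 U) \<longlonglongrightarrow> l2 U" using tendsto_add[OF U_lim tendsto_const[of "l2 U"]] by simp
    have "1 \<le> l2 (\<lambda>x. U x - u (r n) x) + l2 U" for n
      using l2_triangle_diff[OF Us square_integrable_diff[OF Us d(2)[of "r n"]]] one[of "r n"] by simp
    then show "\<exists>N. \<forall>n\<ge>N. 1 \<le> l2 (\<lambda>x. U x - u (r n) x) + l2 U" by blast
  qed
  have m'0: "m' = 0"
  proof (rule ccontr)
    assume "m' \<noteq> 0"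
    then have "U = (\<lambda>x. 0)" using ker(2) by auto
    then show False using U1 by (simp add: l2_def)
  qed
  then obtain \<kappa> where \<kappa>: "\<And>x. U x = gauss (- \<mu>') (\<chi> i. if i = 1 then \<kappa> else - \<kappa>) x" using ker(3) by blast
  define e :: "complex ^ 2" where "e = (\<chi> i. \<kappa>)"
  define e' :: "complex ^ 2" where "e' = (\<chi> i. if i = 1 then \<kappa> else - \<kappa>)"
  have \<kappa>0: "\<kappa> \<noteq> 0"
  proof
    assume "\<kappa> = 0"
    then have "U = (\<lambda>x. 0)" by (auto simp: \<kappa> gauss_def vec_eq_iff)
    then show False using U1 by (simp add: l2_def)
  qed
  have e2: "e $ 2 = e $ 1" by (simp add: e_def)
  have s3g: "sigma3 *v gauss \<alpha> e x = gauss \<alpha> e' x" for \<alpha> x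
    by (simp add: gauss_def vec_eq_iff forall_2 sigma3_component e_def e'_def)
  have U_eq: "U = gauss (- \<mu>') e'" using \<kappa> by (auto simp: e'_def)
  have Ue': "U x \<bullet> gauss \<mu>' e' x = 2 * (cmod \<kappa>)\<^sup>2 * (exp (- (x\<^sup>2)) * cos (2 * \<mu>' * x))" for x
  proof -
    define A where "A = exp (- (x\<^sup>2) / 2)"
    have ex: "exp (- (x\<^sup>2)) = A * A" unfolding A_def by (simp flip: exp_add)
    have "(cis (- \<mu>' * x) * \<kappa>) \<bullet> (cis (\<mu>' * x) * \<kappa>) = (cmod \<kappa>)\<^sup>2 * cos (2 * (\<mu>' * x))"
      unfolding cos_double cmod_power2 by (simp add: inner_complex_def power2_eq_square algebra_simps)
    then have c: "(complex_of_real a * cis (- \<mu>' * x) * \<kappa>) \<bullet> (complex_of_real a * cis (\<mu>' * x) * \<kappa>) = (a * a) * ((cmod \<kappa>)\<^sup>2 * cos (2 * (\<mu>' * x)))" for a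
      by (simp add: mult.assoc inner_mult_left inner_mult_right flip: scaleR_conv_of_real)
    show ?thesis
      unfolding U_eq inner_spinor gauss_def ex A_def[symmetric]
      using c[of A] by (simp add: e'_def algebra_simps)
  qed
  define P where "P n = (LINT x|lborel. u (r n) x \<bullet> gauss (\<mu> (r n)) e' x)" for n
  define G where "G = l2 (gauss 0 e)"
  have G: "l2 (gauss \<alpha> e) = G" "l2 (gauss \<alpha> e') = l2 (gauss 0 e')" for \<alpha>
    unfolding G_def by (rule l2_cong_norm, simp add: norm_gauss)+
  have P_le: "\<bar>P n\<bar> \<le> inverse (real (Suc (s (r n)))) * G" for n
  proof -
    have "m (r n) * P n = (LINT x|lborel. ?T (m (r n)) (\<mu> (r n)) (u (r n)) (v (r n)) x \<bullet> gauss (\<mu> (r n)) e x)"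
      unfolding P_def gauss_pairing[OF dom e2] s3g ..
    also have "\<bar>\<dots>\<bar> \<le> l2 (?T (m (r n)) (\<mu> (r n)) (u (r n)) (v (r n))) * l2 (gauss (\<mu> (r n)) e)"
      by (rule Cauchy_Schwarz_l2[OF square_integrable_dirac_expr[OF dom] square_integrable_gauss(1)])
    also have "\<dots> \<le> (m (r n) * inverse (real (Suc (s (r n))))) * G"
      unfolding G by (rule mult_right_mono[OF T]) (simp add: G_def)
    finally have "m (r n) * \<bar>P n\<bar> \<le> m (r n) * (inverse (real (Suc (s (r n)))) * G)"
      using m(1)[of "r n"] by (simp add: abs_mult mult.assoc)
    then show ?thesis using m(1)[of "r n"] by (rule mult_left_le_imp_le)
  qed
  have P0: "P \<longlonglongrightarrow> 0"
  proof (rule Lim_null_comparison)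
    show "\<forall>\<^sub>F n in sequentially. norm (P n) \<le> inverse (real (Suc (s (r n)))) * G" using P_le by simp
    show "(\<lambda>n. inverse (real (Suc (s (r n)))) * G) \<longlonglongrightarrow> 0"
      using tendsto_mult_left_zero[OF LIMSEQ_subseq_LIMSEQ[OF inv_lim r], of G] by (simp add: o_def)
  qed
  obtain D where D: "\<And>\<mu> \<mu>'. l2 (\<lambda>x. gauss \<mu> e' x - gauss \<mu>' e' x) \<le> \<bar>\<mu> - \<mu>'\<bar> * D" using l2_gauss_diff by blast
  define Q where "Q = (LINT x|lborel. U x \<bullet> gauss \<mu>' e' x)"
  have "(\<lambda>n. P n - Q) \<longlonglongrightarrow> 0"
  proof (rule Lim_null_comparison)
    have "\<bar>P n - Q\<bar> \<le> \<bar>\<mu> (r n) - \<mu>'\<bar> * D + l2 (\<lambda>x. U x - u (r n) x) * l2 (gauss 0 e')" for n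
    proof -
      note g = square_integrable_gauss(1)[of _ e']
      have i: "integrable lborel (\<lambda>x. u (r n) x \<bullet> gauss (\<mu> (r n)) e' x)" "integrable lborel (\<lambda>x. u (r n) x \<bullet> gauss \<mu>' e' x)"
        "integrable lborel (\<lambda>x. U x \<bullet> gauss \<mu>' e' x)"
        by (intro square_integrable_inner d g Us)+
      have e1: "(LINT x|lborel. u (r n) x \<bullet> (gauss (\<mu> (r n)) e' x - gauss \<mu>' e' x)) = P n - (LINT x|lborel. u (r n) x \<bullet> gauss \<mu>' e' x)"
        unfolding P_def inner_diff_right using i by simp
      have e2: "(LINT x|lborel. (U x - u (r n) x) \<bullet> gauss \<mu>' e' x) = Q - (LINT x|lborel. u (r n) x \<bullet> gauss \<mu>' e' x)"
        unfolding Q_def inner_diff_left using i by simp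
      have "\<bar>LINT x|lborel. u (r n) x \<bullet> (gauss (\<mu> (r n)) e' x - gauss \<mu>' e' x)\<bar> \<le> 1 * (\<bar>\<mu> (r n) - \<mu>'\<bar> * D)"
        using Cauchy_Schwarz_l2[OF d(2)[of "r n"] square_integrable_diff[OF g g], of "\<mu> (r n)" \<mu>'] D[of "\<mu> (r n)" \<mu>'] one[of "r n"] by simp
      moreover have "\<bar>LINT x|lborel. (U x - u (r n) x) \<bullet> gauss \<mu>' e' x\<bar> \<le> l2 (\<lambda>x. U x - u (r n) x) * l2 (gauss 0 e')"
        using Cauchy_Schwarz_l2[OF square_integrable_diff[OF Us d(2)] g, of "r n" \<mu>'] G(2)[of \<mu>'] by simp
      ultimately show ?thesis using e1 e2 by linarith
    qed
    then show "\<forall>\<^sub>F n in sequentially. norm (P n - Q) \<le> \<bar>\<mu> (r n) - \<mu>'\<bar> * D + l2 (\<lambda>x. U x - u (r n) x) * l2 (gauss 0 e')" by simp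
    have "(\<lambda>n. \<mu> (r n)) \<longlonglongrightarrow> \<mu>'" using LIMSEQ_subseq_LIMSEQ[OF \<mu>_lim r] by (simp add: o_def)
    then have "(\<lambda>n. \<bar>\<mu> (r n) - \<mu>'\<bar> * D + l2 (\<lambda>x. U x - u (r n) x) * l2 (gauss 0 e')) \<longlonglongrightarrow> \<bar>\<mu>' - \<mu>'\<bar> * D + 0 * l2 (gauss 0 e')"
      by (intro tendsto_intros U_lim)
    then show "(\<lambda>n. \<bar>\<mu> (r n) - \<mu>'\<bar> * D + l2 (\<lambda>x. U x - u (r n) x) * l2 (gauss 0 e')) \<longlonglongrightarrow> 0" by simp
  qed
  from tendsto_diff[OF P0 this] have "(\<lambda>n. Q) \<longlonglongrightarrow> 0" by simp
  then have "Q = 0" using LIMSEQ_unique tendsto_const by blast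
  moreover have "Q > 0"
    unfolding Q_def Ue' using integral_gaussian_cos_pos[of \<mu>'] \<kappa>0 by simp
  ultimately show False by simp
qed

section \<open>The potential near and away from the turning point\<close>

text \<open>By the bound on \<open>V''\<close>, the logarithm of \<open>V'\<close> has derivative at most \<open>2 C2 / X\<close> on \<open>[X/2,
  3X/2]\<close>, so \<open>V'\<close> changes there at most by the factor \<open>exp C2\<close>; inserted once more, this bounds \<open>V''\<close> by
  a multiple of \<open>V' X / X\<close>.\<close>

lemma potential_near_turning_point:
  fixes V V' V'' :: "real \<Rightarrow> real"
  assumes D1: "\<And>x. (V has_real_derivative V' x) (at x)"
    and D2: "\<And>x. x0 < x \<Longrightarrow> (V' has_real_derivative V'' x) (at x)"
    and pos: "\<And>x. x0 < x \<Longrightarrow> 0 < V' x"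
    and sec: "\<And>x. x0 < x \<Longrightarrow> \<bar>V'' x\<bar> \<le> C2 * (V' x / x)" and C2: "0 < C2"
    and X: "0 \<le> x0" "2 * x0 < X" and near: "\<bar>x - X\<bar> \<le> X / 2"
  shows "V' x \<le> exp C2 * V' X"
    "\<bar>V x - V X - V' X * (x - X)\<bar> \<le> 2 * C2 * exp C2 * V' X * (x - X)\<^sup>2 / X"
proof -
  define S where "S = {X / 2..3 * X / 2}"
  have X0: "0 < X" using X by linarith
  have S: "x0 < y" "X / 2 \<le> y" "0 < y" if "y \<in> S" for y using that X X0 by (auto simp: S_def)
  have convS: "convex S" by (simp add: S_def)
  have XS: "X \<in> S" using X0 by (simp add: S_def)
  have inS: "y \<in> S" if "\<bar>y - X\<bar> \<le> X / 2" for y using that by (auto simp: S_def abs_real_def split: if_splits)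
  have V'_le: "V' y \<le> exp C2 * V' X" if y: "y \<in> S" for y
  proof -
    have "norm (ln (V' y) - ln (V' X)) \<le> (C2 * (2 / X)) * norm (y - X)"
    proof (rule field_differentiable_bound[OF convS])
      fix z assume z: "z \<in> S"
      show "((\<lambda>z. ln (V' z)) has_field_derivative V'' z / V' z) (at z within S)"
        using D2[OF S(1)[OF z]] pos[OF S(1)[OF z]]
        by (auto intro!: derivative_eq_intros intro: has_field_derivative_at_within)
      have p: "0 < V' z" by (rule pos[OF S(1)[OF z]])
      have "\<bar>V'' z\<bar> / V' z \<le> C2 * (V' z / z) / V' z"
        using sec[OF S(1)[OF z]] p by (intro divide_right_mono) auto
      also have "\<dots> = C2 * (1 / z)" using p by simp
      also have "\<dots> \<le> C2 * (2 / X)" using S[OF z] X0 C2 by (intro mult_left_mono) (auto simp: field_simps)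
      finally show "norm (V'' z / V' z) \<le> C2 * (2 / X)" using p by simp
    qed (use y XS in auto)
    also have "\<dots> \<le> (C2 * (2 / X)) * (X / 2)" using y X0 C2 by (intro mult_left_mono) (auto simp: S_def abs_real_def)
    also have "\<dots> = C2" using X0 by simp
    finally have "ln (V' y) \<le> C2 + ln (V' X)" by simp
    then have "exp (ln (V' y)) \<le> exp (C2 + ln (V' X))" by simp
    then show ?thesis using pos[OF S(1)[OF y]] pos[OF S(1)[OF XS]] by (simp add: exp_add)
  qed
  show "V' x \<le> exp C2 * V' X" by (rule V'_le[OF inS[OF near]])
  define L where "L = 2 * C2 * exp C2 * V' X / X"
  have L0: "0 \<le> L" using C2 X0 pos[OF S(1)[OF XS]] by (simp add: L_def)
  have V''_le: "\<bar>V'' z\<bar> \<le> L" if z: "z \<in> S" for z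
  proof -
    have "\<bar>V'' z\<bar> \<le> C2 * (V' z / z)" by (rule sec[OF S(1)[OF z]])
    also have "\<dots> \<le> C2 * (exp C2 * V' X / (X / 2))"
      using V'_le[OF z] S[OF z] X0 C2 pos[OF S(1)[OF z]] by (intro mult_left_mono frac_le) auto
    also have "\<dots> = L" by (simp add: L_def)
    finally show ?thesis .
  qed
  have V'_diff: "\<bar>V' y - V' X\<bar> \<le> L * \<bar>y - X\<bar>" if y: "y \<in> S" for y
  proof -
    have "norm (V' y - V' X) \<le> L * norm (y - X)"
      by (rule field_differentiable_bound[OF convS, where f' = V''])
         (use D2 S V''_le y XS in \<open>auto intro: has_field_derivative_at_within\<close>)
    then show ?thesis by simp
  qed
  define S' where "S' = {X - \<bar>x - X\<bar>..X + \<bar>x - X\<bar>}"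
  have S'S: "y \<in> S" if "y \<in> S'" for y using that near by (intro inS) (auto simp: S'_def abs_real_def split: if_splits)
  have "norm ((V x - V' X * x) - (V X - V' X * X)) \<le> (L * \<bar>x - X\<bar>) * norm (x - X)"
  proof (rule field_differentiable_bound[of S' "\<lambda>y. V y - V' X * y" "\<lambda>y. V' y - V' X"])
    show "convex S'" by (simp add: S'_def)
    fix z assume z: "z \<in> S'"
    show "((\<lambda>y. V y - V' X * y) has_field_derivative V' z - V' X) (at z within S')"
      using has_field_derivative_at_within[OF D1[of z]] by (auto intro!: derivative_eq_intros)
    have "\<bar>V' z - V' X\<bar> \<le> L * \<bar>z - X\<bar>" by (rule V'_diff[OF S'S[OF z]])
    also have "\<dots> \<le> L * \<bar>x - X\<bar>" using z L0 by (intro mult_left_mono) (auto simp: S'_def abs_real_def split: if_splits)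
    finally show "norm (V' z - V' X) \<le> L * \<bar>x - X\<bar>" by simp
  qed (auto simp: S'_def)
  also have "(L * \<bar>x - X\<bar>) * norm (x - X) = 2 * C2 * exp C2 * V' X * (x - X)\<^sup>2 / X"
    by (simp add: L_def power2_eq_square abs_mult_self_eq mult.assoc)
  finally show "\<bar>V x - V X - V' X * (x - X)\<bar> \<le> 2 * C2 * exp C2 * V' X * (x - X)\<^sup>2 / X"
    by (simp add: algebra_simps)
qed

text \<open>All constants are independent of \<open>b\<close>; \<open>b\<close> only has to be so large that \<open>large1\<close>,
  \<open>large2\<close>, \<open>large3\<close> hold. Within \<open>\<theta> X\<close> of the turning point the quadratic Taylor error is at most half
  of the linear term, and monotonicity carries the bound on \<open>|V - b|\<close> outwards. In the bound on \<open>V'\<close>, away from the turning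
  point \<open>V - b\<close> is at least of order \<open>b\<close> in absolute value. Where \<open>V > b/2\<close>, the estimate \<open>V' \<le> C1 V
  / x\<close> is linear in \<open>V\<close> and therefore small compared with \<open>(V - b)\<^sup>2\<close>; where \<open>V \<le> b/2\<close>,
  \<open>V\<^sup>2 \<le> (V - b)\<^sup>2\<close> and the hypothesis \<open>|V'| \<le> \<epsilon> V\<^sup>2 + M\<close> applies. The number \<open>(1 +
  \<epsilon>) / 2\<close> is a value between \<open>\<epsilon>\<close> and 1 that leaves room for \<open>M\<close>.\<close>

lemma potential_global:
  fixes V V' V'' :: "real \<Rightarrow> real"
  assumes D1: "\<And>x. (V has_real_derivative V' x) (at x)"
    and D2_all: "\<forall>x>x0. (V' has_real_derivative V'' x) (at x)"
    and pos_all: "\<forall>x>x0. 0 < V' x"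
    and sec_all: "\<forall>x>x0. \<bar>V'' x\<bar> \<le> C2 * (V' x / x)" and C2: "0 < C2"
    and up_all: "\<forall>x>x0. V' x \<le> C1 * (V x / x)" and lo_all: "\<forall>x>x0. V x / x \<le> C1 * V' x" and C1: "0 < C1"
    and left_all: "\<forall>x\<le>x0 + 1. V x \<le> B"
    and gl: "\<And>x. \<bar>V' x\<bar> \<le> \<epsilon> * (V x)\<^sup>2 + M" and \<epsilon>: "0 < \<epsilon>" "\<epsilon> < 1" and M: "0 < M"
    and X: "0 \<le> x0" "2 * x0 < X" "2 \<le> X" and b: "V X = b" "0 < b" "2 * B \<le> b"
    and K1: "K1 = 2 * C2 * exp C2" and \<theta>: "\<theta> = min (1/2) (min (1 / (2 * K1)) (1 / (2 * C1)))" and \<kappa>: "\<kappa> = \<theta> / (2 * C1)"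
    and large1: "C1 * (1 + 1 / \<kappa>) / (\<kappa> * b) \<le> (1 + \<epsilon>) / 2"
    and large2: "C1 / (\<kappa>\<^sup>2 * b) \<le> (1 + \<epsilon>) / 2"
    and large3: "\<epsilon> + 4 * M / b\<^sup>2 \<le> (1 + \<epsilon>) / 2"
  shows "b / (C1 * X) \<le> V' X"
    "\<And>x. \<bar>V' x\<bar> \<le> exp C2 * V' X + (1 + \<epsilon>) / 2 * (V x - b)\<^sup>2"
    "\<And>r x. 0 < r \<Longrightarrow> r \<le> \<theta> * X \<Longrightarrow> \<bar>x - X\<bar> \<le> r \<Longrightarrow> \<bar>V x - b - V' X * (x - X)\<bar> \<le> K1 * V' X * (x - X)\<^sup>2 / X"
    "\<And>r x. 0 < r \<Longrightarrow> r \<le> \<theta> * X \<Longrightarrow> \<bar>x - X\<bar> \<le> r \<Longrightarrow> V' X * \<bar>x - X\<bar> / 2 \<le> \<bar>V x - b\<bar>"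
    "\<And>r x. 0 < r \<Longrightarrow> r \<le> \<theta> * X \<Longrightarrow> r \<le> \<bar>x - X\<bar> \<Longrightarrow> V' X * r / 2 \<le> \<bar>V x - b\<bar>"
proof -
  note D2 = D2_all[rule_format] and pos = pos_all[rule_format] and sec = sec_all[rule_format]
    and up = up_all[rule_format] and lo = lo_all[rule_format] and left = left_all[rule_format]
  have X0: "0 < X" "x0 < X" using X by linarith+
  define S where "S = V' X"
  have S: "0 < S" unfolding S_def by (rule pos[OF X0(2)])
  have K1p: "0 < K1" using C2 by (simp add: K1)
  have \<theta>p: "0 < \<theta>" "\<theta> \<le> 1/2" "\<theta> \<le> 1 / (2 * K1)" "\<theta> \<le> 1 / (2 * C1)" using K1p C1 by (auto simp: \<theta>)
  have K\<theta>: "K1 * \<theta> \<le> 1/2" "C1 * \<theta> \<le> 1/2" using \<theta>p K1p C1 by (auto simp: field_simps)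
  have \<kappa>p: "0 < \<kappa>" using \<theta>p C1 by (simp add: \<kappa>)
  show lower: "b / (C1 * X) \<le> V' X" using lo[OF X0(2)] b C1 X0 by (simp add: field_simps)
  have upper: "S * X \<le> C1 * b" using up[OF X0(2)] b X0 by (simp add: S_def field_simps)
  have mono: "V x \<le> V y" if "x0 < x" "x \<le> y" for x y
    by (rule DERIV_nonneg_imp_nondecreasing[OF that(2)]) (use D1 pos that in \<open>force intro: less_imp_le\<close>)
  have taylor: "\<bar>V x - b - S * (x - X)\<bar> \<le> K1 * S * (x - X)\<^sup>2 / X" if "\<bar>x - X\<bar> \<le> \<theta> * X" for x
  proof -
    have "\<theta> * X \<le> 1/2 * X" using \<theta>p X0 by (intro mult_right_mono) auto
    then have "\<bar>x - X\<bar> \<le> X / 2" using that by simp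
    from potential_near_turning_point(2)[OF D1 D2 pos sec C2 X(1,2) this]
    show ?thesis unfolding K1 S_def b(1) by simp
  qed
  have error: "K1 * S * (x - X)\<^sup>2 / X \<le> S * \<bar>x - X\<bar> / 2" if "\<bar>x - X\<bar> \<le> \<theta> * X" for x
  proof -
    have "K1 * S * (x - X)\<^sup>2 / X = (S * \<bar>x - X\<bar>) * (K1 * \<bar>x - X\<bar> / X)" by (simp add: power2_eq_square)
    also have "\<dots> \<le> (S * \<bar>x - X\<bar>) * (1/2)"
    proof (rule mult_left_mono)
      have "K1 * \<bar>x - X\<bar> / X \<le> K1 * (\<theta> * X) / X" using that K1p X0 by (intro divide_right_mono mult_left_mono) auto
      also have "\<dots> = K1 * \<theta>" using X0 by simp
      finally show "K1 * \<bar>x - X\<bar> / X \<le> 1/2" using K\<theta> by linarith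
    qed (use S in simp)
    finally show ?thesis by simp
  qed
  have far_right: "S * r / 2 \<le> V x - b" if r: "0 < r" "r \<le> \<theta> * X" "X + r \<le> x" for r x
  proof -
    have "\<bar>(X + r) - X\<bar> \<le> \<theta> * X" using r by simp
    note le = this
    have e: "X + r - X = r" "\<bar>r\<bar> = r" using r by auto
    have "S * r / 2 \<le> V (X + r) - b"
      using taylor[OF le, unfolded e] error[OF le, unfolded e] by linarith
    then show ?thesis using mono[of "X + r" x] r X0 by linarith
  qed
  have far_left: "V x - b \<le> - (S * r / 2)" if r: "0 < r" "r \<le> \<theta> * X" "x \<le> X - r" for r x
  proof (cases "x0 < x")
    case True
    have "\<bar>(X - r) - X\<bar> \<le> \<theta> * X" using r by simp
    note le = this
    have e: "X - r - X = - r" "\<bar>- r\<bar> = r" "S * - r = - (S * r)" using r by auto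
    have "V (X - r) - b \<le> - (S * r / 2)"
      using taylor[OF le, unfolded e] error[OF le, unfolded e] by linarith
    then show ?thesis using mono[OF True r(3)] by linarith
  next
    case False
    have "S * r \<le> S * (\<theta> * X)" using r S by (intro mult_left_mono) auto
    also have "\<dots> = \<theta> * (S * X)" by simp
    also have "\<dots> \<le> \<theta> * (C1 * b)" using upper \<theta>p by (intro mult_left_mono) auto
    also have "\<dots> \<le> 1/2 * b" using K\<theta>(2) b by (simp add: mult.assoc[symmetric] mult.commute[of \<theta>] mult_right_mono)
    finally have "S * r / 2 \<le> b / 4" by simp
    then show ?thesis using left[of x] False b by simp
  qed
  have \<theta>X: "0 < \<theta> * X" using \<theta>p X0 by simp
  have \<theta>X2: "\<theta> * X \<le> X / 2" using mult_right_mono[OF \<theta>p(2), of X] X0 by simp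
  \<comment> \<open>At distance \<open>\<theta> X\<close> and beyond, \<open>V - b\<close> is at least \<open>\<kappa> b\<close> in absolute
    value.\<close>
  have "\<kappa> * b \<le> S * (\<theta> * X) / 2"
  proof -
    have "b / (C1 * X) * (\<theta> * X) / 2 \<le> S * (\<theta> * X) / 2"
      using lower \<theta>X by (intro divide_right_mono mult_right_mono) (auto simp: S_def)
    then show ?thesis using X0 by (simp add: \<kappa> field_simps)
  qed
  note \<kappa>b = this
  have \<epsilon>': "0 \<le> (1 + \<epsilon>) / 2" using \<epsilon> by simp
  show "\<bar>V' x\<bar> \<le> exp C2 * V' X + (1 + \<epsilon>) / 2 * (V x - b)\<^sup>2" for x
  proof -
    consider "\<bar>x - X\<bar> \<le> X / 2" | "X + X / 2 < x" | "x < X - X / 2" "V x \<le> b / 2" | "x < X - X / 2" "b / 2 < V x"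
    proof -
      have "\<bar>x - X\<bar> \<le> X / 2 \<or> X + X / 2 < x \<or> x < X - X / 2" by arith
      then show thesis using that by (meson not_le)
    qed
    then show ?thesis
    proof cases
      case 1
      then have "x0 < x" using X X0 by arith
      have "0 \<le> (1 + \<epsilon>) / 2 * (V x - b)\<^sup>2" using \<epsilon>' by simp
      then show ?thesis
        using potential_near_turning_point(1)[OF D1 D2 pos sec C2 X(1,2) 1] pos[OF \<open>x0 < x\<close>] by simp
    next
      case 2
      then have x: "x0 < x" "1 \<le> x" "X + \<theta> * X \<le> x" using X X0 \<theta>X2 by linarith+
      have W: "\<kappa> * b \<le> V x - b" using far_right[OF \<theta>X order_refl x(3)] \<kappa>b by linarith
      have Wp: "0 < V x - b" using W \<kappa>p b by (smt (verit) mult_pos_pos)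
      have "V x \<le> (1 + 1 / \<kappa>) * (V x - b)"
      proof -
        have "b \<le> (V x - b) / \<kappa>" using W \<kappa>p by (simp add: field_simps)
        then show ?thesis by (simp add: distrib_right)
      qed
      have "V' x \<le> C1 * (V x / x)" by (rule up[OF x(1)])
      also have "\<dots> \<le> C1 * V x"
        using x(2) C1 Wp b by (intro mult_left_mono) (auto simp: field_simps)
      also have "\<dots> \<le> C1 * ((1 + 1 / \<kappa>) * (V x - b))" using \<open>V x \<le> (1 + 1 / \<kappa>) * (V x - b)\<close> C1 by (intro mult_left_mono) auto
      also have "\<dots> = (C1 * (1 + 1 / \<kappa>) / (\<kappa> * b)) * (V x - b) * (\<kappa> * b)" using \<kappa>p b by simp
      also have "\<dots> \<le> (1 + \<epsilon>) / 2 * (V x - b) * (V x - b)"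
        using large1 W Wp \<epsilon>' \<kappa>p b C1 by (intro mult_mono) auto
      finally have "V' x \<le> (1 + \<epsilon>) / 2 * (V x - b)\<^sup>2" by (simp add: power2_eq_square mult.assoc)
      moreover have "0 \<le> exp C2 * V' X" using S by (simp add: S_def)
      ultimately show ?thesis using pos[OF x(1)] by simp
    next
      case 3
      have W: "b / 2 \<le> b - V x" "\<bar>V x\<bar> \<le> b - V x" using 3 b by (auto simp: abs_le_iff)
      have V2: "(V x)\<^sup>2 \<le> (V x - b)\<^sup>2"
      proof -
        have "\<bar>V x\<bar>\<^sup>2 \<le> (b - V x)\<^sup>2" using W by (intro power_mono) auto
        then show ?thesis by (simp add: power2_commute)
      qed
      have b2: "b\<^sup>2 / 4 \<le> (V x - b)\<^sup>2"
      proof -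
        have "(b / 2)\<^sup>2 \<le> (b - V x)\<^sup>2" using W b by (intro power_mono) auto
        then show ?thesis by (simp add: power2_commute power_divide)
      qed
      have "\<bar>V' x\<bar> \<le> \<epsilon> * (V x)\<^sup>2 + M" by (rule gl)
      also have "\<epsilon> * (V x)\<^sup>2 \<le> \<epsilon> * (V x - b)\<^sup>2" using V2 \<epsilon> by (intro mult_left_mono) auto
      also have "M = 4 * M / b\<^sup>2 * (b\<^sup>2 / 4)" using b by simp
      also have "4 * M / b\<^sup>2 * (b\<^sup>2 / 4) \<le> 4 * M / b\<^sup>2 * (V x - b)\<^sup>2" using b2 M by (intro mult_left_mono) auto
      also have "\<epsilon> * (V x - b)\<^sup>2 + 4 * M / b\<^sup>2 * (V x - b)\<^sup>2 = (\<epsilon> + 4 * M / b\<^sup>2) * (V x - b)\<^sup>2" by (simp add: distrib_right)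
      also have "\<dots> \<le> (1 + \<epsilon>) / 2 * (V x - b)\<^sup>2" using large3 by (intro mult_right_mono) auto
      finally have "\<bar>V' x\<bar> \<le> (1 + \<epsilon>) / 2 * (V x - b)\<^sup>2" by simp
      moreover have "0 \<le> exp C2 * V' X" using S by (simp add: S_def)
      ultimately show ?thesis by simp
    next
      case 4
      have x: "x0 < x" "1 \<le> x"
      proof -
        have "\<not> x \<le> x0 + 1" using left[of x] 4 b by force
        then show "x0 < x" "1 \<le> x" using X by auto
      qed
      have xl: "x \<le> X - \<theta> * X" using 4 \<theta>X2 by linarith
      have W: "\<kappa> * b \<le> b - V x" using far_left[OF \<theta>X order_refl xl] \<kappa>b by linarith
      have W2: "(\<kappa> * b)\<^sup>2 \<le> (V x - b)\<^sup>2"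
        using power_mono[OF W, of 2] \<kappa>p b by (simp add: power2_commute)
      have "0 < \<kappa> * b" using \<kappa>p b by simp
      then have Vb: "V x \<le> b" using W by linarith
      have "V' x \<le> C1 * (V x / x)" by (rule up[OF x(1)])
      also have "\<dots> \<le> C1 * V x" using x(2) C1 4 b by (intro mult_left_mono) (auto simp: field_simps)
      also have "\<dots> \<le> C1 * b" using Vb C1 by (intro mult_left_mono) auto
      also have "\<dots> = C1 / (\<kappa>\<^sup>2 * b) * (\<kappa> * b)\<^sup>2" using \<kappa>p b by (simp add: power2_eq_square field_simps)
      also have "\<dots> \<le> (1 + \<epsilon>) / 2 * (V x - b)\<^sup>2" using large2 W2 \<epsilon>' by (intro mult_mono) auto
      finally have "V' x \<le> (1 + \<epsilon>) / 2 * (V x - b)\<^sup>2" .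
      moreover have "0 \<le> exp C2 * V' X" using S by (simp add: S_def)
      ultimately show ?thesis using pos[OF x(1)] by simp
    qed
  qed
  fix r x :: real
  assume r: "0 < r" "r \<le> \<theta> * X"
  show "\<bar>V x - b - V' X * (x - X)\<bar> \<le> K1 * V' X * (x - X)\<^sup>2 / X" if "\<bar>x - X\<bar> \<le> r"
    using taylor[of x] that r by (simp add: S_def)
  show "V' X * \<bar>x - X\<bar> / 2 \<le> \<bar>V x - b\<bar>" if "\<bar>x - X\<bar> \<le> r"
  proof -
    have le: "\<bar>x - X\<bar> \<le> \<theta> * X" using that r by simp
    have "S * \<bar>x - X\<bar> = \<bar>S * (x - X)\<bar>" using S by (simp add: abs_mult)
    also have "\<dots> \<le> \<bar>V x - b\<bar> + \<bar>V x - b - S * (x - X)\<bar>" by linarith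
    finally show ?thesis using taylor[OF le] error[OF le] unfolding S_def by linarith
  qed
  show "V' X * r / 2 \<le> \<bar>V x - b\<bar>" if "r \<le> \<bar>x - X\<bar>"
  proof (cases "X \<le> x")
    case True
    then have "S * r / 2 \<le> V x - b" by (intro far_right r) (use that in auto)
    then show ?thesis unfolding S_def by linarith
  next
    case False
    then have "V x - b \<le> - (S * r / 2)" by (intro far_left r) (use that in auto)
    then show ?thesis unfolding S_def by linarith
  qed
qed

section \<open>Comparison of the resolvent norms\<close>

lemma lower_bound_mono:
  assumes "lower_bound m W a c" "c' \<le> c"
  shows "lower_bound m W a c'"
  unfolding lower_bound_def
proof (intro allI impI)
  fix u v assume "dirac_pair W u v"
  then have "c * l2 u \<le> l2 (dirac_expr m W a u v)" using assms(1) by (simp add: lower_bound_def)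
  moreover have "c' * l2 u \<le> c * l2 u" using assms(2) by (intro mult_right_mono) auto
  ultimately show "c' * l2 u \<le> l2 (dirac_expr m W a u v)" by linarith
qed

text \<open>The constant that comes out when the errors of \<open>lower_bound_comparison\<close> are added in \<open>transfer_error\<close>.\<close>

definition transfer_const :: "real \<Rightarrow> real \<Rightarrow> real \<Rightarrow> real \<Rightarrow> real" where
  "transfer_const m K C D = (8 * m + 8) * C * (2 * m * D\<^sup>2 + D) + 2 * K * C * (2 * m + 5 + 2 * C * (2 * m * D + 1))"

text \<open>With \<open>p = X^(-1/2)\<close>, \<open>q = b^(-1/2)\<close> and \<open>r = (p + q) X\<close> all errors are of order \<open>p +
  q\<close>: one has \<open>1/r \<le> p\<close>, \<open>1/(s r) \<le> D (p + q)\<close>, \<open>1/(s\<^sup>2 r) \<le> D\<^sup>2 (p + q)\<close>, and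
  \<open>r / X = p + q\<close>. The bound on \<open>1/s\<close> expresses that \<open>V'(X)\<close> is at least of order \<open>b / X\<close>.\<close>

lemma transfer_error:
  assumes p: "0 < p" "p \<le> 1" and q: "0 < q" "q \<le> 1" and m: "0 < m" and c: "0 \<le> c" "c \<le> 2 * m"
    and KCD: "0 \<le> K" "0 \<le> C" "0 \<le> D" and s: "0 < s" "1 / s \<le> D * q / p"
    and r: "r = (p + q) / p\<^sup>2"
  shows "(4 * c / (s\<^sup>2 * r) + 8 / (s\<^sup>2 * r\<^sup>2)) * (C * (2 * m + s)) + (2 * K * p\<^sup>2) * C * (r * (2 * m) + 5 + (2 / s) * (C * (2 * m + s)))
     \<le> transfer_const m K C D * (p + q)"
proof -
  define \<eta> where "\<eta> = p + q"
  define i where "i = 1 / s"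
  define j where "j = 1 / r"
  have \<eta>: "0 < \<eta>" "p \<le> \<eta>" "q \<le> \<eta>" using p q by (auto simp: \<eta>_def)
  have rp: "0 < r" unfolding r using p q by simp
  have i: "0 < i" "i \<le> D * q / p" using s by (auto simp: i_def)
  have j: "0 < j" using rp by (simp add: j_def)
  have j_eq: "j = p\<^sup>2 / \<eta>" by (simp add: j_def r \<eta>_def)
  have p2: "p\<^sup>2 \<le> p" using p by (simp add: power2_eq_square mult_left_le)
  have j_le: "j \<le> p" "j \<le> 1"
  proof -
    have "p\<^sup>2 \<le> p * \<eta>" using \<eta> p by (simp add: power2_eq_square)
    then show "j \<le> p" using \<eta> by (simp add: j_eq field_simps)
    then show "j \<le> 1" using p by simp
  qed
  have ij: "i * j \<le> D * \<eta>"
  proof -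
    have "i * j \<le> (D * q / p) * (p\<^sup>2 / \<eta>)" unfolding j_eq using i p q \<eta> by (intro mult_right_mono) auto
    also have "\<dots> = D * (p * (q / \<eta>))" using p by (simp add: power2_eq_square)
    also have "\<dots> \<le> D * (p * 1)" using KCD p \<eta> q by (intro mult_left_mono) (auto simp: divide_le_eq)
    also have "\<dots> \<le> D * \<eta>" using KCD \<eta> by (intro mult_left_mono) auto
    finally show ?thesis .
  qed
  have iij: "i\<^sup>2 * j \<le> D\<^sup>2 * \<eta>"
  proof -
    have "i\<^sup>2 * j \<le> (D * q / p)\<^sup>2 * (p\<^sup>2 / \<eta>)" unfolding j_eq using i \<eta> by (intro mult_right_mono power_mono) auto
    also have "\<dots> = D\<^sup>2 * (q * (q / \<eta>))" using p by (simp add: power2_eq_square)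
    also have "\<dots> \<le> D\<^sup>2 * (q * 1)" using q \<eta> by (intro mult_left_mono) (auto simp: divide_le_eq)
    also have "\<dots> \<le> D\<^sup>2 * \<eta>" using \<eta> by (intro mult_left_mono) auto
    finally show ?thesis .
  qed
  have ip: "p\<^sup>2 * i \<le> D * \<eta>"
  proof -
    have "p\<^sup>2 * i \<le> p\<^sup>2 * (D * q / p)" using i by (intro mult_left_mono) auto
    also have "\<dots> = D * (p * q)" using p by (simp add: power2_eq_square)
    also have "\<dots> \<le> D * (1 * \<eta>)" using p q \<eta> KCD by (intro mult_left_mono mult_mono) auto
    finally show ?thesis by simp
  qed
  have rr: "p\<^sup>2 * r = \<eta>" using p by (simp add: r \<eta>_def)
  define E where "E = (2 * m * D\<^sup>2 + D) * \<eta>"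
  have E0: "0 \<le> E" using m KCD \<eta> by (simp add: E_def)
  have first: "1 / (s\<^sup>2 * r) * (2 * m + s) \<le> E"
  proof -
    have "1 / (s\<^sup>2 * r) * (2 * m + s) = 2 * m * (i\<^sup>2 * j) + i * j"
      using s rp by (simp add: i_def j_def power2_eq_square field_simps)
    also have "\<dots> \<le> 2 * m * (D\<^sup>2 * \<eta>) + D * \<eta>" using iij ij m by (intro add_mono mult_left_mono) auto
    finally show ?thesis by (simp add: E_def algebra_simps)
  qed
  have A: "(4 * c / (s\<^sup>2 * r) + 8 / (s\<^sup>2 * r\<^sup>2)) * (C * (2 * m + s)) \<le> (8 * m + 8) * C * E"
  proof -
    have "(4 * c / (s\<^sup>2 * r) + 8 / (s\<^sup>2 * r\<^sup>2)) * (C * (2 * m + s)) = (4 * c + 8 * j) * C * (1 / (s\<^sup>2 * r) * (2 * m + s))"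
      using s rp by (simp add: j_def power2_eq_square field_simps)
    also have "\<dots> \<le> (8 * m + 8) * C * E"
      using c j j_le first KCD m s rp by (intro mult_mono) auto
    finally show ?thesis .
  qed
  have B: "(2 * K * p\<^sup>2) * C * (r * (2 * m) + 5 + (2 / s) * (C * (2 * m + s))) \<le> 2 * K * C * ((2 * m + 5 + 2 * C * (2 * m * D + 1)) * \<eta>)"
  proof -
    have "(2 * K * p\<^sup>2) * C * (r * (2 * m) + 5 + (2 / s) * (C * (2 * m + s))) =
        2 * K * C * (2 * m * (p\<^sup>2 * r) + 5 * p\<^sup>2 + 2 * C * (2 * m * (p\<^sup>2 * i) + p\<^sup>2))"
      using s by (simp add: i_def power2_eq_square field_simps)
    also have "\<dots> \<le> 2 * K * C * (2 * m * \<eta> + 5 * \<eta> + 2 * C * (2 * m * (D * \<eta>) + \<eta>))"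
      using KCD m ip p2 \<eta> unfolding rr by (intro mult_left_mono add_mono) auto
    finally show ?thesis by (simp add: algebra_simps)
  qed
  have "transfer_const m K C D * \<eta> = (8 * m + 8) * C * E + 2 * K * C * ((2 * m + 5 + 2 * C * (2 * m * D + 1)) * \<eta>)"
    by (simp add: transfer_const_def E_def algebra_simps)
  with A B show ?thesis unfolding \<eta>_def[symmetric] by linarith
qed

text \<open>Either \<open>|T u| \<ge> c |u|\<close> and nothing is to be shown, or \<open>|T u| < c |u| \<le> 2 m |u|\<close>, and then all terms of
  \<open>lower_bound_comparison\<close> are bounded by multiples of \<open>|u|\<close>.\<close>

lemma lower_bound_transfer:
  fixes W W2 :: "real \<Rightarrow> real"
  assumes W: "\<And>x. (W has_real_derivative W' x) (at x)" "continuous_on UNIV W'"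
    and bd: "\<And>x. \<bar>W' x\<bar> \<le> K * s\<^sup>2 + \<epsilon> * (W x)\<^sup>2" and \<epsilon>: "\<epsilon> < 1"
    and near: "\<And>x. \<bar>x - X\<bar> \<le> r \<Longrightarrow> s\<^sup>2 * \<bar>x - X\<bar> / 2 \<le> \<bar>W x\<bar>"
    and far: "\<And>x. r \<le> \<bar>x - X\<bar> \<Longrightarrow> s\<^sup>2 * r / 2 \<le> \<bar>W x\<bar>"
    and diff: "\<And>x. \<bar>x - X\<bar> \<le> r \<Longrightarrow> \<bar>W2 x - W x\<bar> \<le> K * s\<^sup>2 * (x - X)\<^sup>2 / (1 / p\<^sup>2)"
    and W2: "continuous_on UNIV W2" and lb: "lower_bound m W2 a c"
    and p: "0 < p" "p \<le> 1" and q: "0 < q" "q \<le> 1" and m: "0 < m" and c: "0 \<le> c" "c \<le> 2 * m"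
    and KD: "0 \<le> K" "0 \<le> D" and s: "0 < s" "1 / s \<le> D * q / p"
    and r: "r = (p + q) / p\<^sup>2"
  shows "lower_bound m W a (c - transfer_const m K (sqrt ((1 + K) / (1 - \<epsilon>))) D * (p + q))"
  unfolding lower_bound_def
proof (intro allI impI)
  fix u v assume dom: "dirac_pair W u v"
  define C where "C = sqrt ((1 + K) / (1 - \<epsilon>))"
  define \<Lambda> where "\<Lambda> = transfer_const m K C D"
  have C: "0 \<le> C" using KD \<epsilon> by (simp add: C_def)
  have \<Lambda>: "0 \<le> \<Lambda> * (p + q)" using C KD m p q by (simp add: \<Lambda>_def transfer_const_def)
  let ?f = "l2 (dirac_expr m W a u v)" and ?u = "l2 u"
  have rp: "0 < r" unfolding r using p q by simp
  show "(c - transfer_const m K (sqrt ((1 + K) / (1 - \<epsilon>))) D * (p + q)) * ?u \<le> ?f"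
    unfolding C_def[symmetric] \<Lambda>_def[symmetric]
  proof (cases "c * ?u \<le> ?f")
    case True
    have "(c - \<Lambda> * (p + q)) * ?u \<le> c * ?u" using \<Lambda> by (intro mult_right_mono) auto
    with True show "(c - \<Lambda> * (p + q)) * ?u \<le> ?f" by linarith
  next
    case False
    have "c * ?u \<le> 2 * m * ?u" using c by (intro mult_right_mono) auto
    with False have f: "?f \<le> 2 * m * ?u" by linarith
    define N where "N = C * (?f + s * ?u)"
    have N: "N \<le> C * (2 * m + s) * ?u"
    proof -
      have "N \<le> C * (2 * m * ?u + s * ?u)" unfolding N_def using f C by (intro mult_left_mono) auto
      then show ?thesis by (simp add: algebra_simps)
    qed
    have "c * ?u \<le> ?f + (4 * c / (s\<^sup>2 * r) + 8 / (s\<^sup>2 * r\<^sup>2)) * N + (2 * K / (1 / p\<^sup>2)) * C * (r * ?f + 5 * ?u + (2 / s) * N)"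
      by (rule lower_bound_comparison[OF dom W bd \<epsilon> KD(1) s(1) rp _ c(1) near far diff W2 lb C_def N_def]) (use p in auto)
    also have "\<dots> \<le> ?f + (4 * c / (s\<^sup>2 * r) + 8 / (s\<^sup>2 * r\<^sup>2)) * (C * (2 * m + s) * ?u)
        + (2 * K / (1 / p\<^sup>2)) * C * (r * (2 * m * ?u) + 5 * ?u + (2 / s) * (C * (2 * m + s) * ?u))"
      using N f C c KD s rp p by (intro add_mono mult_left_mono order_refl) auto
    also have "\<dots> = ?f + ((4 * c / (s\<^sup>2 * r) + 8 / (s\<^sup>2 * r\<^sup>2)) * (C * (2 * m + s)) + (2 * K * p\<^sup>2) * C * (r * (2 * m) + 5 + (2 / s) * (C * (2 * m + s)))) * ?u"
    proof -
      have *: "f + A * (n * y) + B * C * (r * (2 * m * y) + 5 * y + t * (n * y)) = f + (A * n + B * C * (r * (2 * m) + 5 + t * n)) * y"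
        for f A n y B t :: real by (simp add: algebra_simps)
      have "2 * K / (1 / p\<^sup>2) = 2 * K * p\<^sup>2" by simp
      then show ?thesis unfolding * by simp
    qed
    also have "\<dots> \<le> ?f + (\<Lambda> * (p + q)) * ?u"
      unfolding \<Lambda>_def by (intro add_left_mono mult_right_mono transfer_error[OF p q m c KD(1) C KD(2) s r]) simp
    finally show "(c - \<Lambda> * (p + q)) * ?u \<le> ?f" by (simp add: algebra_simps)
  qed
qed

text \<open>For mass \<open>m / s\<close> at most \<open>2 C0 + 1\<close> the uniform bound applies; for larger mass \<open>lower_bound_mass\<close>
  leaves at least half of the mass.\<close>

lemma airy_lower_bound_scaled:
  assumes C0: "0 \<le> C0" and m: "0 < m"
  shows "\<exists>c0>0. \<forall>s \<mu> X. 0 < s \<longrightarrow> \<bar>\<mu>\<bar> \<le> C0 \<longrightarrow> lower_bound m (\<lambda>x. s\<^sup>2 * (x - X)) (\<mu> * s) c0"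
proof -
  obtain cA where cA: "cA > 0" "\<And>m \<mu>. 0 < m \<Longrightarrow> m \<le> 2 * C0 + 1 \<Longrightarrow> \<bar>\<mu>\<bar> \<le> C0 \<Longrightarrow> lower_bound m (\<lambda>x. x) \<mu> (cA * m)"
    using airy_uniform_lower_bound[OF C0, of "2 * C0 + 1"] C0 by auto
  define c0 where "c0 = min (cA * m) (m / 2)"
  have "lower_bound m (\<lambda>x. s\<^sup>2 * (x - X)) (\<mu> * s) c0" if s: "0 < s" and \<mu>: "\<bar>\<mu>\<bar> \<le> C0" for s \<mu> X
    unfolding lower_bound_linear_iff[OF s]
  proof (cases "m / s \<le> 2 * C0 + 1")
    case True
    have "lower_bound (m / s) (\<lambda>x. x) \<mu> (cA * (m / s))" by (rule cA(2)) (use True \<mu> m s in auto)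
    moreover have "c0 / s \<le> cA * (m / s)" using s by (simp add: c0_def divide_right_mono)
    ultimately have "lower_bound (m / s) (\<lambda>x. x) \<mu> (c0 / s)" by (rule lower_bound_mono)
    then show "lower_bound (m / s) (\<lambda>x. x) (\<mu> * s / s) (c0 / s)" using s by simp
  next
    case False
    have "c0 / s \<le> m / 2 / s" using s by (intro divide_right_mono) (auto simp: c0_def)
    also have "\<dots> = m / s / 2" by simp
    also have "\<dots> \<le> m / s - \<bar>\<mu>\<bar>"
    proof -
      have "y / 2 \<le> y - \<bar>\<mu>\<bar>" if "2 * C0 + 1 < y" for y using that \<mu> C0 by linarith
      from this[of "m / s"] show ?thesis using False by (simp only: not_le)
    qed
    finally have "lower_bound (m / s) (\<lambda>x. x) \<mu> (c0 / s)" by (rule lower_bound_mono[OF lower_bound_mass])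
    then show "lower_bound (m / s) (\<lambda>x. x) (\<mu> * s / s) (c0 / s)" using s by simp
  qed
  then show ?thesis using cA(1) m by (intro exI[of _ c0]) (auto simp: c0_def)
qed

text \<open>The best lower bounds are \<open>c1 = 1 / RH\<close> for \<open>V - b\<close> and \<open>c2 = s / RA\<close> for the tangent line. The
  transfer is applied in both directions. It needs constants at most \<open>2 m\<close>: \<open>c2 \<le> m\<close> is known from the Gaussian, but
  \<open>c1\<close> is not bounded in advance and is first replaced by \<open>min c1 (2 m)\<close>; the conclusion then shows that the minimum is
  \<open>c1\<close>.\<close>

lemma resolvent_comparison:
  fixes V V' :: "real \<Rightarrow> real"
  assumes V: "\<And>x. (V has_real_derivative V' x) (at x)" "continuous_on UNIV V'"
    and bd: "\<And>x. \<bar>V' x\<bar> \<le> K * s\<^sup>2 + \<epsilon> * (V x - b)\<^sup>2" and \<epsilon>: "0 \<le> \<epsilon>" "\<epsilon> < 1"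
    and near_all: "\<forall>x. \<bar>x - X\<bar> \<le> r \<longrightarrow> s\<^sup>2 * \<bar>x - X\<bar> / 2 \<le> \<bar>V x - b\<bar>"
    and far_all: "\<forall>x. r \<le> \<bar>x - X\<bar> \<longrightarrow> s\<^sup>2 * r / 2 \<le> \<bar>V x - b\<bar>"
    and diff_all: "\<forall>x. \<bar>x - X\<bar> \<le> r \<longrightarrow> \<bar>V x - b - s\<^sup>2 * (x - X)\<bar> \<le> K * s\<^sup>2 * (x - X)\<^sup>2 / (1 / p\<^sup>2)"
    and p: "0 < p" "p \<le> 1" and q: "0 < q" "q \<le> 1" and m: "0 < m"
    and KD: "1 \<le> K" "0 \<le> D" and s: "0 < s" "1 / s \<le> D * q / p"
    and r: "r = (p + q) / p\<^sup>2"
    and airy: "lower_bound m (\<lambda>x. s\<^sup>2 * (x - X)) a c0" "0 < c0"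
    and \<Lambda>: "\<Lambda> = transfer_const m K (sqrt ((1 + K) / (1 - \<epsilon>))) D"
    and small: "\<Lambda> * (p + q) \<le> c0 / 2" "\<Lambda> * (p + q) < m"
  shows "Complex a b \<in> resolvent_set (dirac m V)"
    "complex_of_real (a / s) \<in> resolvent_set (airy_dirac (m / s))"
    "\<bar>onorm (resolvent (dirac m V) (Complex a b)) / (onorm (resolvent (airy_dirac (m / s)) (complex_of_real (a / s))) / s) - 1\<bar>
       \<le> 2 * \<Lambda> / c0 * (p + q)"
    "0 < onorm (resolvent (airy_dirac (m / s)) (complex_of_real (a / s)))"
proof -
  note near = near_all[rule_format] and far = far_all[rule_format] and diff = diff_all[rule_format]
  let ?W2 = "\<lambda>x. s\<^sup>2 * (x - X)" and ?W1 = "\<lambda>x. V x - b"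
  define \<eta> where "\<eta> = p + q"
  have \<eta>: "0 < \<eta>" using p q by (simp add: \<eta>_def)
  have \<Lambda>0: "0 \<le> \<Lambda>" using KD \<epsilon> m by (simp add: \<Lambda> transfer_const_def)
  define RA where "RA = onorm (resolvent (airy_dirac (m / s)) (complex_of_real (a / s)))"
  define RH where "RH = onorm (resolvent (dirac m V) (Complex a b))"
  have airy': "lower_bound (m / s) (\<lambda>x. x - 0) (a / s) (c0 / s)"
    using airy(1) unfolding lower_bound_linear_iff[OF s(1)] by simp
  have cz: "Complex (a / s) 0 = complex_of_real (a / s)" by (simp add: complex_eq_iff)
  have d1: "((\<lambda>x. x) has_real_derivative (\<lambda>x. 1) x) (at x)" for x :: real by (auto intro!: derivative_eq_intros)
  have d2: "continuous_on UNIV (\<lambda>x :: real. 1 :: real)" by simp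
  have d3: "\<bar>(\<lambda>x. 1) x\<bar> \<le> 1 + 0 * (x - 0)\<^sup>2" for x :: real by simp
  have d4: "(0::real) < 1" "0 < c0 / s" using airy(2) s by auto
  note A = resolvent_dirac[OF d1 d2 d3 d4(1) airy' d4(2), unfolded cz, folded airy_dirac_def]
  have RA: "complex_of_real (a / s) \<in> resolvent_set (airy_dirac (m / s))" "0 < RA"
    "\<And>c'. 0 < c' \<Longrightarrow> lower_bound (m / s) (\<lambda>x. x) (a / s) c' \<longleftrightarrow> RA \<le> 1 / c'"
    unfolding RA_def using A by simp_all
  show "complex_of_real (a / s) \<in> resolvent_set (airy_dirac (m / s))" by (rule RA(1))
  show "0 < onorm (resolvent (airy_dirac (m / s)) (complex_of_real (a / s)))" using RA(2) by (simp add: RA_def)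
  define c2 where "c2 = s / RA"
  have c2: "0 < c2" using RA(2) s by (simp add: c2_def)
  have lb2_iff: "lower_bound m ?W2 a c \<longleftrightarrow> c \<le> c2" if "0 < c" for c
  proof -
    have "lower_bound m ?W2 a c \<longleftrightarrow> RA \<le> 1 / (c / s)"
      unfolding lower_bound_linear_iff[OF s(1)] by (rule RA(3)) (use that s in simp)
    also have "1 / (c / s) = s / c" by simp
    also have "RA \<le> s / c \<longleftrightarrow> c \<le> c2"
      unfolding c2_def pos_le_divide_eq[OF that] pos_le_divide_eq[OF RA(2)] by (simp only: mult.commute)
    finally show ?thesis .
  qed
  have lb2: "lower_bound m ?W2 a c2" using lb2_iff[OF c2] by simp
  have c0_le: "c0 \<le> c2" using lb2_iff[OF airy(2)] airy(1) by simp
  have c2_le: "c2 \<le> m"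
  proof -
    have "c2 / s \<le> \<bar>m / s\<bar>"
      by (rule airy_lower_bound_le_mass) (use lb2 in \<open>simp add: lower_bound_linear_iff[OF s(1)]\<close>)
    also have "\<bar>m / s\<bar> = m / s" using m s by simp
    finally show ?thesis using s by (simp add: divide_le_cancel)
  qed
  have V1: "((\<lambda>x. V x - b) has_real_derivative V' x) (at x)" for x
    using V(1)[of x] by (auto intro!: derivative_eq_intros)
  have Vc: "continuous_on UNIV ?W1"
    using V1 by (auto intro!: continuous_at_imp_continuous_on dest: DERIV_isCont)
  have K0: "0 \<le> K" using KD by simp
  have lb1: "lower_bound m ?W1 a (c2 - \<Lambda> * \<eta>)"
    unfolding \<Lambda> \<eta>_def
  proof (rule lower_bound_transfer[where r = r and X = X and ?W2.0 = ?W2 and W' = V', OF V1 V(2) bd \<epsilon>(2) near far _ _ lb2 p q m _ _ K0 KD(2) s r])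
    show "\<bar>s\<^sup>2 * (x - X) - (V x - b)\<bar> \<le> K * s\<^sup>2 * (x - X)\<^sup>2 / (1 / p\<^sup>2)" if "\<bar>x - X\<bar> \<le> r" for x
      using diff[OF that] unfolding abs_minus_commute[of "V x - b"] .
    show "continuous_on UNIV (\<lambda>x. s\<^sup>2 * (x - X))" by (intro continuous_intros)
    show "0 \<le> c2" "c2 \<le> 2 * m" using c2 c2_le m by linarith+
  qed
  have pos1: "0 < c2 - \<Lambda> * \<eta>" using small(1) c0_le airy(2) by (simp add: \<eta>_def)
  have bd': "\<bar>V' x\<bar> \<le> (K * s\<^sup>2) + \<epsilon> * (V x - b)\<^sup>2" for x by (rule bd)
  note H = resolvent_dirac[OF V bd' \<epsilon>(2) lb1 pos1]
  show "Complex a b \<in> resolvent_set (dirac m V)" by (rule H(1))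
  have RH: "0 < RH" "\<And>c'. 0 < c' \<Longrightarrow> lower_bound m ?W1 a c' \<longleftrightarrow> RH \<le> 1 / c'" unfolding RH_def using H by auto
  define c1 where "c1 = 1 / RH"
  have c1: "0 < c1" using RH(1) by (simp add: c1_def)
  have lb1_iff: "lower_bound m ?W1 a c \<longleftrightarrow> c \<le> c1" if "0 < c" for c
    unfolding RH(2)[OF that] c1_def pos_le_divide_eq[OF that] pos_le_divide_eq[OF RH(1)] by (simp only: mult.commute)
  have lower: "c2 - \<Lambda> * \<eta> \<le> c1" using lb1_iff[OF pos1] lb1 by simp
  have upper: "c1 \<le> c2 + \<Lambda> * \<eta>"
  proof -
    define c where "c = min c1 (2 * m)"
    have c: "0 < c" "c \<le> 2 * m" using c1 m by (auto simp: c_def)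
    have lbc: "lower_bound m ?W1 a c" using lb1_iff[OF c(1)] by (simp add: c_def)
    have "lower_bound m ?W2 a (c - \<Lambda> * \<eta>)"
      unfolding \<Lambda> \<eta>_def
    proof (rule lower_bound_transfer[where r = r and X = X and ?W2.0 = ?W1 and W' = "\<lambda>x. s\<^sup>2", OF _ _ _ \<epsilon>(2) _ _ _ Vc lbc p q m _ c(2) K0 KD(2) s r])
      show "((\<lambda>x. s\<^sup>2 * (x - X)) has_real_derivative s\<^sup>2) (at x)" for x by (auto intro!: derivative_eq_intros)
      show "\<bar>s\<^sup>2\<bar> \<le> K * s\<^sup>2 + \<epsilon> * (s\<^sup>2 * (x - X))\<^sup>2" for x
      proof -
        have "1 * s\<^sup>2 \<le> K * s\<^sup>2" using KD by (intro mult_right_mono) auto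
        moreover have "0 \<le> \<epsilon> * (s\<^sup>2 * (x - X))\<^sup>2" using \<epsilon> by simp
        ultimately show ?thesis by simp
      qed
      have e: "\<bar>s\<^sup>2 * (x - X)\<bar> = s\<^sup>2 * \<bar>x - X\<bar>" for x by (simp add: abs_mult)
      show "s\<^sup>2 * \<bar>x - X\<bar> / 2 \<le> \<bar>s\<^sup>2 * (x - X)\<bar>" for x unfolding e by simp
      show "s\<^sup>2 * r / 2 \<le> \<bar>s\<^sup>2 * (x - X)\<bar>" if "r \<le> \<bar>x - X\<bar>" for x
      proof -
        have "s\<^sup>2 * r \<le> s\<^sup>2 * \<bar>x - X\<bar>" using that by (intro mult_left_mono) auto
        moreover have "0 \<le> s\<^sup>2 * \<bar>x - X\<bar>" by simp
        ultimately show ?thesis unfolding e by linarith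
      qed
      show "\<bar>V x - b - s\<^sup>2 * (x - X)\<bar> \<le> K * s\<^sup>2 * (x - X)\<^sup>2 / (1 / p\<^sup>2)" if "\<bar>x - X\<bar> \<le> r" for x
        by (rule diff[OF that])
      show "0 \<le> c" using c(1) by simp
    qed simp
    then have le: "c - \<Lambda> * \<eta> \<le> c2"
      using lb2_iff[of "c - \<Lambda> * \<eta>"] c2 by (cases "0 < c - \<Lambda> * \<eta>") auto
    have "c < 2 * m" using le c2_le small(2) by (simp add: \<eta>_def)
    then have "c = c1" by (auto simp: c_def)
    with le show ?thesis by simp
  qed
  have c1_low: "c0 / 2 \<le> c1" using lower small(1) c0_le by (simp add: \<eta>_def)
  have "RH / (RA / s) = c2 / c1" using RA(2) RH(1) s by (simp add: c1_def c2_def)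
  moreover have "c2 / c1 - 1 = (c2 - c1) / c1" using c1 by (simp add: diff_divide_distrib)
  ultimately have "\<bar>RH / (RA / s) - 1\<bar> = \<bar>c2 - c1\<bar> / c1" using c1 by (simp only: abs_divide abs_of_pos)
  also have "\<dots> \<le> (\<Lambda> * \<eta>) / (c0 / 2)"
    using lower upper c1_low airy(2) \<Lambda>0 \<eta> by (intro frac_le) auto
  also have "\<dots> = 2 * \<Lambda> / c0 * (p + q)" by (simp add: \<eta>_def)
  finally show "\<bar>onorm (resolvent (dirac m V) (Complex a b)) / (onorm (resolvent (airy_dirac (m / s)) (complex_of_real (a / s))) / s) - 1\<bar>
       \<le> 2 * \<Lambda> / c0 * (p + q)"
    unfolding RA_def RH_def .
qed

section \<open>The asymptotic formula\<close>

lemma turning_point_eventually: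
  assumes "admissible_potential V"
  shows "\<forall>\<^sub>F b in at_top. 0 < turning_point V b \<and> V (turning_point V b) = b"
  using eventually_ex1_turning_point[OF assms]
proof eventually_elim
  case (elim b)
  from theI'[OF this] show ?case by (simp add: turning_point_def)
qed

lemma turning_point_at_top:
  assumes V: "admissible_potential V"
  shows "filterlim (turning_point V) at_top at_top"
  unfolding filterlim_at_top
proof
  fix N :: real
  have "V C1_differentiable_on UNIV" using V by (simp add: admissible_potential_def)
  then have "continuous_on {0..\<bar>N\<bar>} V"
    using C1_differentiable_imp_continuous_on continuous_on_subset by blast
  then have "bounded (V ` {0..\<bar>N\<bar>})" by (intro compact_imp_bounded compact_continuous_image) auto
  then obtain B where B: "\<forall>y\<in>V ` {0..\<bar>N\<bar>}. norm y \<le> B" unfolding bounded_iff by blast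
  show "\<forall>\<^sub>F b in at_top. N \<le> turning_point V b"
    using turning_point_eventually[OF V] eventually_gt_at_top[of B]
  proof eventually_elim
    case (elim b)
    show ?case
    proof (rule ccontr)
      assume "\<not> N \<le> turning_point V b"
      then have "turning_point V b \<in> {0..\<bar>N\<bar>}" using elim by auto
      then have "norm (V (turning_point V b)) \<le> B" using B by blast
      then show False using elim by simp
    qed
  qed
qed

text \<open>A single constant \<open>C1\<close> serves both halves of \<open>V' \<approx> V / x\<close>, and the upper bound \<open>B\<close> is
  extended from \<open>x < 0\<close> to \<open>x \<le> x0 + 1\<close> by compactness. The additional 1 guarantees \<open>x \<ge> 1\<close> to the
  right of this region, so that \<open>V / x \<le> V\<close> where \<open>V \<ge> 0\<close>.\<close>

lemma admissible_potentialE: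
  assumes "admissible_potential V"
  obtains \<epsilon> M x0 C1 C2 B where
    "\<And>x. (V has_real_derivative deriv V x) (at x)" "continuous_on UNIV (deriv V)"
    "0 < \<epsilon>" "\<epsilon> < 1" "0 < M" "\<And>x. \<bar>deriv V x\<bar> \<le> \<epsilon> * (V x)\<^sup>2 + M"
    "0 \<le> x0" "\<forall>x>x0. (deriv V has_real_derivative deriv (deriv V) x) (at x)"
    "\<forall>x>x0. 0 < deriv V x"
    "0 < C1" "\<forall>x>x0. deriv V x \<le> C1 * (V x / x)" "\<forall>x>x0. V x / x \<le> C1 * deriv V x"
    "0 < C2" "\<forall>x>x0. \<bar>deriv (deriv V) x\<bar> \<le> C2 * (deriv V x / x)"
    "\<forall>x\<le>x0 + 1. V x \<le> B"
proof -
  obtain \<epsilon> M where e: "0 < \<epsilon>" "\<epsilon> < 1" "0 < M" "\<And>x. \<bar>deriv V x\<bar> \<le> \<epsilon> * \<bar>V x\<bar>\<^sup>2 + M"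
    using assms by (auto simp: admissible_potential_def)
  obtain B0 where B0: "\<And>x. x < 0 \<Longrightarrow> V x \<le> B0" using assms by (auto simp: admissible_potential_def)
  obtain x0 where x0: "0 \<le> x0" "deriv V C1_differentiable_on {x0<..}" "\<And>x. x0 < x \<Longrightarrow> 0 < deriv V x"
    and approx: "approx_on {x0<..} (deriv V) (\<lambda>x. V x / x)"
    and sec: "lesssim_on {x0<..} (\<lambda>x. \<bar>deriv (deriv V) x\<bar>) (\<lambda>x. deriv V x / x)"
    using assms by (auto simp: admissible_potential_def)
  have "V C1_differentiable_on UNIV" using assms by (simp add: admissible_potential_def)
  then obtain E where E: "\<And>x. (V has_vector_derivative E x) (at x)" "continuous_on UNIV E"
    by (auto simp: C1_differentiable_on_def)
  have D1: "(V has_real_derivative E x) (at x)" for x using E(1) by (simp add: has_real_derivative_iff_has_vector_derivative)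
  then have VE: "deriv V = E" by (auto simp: DERIV_imp_deriv)
  obtain F where F: "\<And>x. x0 < x \<Longrightarrow> (deriv V has_vector_derivative F x) (at x)"
    using x0(2) by (auto simp: C1_differentiable_on_def)
  have D2: "(deriv V has_real_derivative deriv (deriv V) x) (at x)" if "x0 < x" for x
  proof -
    have "(deriv V has_real_derivative F x) (at x)" using F[OF that] by (simp add: has_real_derivative_iff_has_vector_derivative)
    then show ?thesis by (simp add: DERIV_imp_deriv)
  qed
  obtain Ca where Ca: "0 < Ca" "\<And>x. x0 < x \<Longrightarrow> deriv V x \<le> Ca * (V x / x)"
    using approx by (auto simp: approx_on_def lesssim_on_def)
  obtain Cb where Cb: "0 < Cb" "\<And>x. x0 < x \<Longrightarrow> V x / x \<le> Cb * deriv V x"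
    using approx by (auto simp: approx_on_def lesssim_on_def)
  obtain C2 where C2: "0 < C2" "\<And>x. x0 < x \<Longrightarrow> \<bar>deriv (deriv V) x\<bar> \<le> C2 * (deriv V x / x)"
    using sec by (auto simp: lesssim_on_def)
  have up: "deriv V x \<le> max Ca Cb * (V x / x)" if x: "x0 < x" for x
  proof -
    have "0 < Ca * (V x / x)" using Ca(2)[OF x] x0(3)[OF x] by linarith
    then have "0 \<le> V x / x" by (metis zero_less_mult_pos Ca(1) less_imp_le)
    then have "Ca * (V x / x) \<le> max Ca Cb * (V x / x)" by (intro mult_right_mono) auto
    then show ?thesis using Ca(2)[OF x] by linarith
  qed
  have lo: "V x / x \<le> max Ca Cb * deriv V x" if x: "x0 < x" for x
  proof -
    have "Cb * deriv V x \<le> max Ca Cb * deriv V x" using x0(3)[OF x] by (intro mult_right_mono) auto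
    then show ?thesis using Cb(2)[OF x] by linarith
  qed
  have "continuous_on {0..x0 + 1} V"
    using D1 by (auto intro!: continuous_at_imp_continuous_on dest: DERIV_isCont)
  then have "bounded (V ` {0..x0 + 1})" by (intro compact_imp_bounded compact_continuous_image) auto
  then obtain B1 where B1: "\<forall>y\<in>V ` {0..x0 + 1}. norm y \<le> B1" unfolding bounded_iff by blast
  have left: "V x \<le> max B0 B1" if "x \<le> x0 + 1" for x
  proof (cases "x < 0")
    case True then show ?thesis using B0[OF True] by simp
  next
    case False
    then have "norm (V x) \<le> B1" using B1 that by auto
    then show ?thesis by simp
  qed
  show thesis
    by (rule that[of \<epsilon> M x0 "max Ca Cb" C2 "max B0 B1"])
       (use D1 E(2) e x0 D2 Ca(1) up lo C2 left in \<open>auto simp: VE[symmetric]\<close>)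
qed

theorem theorem2p8:
  fixes m :: real and V a :: "real \<Rightarrow> real"
  assumes "0 < m" and "admissible_potential V"
    and "(\<lambda>b. a b / deriv V (turning_point V b) powr (1/2)) \<in> O[at_top](\<lambda>_. 1)"
  shows "\<exists>r :: real \<Rightarrow> real.
    r \<in> O[at_top](\<lambda>b. turning_point V b powr (-1/2) + b powr (-1/2)) \<and>
    (\<forall>\<^sub>F b in at_top.
      let x\<^sub>b = turning_point V b;
          lam\<^sub>b = Complex (a b) b;
          \<mu>\<^sub>b = a b / deriv V x\<^sub>b powr (1/2);
          m\<^sub>b = m / deriv V x\<^sub>b powr (1/2)
      in lam\<^sub>b \<in> resolvent_set (dirac m V) \<and>
         complex_of_real \<mu>\<^sub>b \<in> resolvent_set (airy_dirac m\<^sub>b) \<and>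
         onorm (resolvent (dirac m V) lam\<^sub>b)
           = onorm (resolvent (airy_dirac m\<^sub>b) (complex_of_real \<mu>\<^sub>b))
             * deriv V x\<^sub>b powr (-1/2) * (1 + r b))"
proof -
  note m = assms(1) and V = assms(2)
  obtain \<epsilon> M x0 C1 C2 B where D1: "\<And>x. (V has_real_derivative deriv V x) (at x)" "continuous_on UNIV (deriv V)"
    and \<epsilon>: "0 < \<epsilon>" "\<epsilon> < 1" and M: "0 < M" and gl: "\<And>x. \<bar>deriv V x\<bar> \<le> \<epsilon> * (V x)\<^sup>2 + M"
    and x0: "0 \<le> x0" and D2: "\<forall>x>x0. (deriv V has_real_derivative deriv (deriv V) x) (at x)"
    and pos: "\<forall>x>x0. 0 < deriv V x"
    and C1: "0 < C1" and up: "\<forall>x>x0. deriv V x \<le> C1 * (V x / x)" and lo: "\<forall>x>x0. V x / x \<le> C1 * deriv V x"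
    and C2: "0 < C2" and sec: "\<forall>x>x0. \<bar>deriv (deriv V) x\<bar> \<le> C2 * (deriv V x / x)"
    and left: "\<forall>x\<le>x0 + 1. V x \<le> B"
    apply (rule admissible_potentialE[OF V])
    subgoal premises prems by (rule prems(1)[OF prems(2-16)])
    done
  define X where "X = turning_point V"
  define s where "s b = sqrt (deriv V (X b))" for b
  define p where "p b = X b powr (-1/2)" for b
  define q where "q b = b powr (-1/2)" for b :: real
  obtain Cm where Cm: "\<forall>\<^sub>F b in at_top. norm (a b / deriv V (X b) powr (1/2)) \<le> Cm * norm (1::real)"
    using assms(3) unfolding X_def by (elim landau_o.bigE)
  define C0 where "C0 = max 0 Cm"
  \<comment> \<open>\<open>K1\<close>, \<open>\<theta>\<close> and \<open>\<kappa>\<close> are the constants of \<open>potential_global\<close>;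
    \<open>D\<close> is the constant in \<open>1/s \<le> D (X/b)^(1/2)\<close>.\<close>
  define K1 where "K1 = 2 * C2 * exp C2"
  define \<theta> where "\<theta> = min (1/2) (min (1 / (2 * K1)) (1 / (2 * C1)))"
  define \<kappa> where "\<kappa> = \<theta> / (2 * C1)"
  define K where "K = max 1 (max K1 (exp C2))"
  define \<epsilon>' where "\<epsilon>' = (1 + \<epsilon>) / 2"
  define D where "D = sqrt C1"
  have K1: "0 < K1" using C2 by (simp add: K1_def)
  have \<theta>: "0 < \<theta>" using K1 C1 by (simp add: \<theta>_def)
  have \<kappa>: "0 < \<kappa>" using \<theta> C1 by (simp add: \<kappa>_def)
  have K: "1 \<le> K" "K1 \<le> K" "exp C2 \<le> K" by (auto simp: K_def)
  have \<epsilon>': "0 < \<epsilon>'" "0 \<le> \<epsilon>'" "\<epsilon>' < 1" "0 < \<epsilon>' - \<epsilon>" using \<epsilon> by (auto simp: \<epsilon>'_def)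
  obtain c0 where c0: "0 < c0" "\<And>s \<mu> X. 0 < s \<Longrightarrow> \<bar>\<mu>\<bar> \<le> C0 \<Longrightarrow> lower_bound m (\<lambda>x. s\<^sup>2 * (x - X)) (\<mu> * s) c0"
    using airy_lower_bound_scaled[of C0 m] m by (auto simp: C0_def)
  define \<Lambda> where "\<Lambda> = transfer_const m K (sqrt ((1 + K) / (1 - \<epsilon>'))) D"
  have X_lim: "filterlim X at_top at_top" unfolding X_def by (rule turning_point_at_top[OF V])
  have powr_lim: "((\<lambda>x::real. x powr (-1/2)) \<longlongrightarrow> 0) at_top" by (rule tendsto_neg_powr) (auto intro: filterlim_ident)
  have pq_lim: "((\<lambda>b. p b + q b) \<longlongrightarrow> 0) at_top"
    using tendsto_add[OF filterlim_compose[OF powr_lim X_lim] powr_lim] by (simp add: p_def q_def)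
  have pq_small: "\<forall>\<^sub>F b in at_top. p b + q b < \<delta>" if "0 < \<delta>" for \<delta>
    using order_tendstoD(2)[OF pq_lim that] .
  have inv_lim: "((\<lambda>b::real. k / b) \<longlongrightarrow> 0) at_top" for k :: real
    by (rule tendsto_divide_0[OF tendsto_const]) (rule filterlim_at_top_imp_at_infinity[OF filterlim_ident])
  have inv2_lim: "((\<lambda>b::real. k / b\<^sup>2) \<longlongrightarrow> 0) at_top" for k :: real
    using tendsto_mult[OF inv_lim[of k] inv_lim[of 1]] by (simp add: power2_eq_square)
  \<comment> \<open>Everything required of \<open>b\<close>: the conditions of \<open>potential_global\<close>, \<open>r \<le> \<theta> X\<close>, and
    that the difference of the lower bounds is at most \<open>c0 / 2\<close> and less than \<open>m\<close>.\<close>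
  have "\<forall>\<^sub>F b in at_top. (C1 * (1 + 1 / \<kappa>) / \<kappa>) / b < \<epsilon>'" by (rule order_tendstoD(2)[OF inv_lim \<epsilon>'(1)])
  moreover have "\<forall>\<^sub>F b in at_top. (C1 / \<kappa>\<^sup>2) / b < \<epsilon>'" by (rule order_tendstoD(2)[OF inv_lim \<epsilon>'(1)])
  moreover have "\<forall>\<^sub>F b in at_top. (4 * M) / b\<^sup>2 < \<epsilon>' - \<epsilon>" by (rule order_tendstoD(2)[OF inv2_lim \<epsilon>'(4)])
  moreover have "\<forall>\<^sub>F b in at_top. max 2 (2 * x0 + 1) \<le> X b" using X_lim unfolding filterlim_at_top by blast
  moreover have "\<forall>\<^sub>F b in at_top. max 1 (2 * B) \<le> b" by (rule eventually_ge_at_top)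
  moreover have "\<forall>\<^sub>F b in at_top. 0 < X b \<and> V (X b) = b" unfolding X_def by (rule turning_point_eventually[OF V])
  moreover note Cm
  moreover have "\<forall>\<^sub>F b in at_top. p b + q b < \<theta>" by (rule pq_small[OF \<theta>])
  moreover have "\<forall>\<^sub>F b in at_top. p b + q b < min (c0 / 2) (m / 2) / (\<bar>\<Lambda>\<bar> + 1)"
    by (rule pq_small) (use c0 m in simp)
  ultimately have main: "\<forall>\<^sub>F b in at_top.
      Complex (a b) b \<in> resolvent_set (dirac m V) \<and>
      complex_of_real (a b / s b) \<in> resolvent_set (airy_dirac (m / s b)) \<and>
      \<bar>onorm (resolvent (dirac m V) (Complex (a b) b)) /
        (onorm (resolvent (airy_dirac (m / s b)) (complex_of_real (a b / s b))) / s b) - 1\<bar> \<le> 2 * \<Lambda> / c0 * (p b + q b) \<and>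
      0 < onorm (resolvent (airy_dirac (m / s b)) (complex_of_real (a b / s b))) \<and>
      0 < s b \<and> 0 < deriv V (X b) \<and> 0 < p b + q b"
  proof eventually_elim
    case (elim b)
    have b: "0 < b" "1 \<le> b" "2 * B \<le> b" and Xb: "0 < X b" "V (X b) = b" "2 * x0 < X b" "2 \<le> X b" "x0 < X b"
      using elim x0 by auto
    have S: "0 < deriv V (X b)" using pos Xb(5) by blast
    have sb: "0 < s b" "(s b)\<^sup>2 = deriv V (X b)" using S by (auto simp: s_def)
    have l1: "C1 * (1 + 1 / \<kappa>) / (\<kappa> * b) \<le> (1 + \<epsilon>) / 2" using elim(1) by (simp add: \<epsilon>'_def divide_divide_eq_left less_imp_le)
    have l2: "C1 / (\<kappa>\<^sup>2 * b) \<le> (1 + \<epsilon>) / 2" using elim(2) by (simp add: \<epsilon>'_def divide_divide_eq_left less_imp_le)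
    have l3: "\<epsilon> + 4 * M / b\<^sup>2 \<le> (1 + \<epsilon>) / 2" using elim(3) unfolding \<epsilon>'_def by linarith
    note G = potential_global[OF D1(1) D2 pos sec C2 up lo C1 left gl \<epsilon> M x0 Xb(3,4,2) b(1,3) K1_def \<theta>_def \<kappa>_def l1 l2 l3]
    have pb: "0 < p b" "p b \<le> 1" and qb: "0 < q b" "q b \<le> 1"
      unfolding p_def q_def using Xb b powr_mono2'[of "-1/2" 1 "X b"] powr_mono2'[of "-1/2" 1 b] by (auto simp: )
    have p2: "(p b)\<^sup>2 = 1 / X b"
      using Xb by (simp add: p_def power2_eq_square powr_minus_divide flip: powr_add)
    have pX: "p b = 1 / sqrt (X b)" and qb': "q b = 1 / sqrt b"
      using Xb b by (simp_all add: p_def q_def powr_minus_divide powr_half_sqrt)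
    \<comment> \<open>As \<open>(p b)\<^sup>2 = 1 / X b\<close>, the radius is \<open>(p b + q b) X b\<close>.\<close>
    define r where "r = (p b + q b) / (p b)\<^sup>2"
    have r: "0 < r" "r \<le> \<theta> * X b"
    proof -
      show "0 < r" using pb qb by (simp add: r_def)
      have "(p b + q b) * X b \<le> \<theta> * X b" using elim(8) Xb by (intro mult_right_mono) auto
      then show "r \<le> \<theta> * X b" by (simp add: r_def p2)
    qed
    have inv_s: "1 / s b \<le> D * q b / p b"
    proof -
      have "sqrt (b / (C1 * X b)) \<le> s b" unfolding s_def by (rule real_sqrt_le_mono[OF G(1)])
      then have "1 / s b \<le> 1 / sqrt (b / (C1 * X b))" using b C1 Xb sb by (intro divide_left_mono) auto
      also have "\<dots> = D * q b / p b" by (simp add: D_def pX qb' real_sqrt_divide real_sqrt_mult)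
      finally show ?thesis .
    qed
    have bd: "\<bar>deriv V x\<bar> \<le> K * (s b)\<^sup>2 + \<epsilon>' * (V x - b)\<^sup>2" for x
    proof -
      have "exp C2 * deriv V (X b) \<le> K * deriv V (X b)" using K S by (intro mult_right_mono) auto
      then show ?thesis using G(2)[of x] unfolding sb(2) \<epsilon>'_def by linarith
    qed
    have near: "\<forall>x. \<bar>x - X b\<bar> \<le> r \<longrightarrow> (s b)\<^sup>2 * \<bar>x - X b\<bar> / 2 \<le> \<bar>V x - b\<bar>"
      using G(4)[OF r] by (simp add: sb)
    have far: "\<forall>x. r \<le> \<bar>x - X b\<bar> \<longrightarrow> (s b)\<^sup>2 * r / 2 \<le> \<bar>V x - b\<bar>"
      using G(5)[OF r] by (simp add: sb)
    have diff: "\<forall>x. \<bar>x - X b\<bar> \<le> r \<longrightarrow> \<bar>V x - b - (s b)\<^sup>2 * (x - X b)\<bar> \<le> K * (s b)\<^sup>2 * (x - X b)\<^sup>2 / (1 / (p b)\<^sup>2)"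
    proof (intro allI impI)
      fix x assume x: "\<bar>x - X b\<bar> \<le> r"
      have "K1 * deriv V (X b) * (x - X b)\<^sup>2 / X b \<le> K * deriv V (X b) * (x - X b)\<^sup>2 / X b"
        using K S Xb by (intro divide_right_mono mult_right_mono) auto
      then show "\<bar>V x - b - (s b)\<^sup>2 * (x - X b)\<bar> \<le> K * (s b)\<^sup>2 * (x - X b)\<^sup>2 / (1 / (p b)\<^sup>2)"
        using G(3)[OF r x] unfolding sb(2) p2 by simp
    qed
    have \<mu>: "\<bar>a b / s b\<bar> \<le> C0"
      using elim(7) S by (simp add: powr_half_sqrt s_def C0_def)
    have airy: "lower_bound m (\<lambda>x. (s b)\<^sup>2 * (x - X b)) (a b) c0"
      using c0(2)[OF sb(1) \<mu>, of "X b"] sb(1) by simp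
    have "\<Lambda> * (p b + q b) \<le> (\<bar>\<Lambda>\<bar> + 1) * (p b + q b)" using pb qb by (intro mult_right_mono) auto
    also have "\<dots> < min (c0 / 2) (m / 2)" using elim(9) by (simp add: pos_less_divide_eq mult.commute)
    finally have small: "\<Lambda> * (p b + q b) \<le> c0 / 2" "\<Lambda> * (p b + q b) < m" using m by auto
    have D0: "0 \<le> D" using C1 by (simp add: D_def)
    note R = resolvent_comparison[OF D1 bd \<epsilon>'(2,3) near far diff pb qb m K(1) D0 sb(1) inv_s r_def airy c0(1) \<Lambda>_def small]
    show ?case using R sb(1) S pb qb by simp
  qed
  define r where "r b = onorm (resolvent (dirac m V) (Complex (a b) b)) /
        (onorm (resolvent (airy_dirac (m / s b)) (complex_of_real (a b / s b))) / s b) - 1" for b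
  show ?thesis
  proof (intro exI[of _ r] conjI)
    show "r \<in> O[at_top](\<lambda>b. turning_point V b powr (-1/2) + b powr (-1/2))"
    proof (rule bigoI[of _ "2 * \<Lambda> / c0"], use main in eventually_elim)
      case (elim b)
      then show ?case by (simp add: r_def p_def q_def X_def)
    qed
    show "\<forall>\<^sub>F b in at_top.
      let x\<^sub>b = turning_point V b;
          lam\<^sub>b = Complex (a b) b;
          \<mu>\<^sub>b = a b / deriv V x\<^sub>b powr (1/2);
          m\<^sub>b = m / deriv V x\<^sub>b powr (1/2)
      in lam\<^sub>b \<in> resolvent_set (dirac m V) \<and>
         complex_of_real \<mu>\<^sub>b \<in> resolvent_set (airy_dirac m\<^sub>b) \<and>
         onorm (resolvent (dirac m V) lam\<^sub>b)
           = onorm (resolvent (airy_dirac m\<^sub>b) (complex_of_real \<mu>\<^sub>b))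
             * deriv V x\<^sub>b powr (-1/2) * (1 + r b)"
      using main
    proof eventually_elim
      case (elim b)
      have s1: "deriv V (turning_point V b) powr (1/2) = s b" using elim by (simp add: s_def X_def powr_half_sqrt)
      have s2: "deriv V (turning_point V b) powr (-1/2) = 1 / s b"
        using elim by (simp add: s_def X_def powr_minus_divide powr_half_sqrt)
      define RA where "RA = onorm (resolvent (airy_dirac (m / s b)) (complex_of_real (a b / s b)))"
      have "0 < RA" "0 < s b" using elim by (auto simp: RA_def)
      then have "RA * (1 / s b) * (1 + r b) = onorm (resolvent (dirac m V) (Complex (a b) b))"
        unfolding r_def RA_def[symmetric] by simp
      then show ?case using elim unfolding Let_def s1 s2 RA_def by simp
    qed
  qed
qed

end
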